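(* Let $K$ be a number field with ring of integers $R=\mathcal{O}_K$, and let $G$ be a finite group with $|G|>1$. Then the reduced group ring $RG_t$ has only trivial units if and only if at least one of the following holds: (1) $G\cong C_2$ (with $R$ arbitrary); (2) $G\cong C_3$ and $K$ is a totally real field; (3) one of the following holds for some integers $m,n\geq 0$: (a) $R=\mathbb{Z}$ and $G\cong C_3^m\times C_2^n$, or $G\cong C_4^m\times C_2^n$, or $G\cong Q_8\times C_2^n$; (b) $R=\mathbb{Z}[i]$ and $G\cong C_4^m\times C_2^n$; (c) $R=\mathbb{Z}[\omega]$ and $G\cong C_3^m\times C_2^n$; (d) $R=\mathcal{O}_{\mathbb{Q}(\sqrt{-d})}$ for some square-free integer $d>1$ with $d\neq 3$, and $G\cong C_2^n$.
   Context: $C_k$ denotes the cyclic group of order $k$, $Q_8$ the quaternion group of order 8, $i=\sqrt{-1}$ and $\omega=\frac{-1+i\sqrt{3}}{2}$. For a ring $S$, $U(S)$ is its group of units. Let $\Sigma=\sum_{g\in G}g\in RG$ and let $(\Sigma)=\Sigma\, RG$ be the (two-sided) principal ideal it generates. The reduced (truncated) group ring is $RG_t:=RG/(\Sigma)$. Its trivial units are $TU(RG_t)=\{ug+(\Sigma) : u\in U(R),\ g\in G\}$. We say $RG_t$ has only trivial units if $U(RG_t)=TU(RG_t)$. *)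

theory Defs
  imports
    Complex_Main
    "HOL-Algebra.Algebra"
    "HOL-Algebra.Algebraic_Closure_Type"
    "HOL-Computational_Algebra.Squarefree"
begin

text \<open>
  The set \<^term>\<open>generate_field K {}\<close> is the prime subfield of \<open>K\<close>; in characteristic 0
  this is the copy of \<open>\<rat>\<close> inside \<open>K\<close>.
\<close>

locale number_field = field K for K (structure) +
  assumes char_0: "n > 0 \<Longrightarrow> add_pow K (n::nat) \<one> \<noteq> \<zero>"
    and finite_degree: "finite_dimension (generate_field K {}) (carrier K)"

text \<open>
  Polynomials in \<open>univ_poly\<close> are coefficient lists with the leading coefficient first, and
  \<open>p \<noteq> []\<close> excludes the zero polynomial, on which \<open>hd\<close> is unspecified.
\<close>

definition ring_of_integers :: "('a, 'm) ring_scheme \<Rightarrow> ('a, 'm) ring_scheme" where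
  "ring_of_integers K = K\<lparr>carrier :=
     {x \<in> carrier K. \<exists>p \<in> carrier (univ_poly K (range (\<lambda>k::int. add_pow K k \<one>\<^bsub>K\<^esub>))).
        p \<noteq> [] \<and> hd p = \<one>\<^bsub>K\<^esub> \<and> ring.eval K p x = \<zero>\<^bsub>K\<^esub>}\<rparr>"

abbreviation complex_field :: "complex ring" where
  "complex_field \<equiv> ring_of_type_algebra"

definition totally_real :: "('a, 'm) ring_scheme \<Rightarrow> bool" where
  "totally_real K \<longleftrightarrow> (\<forall>\<sigma> \<in> ring_hom K complex_field. \<sigma> ` carrier K \<subseteq> \<real>)"

definition gaussian_integers :: "complex ring" where
  "gaussian_integers = complex_field\<lparr>carrier := generate_ring complex_field {\<i>}\<rparr>"

definition eisenstein_integers :: "complex ring" where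
  "eisenstein_integers =
     complex_field\<lparr>carrier := generate_ring complex_field {(-1 + \<i> * complex_of_real (sqrt 3)) / 2}\<rparr>"

definition imaginary_quadratic_field :: "int \<Rightarrow> complex ring" where
  "imaginary_quadratic_field d =
     complex_field\<lparr>carrier :=
       generate_field complex_field {\<i> * complex_of_real (sqrt (real_of_int d))}\<rparr>"

text \<open>
  The group ring of a finite group \<open>G\<close>: every function from \<open>G\<close> to \<open>R\<close> has finite support.
  The product is the convolution
  \<open>(a b)(x) = \<Sum>\<^sub>y a(y) b(y\<^sup>-\<^sup>1 x)\<close>.
\<close>

definition group_ring :: "('r, 'm) ring_scheme \<Rightarrow> ('g, 'n) monoid_scheme \<Rightarrow> ('g \<Rightarrow> 'r) ring" where
  "group_ring R G =
     \<lparr>carrier = carrier G \<rightarrow>\<^sub>E carrier R,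
      monoid.mult = (\<lambda>a b. \<lambda>x\<in>carrier G. \<Oplus>\<^bsub>R\<^esub>y\<in>carrier G. a y \<otimes>\<^bsub>R\<^esub> b (inv\<^bsub>G\<^esub> y \<otimes>\<^bsub>G\<^esub> x)),
      one = (\<lambda>x\<in>carrier G. if x = \<one>\<^bsub>G\<^esub> then \<one>\<^bsub>R\<^esub> else \<zero>\<^bsub>R\<^esub>),
      ring.zero = (\<lambda>x\<in>carrier G. \<zero>\<^bsub>R\<^esub>),
      add = (\<lambda>a b. \<lambda>x\<in>carrier G. a x \<oplus>\<^bsub>R\<^esub> b x)\<rparr>"

text \<open>The element \<open>u g\<close> of the group ring, for \<open>u\<close> in \<open>R\<close> and \<open>g\<close> in \<open>G\<close>.\<close>

definition gr_monom :: "('r, 'm) ring_scheme \<Rightarrow> ('g, 'n) monoid_scheme \<Rightarrow> 'r \<Rightarrow> 'g \<Rightarrow> 'g \<Rightarrow> 'r" where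
  "gr_monom R G u g = (\<lambda>x\<in>carrier G. if x = g then u else \<zero>\<^bsub>R\<^esub>)"

definition gr_Sigma :: "('r, 'm) ring_scheme \<Rightarrow> ('g, 'n) monoid_scheme \<Rightarrow> 'g \<Rightarrow> 'r" where
  "gr_Sigma R G = (\<Oplus>\<^bsub>group_ring R G\<^esub>g\<in>carrier G. gr_monom R G \<one>\<^bsub>R\<^esub> g)"

definition Sigma_ideal :: "('r, 'm) ring_scheme \<Rightarrow> ('g, 'n) monoid_scheme \<Rightarrow> ('g \<Rightarrow> 'r) set" where
  "Sigma_ideal R G = Idl\<^bsub>group_ring R G\<^esub> {gr_Sigma R G}"

definition reduced_group_ring ::
    "('r, 'm) ring_scheme \<Rightarrow> ('g, 'n) monoid_scheme \<Rightarrow> ('g \<Rightarrow> 'r) set ring" where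
  "reduced_group_ring R G = group_ring R G Quot Sigma_ideal R G"

definition trivial_units ::
    "('r, 'm) ring_scheme \<Rightarrow> ('g, 'n) monoid_scheme \<Rightarrow> ('g \<Rightarrow> 'r) set set" where
  "trivial_units R G =
     {Sigma_ideal R G +>\<^bsub>group_ring R G\<^esub> gr_monom R G u g | u g. u \<in> Units R \<and> g \<in> carrier G}"

definition only_trivial_units :: "('r, 'm) ring_scheme \<Rightarrow> ('g, 'n) monoid_scheme \<Rightarrow> bool" where
  "only_trivial_units R G \<longleftrightarrow> Units (reduced_group_ring R G) = trivial_units R G"

definition cyclic_power :: "nat \<Rightarrow> nat \<Rightarrow> (nat \<Rightarrow> int) monoid" where
  "cyclic_power k n = product_group {..<n} (\<lambda>_. integer_mod_group k)"

text \<open>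
  The quaternion group \<open>{\<plusminus>1, \<plusminus>i, \<plusminus>j, \<plusminus>k}\<close>, where \<open>(a, b, c, d)\<close> stands for the
  quaternion \<open>a + b i + c j + d k\<close>.
\<close>

fun hamilton_mult :: "int \<times> int \<times> int \<times> int \<Rightarrow> int \<times> int \<times> int \<times> int \<Rightarrow> int \<times> int \<times> int \<times> int" where
  "hamilton_mult (a1, b1, c1, d1) (a2, b2, c2, d2) =
     (a1 * a2 - b1 * b2 - c1 * c2 - d1 * d2,
      a1 * b2 + b1 * a2 + c1 * d2 - d1 * c2,
      a1 * c2 - b1 * d2 + c1 * a2 + d1 * b2,
      a1 * d2 + b1 * c2 - c1 * b2 + d1 * a2)"

definition quaternion_group :: "(int \<times> int \<times> int \<times> int) monoid" where
  "quaternion_group =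
     \<lparr>carrier = {(1, 0, 0, 0), (-1, 0, 0, 0), (0, 1, 0, 0), (0, -1, 0, 0),
                 (0, 0, 1, 0), (0, 0, -1, 0), (0, 0, 0, 1), (0, 0, 0, -1)},
      monoid.mult = hamilton_mult,
      one = (1, 0, 0, 0)\<rparr>"

lemma group_quaternion_group: "group quaternion_group"
proof (rule groupI)
  fix x y z
  assume x: "x \<in> carrier quaternion_group" and y: "y \<in> carrier quaternion_group"
  then show "x \<otimes>\<^bsub>quaternion_group\<^esub> y \<in> carrier quaternion_group"
    unfolding quaternion_group_def by simp (elim disjE; simp)
  show "x \<otimes>\<^bsub>quaternion_group\<^esub> y \<otimes>\<^bsub>quaternion_group\<^esub> z =
      x \<otimes>\<^bsub>quaternion_group\<^esub> (y \<otimes>\<^bsub>quaternion_group\<^esub> z)"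
    by (cases x; cases y; cases z) (simp add: quaternion_group_def algebra_simps)
  show "\<one>\<^bsub>quaternion_group\<^esub> \<otimes>\<^bsub>quaternion_group\<^esub> x = x"
    by (cases x) (simp add: quaternion_group_def)
  show "\<exists>y\<in>carrier quaternion_group. y \<otimes>\<^bsub>quaternion_group\<^esub> x = \<one>\<^bsub>quaternion_group\<^esub>"
    using x unfolding quaternion_group_def by simp (elim disjE; simp)
qed (simp add: quaternion_group_def)

end

(*
Embed K into the complex numbers. Then R becomes the ring O of algebraic integers of a complex
number field F, and a unit of RG_t becomes a function on G with a convolution inverse up to constants.

Necessity. Suppose first that F has an embedding besides the inclusion and its conjugate. Dirichlet's
pigeonhole argument gives a unit u of O with |u| > 1 that is congruent to 1 modulo any given k and whose
other conjugates are small. If the subgroup generated by g is proper of order k, then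
1 + ((u - 1) / k) (1 + g + ... + g^(k-1)) is a nontrivial unit; so G is cyclic of prime order p. The unit
1 + g excludes p > 3, and if F is not real, a unit of O[omega] congruent to 1 modulo a power of 3 excludes
p = 3. Otherwise F is rational or imaginary quadratic and all units of O have absolute value 1. Bicyclic
units make all cyclic subgroups normal, Bass units leave only the element orders 1, 2, 3, 4, 6, and for
zeta = omega, i outside a non-real F the units of O[zeta] exclude the order of zeta. What remains are
Dedekind groups of exponent dividing 4 or 6; over the Gaussian integers the quaternion group is excluded
by 1 + (1 - z) (a + i b), where a^2 = b^2 = z.

Sufficiency. If all characters take values in a ring where |x|^2 is always an integer, then every
nontrivial character value of a unit u has absolute value 1. By Parseval, the sum of |u(x) - u(y)|^2
over all x, y is 2 (|G| - 1), which forces u to be constant except at one point. The quaternion group is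
treated in the same way, with the four-square norm for its representation of degree 4. For C_3 over a
totally real field let w be the character value of a unit and N its norm to R: the coordinates A, B of
w^2 / N satisfy A^2 - A B + B^2 = 1, so all conjugates of A B (A - B) are smaller than 1, hence it is 0.
*)
theory Submission
  imports Defs "Jordan_Normal_Form.Char_Poly" "HOL-Number_Theory.Residues"
begin

text \<open>Every exclusion of an element order rests on one test. If g has order k, a trivial unit
  represented by a polynomial in g takes at each k-th root of unity \<zeta> a value r * \<zeta>^j
  with r and j independent of \<zeta>, so these values share one modulus. Only \<zeta> = 1 is
  exempt, and only if g generates G, since a constant function then changes nothing but the value at
  1. It suffices to find two polynomials over O that are inverse to each other at the relevant
  roots, and two such roots where the first has different moduli. The congruence of u modulo k makes
  (u - 1) / k an admissible coefficient. For \<zeta> outside a non-real F, the field F(\<zeta>) has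
  an automorphism that fixes F and conjugates \<zeta>. It is neither the identity nor complex
  conjugation, so F(\<zeta>) has large units even when F has none; an element built from such a unit
  takes conjugate values of different moduli at \<zeta> and at its conjugate. For sufficiency the
  characters may need a ring D larger than R, as for C_3 over the integers. The coefficient of a
  unit still lies in R, being a difference of two values of the unit.\<close>

section \<open>Closure properties of algebraic integers and algebraic numbers\<close>

text \<open>The determinant trick: the vector \<open>v\<close> makes x an eigenvalue of an integer
  matrix, whose characteristic polynomial is monic with integer coefficients. Sums, products and
  integral multiples are all reduced to this criterion.\<close>

lemma algebraic_int_eigenvalue:
 fixes v :: "'i \<Rightarrow> complex" and c :: "'i \<Rightarrow> 'i \<Rightarrow> int"
 assumes fin: "finite I" and i0: "i0 \<in> I" "v i0 \<noteq> 0"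
  and eq: "\<And>i. i \<in> I \<Longrightarrow> x * v i = (\<Sum>j\<in>I. of_int (c i j) * v j)"
 shows "algebraic_int x"
proof -
 define n where "n = card I"
 obtain h where h: "bij_betw h {0..<n} I" using ex_bij_betw_nat_finite[OF fin] n_def by blast
 define A where "A = mat n n (\<lambda>(i,j). c (h i) (h j))"
 define w where "w = vec n (\<lambda>i. v (h i))"
 have A: "A \<in> carrier_mat n n" by (simp add: A_def)
 have A': "map_mat (of_int :: int \<Rightarrow> complex) A \<in> carrier_mat n n" using A by simp
 obtain k0 where k0: "k0 < n" "h k0 = i0" using h i0 by (metis atLeastLessThan_iff bij_betw_def image_iff)
 have "eigenvector (map_mat (of_int :: int \<Rightarrow> complex) A) w x" unfolding eigenvector_def
 proof (intro conjI)
  show "w \<in> carrier_vec (dim_row (map_mat (of_int :: int \<Rightarrow> complex) A))" using A by (simp add: w_def)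
  have "w $ k0 \<noteq> 0" using k0 i0 by (simp add: w_def)
  thus "w \<noteq> 0\<^sub>v (dim_row (map_mat (of_int :: int \<Rightarrow> complex) A))" using A k0 by auto
  show "map_mat (of_int :: int \<Rightarrow> complex) A *\<^sub>v w = x \<cdot>\<^sub>v w"
  proof (rule eq_vecI)
   fix i assume "i < dim_vec (x \<cdot>\<^sub>v w)"
   hence i: "i < n" by (simp add: w_def)
   hence hi: "h i \<in> I" using h by (auto simp: bij_betw_def)
   have "(map_mat (of_int :: int \<Rightarrow> complex) A *\<^sub>v w) $ i
     = (\<Sum>j\<in>{0..<n}. of_int (c (h i) (h j)) * v (h j))"
    using i by (simp add: A_def w_def scalar_prod_def)
   also have "\<dots> = (\<Sum>j\<in>I. of_int (c (h i) j) * v j)"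
    using sum.reindex_bij_betw[OF h, of "\<lambda>j. of_int (c (h i) j) * v j"] by simp
   also have "\<dots> = (x \<cdot>\<^sub>v w) $ i" using eq[OF hi] i by (simp add: w_def)
   finally show "(map_mat (of_int :: int \<Rightarrow> complex) A *\<^sub>v w) $ i = (x \<cdot>\<^sub>v w) $ i" .
  qed (simp add: A_def w_def)
 qed
 hence "eigenvalue (map_mat (of_int :: int \<Rightarrow> complex) A) x" unfolding eigenvalue_def by blast
 hence "poly (char_poly (map_mat (of_int :: int \<Rightarrow> complex) A)) x = 0" using eigenvalue_root_char_poly[OF A'] by simp
 hence "poly (map_poly (of_int :: int \<Rightarrow> complex) (char_poly A)) x = 0" by (simp add: of_int_hom.char_poly_hom[OF A])
 moreover have "lead_coeff (char_poly A) = 1" using degree_monic_char_poly[OF A] by simp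
 ultimately show ?thesis unfolding algebraic_int_altdef_ipoly by blast
qed

text \<open>The ring of all \<open>x\<close> that map the \<open>\<int>\<close>-span of the family \<open>v\<close> into itself.\<close>

definition multiplier :: "'i set \<Rightarrow> ('i \<Rightarrow> complex) \<Rightarrow> complex \<Rightarrow> bool" where
 "multiplier I v x \<longleftrightarrow> (\<exists>c :: 'i \<Rightarrow> 'i \<Rightarrow> int. \<forall>i\<in>I. x * v i = (\<Sum>j\<in>I. of_int (c i j) * v j))"

lemma multiplier_add:
 assumes "multiplier I v x" "multiplier I v y"
 shows "multiplier I v (x + y)"
proof -
 obtain c d :: "'a \<Rightarrow> 'a \<Rightarrow> int" where
  "\<forall>i\<in>I. x * v i = (\<Sum>j\<in>I. of_int (c i j) * v j)"
  "\<forall>i\<in>I. y * v i = (\<Sum>j\<in>I. of_int (d i j) * v j)"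
  using assms unfolding multiplier_def by blast
 hence "\<forall>i\<in>I. (x + y) * v i = (\<Sum>j\<in>I. of_int (c i j + d i j) * v j)" by (simp add: ring_distribs sum.distrib)
 thus ?thesis unfolding multiplier_def by (intro exI[of _ "\<lambda>i j. c i j + d i j"])
qed

lemma multiplier_mult:
 assumes "multiplier I v x" "multiplier I v y"
 shows "multiplier I v (x * y)"
proof -
 obtain c d :: "'a \<Rightarrow> 'a \<Rightarrow> int" where
  c: "\<forall>i\<in>I. x * v i = (\<Sum>j\<in>I. of_int (c i j) * v j)" and
  d: "\<forall>i\<in>I. y * v i = (\<Sum>j\<in>I. of_int (d i j) * v j)"
  using assms unfolding multiplier_def by blast
 have "(x * y) * v i = (\<Sum>j\<in>I. of_int (\<Sum>k\<in>I. d i k * c k j) * v j)" if i: "i \<in> I" for i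
 proof -
  have "(x * y) * v i = (\<Sum>k\<in>I. of_int (d i k) * (x * v k))" using d i by (simp add: sum_distrib_left mult_ac)
  also have "\<dots> = (\<Sum>k\<in>I. \<Sum>j\<in>I. of_int (d i k * c k j) * v j)" using c by (simp add: sum_distrib_left mult_ac)
  also have "\<dots> = (\<Sum>j\<in>I. of_int (\<Sum>k\<in>I. d i k * c k j) * v j)" by (subst sum.swap) (simp add: sum_distrib_right)
  finally show ?thesis .
 qed
 thus ?thesis unfolding multiplier_def by (intro exI[of _ "\<lambda>i j. \<Sum>k\<in>I. d i k * c k j"]) blast
qed

text \<open>Multiplication by x shifts the exponent, and at the top exponent the monic relation
  rewrites x^a. The matrix is the companion matrix in the first index and the identity in the
  second.\<close>

lemma multiplier_powers:
 fixes x :: complex and y :: "'j \<Rightarrow> complex"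
 assumes x: "x ^ a = (\<Sum>k<a. of_int (p k) * x ^ k)"
  and True: "finite J"
 shows "multiplier ({..<a} \<times> J) (\<lambda>(i,j). x ^ i * y j) x"
proof -
 define c :: "nat \<times> 'j \<Rightarrow> nat \<times> 'j \<Rightarrow> int" where "c = (\<lambda>(i,j) (k,l). if j \<noteq> l then 0
   else if Suc i < a then (if k = Suc i then 1 else 0) else (p k :: int))"
 have "x * (x ^ i * y j) = (\<Sum>m\<in>{..<a} \<times> J. of_int (c (i,j) m) * (case m of (k,l) \<Rightarrow> x ^ k * y l))"
  if ij: "i < a" "j \<in> J" for i j
 proof -
  have "(\<Sum>m\<in>{..<a} \<times> J. of_int (c (i,j) m) * (case m of (k,l) \<Rightarrow> x ^ k * y l))
    = (\<Sum>k<a. \<Sum>l\<in>J. of_int (c (i,j) (k,l)) * (x ^ k * y l))"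
   by (simp add: sum.cartesian_product split_def)
  also have "\<dots> = (\<Sum>k<a. \<Sum>l\<in>J. if l = j then
    of_int (if Suc i < a then (if k = Suc i then 1 else 0) else p k) * (x ^ k * y j) else 0)"
   by (intro sum.cong refl) (auto simp: c_def)
  also have "\<dots> = (\<Sum>k<a. of_int (if Suc i < a then (if k = Suc i then 1 else 0) else p k) * (x ^ k * y j))"
   using ij True by (simp add: sum.delta)
  also have "\<dots> = x * (x ^ i * y j)"
  proof (cases "Suc i < a")
   case True
   have "(\<Sum>k<a. of_int (if Suc i < a then (if k = Suc i then 1 else 0) else p k) * (x ^ k * y j))
     = (\<Sum>k<a. if k = Suc i then x ^ k * y j else 0)"
    using True by (intro sum.cong) auto
   also have "\<dots> = x ^ Suc i * y j" using True by (subst sum.delta) auto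
   finally show ?thesis by (simp add: mult_ac)
  next
   case False
   hence "Suc i = a" using ij by simp
   hence "x * (x ^ i * y j) = x ^ a * y j" by (auto simp: mult_ac)
   also have "\<dots> = (\<Sum>k<a. of_int (p k) * (x ^ k * y j))" unfolding x by (simp add: sum_distrib_right mult.assoc)
   finally show ?thesis using False by simp
  qed
  finally show ?thesis by simp
 qed
 thus ?thesis unfolding multiplier_def by (intro exI[of _ c]) auto
qed

text \<open>The condition n > 0 matters later: it puts the exponent 0 into the index range, where
  the vector of powers has the nonzero entry 1.\<close>

lemma algebraic_int_power_relation:
 fixes x :: complex
 assumes "algebraic_int x"
 obtains n p where "n > 0" "x ^ n = (\<Sum>k<n. of_int (p k) * x ^ k)"
proof -
 obtain q where q: "poly (map_poly of_int q) x = 0" "lead_coeff q = (1::int)" using assms unfolding algebraic_int_altdef_ipoly by blast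
 let ?n = "degree q"
 have "?n > 0"
 proof (rule ccontr)
  assume "\<not> ?n > 0"
  then obtain a where "q = [:a:]" using degree_eq_zeroE by blast
  with q show False by simp
 qed
 moreover have "x ^ ?n = (\<Sum>k<?n. of_int (- coeff q k) * x ^ k)"
 proof -
  have "0 = (\<Sum>k\<le>?n. of_int (coeff q k) * x ^ k)" using q(1) by (simp add: poly_altdef degree_map_poly coeff_map_poly)
  also have "\<dots> = (\<Sum>k<?n. of_int (coeff q k) * x ^ k) + x ^ ?n" using q(2) by (simp flip: lessThan_Suc_atMost)
  finally show ?thesis by (simp add: sum_negf eq_neg_iff_add_eq_0 add.commute)
 qed
 ultimately show ?thesis by (rule that)
qed

text \<open>\<open>multiplier_powers\<close> puts the powers of the multiplier in the first index,
  but x and y have to act on one common family of monomials.\<close>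

lemma multiplier_swap:
 assumes "multiplier (I \<times> J) (\<lambda>(i,j). v i j) x"
 shows "multiplier (J \<times> I) (\<lambda>(j,i). v i j) x"
proof -
 obtain c :: "'a \<times> 'b \<Rightarrow> 'a \<times> 'b \<Rightarrow> int" where
  c: "\<forall>m\<in>I \<times> J. x * (case m of (i,j) \<Rightarrow> v i j) = (\<Sum>l\<in>I \<times> J. of_int (c m l) * (case l of (i,j) \<Rightarrow> v i j))"
  using assms unfolding multiplier_def by blast
 have bij: "bij_betw prod.swap (J \<times> I) (I \<times> J)" by (auto simp: bij_betw_def inj_on_def image_def)
 have "x * v i j = (\<Sum>l\<in>J \<times> I. of_int (c (i,j) (prod.swap l)) * (case l of (j,i) \<Rightarrow> v i j))"
  if "i \<in> I" "j \<in> J" for i j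
 proof -
  have "x * v i j = (\<Sum>l\<in>I \<times> J. of_int (c (i,j) l) * v (fst l) (snd l))" using bspec[OF c, of "(i,j)"] that by (simp add: split_def)
  also have "\<dots> = (\<Sum>l\<in>J \<times> I. of_int (c (i,j) (prod.swap l)) * v (fst (prod.swap l)) (snd (prod.swap l)))"
   by (rule sum.reindex_bij_betw[OF bij, symmetric])
  finally show ?thesis by (simp add: split_def)
 qed
 thus ?thesis unfolding multiplier_def by (intro exI[of _ "\<lambda>m l. c (prod.swap m) (prod.swap l)"]) auto
qed

text \<open>The span of the monomials x^i * y^j is stable under x and under y, hence under their sum
  and product, and it contains 1.\<close>

lemma algebraic_int_add_mult:
 fixes x y :: complex
 assumes "algebraic_int x" "algebraic_int y"
 shows algebraic_int_add: "algebraic_int (x + y)" and algebraic_int_mult: "algebraic_int (x * y)"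
proof -
 obtain a p where a: "a > 0" "x ^ a = (\<Sum>k<a. of_int (p k) * x ^ k)" using algebraic_int_power_relation[OF assms(1)] .
 obtain b q where b: "b > 0" "y ^ b = (\<Sum>k<b. of_int (q k) * y ^ k)" using algebraic_int_power_relation[OF assms(2)] .
 let ?I = "{..<a} \<times> {..<b}" and ?v = "\<lambda>(i,j). x ^ i * y ^ j"
 have x: "multiplier ?I ?v x" by (rule multiplier_powers) (use a in auto)
 have y: "multiplier ?I ?v y" using multiplier_swap[of "{..<b}" "{..<a}" "\<lambda>j i. y ^ j * x ^ i" y]
   multiplier_powers[of y b q "{..<a}" "\<lambda>i. x ^ i"] b by (simp add: mult.commute)
 have *: "algebraic_int z" if z: "multiplier ?I ?v z" for z
 proof -
  obtain c where "\<forall>i\<in>?I. z * ?v i = (\<Sum>j\<in>?I. of_int (c i j) * ?v j)" using z unfolding multiplier_def by blast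
  thus ?thesis by (intro algebraic_int_eigenvalue[of ?I "(0,0)" ?v z c]) (use a b in auto)
 qed
 show "algebraic_int (x + y)" "algebraic_int (x * y)" using * multiplier_add[OF x y] multiplier_mult[OF x y] by auto
qed

lemma algebraic_int_diff: "algebraic_int x \<Longrightarrow> algebraic_int y \<Longrightarrow> algebraic_int (x - y)" for x y :: complex
 using algebraic_int_add[of x "- y"] by auto

lemma algebraic_int_power: "algebraic_int x \<Longrightarrow> algebraic_int (x ^ n)" for x :: complex
 by (induction n) (auto intro: algebraic_int_mult)

lemma algebraic_int_sum: "(\<And>i. i \<in> A \<Longrightarrow> algebraic_int (f i)) \<Longrightarrow> algebraic_int (sum f A)" for f :: "_ \<Rightarrow> complex"
 by (induction A rule: infinite_finite_induct) (auto intro: algebraic_int_add)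

lemma algebraic_int_prod: "(\<And>i. i \<in> A \<Longrightarrow> algebraic_int (f i)) \<Longrightarrow> algebraic_int (prod f A)" for f :: "_ \<Rightarrow> complex"
 by (induction A rule: infinite_finite_induct) (auto intro: algebraic_int_mult)

text \<open>With c the leading coefficient of an integer polynomial vanishing at x, the product c *
  x acts on 1, x, ..., x^(n-1) by an integer matrix: the shift scaled by c, and the negated lower
  coefficients in the last row.\<close>

lemma algebraic_integral_multiple:
 fixes x :: complex
 assumes "algebraic x"
 obtains N :: int where "N > 0" "algebraic_int (of_int N * x)"
proof -
 obtain p where p: "p \<noteq> 0" "poly (map_poly of_int p) x = 0" using algebraicE'[OF assms] by blast
 define n where "n = degree p"
 define c where "c = coeff p n"
 have c: "c \<noteq> 0" using p by (simp add: c_def n_def)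
 have n: "n > 0"
 proof (rule ccontr)
  assume "\<not> n > 0"
  then obtain a where "p = [:a:]" unfolding n_def using degree_eq_zeroE by blast
  with p show False by simp
 qed
 have rel: "of_int c * x ^ n = (\<Sum>k<n. of_int (- coeff p k) * x ^ k)"
 proof -
  have "0 = (\<Sum>k\<le>n. of_int (coeff p k) * x ^ k)" using p(2) by (simp add: poly_altdef degree_map_poly coeff_map_poly n_def)
  also have "\<dots> = (\<Sum>k<n. of_int (coeff p k) * x ^ k) + of_int c * x ^ n" by (simp add: c_def flip: lessThan_Suc_atMost)
  finally show ?thesis by (simp add: sum_negf eq_neg_iff_add_eq_0 add.commute)
 qed
 define d :: "nat \<Rightarrow> nat \<Rightarrow> int" where
  "d i j = (if Suc i < n then (if j = Suc i then c else 0) else - coeff p j)" for i j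
 have "algebraic_int (of_int c * x)"
 proof (rule algebraic_int_eigenvalue[of "{..<n}" 0 "\<lambda>i. x ^ i" _ d])
  fix i assume i: "i \<in> {..<n}"
  show "of_int c * x * x ^ i = (\<Sum>j<n. of_int (d i j) * x ^ j)"
  proof (cases "Suc i < n")
   case True
   have "(\<Sum>j<n. of_int (d i j) * x ^ j) = (\<Sum>j<n. if j = Suc i then of_int c * x ^ j else 0)"
    using True by (intro sum.cong) (auto simp: d_def)
   also have "\<dots> = of_int c * x ^ Suc i" using True by (subst sum.delta) auto
   finally show ?thesis by (simp add: mult_ac)
  next
   case False
   hence "Suc i = n" using i by simp
   hence "of_int c * x * x ^ i = of_int c * x ^ n" by (auto simp: mult_ac)
   thus ?thesis using rel False by (simp add: d_def)
  qed
 qed (use n in auto)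
 hence "algebraic_int (of_int \<bar>c\<bar> * x)" by (cases "c \<ge> 0") auto
 thus ?thesis using that[of "\<bar>c\<bar>"] c by simp
qed

lemma algebraic_if_integral_multiple:
 fixes x :: complex
 assumes "algebraic (of_int N * x)" "N \<noteq> 0"
 shows "algebraic x"
proof -
 obtain p where p: "p \<noteq> 0" "\<forall>i. coeff p i \<in> \<int>" "poly p (of_int N * x) = 0" using algebraicE[OF assms(1)] by metis
 let ?q = "pcompose p [:0, of_int N:]"
 have "coeff ?q i \<in> \<rat>" for i using p(2) subsetD[OF Ints_subset_Rats, of "coeff p i"]
  by (subst coeff_pcompose_linear) (intro Rats_mult Rats_power, simp_all)
 moreover have "?q \<noteq> 0" using assms p by (subst pcompose_eq_0_iff) auto
 moreover have "poly ?q x = 0" using p(3) by (simp add: poly_pcompose mult.commute)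
 ultimately show ?thesis by (rule algebraicI')
qed

lemma algebraic_add_mult:
 fixes x y :: complex
 assumes "algebraic x" "algebraic y"
 shows algebraic_add: "algebraic (x + y)" and algebraic_mult: "algebraic (x * y)"
proof -
 obtain M where M: "M > 0" "algebraic_int (of_int M * x)" using algebraic_integral_multiple[OF assms(1)] .
 obtain N where N: "N > 0" "algebraic_int (of_int N * y)" using algebraic_integral_multiple[OF assms(2)] .
 have "algebraic_int (of_int N * (of_int M * x) + of_int M * (of_int N * y))"
  by (intro algebraic_int_add algebraic_int_mult[OF _ M(2)] algebraic_int_mult[OF _ N(2)]) auto
 hence "algebraic (of_int (M * N) * (x + y))" by (simp add: algebra_simps algebraic_int_imp_algebraic)
 thus "algebraic (x + y)" by (rule algebraic_if_integral_multiple) (use M N in auto)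
 have "algebraic_int ((of_int M * x) * (of_int N * y))" by (rule algebraic_int_mult[OF M(2) N(2)])
 hence "algebraic (of_int (M * N) * (x * y))" by (simp add: algebra_simps algebraic_int_imp_algebraic)
 thus "algebraic (x * y)" by (rule algebraic_if_integral_multiple) (use M N in auto)
qed

lemma rational_common_denominator:
 assumes "finite A"
 obtains N :: int where "N > 0" "\<And>a. a \<in> A \<Longrightarrow> of_int N * (q a :: rat) \<in> \<int>"
proof -
 have "\<exists>N::int. N > 0 \<and> (\<forall>a\<in>A. of_int N * q a \<in> \<int>)" using assms
 proof (induction A)
  case empty thus ?case by (intro exI[of _ 1]) auto
 next
  case (insert a A)
  then obtain N :: int where N: "N > 0" "\<forall>a\<in>A. of_int N * q a \<in> \<int>" by blast
  obtain u v where uv: "q a = of_int u / of_int v" "v > 0"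
   using quotient_of_div[of "q a"] quotient_of_denom_pos[of "q a"] by (cases "quotient_of (q a)") simp
  have "of_int (N * v) * q b \<in> \<int>" if b: "b \<in> insert a A" for b
  proof (cases "b = a")
   case True
   have "of_int (N * v) * q a = of_int (N * u)" using uv by simp
   thus ?thesis using True by (metis Ints_of_int)
  next
   case False
   have "of_int N * q b \<in> \<int>" using N b False by blast
   hence "of_int v * (of_int N * q b) \<in> \<int>" by (rule Ints_mult[OF Ints_of_int])
   thus ?thesis by (simp add: mult_ac)
  qed
  thus ?case using N uv by (intro exI[of _ "N * v"]) auto
 qed
 thus ?thesis using that by blast
qed

lemma algebraic_rational_eigenvalue:
 fixes v :: "'i \<Rightarrow> complex" and q :: "'i \<Rightarrow> 'i \<Rightarrow> rat"
 assumes fin: "finite I" and i0: "i0 \<in> I" "v i0 \<noteq> 0"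
  and eq: "\<And>i. i \<in> I \<Longrightarrow> x * v i = (\<Sum>j\<in>I. of_rat (q i j) * v j)"
 shows "algebraic x"
proof -
 obtain N :: int where N: "N > 0" "\<And>p. p \<in> I \<times> I \<Longrightarrow> of_int N * (case p of (i,j) \<Rightarrow> q i j) \<in> \<int>"
  using rational_common_denominator[of "I \<times> I" "\<lambda>(i,j). q i j"] fin by auto
 define c where "c i j = \<lfloor>of_int N * q i j\<rfloor>" for i j
 have c: "of_int (c i j) = of_int N * q i j" if "i \<in> I" "j \<in> I" for i j using N(2)[of "(i,j)"] that by (simp add: c_def)
 have c': "(of_int (c i j) :: complex) = of_int N * of_rat (q i j)" if "i \<in> I" "j \<in> I" for i j
  using arg_cong[OF c[OF that], of "of_rat :: rat \<Rightarrow> complex"] by (simp add: of_rat_mult)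
 have "algebraic_int (of_int N * x)"
 proof (rule algebraic_int_eigenvalue[where I = I and v = v and c = c, OF fin i0])
  fix i assume "i \<in> I"
  thus "of_int N * x * v i = (\<Sum>j\<in>I. of_int (c i j) * v j)" using eq c' by (simp add: mult.assoc sum_distrib_left)
 qed
 thus ?thesis using algebraic_if_integral_multiple[of N x] N(1) algebraic_int_imp_algebraic by blast
qed

section \<open>Number fields inside the complex numbers and their embeddings\<close>

text \<open>Finite degree appears as a finite spanning subset of F over the rationals. This is the
  form in which it is used: an embedding is determined by finitely many values.\<close>

locale complex_number_field =
 fixes F :: "complex set"
 assumes one_mem: "1 \<in> F"
  and diff_mem: "x \<in> F \<Longrightarrow> y \<in> F \<Longrightarrow> x - y \<in> F"
  and mult_mem: "x \<in> F \<Longrightarrow> y \<in> F \<Longrightarrow> x * y \<in> F"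
  and inverse_mem: "x \<in> F \<Longrightarrow> inverse x \<in> F"
  and finite_span: "\<exists>B. finite B \<and> B \<subseteq> F \<and> (\<forall>x\<in>F. \<exists>q :: complex \<Rightarrow> rat. x = (\<Sum>b\<in>B. of_rat (q b) * b))"

text \<open>Extensionality makes embeddings that agree on F equal, so that the set can be finite and
  products over it are norms.\<close>

definition emb :: "complex set \<Rightarrow> (complex \<Rightarrow> complex) set" where
 "emb F = {\<sigma> \<in> extensional F. \<sigma> 1 = 1 \<and> (\<forall>x\<in>F. \<forall>y\<in>F. \<sigma> (x + y) = \<sigma> x + \<sigma> y \<and> \<sigma> (x * y) = \<sigma> x * \<sigma> y)}"

context complex_number_field
begin

lemma zero_mem: "0 \<in> F" using diff_mem[OF one_mem one_mem] by simp
lemma minus_mem: "x \<in> F \<Longrightarrow> - x \<in> F" using diff_mem[OF zero_mem] by force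
lemma add_mem: "x \<in> F \<Longrightarrow> y \<in> F \<Longrightarrow> x + y \<in> F" using diff_mem[of x "- y"] minus_mem by force
lemma divide_mem: "x \<in> F \<Longrightarrow> y \<in> F \<Longrightarrow> x / y \<in> F" by (simp add: divide_inverse mult_mem inverse_mem)
lemma sum_mem: "(\<And>i. i \<in> A \<Longrightarrow> f i \<in> F) \<Longrightarrow> sum f A \<in> F"
 by (induction A rule: infinite_finite_induct) (auto intro: add_mem zero_mem)
lemma power_mem: "x \<in> F \<Longrightarrow> x ^ n \<in> F" by (induction n) (auto intro: mult_mem one_mem)
lemma of_nat_mem: "of_nat n \<in> F" by (induction n) (auto intro: add_mem one_mem zero_mem)
lemma of_int_mem: "of_int n \<in> F" by (cases n rule: int_diff_cases) (auto intro: diff_mem of_nat_mem)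
lemma numeral_mem: "numeral n \<in> F" using of_nat_mem[of "numeral n"] by simp
lemma of_rat_mem: "of_rat q \<in> F"
proof (cases q)
 case (Fract a b)
 thus ?thesis using divide_mem[OF of_int_mem[of a] of_int_mem[of b]] by (simp add: of_rat_rat)
qed
lemma Rats_mem: "q \<in> \<rat> \<Longrightarrow> q \<in> F" by (auto simp: Rats_def of_rat_mem)

text \<open>Multiplication by x maps the rational span of B into itself. Some element of B is
  nonzero because 1 lies in the span.\<close>

lemma algebraic_mem:
 assumes x: "x \<in> F" shows "algebraic x"
proof -
 obtain B where B: "finite B" "B \<subseteq> F" "\<forall>x\<in>F. \<exists>q :: complex \<Rightarrow> rat. x = (\<Sum>b\<in>B. of_rat (q b) * b)"
  using finite_span by blast
 have "\<exists>b\<in>B. b \<noteq> 0"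
 proof (rule ccontr)
  assume "\<not> (\<exists>b\<in>B. b \<noteq> 0)"
  hence "(\<Sum>b\<in>B. of_rat (q b) * b) = 0" for q :: "complex \<Rightarrow> rat" by (intro sum.neutral) auto
  thus False using B(3) one_mem by (metis zero_neq_one)
 qed
 then obtain b0 where b0: "b0 \<in> B" "b0 \<noteq> 0" by blast
 have "\<forall>b\<in>B. \<exists>q :: complex \<Rightarrow> rat. x * b = (\<Sum>c\<in>B. of_rat (q c) * c)" using B x by (meson mult_mem subsetD)
 then obtain q :: "complex \<Rightarrow> complex \<Rightarrow> rat" where q: "\<And>b. b \<in> B \<Longrightarrow> x * b = (\<Sum>c\<in>B. of_rat (q b c) * c)"
  by (auto dest!: bchoice)
 show ?thesis by (rule algebraic_rational_eigenvalue[where v = "\<lambda>b. b" and q = q, OF B(1) b0]) (use q in auto)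
qed

end

lemma emb_extI:
 assumes "\<sigma> \<in> emb F" "\<tau> \<in> emb F" "\<And>x. x \<in> F \<Longrightarrow> \<sigma> x = \<tau> x"
 shows "\<sigma> = \<tau>"
 using assms extensionalityI[of \<sigma> F \<tau>] unfolding emb_def by blast

locale embedding = complex_number_field F for F :: "complex set" +
 fixes \<sigma> :: "complex \<Rightarrow> complex"
 assumes emb: "\<sigma> \<in> emb F"
begin

lemma e_one [simp]: "\<sigma> 1 = 1" using emb by (simp add: emb_def)
lemma e_add: "x \<in> F \<Longrightarrow> y \<in> F \<Longrightarrow> \<sigma> (x + y) = \<sigma> x + \<sigma> y" using emb by (simp add: emb_def)
lemma e_mult: "x \<in> F \<Longrightarrow> y \<in> F \<Longrightarrow> \<sigma> (x * y) = \<sigma> x * \<sigma> y" using emb by (simp add: emb_def)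
lemma e_zero [simp]: "\<sigma> 0 = 0" using e_add[OF zero_mem zero_mem] by simp
lemma e_minus: "x \<in> F \<Longrightarrow> \<sigma> (- x) = - \<sigma> x"
 using e_add[of x "- x"] minus_mem by (simp add: eq_neg_iff_add_eq_0 add.commute)
lemma e_diff: "x \<in> F \<Longrightarrow> y \<in> F \<Longrightarrow> \<sigma> (x - y) = \<sigma> x - \<sigma> y"
 using e_add[of x "- y"] by (simp add: minus_mem e_minus)
lemma e_inverse: assumes "x \<in> F" shows "\<sigma> (inverse x) = inverse (\<sigma> x)"
proof (cases "x = 0")
 case False
 hence "\<sigma> x * \<sigma> (inverse x) = 1" using e_mult[OF assms inverse_mem[OF assms]] by simp
 thus ?thesis by (metis inverse_unique)
qed simp
lemma e_divide: "x \<in> F \<Longrightarrow> y \<in> F \<Longrightarrow> \<sigma> (x / y) = \<sigma> x / \<sigma> y"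
 by (simp add: divide_inverse e_mult e_inverse inverse_mem)
lemma e_zero_iff: assumes "x \<in> F" shows "\<sigma> x = 0 \<longleftrightarrow> x = 0"
proof
 assume 0: "\<sigma> x = 0"
 show "x = 0"
 proof (rule ccontr)
  assume "x \<noteq> 0"
  hence "\<sigma> x * \<sigma> (inverse x) = 1" using e_mult[OF assms inverse_mem[OF assms]] by simp
  with 0 show False by simp
 qed
qed simp
lemma e_sum: "(\<And>i. i \<in> A \<Longrightarrow> f i \<in> F) \<Longrightarrow> \<sigma> (sum f A) = (\<Sum>i\<in>A. \<sigma> (f i))"
 by (induction A rule: infinite_finite_induct) (auto simp: e_add sum_mem)
lemma e_power: "x \<in> F \<Longrightarrow> \<sigma> (x ^ n) = \<sigma> x ^ n" by (induction n) (auto simp: e_mult power_mem)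
lemma e_of_nat [simp]: "\<sigma> (of_nat n) = of_nat n" by (induction n) (auto simp: e_add one_mem of_nat_mem)
lemma e_of_int [simp]: "\<sigma> (of_int n) = of_int n" by (cases n rule: int_diff_cases) (auto simp: e_diff of_nat_mem)
lemma e_numeral [simp]: "\<sigma> (numeral n) = numeral n" using e_of_nat[of "numeral n"] by simp
lemma e_of_rat [simp]: "\<sigma> (of_rat q) = of_rat q"
proof (cases q)
 case (Fract a b)
 thus ?thesis using e_divide[OF of_int_mem[of a] of_int_mem[of b]] by (simp add: of_rat_rat)
qed
lemma e_Rats: "q \<in> \<rat> \<Longrightarrow> \<sigma> q = q" by (auto simp: Rats_def)

lemma e_poly:
 assumes "\<And>i. coeff p i \<in> \<rat>" "x \<in> F"
 shows "\<sigma> (poly p x) = poly p (\<sigma> x)"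
 unfolding poly_altdef using assms by (subst e_sum) (auto simp: e_mult e_power e_Rats Rats_mem power_mem intro!: mult_mem)

lemma e_algebraic_int:
 assumes "x \<in> F" "algebraic_int x"
 shows "algebraic_int (\<sigma> x)"
proof -
 obtain p where p: "lead_coeff p = 1" "\<forall>i. coeff p i \<in> \<int>" "poly p x = 0" using assms(2) by (auto elim: algebraic_int.cases)
 have "poly p (\<sigma> x) = \<sigma> (poly p x)" using p(2) Ints_subset_Rats assms(1) by (intro e_poly[symmetric]) auto
 thus ?thesis using p by (intro algebraic_int.intros[of p]) auto
qed

end

context complex_number_field
begin

lemma embedding: "\<sigma> \<in> emb F \<Longrightarrow> embedding F \<sigma>"
 by (simp add: embedding_def embedding_axioms_def complex_number_field_axioms)

lemma id_emb: "(\<lambda>x\<in>F. x) \<in> emb F" by (auto simp: emb_def one_mem add_mem mult_mem)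

lemma cnj_emb: "\<sigma> \<in> emb F \<Longrightarrow> (\<lambda>x\<in>F. cnj (\<sigma> x)) \<in> emb F"
 by (auto simp: emb_def one_mem add_mem mult_mem)

text \<open>An embedding is determined by its values on B, and each b in B can only go to a root of
  a fixed rational polynomial.\<close>

lemma finite_emb: "finite (emb F)"
proof -
 obtain B where B: "finite B" "B \<subseteq> F" "\<forall>x\<in>F. \<exists>q :: complex \<Rightarrow> rat. x = (\<Sum>b\<in>B. of_rat (q b) * b)"
  using finite_span by blast
 have "\<exists>p. p \<noteq> 0 \<and> (\<forall>i. coeff p i \<in> \<rat>) \<and> poly p b = 0" if "b \<in> B" for b
  using algebraic_mem[of b] B(2) that by (auto simp: algebraic_altdef)
 then obtain p where p: "\<And>b. b \<in> B \<Longrightarrow> p b \<noteq> 0 \<and> (\<forall>i. coeff (p b) i \<in> \<rat>) \<and> poly (p b) b = 0" by metis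
 let ?T = "PiE B (\<lambda>b. {z. poly (p b) z = 0})"
 have "finite ?T" using B(1) p by (intro finite_PiE) (auto simp: poly_roots_finite)
 moreover have "(\<lambda>\<sigma>. restrict \<sigma> B) ` emb F \<subseteq> ?T"
 proof clarify
  fix \<sigma> assume "\<sigma> \<in> emb F"
  then interpret embedding F \<sigma> by (rule embedding)
  have "poly (p b) (\<sigma> b) = 0" if "b \<in> B" for b using e_poly[of "p b" b] p[OF that] B(2) that by auto
  thus "restrict \<sigma> B \<in> ?T" by auto
 qed
 moreover have "inj_on (\<lambda>\<sigma>. restrict \<sigma> B) (emb F)"
 proof (rule inj_onI)
  fix \<sigma> \<tau> assume st: "\<sigma> \<in> emb F" "\<tau> \<in> emb F" and eq: "restrict \<sigma> B = restrict \<tau> B"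
  interpret s: embedding F \<sigma> by (rule embedding) fact
  interpret t: embedding F \<tau> by (rule embedding) fact
  show "\<sigma> = \<tau>"
  proof (rule emb_extI[OF st])
   fix x assume "x \<in> F"
   then obtain q :: "complex \<Rightarrow> rat" where q: "x = (\<Sum>b\<in>B. of_rat (q b) * b)" using B(3) by blast
   have "\<sigma> b = \<tau> b" if "b \<in> B" for b using fun_cong[OF eq, of b] that by simp
   moreover have "b \<in> F" "of_rat (q b) * b \<in> F" if "b \<in> B" for b using B(2) that by (auto intro: mult_mem of_rat_mem)
   ultimately show "\<sigma> x = \<tau> x" unfolding q by (simp add: s.e_sum t.e_sum s.e_mult t.e_mult of_rat_mem)
  qed
 qed
 ultimately show ?thesis by (metis finite_imageD finite_subset)
qed

end

section \<open>Extending embeddings of subfields into the complex numbers\<close>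

lemma complex_field_simps [simp]:
 "carrier complex_field = UNIV" "x \<otimes>\<^bsub>complex_field\<^esub> y = x * y" "\<one>\<^bsub>complex_field\<^esub> = 1"
 "\<zero>\<^bsub>complex_field\<^esub> = 0" "x \<oplus>\<^bsub>complex_field\<^esub> y = x + y"
 by (simp_all add: ring_of_type_algebra_def)

lemma field_complex_field: "field complex_field" by (rule field_from_type_algebra)

interpretation cf: cring complex_field by (rule cring_from_type_algebra)

lemma complex_field_pow [simp]: "x [^]\<^bsub>complex_field\<^esub> (n :: nat) = x ^ n" by (induction n) (auto simp: mult.commute)

lemma complex_field_neg [simp]: "\<ominus>\<^bsub>complex_field\<^esub> x = - x"
proof -
 have "x + (\<ominus>\<^bsub>complex_field\<^esub> x) = 0" using cf.r_neg[of x] by simp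
 thus ?thesis by (simp add: eq_neg_iff_add_eq_0 add.commute)
qed

lemma complex_field_inv [simp]: "x \<noteq> 0 \<Longrightarrow> inv\<^bsub>complex_field\<^esub> x = inverse x" by (rule cf.comm_inv_char) auto

lemma complex_field_eval: "cf.eval p x = poly (Poly (rev p)) x" by (induction p) (auto simp: Poly_append poly_monom)

text \<open>Evaluation at \<beta> of the image of a polynomial under h. \<open>ring.eval\<close>
  keeps coefficients and point in one ring, whereas here h first carries the coefficients to the
  complex numbers.\<close>

fun list_ev :: "('a \<Rightarrow> complex) \<Rightarrow> complex \<Rightarrow> 'a list \<Rightarrow> complex" where
 "list_ev h \<beta> [] = 0"
| "list_ev h \<beta> (a # p) = h a * \<beta> ^ length p + list_ev h \<beta> p"

lemma list_ev_poly: "list_ev h \<beta> p = poly (Poly (rev (map h p))) \<beta>" by (induction p) (auto simp: Poly_append poly_monom)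

lemma list_ev_append: "list_ev h \<beta> (p @ q) = list_ev h \<beta> p * \<beta> ^ length q + list_ev h \<beta> q"
 by (induction p) (auto simp: algebra_simps power_add)

text \<open>The state of an extension process: h is defined on the subfield E and is enlarged by one
  algebraic element at a time. The case where K is the complex field itself yields the conjugates of
  algebraic numbers.\<close>

locale partial_embedding = field K for K (structure) +
 fixes E :: "'a set" and h :: "'a \<Rightarrow> complex"
 assumes E: "subfield E K" and h: "h \<in> Ring.ring_hom (K\<lparr>carrier := E\<rparr>) complex_field"
begin

lemma E_mem: "\<zero> \<in> E" "\<one> \<in> E" "x \<in> E \<Longrightarrow> y \<in> E \<Longrightarrow> x \<oplus> y \<in> E" "x \<in> E \<Longrightarrow> y \<in> E \<Longrightarrow> x \<otimes> y \<in> E"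
 "x \<in> E \<Longrightarrow> x \<in> carrier K"
 using subringE[OF subfieldE(1)[OF E]] by auto

lemma h_simps: "h \<one> = 1" "x \<in> E \<Longrightarrow> y \<in> E \<Longrightarrow> h (x \<oplus> y) = h x + h y" "x \<in> E \<Longrightarrow> y \<in> E \<Longrightarrow> h (x \<otimes> y) = h x * h y"
 using ring_hom_memE[OF h] by auto

lemma h_zero: "h \<zero> = 0" using h_simps(2)[OF E_mem(1) E_mem(1)] E_mem(1)[THEN E_mem(5)] by simp

lemma list_ev_replicate: "list_ev h \<beta> (replicate n \<zero>) = 0" by (induction n) (auto simp: h_zero)

lemma list_ev_normalize: "list_ev h \<beta> (normalize p) = list_ev h \<beta> p" by (induction p) (auto simp: h_zero)

lemma list_ev_map2: "length p = length q \<Longrightarrow> set p \<subseteq> E \<Longrightarrow> set q \<subseteq> E \<Longrightarrow>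
  list_ev h \<beta> (map2 (\<oplus>) p q) = list_ev h \<beta> p + list_ev h \<beta> q"
 by (induction p q rule: list_induct2) (auto simp: h_simps algebra_simps)

lemma list_ev_poly_add_aux: "length p \<ge> length q \<Longrightarrow> set p \<subseteq> E \<Longrightarrow> set q \<subseteq> E \<Longrightarrow>
  list_ev h \<beta> (poly_add p q) = list_ev h \<beta> p + list_ev h \<beta> q"
 using list_ev_map2[of p "replicate (length p - length q) \<zero> @ q" \<beta>] E_mem(1)
 by (auto simp: list_ev_normalize list_ev_append list_ev_replicate set_replicate_conv_if)

lemma list_ev_poly_add: "set p \<subseteq> E \<Longrightarrow> set q \<subseteq> E \<Longrightarrow>
  list_ev h \<beta> (poly_add p q) = list_ev h \<beta> p + list_ev h \<beta> q"
proof (cases "length p \<ge> length q")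
 case False
 assume pq: "set p \<subseteq> E" "set q \<subseteq> E"
 have "poly_add p q = poly_add q p" using False by (subst poly_add.simps) simp
 thus ?thesis using list_ev_poly_add_aux[of p q \<beta>] False pq by simp
qed (rule list_ev_poly_add_aux)

lemma list_ev_scale: "a \<in> E \<Longrightarrow> set q \<subseteq> E \<Longrightarrow> list_ev h \<beta> (map ((\<otimes>) a) q) = h a * list_ev h \<beta> q"
 by (induction q) (auto simp: h_simps algebra_simps)

lemma poly_add_set: "set p \<subseteq> E \<Longrightarrow> set q \<subseteq> E \<Longrightarrow> set (poly_add p q) \<subseteq> E"
 using poly_add_is_polynomial[OF subfieldE(1)[OF E], of p q] by (auto simp: polynomial_def)

lemma list_ev_poly_mult: "set p \<subseteq> E \<Longrightarrow> set q \<subseteq> E \<Longrightarrow>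
  set (poly_mult p q) \<subseteq> E \<and> list_ev h \<beta> (poly_mult p q) = list_ev h \<beta> p * list_ev h \<beta> q"
proof (induction p)
 case (Cons a p)
 let ?r = "map ((\<otimes>) a) q @ replicate (length p) \<zero>"
 have r: "set ?r \<subseteq> E" using Cons.prems E_mem by (auto simp: set_replicate_conv_if)
 have IH: "set (poly_mult p q) \<subseteq> E" "list_ev h \<beta> (poly_mult p q) = list_ev h \<beta> p * list_ev h \<beta> q" using Cons by auto
 have eq: "poly_mult (a # p) q = poly_add ?r (poly_mult p q)" by simp
 show ?case unfolding eq using poly_add_set[OF r IH(1)] list_ev_poly_add[OF r IH(1), of \<beta>] IH(2) Cons.prems
  by (simp add: list_ev_append list_ev_replicate list_ev_scale algebra_simps)
qed simp

lemma list_ev_ring_hom: "list_ev h \<beta> \<in> Ring.ring_hom (univ_poly K E) complex_field"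
proof (rule ring_hom_memI)
 have set_E: "set p \<subseteq> E" if "p \<in> carrier (univ_poly K E)" for p using that by (auto simp: univ_poly_def polynomial_def)
 fix p q assume "p \<in> carrier (univ_poly K E)" "q \<in> carrier (univ_poly K E)"
 thus "list_ev h \<beta> (p \<oplus>\<^bsub>univ_poly K E\<^esub> q) = list_ev h \<beta> p \<oplus>\<^bsub>complex_field\<^esub> list_ev h \<beta> q"
  "list_ev h \<beta> (p \<otimes>\<^bsub>univ_poly K E\<^esub> q) = list_ev h \<beta> p \<otimes>\<^bsub>complex_field\<^esub> list_ev h \<beta> q"
  using list_ev_poly_add[of p q \<beta>] list_ev_poly_mult[of p q \<beta>] set_E by (auto simp: univ_poly_add univ_poly_mult)
qed (auto simp: univ_poly_one h_simps)

text \<open>E(x) consists of the values p(x), and p(x) \<mapsto> p(\<beta>) is well defined: if two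
  polynomials agree at x, the minimal polynomial divides their difference, and \<beta> is a root of
  its image.\<close>

lemma extend_to_root:
 assumes x: "x \<in> carrier K" "(algebraic over E) x" and root: "list_ev h \<beta> (Irr E x) = 0"
 shows "\<exists>h'. partial_embedding K (simple_extension E x) h' \<and> (\<forall>y\<in>E. h' y = h y) \<and> h' x = \<beta>"
proof -
 let ?P = "univ_poly K E" and ?S = "simple_extension E x"
 note subr = subfieldE(1)[OF E]
 interpret UP: ring ?P by (rule univ_poly_is_ring[OF subr])
 interpret ev: ring_hom_ring ?P K "\<lambda>p. eval p x" by (rule eval_ring_hom[OF subr x(1)])
 interpret le: ring_hom_ring ?P complex_field "list_ev h \<beta>"
  by (intro ring_hom_ringI2 UP.ring_axioms cf.ring_axioms list_ev_ring_hom)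
 have ker: "list_ev h \<beta> p = 0" if p: "p \<in> carrier ?P" "eval p x = \<zero>" for p
 proof -
  have "Irr E x divides\<^bsub>?P\<^esub> p" using Irr_minimal[OF E x p] pdivides_iff_shell[OF E IrrE(1)[OF E x] p(1)] by simp
  then obtain r where r: "r \<in> carrier ?P" "p = Irr E x \<otimes>\<^bsub>?P\<^esub> r" unfolding factor_def by blast
  show ?thesis using le.hom_mult[OF IrrE(1)[OF E x] r(1)] r(2) root by simp
 qed
 have wd: "list_ev h \<beta> p = list_ev h \<beta> q" if pq: "p \<in> carrier ?P" "q \<in> carrier ?P" "eval p x = eval q x" for p q
 proof -
  have "eval (p \<ominus>\<^bsub>?P\<^esub> q) x = \<zero>" using pq ev.hom_closed[OF pq(2)] by (simp add: a_minus_def r_neg)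
  hence "list_ev h \<beta> (p \<ominus>\<^bsub>?P\<^esub> q) = 0" using ker pq by blast
  thus ?thesis using pq by (simp add: a_minus_def)
 qed
 have S: "?S = (\<lambda>p. eval p x) ` carrier ?P" by (rule simple_extension_as_eval_img) (use E_mem x in auto)
 \<comment> \<open>Any polynomial that represents y may be chosen; \<open>wd\<close> makes the value
   independent of the choice.\<close>
 define h' where "h' y = list_ev h \<beta> (SOME p. p \<in> carrier ?P \<and> eval p x = y)" for y
 have h': "h' (eval p x) = list_ev h \<beta> p" if p: "p \<in> carrier ?P" for p
 proof -
  have "(SOME q. q \<in> carrier ?P \<and> eval q x = eval p x) \<in> carrier ?P \<and>
    eval (SOME q. q \<in> carrier ?P \<and> eval q x = eval p x) x = eval p x"
   by (rule someI[of "\<lambda>q. q \<in> carrier ?P \<and> eval q x = eval p x" p]) (use p in simp)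
  thus ?thesis unfolding h'_def using wd p by blast
 qed
 have hom: "h' \<in> Ring.ring_hom (K\<lparr>carrier := ?S\<rparr>) complex_field"
 proof (rule ring_hom_memI)
  fix y z assume "y \<in> carrier (K\<lparr>carrier := ?S\<rparr>)" "z \<in> carrier (K\<lparr>carrier := ?S\<rparr>)"
  then obtain p q where pq: "p \<in> carrier ?P" "q \<in> carrier ?P" "y = eval p x" "z = eval q x" unfolding S by auto
  show "h' (y \<otimes>\<^bsub>K\<lparr>carrier := ?S\<rparr>\<^esub> z) = h' y \<otimes>\<^bsub>complex_field\<^esub> h' z"
   using h'[OF UP.m_closed[OF pq(1,2)]] h'[OF pq(1)] h'[OF pq(2)] pq by simp
  show "h' (y \<oplus>\<^bsub>K\<lparr>carrier := ?S\<rparr>\<^esub> z) = h' y \<oplus>\<^bsub>complex_field\<^esub> h' z"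
   using h'[OF UP.a_closed[OF pq(1,2)]] h'[OF pq(1)] h'[OF pq(2)] pq by simp
 next
  show "h' \<one>\<^bsub>K\<lparr>carrier := ?S\<rparr>\<^esub> = \<one>\<^bsub>complex_field\<^esub>" using h'[OF UP.one_closed] by simp
 qed simp
 have "h' y = h y" if y: "y \<in> E" for y
 proof (cases "y = \<zero>")
  case True
  thus ?thesis using h'[OF UP.zero_closed] h_zero by simp
 next
  case False
  hence "[y] \<in> carrier ?P" using y by (simp add: univ_poly_def polynomial_def)
  from h'[OF this] show ?thesis using E_mem(5)[OF y] by simp
 qed
 moreover have "h' x = \<beta>"
 proof -
  have "[\<one>, \<zero>] \<in> carrier ?P" using E_mem by (simp add: univ_poly_def polynomial_def)
  from h'[OF this] show ?thesis using x(1) by (simp add: h_simps h_zero)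
 qed
 moreover have "subfield ?S K" using simple_extension_is_subfield[OF E x(1)] x(2) by simp
 ultimately show ?thesis using hom by (intro exI[of _ h']) (auto simp: partial_embedding_def partial_embedding_axioms_def field_axioms)
qed

text \<open>h sends the leading coefficient 1 to 1, so the image of the minimal polynomial keeps its
  positive degree and has a complex root.\<close>

lemma exists_root_Irr:
 assumes x: "x \<in> carrier K" "(algebraic over E) x"
 shows "\<exists>\<beta>. list_ev h \<beta> (Irr E x) = 0"
proof -
 obtain p where p: "Irr E x = \<one> # p"
  using IrrE(2,3)[OF E x] IrrE(1)[OF E x] pirreducibleE(1)[OF subfieldE(1)[OF E] IrrE(1)[OF E x] IrrE(2)[OF E x]] by (cases "Irr E x") auto
 have "p \<noteq> []"
 proof
  assume "p = []"
  thus False using IrrE(4)[OF E x] p x(1) by simp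
 qed
 let ?q = "Poly (rev (map h (Irr E x)))"
 have "poly.coeff ?q (length p) = 1" using p by (simp add: h_simps nth_append coeff_Poly_eq nth_default_append)
 hence "length p \<le> Polynomial.degree ?q" by (intro le_degree) simp
 hence "Polynomial.degree ?q \<noteq> 0" using \<open>p \<noteq> []\<close> by (cases p) auto
 hence "\<exists>z. poly ?q z = 0" by (intro fundamental_theorem_of_algebra) (simp add: constant_degree)
 thus ?thesis by (simp add: list_ev_poly)
qed

lemma extend_to_finite_set:
 assumes "finite A" "A \<subseteq> carrier K" "\<And>x. x \<in> A \<Longrightarrow> (algebraic over E) x"
 shows "\<exists>E' h'. partial_embedding K E' h' \<and> E \<subseteq> E' \<and> A \<subseteq> E' \<and> (\<forall>y\<in>E. h' y = h y)"
 using assms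
proof (induction A)
 case empty
 thus ?case using partial_embedding_axioms by blast
next
 case (insert x A)
 then obtain E' h' where E': "partial_embedding K E' h'" "E \<subseteq> E'" "A \<subseteq> E'" "\<forall>y\<in>E. h' y = h y" by auto
 interpret E': partial_embedding K E' h' by fact
 have x: "x \<in> carrier K" "(algebraic over E') x" using insert.prems algebraic_mono[of E E'] E'(2) E'.E_mem(5) by (auto simp: over_def)
 obtain \<beta> where "list_ev h' \<beta> (Irr E' x) = 0" using E'.exists_root_Irr[OF x] by blast
 then obtain h'' where h'': "partial_embedding K (simple_extension E' x) h''" "\<forall>y\<in>E'. h'' y = h' y"
  using E'.extend_to_root[OF x] by blast
 have "E' \<subseteq> simple_extension E' x" "x \<in> simple_extension E' x"
  using simple_extension_incl[of E' x] simple_extension_mem[of E' x] subfieldE(1)[OF E'.E] E'.E_mem(5) x by auto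
 thus ?case using h'' E' by (intro exI[of _ "simple_extension E' x"] exI[of _ h'']) auto
qed

end

text \<open>Links two encodings of a monic integer polynomial: the polynomial type behind
  \<open>algebraic_int\<close>, and the lists with leading coefficient first in
  \<open>ring_of_integers\<close>.\<close>

lemma algebraic_int_iff_monic_list:
 fixes z :: complex
 shows "algebraic_int z \<longleftrightarrow> (\<exists>ks :: int list. ks \<noteq> [] \<and> hd ks = 1 \<and> poly (Poly (rev (map of_int ks))) z = 0)"
proof
 assume "algebraic_int z"
 then obtain q :: "int poly" where q: "poly (map_poly of_int q) z = 0" "lead_coeff q = 1" unfolding algebraic_int_altdef_ipoly by blast
 have q0: "q \<noteq> 0" using q(2) by auto
 have "hd (rev (coeffs q)) = 1" using q q0 by (simp add: hd_rev last_coeffs_eq_coeff_degree)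
 moreover have "rev (coeffs q) \<noteq> []" using q0 by simp
 moreover have "Poly (rev (map of_int (rev (coeffs q)))) = (map_poly of_int q :: complex poly)" by (simp add: map_poly_def rev_map)
 ultimately show "\<exists>ks :: int list. ks \<noteq> [] \<and> hd ks = 1 \<and> poly (Poly (rev (map of_int ks))) z = 0" using q(1) by metis
next
 assume "\<exists>ks :: int list. ks \<noteq> [] \<and> hd ks = 1 \<and> poly (Poly (rev (map of_int ks))) z = 0"
 then obtain ks' where ks: "poly (Poly (rev (map of_int (1 # ks')))) z = 0" by (metis list.exhaust list.sel(1))
 let ?q = "Poly (rev (map of_int (1 # ks'))) :: complex poly"
 have c: "coeff ?q (length ks') = 1" by (simp add: coeff_Poly_eq nth_default_append)
 have "degree ?q \<le> length ks'" by (intro degree_le) (auto simp: coeff_Poly_eq nth_default_beyond)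
 hence "degree ?q = length ks'" using c le_degree[of ?q "length ks'"] by fastforce
 hence "lead_coeff ?q = 1" using c by simp
 moreover have "coeff ?q i \<in> \<int>" for i
 proof -
  have "set (rev (map of_int (1 # ks'))) \<subseteq> (\<int> :: complex set)" by auto
  thus ?thesis unfolding coeff_Poly_eq nth_default_def by (metis Ints_0 nth_mem subsetD)
 qed
 ultimately show "algebraic_int z" using ks by (intro algebraic_int.intros[of ?q]) auto
qed

section \<open>Embedding an abstract number field into the complex numbers\<close>

context number_field
begin

abbreviation prime_field :: "'a set" where "prime_field \<equiv> generate_field K {}"
abbreviation int_embed :: "int \<Rightarrow> 'a" where "int_embed k \<equiv> add_pow K k \<one>"

lemma int_embed_add: "int_embed (i + j) = int_embed i \<oplus> int_embed j" by (rule add.int_pow_mult) simp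

lemma int_embed_mult: "int_embed (i * j) = int_embed i \<otimes> int_embed j"
proof -
 have "int_embed i \<otimes> int_embed j = add_pow K i (\<one> \<otimes> int_embed j)" by (rule add_pow_ldistr_int) auto
 also have "\<dots> = int_embed (i * j)" by (simp add: add.int_pow_pow mult.commute)
 finally show ?thesis by simp
qed

lemma int_embed_closed [simp]: "int_embed i \<in> carrier K" by (rule add.int_pow_closed) simp

lemma int_embed_zero [simp]: "int_embed 0 = \<zero>" by (simp add: add_pow_def)

lemma int_embed_one [simp]: "int_embed 1 = \<one>" using add.int_pow_1[OF one_closed] by simp

lemma int_embed_minus: "int_embed (- i) = \<ominus> int_embed i" by (rule add.int_pow_neg) simp

lemma int_embed_eq_zero: "int_embed i = \<zero> \<longleftrightarrow> i = 0"
proof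
 assume i: "int_embed i = \<zero>"
 show "i = 0"
 proof (rule ccontr)
  assume "i \<noteq> 0"
  hence n: "nat \<bar>i\<bar> > 0" by simp
  have "int_embed \<bar>i\<bar> = \<zero>" using i int_embed_minus[of i] by (cases "i \<ge> 0") auto
  moreover have "int_embed \<bar>i\<bar> = add_pow K (nat \<bar>i\<bar>) \<one>" by (subst add_pow_int_ge) auto
  ultimately show False using char_0[OF n] by simp
 qed
qed simp

lemma prime_field_fraction:
 assumes "x \<in> prime_field"
 shows "x \<in> carrier K \<and> (\<exists>a b. b \<noteq> 0 \<and> x \<otimes> int_embed b = int_embed a)"
 using assms
proof (induction rule: generate_field.induct)
 case one
 show ?case by (intro conjI exI[of _ 1]) auto
next
 case (a_inv x)
 then obtain a b where "b \<noteq> 0" "x \<otimes> int_embed b = int_embed a" by blast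
 thus ?case using a_inv by (intro conjI exI[of _ b] exI[of _ "- a"]) (auto simp: l_minus int_embed_minus)
next
 case (m_inv x)
 then obtain a b where ab: "b \<noteq> 0" "x \<otimes> int_embed b = int_embed a" by blast
 have u: "x \<in> Units K" using m_inv by (simp add: field_Units)
 have "a \<noteq> 0"
 proof
  assume "a = 0"
  hence "x \<otimes> int_embed b = \<zero>" using ab by simp
  thus False using m_inv ab integral[of x "int_embed b"] by (auto simp: int_embed_eq_zero)
 qed
 moreover have "inv x \<otimes> int_embed a = int_embed b" using ab(2)[symmetric] u by (simp add: m_assoc[symmetric] Units_closed del: ab)
 ultimately show ?case using u by (intro conjI exI[of _ a] exI[of _ b]) auto
next
 case (eng_add x y)
 then obtain a b c d where ab: "b \<noteq> 0" "x \<otimes> int_embed b = int_embed a" and cd: "d \<noteq> 0" "y \<otimes> int_embed d = int_embed c"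
  by blast
 have "(x \<oplus> y) \<otimes> int_embed (b * d) = x \<otimes> int_embed b \<otimes> int_embed d \<oplus> y \<otimes> int_embed d \<otimes> int_embed b"
  using eng_add by (simp add: int_embed_mult l_distr m_ac)
 also have "\<dots> = int_embed (a * d + c * b)" using ab cd by (simp add: int_embed_add int_embed_mult)
 finally show ?case using eng_add ab cd by (intro conjI exI[of _ "b * d"] exI[of _ "a * d + c * b"]) auto
next
 case (eng_mult x y)
 then obtain a b c d where ab: "b \<noteq> 0" "x \<otimes> int_embed b = int_embed a" and cd: "d \<noteq> 0" "y \<otimes> int_embed d = int_embed c"
  by blast
 have "(x \<otimes> y) \<otimes> int_embed (b * d) = (x \<otimes> int_embed b) \<otimes> (y \<otimes> int_embed d)"
  using eng_mult by (simp add: int_embed_mult m_ac)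
 also have "\<dots> = int_embed (a * c)" using ab cd by (simp add: int_embed_mult)
 finally show ?case using eng_mult ab cd by (intro conjI exI[of _ "b * d"] exI[of _ "a * c"]) auto
qed auto

text \<open>The value a / b for any presentation of x as a fraction of integers. Presentations agree
  because the characteristic is 0.\<close>

definition prime_embed :: "'a \<Rightarrow> complex" where
 "prime_embed x = (THE z. \<forall>a b. b \<noteq> 0 \<longrightarrow> x \<otimes> int_embed b = int_embed a \<longrightarrow> z = of_int a / of_int b)"

lemma prime_embed_eq:
 assumes x: "x \<in> carrier K" "b \<noteq> 0" "x \<otimes> int_embed b = int_embed a"
 shows "prime_embed x = of_int a / of_int b"
 unfolding prime_embed_def
proof (rule the_equality)
 show "\<forall>a' b'. b' \<noteq> 0 \<longrightarrow> x \<otimes> int_embed b' = int_embed a' \<longrightarrow> of_int a / of_int b = (of_int a' / of_int b' :: complex)"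
 proof (intro allI impI)
  fix a' b' :: int assume b': "b' \<noteq> 0" "x \<otimes> int_embed b' = int_embed a'"
  have "int_embed (a * b') = x \<otimes> int_embed b \<otimes> int_embed b'" unfolding x(3) by (rule int_embed_mult)
  also have "\<dots> = x \<otimes> int_embed b' \<otimes> int_embed b" using x(1) by (simp add: m_ac)
  also have "\<dots> = int_embed (a' * b)" using b' by (simp add: int_embed_mult)
  finally have "int_embed (a * b' + - (a' * b)) = \<zero>" unfolding int_embed_add int_embed_minus by (simp add: r_neg)
  hence "a * b' = a' * b" by (simp add: int_embed_eq_zero)
  hence "(of_int a * of_int b' :: complex) = of_int a' * of_int b" by (simp flip: of_int_mult)
  thus "of_int a / of_int b = (of_int a' / of_int b' :: complex)" using x(2) b'(1) by (simp add: frac_eq_eq)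
 qed
qed (use x in blast)

lemma partial_embedding_prime_field: "partial_embedding K prime_field prime_embed" unfolding partial_embedding_def partial_embedding_axioms_def
proof (intro conjI field_axioms generate_field_is_subfield ring_hom_memI; simp?)
 show "prime_embed \<one> = 1" using prime_embed_eq[OF one_closed, of 1 1] by simp
 fix x y assume xy': "x \<in> prime_field" "y \<in> prime_field"
 from prime_field_fraction[OF xy'(1)] obtain a b where x: "x \<in> carrier K"
  and ab: "b \<noteq> 0" "x \<otimes> int_embed b = int_embed a" by (elim conjE exE)
 from prime_field_fraction[OF xy'(2)] obtain c d where y: "y \<in> carrier K"
  and cd: "d \<noteq> 0" "y \<otimes> int_embed d = int_embed c" by (elim conjE exE)
 note xy = x y
 have "(x \<oplus> y) \<otimes> int_embed (b * d) = x \<otimes> int_embed b \<otimes> int_embed d \<oplus> y \<otimes> int_embed d \<otimes> int_embed b"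
  using xy by (simp add: int_embed_mult l_distr m_ac)
 also have "\<dots> = int_embed (a * d + c * b)" using ab cd by (simp add: int_embed_add int_embed_mult)
 finally have s: "(x \<oplus> y) \<otimes> int_embed (b * d) = int_embed (a * d + c * b)" .
 have "(x \<otimes> y) \<otimes> int_embed (b * d) = (x \<otimes> int_embed b) \<otimes> (y \<otimes> int_embed d)"
  using xy by (simp add: int_embed_mult m_ac)
 also have "\<dots> = int_embed (a * c)" using ab cd by (simp add: int_embed_mult)
 finally have p: "(x \<otimes> y) \<otimes> int_embed (b * d) = int_embed (a * c)" .
 have "b * d \<noteq> 0" using ab cd by simp
 note e = prime_embed_eq[OF xy(1) ab] prime_embed_eq[OF xy(2) cd] prime_embed_eq[OF a_closed[OF xy] this s]
  prime_embed_eq[OF m_closed[OF xy] this p]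
 show "prime_embed (x \<otimes> y) = prime_embed x * prime_embed y" using e by simp
 show "prime_embed (x \<oplus> y) = prime_embed x + prime_embed y" unfolding e using ab(1) cd(1) by (simp add: add_frac_eq)
qed

lemma subfield_prime_field: "subfield prime_field K" by (rule generate_field_is_subfield) simp

lemma exists_basis: "\<exists>Us. set Us \<subseteq> carrier K \<and> Span prime_field Us = carrier K"
proof -
 from finite_degree obtain n where "dimension n prime_field (carrier K)" by (rule finite_dimensionE')
 from exists_base[OF subfield_prime_field this] obtain Us where "set Us \<subseteq> carrier K" "Span prime_field Us = carrier K" by (elim exE conjE)
 thus ?thesis by (intro exI[of _ Us] conjI)
qed

lemma Span_prime_field_combine:
 assumes "set Us \<subseteq> carrier K" "x \<in> Span prime_field Us"
 obtains ks where "set ks \<subseteq> prime_field" "x = combine ks Us"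
proof -
 have "\<exists>ks. set ks \<subseteq> prime_field \<and> length ks = length Us \<and> x = combine ks Us"
  using assms(2) unfolding Span_mem_iff_length_version[OF subfield_prime_field assms(1)] .
 thus ?thesis using that by (elim exE conjE)
qed

text \<open>The embedding of the prime field extends to a subfield that contains a finite spanning
  set of K, and such a subfield is all of K.\<close>

lemma exists_complex_embedding: "\<exists>\<phi>. \<phi> \<in> Ring.ring_hom K complex_field"
proof -
 interpret P: partial_embedding K prime_field prime_embed by (rule partial_embedding_prime_field)
 obtain Us where Us: "set Us \<subseteq> carrier K" "Span prime_field Us = carrier K" using exists_basis by (elim exE conjE)
 have alg: "(algebraic over prime_field) x" if "x \<in> set Us" for x
  by (rule finite_dimension_imp_algebraic[OF subfield_prime_field carrier_is_subring finite_degree])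
    (rule subsetD[OF Us(1) that])
 have "\<exists>E h. partial_embedding K E h \<and> prime_field \<subseteq> E \<and> set Us \<subseteq> E \<and> (\<forall>y\<in>prime_field. h y = prime_embed y)"
  by (rule P.extend_to_finite_set[OF finite_set Us(1)]) (rule alg)
 then obtain E h where E: "partial_embedding K E h" "prime_field \<subseteq> E" "set Us \<subseteq> E" by (elim exE conjE)
 interpret E: partial_embedding K E h by fact
 have "carrier K \<subseteq> E" unfolding Us(2)[symmetric]
 proof
  fix x assume "x \<in> Span prime_field Us"
  then obtain ks where ks: "x = combine ks Us" "set ks \<subseteq> prime_field" using Span_prime_field_combine[OF Us(1)] by metis
  have "set ks \<subseteq> E" using ks(2) E(2) by blast
  thus "x \<in> E" unfolding ks(1) using E(3) by (induction ks Us rule: combine.induct) (auto simp: E.E_mem)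
 qed
 hence "E = carrier K" using E.E_mem(5) by blast
 thus ?thesis using E.h by auto
qed

context
 fixes \<phi> :: "'a \<Rightarrow> complex"
 assumes \<phi>: "\<phi> \<in> Ring.ring_hom K complex_field"
begin

lemma \<phi>_simps [simp]: "\<phi> \<one> = 1" "x \<in> carrier K \<Longrightarrow> y \<in> carrier K \<Longrightarrow> \<phi> (x \<oplus> y) = \<phi> x + \<phi> y"
 "x \<in> carrier K \<Longrightarrow> y \<in> carrier K \<Longrightarrow> \<phi> (x \<otimes> y) = \<phi> x * \<phi> y"
 using ring_hom_memE[OF \<phi>] by auto

lemma \<phi>_zero [simp]: "\<phi> \<zero> = 0" using \<phi>_simps(2)[OF zero_closed zero_closed] by simp

lemma \<phi>_minus: "x \<in> carrier K \<Longrightarrow> \<phi> (\<ominus> x) = - \<phi> x"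
 using \<phi>_simps(2)[of x "\<ominus> x"] by (simp add: r_neg eq_neg_iff_add_eq_0 add.commute)

lemma \<phi>_int [simp]: "\<phi> (int_embed k) = of_int k"
proof (induction k rule: int_induct[where k = 0])
 case (step1 i) thus ?case by (simp add: int_embed_add)
next
 case (step2 i)
 have "int_embed (i - 1) = int_embed i \<oplus> \<ominus> \<one>" using int_embed_add[of i "-1"] int_embed_minus[of 1] by simp
 thus ?case using step2 by (simp add: \<phi>_minus)
qed simp

lemma \<phi>_zero_iff: assumes "x \<in> carrier K" shows "\<phi> x = 0 \<longleftrightarrow> x = \<zero>"
proof
 assume 0: "\<phi> x = 0"
 show "x = \<zero>"
 proof (rule ccontr)
  assume "x \<noteq> \<zero>"
  hence u: "x \<in> Units K" using assms by (simp add: field_Units)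
  hence "\<phi> x * \<phi> (inv x) = 1" using \<phi>_simps(3)[of x "inv x"] assms by simp
  with 0 show False by simp
 qed
qed simp

lemma \<phi>_inj: "inj_on \<phi> (carrier K)"
proof (rule inj_onI)
 fix x y assume xy: "x \<in> carrier K" "y \<in> carrier K" "\<phi> x = \<phi> y"
 hence "\<phi> (x \<oplus> \<ominus> y) = 0" by (simp add: \<phi>_minus)
 hence "x \<oplus> \<ominus> y = \<zero>" using xy \<phi>_zero_iff[of "x \<oplus> \<ominus> y"] by simp
 thus "x = y" using xy by (metis a_minus_def r_right_minus_eq)
qed

lemma \<phi>_prime_field: assumes "x \<in> prime_field" shows "\<phi> x \<in> \<rat>"
proof -
 obtain a b where ab: "x \<in> carrier K" "b \<noteq> 0" "x \<otimes> int_embed b = int_embed a" using prime_field_fraction[OF assms] by blast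
 from arg_cong[OF ab(3), of \<phi>] have "\<phi> x * of_int b = of_int a" using ab(1) by simp
 hence "\<phi> x = of_int a / of_int b" using ab(2) by (simp add: field_simps)
 thus ?thesis by auto
qed

lemma complex_number_field_image: "complex_number_field (\<phi> ` carrier K)"
proof
 show "1 \<in> \<phi> ` carrier K" by (intro image_eqI[of _ _ "\<one>"]) auto
 fix x y assume "x \<in> \<phi> ` carrier K" "y \<in> \<phi> ` carrier K"
 then obtain a b where ab: "a \<in> carrier K" "b \<in> carrier K" "x = \<phi> a" "y = \<phi> b" by blast
 show "x - y \<in> \<phi> ` carrier K" using ab by (intro image_eqI[of _ _ "a \<oplus> \<ominus> b"]) (auto simp: \<phi>_minus)
 show "x * y \<in> \<phi> ` carrier K" using ab by (intro image_eqI[of _ _ "a \<otimes> b"]) auto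
next
 fix x assume "x \<in> \<phi> ` carrier K"
 then obtain a where a: "a \<in> carrier K" "x = \<phi> a" by blast
 show "inverse x \<in> \<phi> ` carrier K"
 proof (cases "a = \<zero>")
  case True thus ?thesis using a by (intro image_eqI[of _ _ a]) auto
 next
  case False
  hence u: "a \<in> Units K" using a by (simp add: field_Units)
  hence "\<phi> a * \<phi> (inv a) = 1" using \<phi>_simps(3)[of a "inv a"] a by simp
  hence "inverse x = \<phi> (inv a)" unfolding a(2) by (rule inverse_unique)
  thus ?thesis using u by (intro image_eqI[of _ _ "inv a"]) auto
 qed
next
 obtain Us where Us: "set Us \<subseteq> carrier K" "Span prime_field Us = carrier K" using exists_basis by (elim exE conjE)
 have span: "\<exists>q :: complex \<Rightarrow> rat. \<phi> (combine ks Us) = (\<Sum>b\<in>\<phi> ` set Us. of_rat (q b) * b)"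
  if "set ks \<subseteq> prime_field" "set Us \<subseteq> carrier K" for ks Us
  using that
 proof (induction ks Us rule: combine.induct)
  case (1 k ks u Us)
  then obtain q :: "complex \<Rightarrow> rat" where q: "\<phi> (combine ks Us) = (\<Sum>b\<in>\<phi> ` set Us. of_rat (q b) * b)" by auto
  obtain r where r: "\<phi> k = of_rat r" using \<phi>_prime_field[of k] 1 by (auto simp: Rats_def)
  have kc: "set ks \<subseteq> carrier K" "k \<in> carrier K" "u \<in> carrier K" "set Us \<subseteq> carrier K"
   using 1 prime_field_fraction by auto
  \<comment> \<open>The image of u may already occur among the images of the tail, so r is added to
    the coefficient present there.\<close>
  define q' where "q' b = (if b \<in> \<phi> ` set Us then q b else 0) + (if b = \<phi> u then r else 0)" for b
  have "\<phi> (combine (k # ks) (u # Us)) = of_rat r * \<phi> u + (\<Sum>b\<in>\<phi> ` set Us. of_rat (q b) * b)" using kc q r by simp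
  also have "\<dots> = (\<Sum>b\<in>\<phi> ` set (u # Us). of_rat (if b = \<phi> u then r else 0) * b) +
    (\<Sum>b\<in>\<phi> ` set (u # Us). of_rat (if b \<in> \<phi> ` set Us then q b else 0) * b)"
  proof (intro arg_cong2[of _ _ _ _ "(+)"])
   have "(\<Sum>b\<in>\<phi> ` set (u # Us). of_rat (if b = \<phi> u then r else 0) * b)
     = (\<Sum>b\<in>\<phi> ` set (u # Us). if b = \<phi> u then of_rat r * b else 0)"
    by (intro sum.cong) auto
   thus "of_rat r * \<phi> u = (\<Sum>b\<in>\<phi> ` set (u # Us). of_rat (if b = \<phi> u then r else 0) * b)" by (simp add: sum.delta)
   show "(\<Sum>b\<in>\<phi> ` set Us. of_rat (q b) * b) =
     (\<Sum>b\<in>\<phi> ` set (u # Us). of_rat (if b \<in> \<phi> ` set Us then q b else 0) * b)"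
    by (intro sum.mono_neutral_cong_left) auto
  qed
  also have "\<dots> = (\<Sum>b\<in>\<phi> ` set (u # Us). of_rat (q' b) * b)"
   by (simp add: q'_def of_rat_add ring_distribs add.commute flip: sum.distrib)
  finally show ?case by (rule exI[of _ q'])
 next
  case ("2_1" Us)
  show ?case by (intro exI[of _ "\<lambda>_. 0"]) simp
 next
  case ("2_2" ks)
  show ?case by (intro exI[of _ "\<lambda>_. 0"]) simp
 qed
 show "\<exists>B. finite B \<and> B \<subseteq> \<phi> ` carrier K \<and> (\<forall>x\<in>\<phi> ` carrier K. \<exists>q :: complex \<Rightarrow> rat. x = (\<Sum>b\<in>B. of_rat (q b) * b))"
 proof (rule exI[of _ "\<phi> ` set Us"], intro conjI ballI)
  show "finite (\<phi> ` set Us)" by simp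
  show "\<phi> ` set Us \<subseteq> \<phi> ` carrier K" using Us(1) by (rule image_mono)
 next
  fix x assume "x \<in> \<phi> ` carrier K"
  then obtain y where y: "y \<in> carrier K" "x = \<phi> y" by (rule imageE)
  from y(1) have "y \<in> Span prime_field Us" unfolding Us(2) .
  then obtain ks where ks: "y = combine ks Us" "set ks \<subseteq> prime_field" using Span_prime_field_combine[OF Us(1)] by metis
  show "\<exists>q :: complex \<Rightarrow> rat. x = (\<Sum>b\<in>\<phi> ` set Us. of_rat (q b) * b)"
   unfolding y(2) ks(1) by (rule span[OF ks(2) Us(1)])
 qed
qed

lemma emb_image_comp:
 assumes "\<tau> \<in> emb (\<phi> ` carrier K)"
 shows "\<tau> \<circ> \<phi> \<in> Ring.ring_hom K complex_field"
 using assms by (intro ring_hom_memI) (auto simp: emb_def)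

lemma \<phi>_eval: "set p \<subseteq> carrier K \<Longrightarrow> x \<in> carrier K \<Longrightarrow> \<phi> (eval p x) = poly (Poly (rev (map \<phi> p))) (\<phi> x)"
proof -
 interpret h: ring_hom_ring K complex_field \<phi>
  by (intro ring_hom_ringI2 ring_axioms cf.ring_axioms \<phi>)
 show "set p \<subseteq> carrier K \<Longrightarrow> x \<in> carrier K \<Longrightarrow> \<phi> (eval p x) = poly (Poly (rev (map \<phi> p))) (\<phi> x)"
  using h.eval_hom'[of x p] by (simp add: complex_field_eval)
qed

lemma image_ring_of_integers:
 "\<phi> ` carrier (ring_of_integers K) = {z \<in> \<phi> ` carrier K. algebraic_int z}"
proof (intro Set.set_eqI iffI)
 fix z assume "z \<in> \<phi> ` carrier (ring_of_integers K)"
 then obtain x p where x: "x \<in> carrier K" "z = \<phi> x" and p: "p \<in> carrier (univ_poly K (range int_embed))"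
  "p \<noteq> []" "hd p = \<one>" "eval p x = \<zero>"
  by (auto simp: ring_of_integers_def)
 have sp: "set p \<subseteq> range int_embed" using p(1,2) by (auto simp: univ_poly_def polynomial_def)
 have "\<exists>ks. p = map int_embed ks" using sp
 proof (induction p)
  case (Cons a p)
  then obtain k ks where "a = int_embed k" "p = map int_embed ks" by auto
  thus ?case by (intro exI[of _ "k # ks"]) simp
 qed simp
 then obtain ks where pk: "p = map int_embed ks" by blast
 have "map \<phi> p = map of_int ks" unfolding pk by simp
 hence "poly (Poly (rev (map of_int ks))) z = \<phi> (eval p x)" unfolding x(2) using sp by (subst \<phi>_eval[OF _ x(1)]) (force, simp only:)
 hence "poly (Poly (rev (map of_int ks))) z = 0" by (simp only: p(4) \<phi>_zero)
 moreover obtain k ks' where k: "ks = k # ks'" using pk p(2) by (cases ks) auto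
 moreover have "\<phi> (int_embed k) = 1" using p(3) pk k by simp
 hence "k = 1" by simp
 ultimately have "algebraic_int z" unfolding algebraic_int_iff_monic_list by (intro exI[of _ ks]) simp
 thus "z \<in> {z \<in> \<phi> ` carrier K. algebraic_int z}" using x by simp
next
 fix z assume z: "z \<in> {z \<in> \<phi> ` carrier K. algebraic_int z}"
 from z have za: "algebraic_int z" by simp
 from z have "z \<in> \<phi> ` carrier K" by simp
 then obtain x where x: "x \<in> carrier K" "z = \<phi> x" by (elim imageE)
 obtain ks where ks: "ks \<noteq> []" "hd ks = (1::int)" "poly (Poly (rev (map of_int ks))) z = 0"
  using za[unfolded algebraic_int_iff_monic_list] by blast
 let ?p = "map int_embed ks"
 have hd: "hd ?p = \<one>" and ne: "?p \<noteq> []" using ks by (auto simp: hd_map)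
 have "set ?p \<subseteq> range int_embed" by auto
 hence pc: "?p \<in> carrier (univ_poly K (range int_embed))" using hd one_not_zero by (simp add: univ_poly_def polynomial_def)
 have "map \<phi> ?p = map of_int ks" by simp
 hence "poly (Poly (rev (map of_int ks))) z = \<phi> (eval ?p x)" unfolding x(2) by (subst \<phi>_eval[OF _ x(1)]) (force, simp only:)
 hence "\<phi> (eval ?p x) = 0" by (simp only: ks(3))
 moreover have "eval ?p x \<in> carrier K" using x(1) by (intro eval_in_carrier) auto
 ultimately have "eval ?p x = \<zero>" using \<phi>_zero_iff by blast
 thus "z \<in> \<phi> ` carrier (ring_of_integers K)" using x pc ne hd unfolding ring_of_integers_def by auto
qed

end

end

section \<open>Conjugates of algebraic numbers and the norm of a number field\<close>

lemma subfield_complexI: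
 assumes "1 \<in> S" "\<And>x y. x \<in> S \<Longrightarrow> y \<in> S \<Longrightarrow> x - y \<in> S" "\<And>x y. x \<in> S \<Longrightarrow> y \<in> S \<Longrightarrow> x * y \<in> S"
  "\<And>x. x \<in> S \<Longrightarrow> inverse x \<in> S"
 shows "subfield S complex_field"
proof -
 have z: "0 \<in> S" using assms(2)[OF assms(1) assms(1)] by simp
 have m: "- x \<in> S" if "x \<in> S" for x using assms(2)[OF z that] by simp
 have a: "x + y \<in> S" if "x \<in> S" "y \<in> S" for x y using assms(2)[OF that(1) m[OF that(2)]] by simp
 have "subcring S complex_field" by (intro cf.subcringI' cf.subringI) (use assms m a in auto)
 thus ?thesis by (rule field.subfieldI'[OF field_complex_field, OF subcring.axioms(1), rule_format])
    (use assms(4) in auto)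
qed

lemma subfield_complexD:
 assumes "subfield S complex_field"
 shows "1 \<in> S" "x \<in> S \<Longrightarrow> y \<in> S \<Longrightarrow> x + y \<in> S" "x \<in> S \<Longrightarrow> y \<in> S \<Longrightarrow> x * y \<in> S"
  "x \<in> S \<Longrightarrow> - x \<in> S" "x \<in> S \<Longrightarrow> inverse x \<in> S" "0 \<in> S"
proof -
 note r = subringE[OF subfieldE(1)[OF assms]]
 show z: "0 \<in> S" using r(2) by simp
 show "1 \<in> S" "x \<in> S \<Longrightarrow> y \<in> S \<Longrightarrow> x + y \<in> S" "x \<in> S \<Longrightarrow> y \<in> S \<Longrightarrow> x * y \<in> S" 
  "x \<in> S \<Longrightarrow> - x \<in> S"
  using r(3,7,6) r(5)[of x] by auto
 show "inverse x \<in> S" if "x \<in> S" using cf.subfield_m_inv(1)[OF assms, of x] that z by (cases "x = 0") auto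
qed

lemma subfield_sum_mem:
 assumes "subfield S complex_field" "\<And>i. i \<in> A \<Longrightarrow> f i \<in> S"
 shows "sum f A \<in> S"
 using assms(2) by (induction A rule: infinite_finite_induct) (auto intro: subfield_complexD[OF assms(1)])

lemma subfield_Rats: "subfield \<rat> complex_field" by (rule subfield_complexI) auto

lemma subfield_of_rat_mem:
 assumes "subfield S complex_field" shows "of_rat q \<in> S"
proof -
 note S = subfield_complexD[OF assms]
 have n: "of_nat n \<in> S" for n by (induction n) (auto intro: S)
 have i: "of_int k \<in> S" for k :: int by (cases k rule: int_diff_cases) (use S(2)[OF n S(4)[OF n]] in auto)
 show ?thesis
 proof (cases q)
  case (Fract a b)
  thus ?thesis using S(3)[OF i S(5)[OF i], of a b] by (simp add: of_rat_rat divide_inverse)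
 qed
qed

text \<open>
 A rational polynomial of least degree vanishing at \<open>y\<close> has \<open>y\<close> as a simple root, so it is linear
 once \<open>y\<close> is its only root.
\<close>

lemma rational_if_unique_conjugate:
 fixes y :: complex
 assumes y: "algebraic y"
  and unique: "\<And>p z. p \<noteq> 0 \<Longrightarrow> (\<And>i. coeff p i \<in> \<rat>) \<Longrightarrow> poly p y = 0 \<Longrightarrow>
   (\<And>q. q \<noteq> 0 \<Longrightarrow> (\<And>i. coeff q i \<in> \<rat>) \<Longrightarrow> poly q y = 0 \<Longrightarrow> degree p \<le> degree q) \<Longrightarrow> poly p z = 0 \<Longrightarrow> z = y"
 shows "y \<in> \<rat>"
proof -
 let ?Q = "\<lambda>p :: complex poly. p \<noteq> 0 \<and> (\<forall>i. coeff p i \<in> \<rat>) \<and> poly p y = 0"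
 have "\<exists>p. ?Q p" using y by (auto simp: algebraic_altdef)
 then obtain p where p: "?Q p" and min: "\<And>q. ?Q q \<Longrightarrow> degree p \<le> degree q" using ex_has_least_nat[of ?Q _ degree] by metis
 have only: "z = y" if "poly p z = 0" for z by (rule unique[of p]) (use p min that in auto)
 have deg: "degree p \<noteq> 0"
 proof
  assume "degree p = 0"
  then obtain a where a: "p = [:a:]" by (rule degree_eq_zeroE)
  have "poly p y = a" by (simp add: a)
  hence "a = 0" using p by simp
  thus False using p by (simp add: a)
 qed
 have "poly (pderiv p) y \<noteq> 0"
 proof
  assume 0: "poly (pderiv p) y = 0"
  have "pderiv p \<noteq> 0" using deg by (simp add: pderiv_eq_0_iff)
  moreover have "coeff (pderiv p) i \<in> \<rat>" for i unfolding coeff_pderiv using p by (metis Rats_mult Rats_of_nat)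
  ultimately have "degree p \<le> degree (pderiv p)" using 0 by (intro min) auto
  thus False using deg by (simp add: degree_pderiv)
 qed
 obtain q where q: "p = [:-y, 1:] * q" using p by (metis dvdE poly_eq_0_iff_dvd)
 have q0: "q \<noteq> 0" using q p by auto
 have "poly q y \<noteq> 0"
 proof -
  have "pderiv p = [:-y, 1:] * pderiv q + q * 1" unfolding q by (simp only: pderiv_mult) (simp add: pderiv_pCons one_pCons)
  thus ?thesis using \<open>poly (pderiv p) y \<noteq> 0\<close> by simp
 qed
 have "degree q = 0"
 proof (rule ccontr)
  assume "degree q \<noteq> 0"
  then obtain z where z: "poly q z = 0" using fundamental_theorem_of_algebra[of q] by (auto simp: constant_degree)
  hence "z = y" using q by (intro only) simp
  with z \<open>poly q y \<noteq> 0\<close> show False by simp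
 qed
 then obtain a where a: "q = [:a:]" by (rule degree_eq_zeroE)
 hence "a \<noteq> 0" using q0 by simp
 have "coeff p 0 = - (y * a)" "coeff p 1 = a" using q a by auto
 hence "y = - coeff p 0 / coeff p 1" using \<open>a \<noteq> 0\<close> by (simp add: field_simps)
 moreover have "- coeff p 0 / coeff p 1 \<in> \<rat>" using p by (intro Rats_divide) auto
 ultimately show ?thesis by simp
qed

lemma poly_Poly_rev_minimal:
 assumes "set p \<subseteq> S" "0 \<in> S" shows "coeff (Poly (rev p)) i \<in> S"
proof -
 have "i < length p \<Longrightarrow> rev p ! i \<in> S" using assms(1) by (metis length_rev nth_mem set_rev subsetD)
 thus ?thesis using assms(2) by (simp add: coeff_Poly_eq nth_default_def)
qed

lemma partial_embedding_complex_iff: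
 "partial_embedding complex_field S h \<longleftrightarrow> subfield S complex_field \<and> h 1 = 1 \<and>
  (\<forall>x\<in>S. \<forall>y\<in>S. h (x + y) = h x + h y \<and> h (x * y) = h x * h y)"
 using field_complex_field by (auto simp: partial_embedding_def partial_embedding_axioms_def intro!: ring_hom_memI
   dest: ring_hom_memE)

lemma algebraic_over_Rats:
 fixes y :: complex
 assumes "algebraic y" "\<rat> \<subseteq> S"
 shows "(ring.algebraic complex_field over S) y"
proof -
 obtain p where p: "p \<noteq> 0" "\<forall>i. coeff p i \<in> \<rat>" "poly p y = 0" using assms by (auto simp: algebraic_altdef)
 let ?p = "rev (coeffs p)"
 have "set ?p \<subseteq> S" using p(2) assms(2) by (auto simp: coeffs_def)
 moreover have "hd ?p \<noteq> 0" using p(1) by (simp add: hd_rev last_coeffs_eq_coeff_degree)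
 ultimately have "?p \<in> carrier (univ_poly complex_field S)" by (simp add: univ_poly_def polynomial_def)
 moreover have "?p \<noteq> []" using p(1) by simp
 moreover have "cf.eval ?p y = 0" using p(3) by (simp add: complex_field_eval)
 ultimately show ?thesis using cf.algebraicI[of ?p S y] by simp
qed

text \<open>The assumptions make p a minimal polynomial of y, so y \<mapsto> z defines an embedding
  of the field generated by y. It then extends to the finitely many algebraic numbers in A.\<close>

lemma conjugate_extension:
 fixes y :: complex
 assumes y: "algebraic y" and A: "finite A" "\<And>a. a \<in> A \<Longrightarrow> algebraic a"
  and p: "p \<noteq> 0" "\<And>i. coeff p i \<in> \<rat>" "poly p y = 0"
  and min: "\<And>q. q \<noteq> 0 \<Longrightarrow> (\<And>i. coeff q i \<in> \<rat>) \<Longrightarrow> poly q y = 0 \<Longrightarrow> degree p \<le> degree q"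
  and z: "poly p z = 0"
 shows "\<exists>S h. partial_embedding complex_field S h \<and> y \<in> S \<and> A \<subseteq> S \<and> h y = z"
proof -
 interpret R: partial_embedding complex_field "\<rat>" "\<lambda>x. x"
  using subfield_Rats by (simp add: partial_embedding_complex_iff)
 have alg: "(ring.algebraic complex_field over \<rat>) y" by (rule algebraic_over_Rats[OF y]) simp
 have yc: "y \<in> carrier complex_field" by simp
 let ?I = "cf.Irr \<rat> y"
 note I = R.IrrE[OF subfield_Rats yc alg]
 let ?q = "Poly (rev ?I)"
 have Iset: "set ?I \<subseteq> \<rat>" using I(1) by (auto simp: univ_poly_def polynomial_def)
 have qR: "coeff ?q i \<in> \<rat>" for i by (rule poly_Poly_rev_minimal[OF Iset]) simp
 have q0: "poly ?q y = 0" using I(4) by (simp add: complex_field_eval)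
 \<comment> \<open>Division by p, one leading term at a time: a rational polynomial that vanishes at
   y also vanishes at z. This is applied to the minimal polynomial in list form, which
   \<open>extend_to_root\<close> refers to.\<close>
 have ldvd: "poly r z = 0" if r: "r \<noteq> 0" "\<And>i. coeff r i \<in> \<rat>" "poly r y = 0" for r using r
 proof (induction "degree r" arbitrary: r rule: less_induct)
  case less
  have le: "degree p \<le> degree r" using less.prems by (intro min) auto
  define c where "c = lead_coeff r / lead_coeff p"
  define r' where "r' = r - monom c (degree r - degree p) * p"
  have c: "c \<in> \<rat>" "c \<noteq> 0" unfolding c_def using p(1,2) less.prems by auto
  have r'R: "coeff r' i \<in> \<rat>" for i unfolding r'_def coeff_diff coeff_monom_mult using c p(2) less.prems(2) by (auto intro!: Rats_diff)
  have r'y: "poly r' y = 0" using p(3) less.prems(3) by (simp add: r'_def)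
  have "poly r' z = 0"
  proof (cases "r' = 0")
   case False
   have "degree (monom c (degree r - degree p) * p) = degree r" using c p(1) le by (simp add: degree_mult_eq degree_monom_eq)
   moreover have "coeff (monom c (degree r - degree p) * p) (degree r) = lead_coeff r" using le p(1) by (simp add: coeff_monom_mult c_def)
   ultimately have "degree r' \<le> degree r" "coeff r' (degree r) = 0" unfolding r'_def by (auto intro: order_trans[OF degree_diff_le_max])
   hence "degree r' < degree r" using False by (metis le_neq_implies_less leading_coeff_0_iff)
   thus ?thesis using less.hyps[of r'] False r'R r'y by blast
  qed simp
  thus ?case using z by (simp add: r'_def)
 qed
 have "?q \<noteq> 0"
 proof
  assume "?q = 0"
  hence "cf.eval ?I 0 = 0 \<and> (\<forall>x. cf.eval ?I x = 0)" by (simp add: complex_field_eval)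
  moreover have "coeff ?q (length ?I - 1) = 1" using I(3) R.pirreducibleE(1)[OF subfieldE(1)[OF subfield_Rats] I(1,2)]
   by (cases ?I) (auto simp: coeff_Poly_eq nth_default_append)
  ultimately show False using \<open>?q = 0\<close> by simp
 qed
 hence "list_ev (\<lambda>x. x) z ?I = 0" using ldvd[of ?q] qR q0 by (simp add: list_ev_poly)
 from R.extend_to_root[OF yc alg this] obtain h where
  h: "partial_embedding complex_field (cf.simple_extension \<rat> y) h" "h y = z" by blast
 interpret E: partial_embedding complex_field "cf.simple_extension \<rat> y" h by fact
 have QS: "\<rat> \<subseteq> cf.simple_extension \<rat> y" by (rule cf.simple_extension_incl) auto
 have yS: "y \<in> cf.simple_extension \<rat> y" by (rule cf.simple_extension_mem[OF subfieldE(1)[OF subfield_Rats] yc])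
 obtain S h' where "partial_embedding complex_field S h'" "cf.simple_extension \<rat> y \<subseteq> S" "A \<subseteq> S"
  "\<forall>x\<in>cf.simple_extension \<rat> y. h' x = h x"
  using E.extend_to_finite_set[OF A(1) _ algebraic_over_Rats[OF A(2) QS]] by auto
 thus ?thesis using yS h(2) by (intro exI[of _ S] exI[of _ h']) auto
qed

context complex_number_field
begin

text \<open>If z is a conjugate of the norm y, some h with h y = z is defined on all conjugates of
  elements of F. Composition with h permutes the finite set \<open>emb F\<close>, so it only
  reorders the factors of y, and z = y. A number that is its own only conjugate is rational.\<close>

lemma norm_rational:
 assumes x: "x \<in> F"
 shows "(\<Prod>\<sigma>\<in>emb F. \<sigma> x) \<in> \<rat>"
proof -
 define y where "y = (\<Prod>\<sigma>\<in>emb F. \<sigma> x)"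
 obtain B where B: "finite B" "B \<subseteq> F" "\<forall>x\<in>F. \<exists>q :: complex \<Rightarrow> rat. x = (\<Sum>b\<in>B. of_rat (q b) * b)"
  using finite_span by blast
 \<comment> \<open>The domain of h has to contain every \<sigma> x with x in F; the images of a
   spanning set are enough for that.\<close>
 define A where "A = (\<Union>\<sigma>\<in>emb F. \<sigma> ` B)"
 have e_alg: "algebraic (\<sigma> a)" if s: "\<sigma> \<in> emb F" and a: "a \<in> F" for \<sigma> a
 proof -
  interpret embedding F \<sigma> by (rule embedding[OF s])
  obtain p where p: "p \<noteq> 0" "\<forall>i. coeff p i \<in> \<rat>" "poly p a = 0" using algebraic_mem[OF a] unfolding algebraic_altdef by blast
  hence "poly p (\<sigma> a) = 0" using e_poly[of p a] a by simp
  thus ?thesis using p unfolding algebraic_altdef by blast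
 qed
 have A: "finite A" "\<And>a. a \<in> A \<Longrightarrow> algebraic a" unfolding A_def using finite_emb B e_alg by auto
 have "algebraic (\<Prod>\<sigma>\<in>T. \<sigma> x)" if "finite T" "T \<subseteq> emb F" for T using that
 proof (induction T)
  case (insert \<sigma> T)
  thus ?case using algebraic_mult[OF e_alg[OF _ x, of \<sigma>]] by simp
 qed simp
 hence "algebraic y" unfolding y_def using finite_emb by blast
 hence "y \<in> \<rat>"
 proof (rule rational_if_unique_conjugate)
  fix p z
  assume p: "p \<noteq> 0" "\<And>i. coeff p i \<in> \<rat>" "poly p y = 0" "poly p z = 0"
   and min: "\<And>q. q \<noteq> 0 \<Longrightarrow> (\<And>i. coeff q i \<in> \<rat>) \<Longrightarrow> poly q y = 0 \<Longrightarrow> degree p \<le> degree q"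
  obtain S h where S: "partial_embedding complex_field S h" "y \<in> S" "A \<subseteq> S" "h y = z"
   using conjugate_extension[OF \<open>algebraic y\<close> A p(1-3) min p(4)] by blast
  interpret h: partial_embedding complex_field S h by fact
  note sub = subfield_complexD[OF h.E]
  have im: "\<sigma> a \<in> S" if "\<sigma> \<in> emb F" "a \<in> F" for \<sigma> a
  proof -
   interpret embedding F \<sigma> by (rule embedding[OF that(1)])
   obtain q :: "complex \<Rightarrow> rat" where q: "a = (\<Sum>b\<in>B. of_rat (q b) * b)" using B(3) \<open>a \<in> F\<close> by blast
   have "b \<in> F" "of_rat (q b) * b \<in> F" if "b \<in> B" for b using B(2) that by (auto intro: mult_mem of_rat_mem)
   hence "\<sigma> a = (\<Sum>b\<in>B. of_rat (q b) * \<sigma> b)" unfolding q by (simp add: e_sum e_mult of_rat_mem)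
   also have "\<dots> \<in> S"
   proof -
    have "of_rat (q b) * \<sigma> b \<in> S" if "b \<in> B" for b
     using S(3) that \<open>\<sigma> \<in> emb F\<close> by (auto simp: A_def intro!: sub(3) subfield_of_rat_mem h.E)
    thus ?thesis by (rule subfield_sum_mem[OF h.E])
   qed
   finally show ?thesis .
  qed
  have hinj: "a = b" if "a \<in> S" "b \<in> S" "h a = h b" for a b
  proof (rule ccontr)
   assume ne: "a \<noteq> b"
   have d: "a - b \<in> S" using sub(2)[OF that(1) sub(4)[OF that(2)]] by simp
   have "h a = h (a - b) + h b" using h.h_simps(2)[of "a - b" b] d that by simp
   hence "h (a - b) = 0" using that by simp
   moreover have "h (a - b) * h (inverse (a - b)) = 1" using h.h_simps(3)[of "a - b" "inverse (a - b)"] h.h_simps(1) d sub(5)[OF d] ne by simp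
   ultimately show False by simp
  qed
  let ?c = "\<lambda>\<sigma>. (\<lambda>a\<in>F. h (\<sigma> a))"
  have c: "?c ` emb F \<subseteq> emb F"
  proof clarify
   fix \<sigma> assume "\<sigma> \<in> emb F"
   then interpret embedding F \<sigma> by (rule embedding)
   show "?c \<sigma> \<in> emb F"
    using h.h_simps im[OF \<open>\<sigma> \<in> emb F\<close>] by (auto simp: emb_def one_mem add_mem mult_mem e_add e_mult)
  qed
  have inj: "inj_on ?c (emb F)"
  proof (rule inj_onI)
   fix \<sigma> \<tau> assume st: "\<sigma> \<in> emb F" "\<tau> \<in> emb F" "?c \<sigma> = ?c \<tau>"
   show "\<sigma> = \<tau>"
   proof (rule emb_extI[OF st(1,2)])
    fix a assume a: "a \<in> F"
    hence "h (\<sigma> a) = h (\<tau> a)" using fun_cong[OF st(3), of a] by simp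
    thus "\<sigma> a = \<tau> a" using hinj im st a by blast
   qed
  qed
  hence bij: "bij_betw ?c (emb F) (emb F)" using c finite_emb by (simp add: bij_betw_def endo_inj_surj)
  have hprod: "h (\<Prod>\<sigma>\<in>T. \<sigma> x) = (\<Prod>\<sigma>\<in>T. h (\<sigma> x)) \<and> (\<Prod>\<sigma>\<in>T. \<sigma> x) \<in> S" if "finite T" "T \<subseteq> emb F" for T
   using that
  proof (induction T)
   case (insert \<sigma> T)
   thus ?case using h.h_simps(3)[of "\<sigma> x" "\<Prod>\<sigma>\<in>T. \<sigma> x"] im[OF _ x] sub(3) by auto
  qed (use h.h_simps(1) sub(1) in auto)
  have "z = h y" using S(4) by simp
  also have "\<dots> = (\<Prod>\<sigma>\<in>emb F. h (\<sigma> x))" unfolding y_def using hprod finite_emb by blast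
  also have "\<dots> = (\<Prod>\<sigma>\<in>emb F. ?c \<sigma> x)" using x by simp
  also have "\<dots> = y" unfolding y_def by (rule prod.reindex_bij_betw[OF bij])
  finally show "z = y" .
 qed
 thus ?thesis by (simp add: y_def)
qed

lemma norm_integer:
 assumes "x \<in> F" "algebraic_int x"
 shows "(\<Prod>\<sigma>\<in>emb F. \<sigma> x) \<in> \<int>"
proof (rule rational_algebraic_int_is_int[OF _ norm_rational[OF assms(1)]])
 show "algebraic_int (\<Prod>\<sigma>\<in>emb F. \<sigma> x)" by (rule algebraic_int_prod) (rule embedding.e_algebraic_int[OF embedding assms])
qed

lemma norm_ge_1:
 assumes "x \<in> F" "algebraic_int x" "x \<noteq> 0"
 shows "(\<Prod>\<sigma>\<in>emb F. cmod (\<sigma> x)) \<ge> 1"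
proof -
 obtain k where k: "(\<Prod>\<sigma>\<in>emb F. \<sigma> x) = of_int k" using norm_integer[OF assms(1,2)] by (auto elim: Ints_cases)
 have "(\<Prod>\<sigma>\<in>emb F. \<sigma> x) \<noteq> 0" using finite_emb assms embedding.e_zero_iff[OF embedding] by auto
 hence "k \<noteq> 0" using k by auto
 have "(\<Prod>\<sigma>\<in>emb F. cmod (\<sigma> x)) = cmod (of_int k)" unfolding k[symmetric] by (rule prod_norm)
 also have "\<dots> = \<bar>of_int k\<bar>" by simp
 also have "\<dots> \<ge> 1" using \<open>k \<noteq> 0\<close> by linarith
 finally show ?thesis .
qed

text \<open>Otherwise the norm would be a nonzero integer of modulus below 1.\<close>

lemma conjugates_small_imp_zero:
 assumes "x \<in> F" "algebraic_int x" "\<And>\<sigma>. \<sigma> \<in> emb F \<Longrightarrow> cmod (\<sigma> x) < 1"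
 shows "x = 0"
proof (rule ccontr)
 assume "x \<noteq> 0"
 have "(\<Prod>\<sigma>\<in>emb F. cmod (\<sigma> x)) < 1"
 proof -
  have fin: "finite (emb F)" "(\<lambda>x\<in>F. x) \<in> emb F" using finite_emb id_emb by auto
  have "(\<Prod>\<sigma>\<in>emb F. cmod (\<sigma> x)) = cmod ((\<lambda>x\<in>F. x) x) * (\<Prod>\<sigma>\<in>emb F - {\<lambda>x\<in>F. x}. cmod (\<sigma> x))"
   by (rule prod.remove[OF fin])
  also have "\<dots> \<le> cmod ((\<lambda>x\<in>F. x) x) * 1" using assms(3) by (intro mult_left_mono prod_le_1) (auto simp: less_imp_le)
  also have "\<dots> < 1" using assms(3)[OF fin(2)] by simp
  finally show ?thesis .
 qed
 with norm_ge_1[OF assms(1,2) \<open>x \<noteq> 0\<close>] show False by simp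
qed

end

section \<open>A unit that dominates its other conjugates\<close>

lemma exists_nat_nonroot:
 fixes P :: "'i \<Rightarrow> complex poly"
 assumes "finite I" "\<And>i. i \<in> I \<Longrightarrow> P i \<noteq> 0"
 obtains t :: nat where "\<And>i. i \<in> I \<Longrightarrow> poly (P i) (of_nat t) \<noteq> 0"
proof -
 let ?Z = "\<Union>i\<in>I. {z. poly (P i) z = 0}"
 have "finite ?Z" using assms by (auto intro: poly_roots_finite)
 hence "finite {t :: nat. of_nat t \<in> ?Z}"
  by (rule finite_vimageI[of ?Z "of_nat :: nat \<Rightarrow> complex", unfolded vimage_def]) (auto simp: inj_on_def)
 then obtain t :: nat where "of_nat t \<notin> ?Z" using ex_new_if_finite[OF infinite_UNIV_nat] by blast
 thus ?thesis by (intro that) auto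
qed

context complex_number_field
begin

text \<open>For two embeddings the difference of the values of \<Sum> f i * t^i is a polynomial in
  t, and it is not zero because the embeddings differ on the spanning set. A natural number t avoids
  the roots of these finitely many polynomials; scaling by a positive integer makes the element
  integral and keeps its conjugates distinct.\<close>

lemma exists_separating_integer: "\<exists>\<theta>\<in>F. algebraic_int \<theta> \<and> inj_on (\<lambda>\<sigma>. \<sigma> \<theta>) (emb F)"
proof -
 obtain B where B: "finite B" "B \<subseteq> F" "\<forall>x\<in>F. \<exists>q :: complex \<Rightarrow> rat. x = (\<Sum>b\<in>B. of_rat (q b) * b)"
  using finite_span by blast
 obtain f m where f: "bij_betw f {..<m::nat} B" using ex_bij_betw_nat_finite[OF B(1)] by (auto simp: atLeast0LessThan)
 have fF: "f i \<in> F" if "i < m" for i using f B(2) that by (auto simp: bij_betw_def)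
 define P :: "(complex \<Rightarrow> complex) \<times> (complex \<Rightarrow> complex) \<Rightarrow> complex poly"
  where "P = (\<lambda>(\<sigma>,\<tau>). \<Sum>i<m. monom (\<sigma> (f i) - \<tau> (f i)) i)"
 have c: "coeff (P (\<sigma>,\<tau>)) i = \<sigma> (f i) - \<tau> (f i)" if "i < m" for \<sigma> \<tau> i using that by (simp add: P_def coeff_sum)
 define I where "I = {(\<sigma>,\<tau>). \<sigma> \<in> emb F \<and> \<tau> \<in> emb F \<and> \<sigma> \<noteq> \<tau>}"
 have "finite I" by (rule finite_subset[of _ "emb F \<times> emb F"]) (auto simp: I_def finite_emb)
 moreover have "P i \<noteq> 0" if iI: "i \<in> I" for i
 proof
  assume 0: "P i = 0"
  obtain \<sigma> \<tau> where i: "i = (\<sigma>,\<tau>)" and st: "\<sigma> \<in> emb F" "\<tau> \<in> emb F" "\<sigma> \<noteq> \<tau>"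
   using iI by (auto simp: I_def)
  interpret s: embedding F \<sigma> by (rule embedding) fact
  interpret t: embedding F \<tau> by (rule embedding) fact
  have eq: "\<sigma> b = \<tau> b" if "b \<in> B" for b using c[of _ \<sigma> \<tau>] 0 f that unfolding i bij_betw_def by force
  have "\<sigma> = \<tau>"
  proof (rule emb_extI[OF st(1,2)])
   fix x assume "x \<in> F"
   then obtain q :: "complex \<Rightarrow> rat" where q: "x = (\<Sum>b\<in>B. of_rat (q b) * b)" using B(3) by blast
   have "b \<in> F" "of_rat (q b) * b \<in> F" if "b \<in> B" for b using B(2) that by (auto intro: mult_mem of_rat_mem)
   thus "\<sigma> x = \<tau> x" unfolding q using eq by (simp add: s.e_sum t.e_sum s.e_mult t.e_mult of_rat_mem)
  qed
  with st show False by simp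
 qed
 ultimately obtain t :: nat where t: "\<And>i. i \<in> I \<Longrightarrow> poly (P i) (of_nat t) \<noteq> 0"
  using exists_nat_nonroot[of I P] by blast
 define \<theta>0 where "\<theta>0 = (\<Sum>i<m. f i * of_nat t ^ i)"
 have \<theta>0: "\<theta>0 \<in> F" unfolding \<theta>0_def by (intro sum_mem mult_mem power_mem of_nat_mem fF) auto
 have ne: "\<sigma> \<theta>0 \<noteq> \<tau> \<theta>0" if st: "\<sigma> \<in> emb F" "\<tau> \<in> emb F" "\<sigma> \<noteq> \<tau>" for \<sigma> \<tau>
 proof -
  interpret s: embedding F \<sigma> by (rule embedding) fact
  interpret t: embedding F \<tau> by (rule embedding) fact
  have tF: "f i * of_nat t ^ i \<in> F" if "i \<in> {..<m}" for i using that by (auto intro!: mult_mem power_mem of_nat_mem fF)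
  have "\<sigma> \<theta>0 = (\<Sum>i<m. \<sigma> (f i * of_nat t ^ i))" "\<tau> \<theta>0 = (\<Sum>i<m. \<tau> (f i * of_nat t ^ i))"
   unfolding \<theta>0_def by (rule s.e_sum[OF tF], assumption) (rule t.e_sum[OF tF], assumption)
  hence "\<sigma> \<theta>0 = (\<Sum>i<m. \<sigma> (f i) * of_nat t ^ i)" "\<tau> \<theta>0 = (\<Sum>i<m. \<tau> (f i) * of_nat t ^ i)"
   by (simp_all add: s.e_mult t.e_mult s.e_power t.e_power fF power_mem of_nat_mem)
  hence "\<sigma> \<theta>0 - \<tau> \<theta>0 = (\<Sum>i<m. (\<sigma> (f i) - \<tau> (f i)) * of_nat t ^ i)"
   by (simp add: left_diff_distrib sum_subtractf)
  also have "\<dots> = poly (P (\<sigma>,\<tau>)) (of_nat t)" by (simp add: P_def poly_sum poly_monom)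
  also have "\<dots> \<noteq> 0" using st by (intro t) (auto simp: I_def)
  finally show ?thesis by simp
 qed
 obtain N :: int where N: "N > 0" "algebraic_int (of_int N * \<theta>0)" using algebraic_integral_multiple[OF algebraic_mem[OF \<theta>0]] .
 have "\<sigma> (of_int N * \<theta>0) \<noteq> \<tau> (of_int N * \<theta>0)" if st: "\<sigma> \<in> emb F" "\<tau> \<in> emb F" "\<sigma> \<noteq> \<tau>" for \<sigma> \<tau>
 proof -
  interpret s: embedding F \<sigma> by (rule embedding) fact
  interpret t: embedding F \<tau> by (rule embedding) fact
  show ?thesis using ne[OF st] N(1) by (simp add: s.e_mult t.e_mult of_int_mem \<theta>0)
 qed
 hence "inj_on (\<lambda>\<sigma>. \<sigma> (of_int N * \<theta>0)) (emb F)" by (auto simp: inj_on_def)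
 thus ?thesis using N(2) \<theta>0 by (intro bexI[of _ "of_int N * \<theta>0"]) (simp_all add: mult_mem of_int_mem)
qed

text \<open>The embeddings that do not belong to the archimedean place of the inclusion. All others
  give every element the modulus it already has.\<close>

definition outer_emb :: "(complex \<Rightarrow> complex) set" where
 "outer_emb = emb F - {\<lambda>x\<in>F. x, \<lambda>x\<in>F. cnj x}"

lemma cnj_outer: assumes "\<sigma> \<in> outer_emb" shows "(\<lambda>x\<in>F. cnj (\<sigma> x)) \<in> outer_emb"
proof -
 have s: "\<sigma> \<in> emb F" "\<sigma> \<noteq> (\<lambda>x\<in>F. x)" "\<sigma> \<noteq> (\<lambda>x\<in>F. cnj x)" using assms by (auto simp: outer_emb_def)
 have ext: "\<sigma> = (\<lambda>x\<in>F. g x)" if "\<And>x. x \<in> F \<Longrightarrow> \<sigma> x = g x" for g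
  using s(1) that by (intro extensionalityI[of _ F]) (auto simp: emb_def)
 have "(\<lambda>x\<in>F. cnj (\<sigma> x)) \<noteq> (\<lambda>x\<in>F. x)"
 proof
  assume eq: "(\<lambda>x\<in>F. cnj (\<sigma> x)) = (\<lambda>x\<in>F. x)"
  have "cnj (\<sigma> x) = x" if "x \<in> F" for x using fun_cong[OF eq, of x] that by simp
  hence "\<sigma> = (\<lambda>x\<in>F. cnj x)" by (intro ext) (metis complex_cnj_cnj)
  with s show False by simp
 qed
 moreover have "(\<lambda>x\<in>F. cnj (\<sigma> x)) \<noteq> (\<lambda>x\<in>F. cnj x)"
 proof
  assume eq: "(\<lambda>x\<in>F. cnj (\<sigma> x)) = (\<lambda>x\<in>F. cnj x)"
  have "\<sigma> x = x" if "x \<in> F" for x using fun_cong[OF eq, of x] that by simp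
  hence "\<sigma> = (\<lambda>x\<in>F. x)" by (intro ext)
  with s show False by simp
 qed
 ultimately show ?thesis using cnj_emb[OF s(1)] by (simp add: outer_emb_def)
qed

end

lemma pigeonhole_obtain:
 assumes "f ` A \<subseteq> Y" "finite Y" "card Y < card A"
 obtains a b where "a \<in> A" "b \<in> A" "a \<noteq> b" "f a = f b"
 using pigeonhole[of f A] assms card_mono[OF assms(2,1)] unfolding inj_on_def by force

text \<open>C is uniform in \<sigma> and j, so that an integer combination of powers of \<theta>
  with coefficients bounded by B has every conjugate below C * B.\<close>

locale separated_number_field = complex_number_field +
 fixes \<theta> :: complex and C :: real
 assumes \<theta>: "\<theta> \<in> F" "algebraic_int \<theta>" "inj_on (\<lambda>\<sigma>. \<sigma> \<theta>) (emb F)"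
  and C: "\<And>\<sigma> j. \<sigma> \<in> emb F \<Longrightarrow> j < card (emb F) \<Longrightarrow> card (emb F) * cmod (\<sigma> \<theta>) ^ j < C"
begin

abbreviation n where "n \<equiv> card (emb F)"
abbreviation r where "r \<equiv> card outer_emb"

definition comb :: "(nat \<Rightarrow> int) \<Rightarrow> complex" where "comb c = (\<Sum>j<n. of_int (c j) * \<theta> ^ j)"

lemma comb_mem: "comb c \<in> F" unfolding comb_def by (intro sum_mem mult_mem of_int_mem power_mem \<theta>)

lemma comb_int: "algebraic_int (comb c)"
 unfolding comb_def by (intro algebraic_int_sum algebraic_int_mult algebraic_int_power \<theta> algebraic_int_of_int)

lemma comb_diff: "comb (\<lambda>j. c j - d j) = comb c - comb d" by (simp add: comb_def algebra_simps sum_subtractf)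

lemma comb_scale: "comb (\<lambda>j. m * c j) = of_int m * comb c" by (simp add: comb_def sum_distrib_left mult_ac)

lemma emb_comb: assumes "\<sigma> \<in> emb F" shows "\<sigma> (comb c) = (\<Sum>j<n. of_int (c j) * \<sigma> \<theta> ^ j)"
proof -
 interpret embedding F \<sigma> by (rule embedding) fact
 have "of_int (c j) * \<theta> ^ j \<in> F" for j by (intro mult_mem of_int_mem power_mem \<theta>)
 thus ?thesis unfolding comb_def by (simp add: e_sum e_mult e_power of_int_mem power_mem \<theta>)
qed

lemma n_pos: "n > 0" using id_emb finite_emb card_gt_0_iff by blast

lemma C_pos: "C > 0"
proof -
 have "0 \<le> real n * cmod (\<theta>) ^ 0" by simp
 also have "\<dots> < C" using C[OF id_emb, of 0] n_pos by simp
 finally show ?thesis .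
qed

lemma emb_comb_bound:
 assumes "\<sigma> \<in> emb F" "\<And>j. j < n \<Longrightarrow> \<bar>c j\<bar> \<le> B" "B > 0"
 shows "cmod (\<sigma> (comb c)) < C * of_int B"
proof -
 have "cmod (\<sigma> (comb c)) \<le> (\<Sum>j<n. cmod (of_int (c j) * \<sigma> \<theta> ^ j))" unfolding emb_comb[OF assms(1)] by (rule norm_sum)
 also have "\<dots> < (\<Sum>j<n. C / n * of_int B)"
 proof (rule sum_strict_mono)
  fix j assume j: "j \<in> {..<n}"
  have "cmod (of_int (c j) * \<sigma> \<theta> ^ j) \<le> of_int B * cmod (\<sigma> \<theta>) ^ j"
   using assms(2)[of j] j by (auto simp: norm_mult norm_power intro!: mult_right_mono)
  also have "cmod (\<sigma> \<theta>) ^ j < C / n" using C[OF assms(1), of j] j n_pos by (simp add: field_simps)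
  finally show "cmod (of_int (c j) * \<sigma> \<theta> ^ j) < C / n * of_int B" using assms(3) by (simp add: mult.commute)
 qed (use n_pos in auto)
 also have "\<dots> = C * of_int B" using n_pos by simp
 finally show ?thesis .
qed

text \<open>A nonzero polynomial of degree less than n cannot vanish at the n distinct conjugates of
  \<theta>.\<close>

lemma comb_zero: assumes "comb c = 0" "j < n" shows "c j = 0"
proof -
 define p :: "complex poly" where "p = (\<Sum>j<n. monom (of_int (c j)) j)"
 have "(\<lambda>\<sigma>. \<sigma> \<theta>) ` emb F \<subseteq> {z. poly p z = 0}"
 proof clarify
  fix \<sigma> assume s: "\<sigma> \<in> emb F"
  then interpret embedding F \<sigma> by (rule embedding)
  have "poly p (\<sigma> \<theta>) = \<sigma> (comb c)" unfolding emb_comb[OF s] by (simp add: p_def poly_sum poly_monom)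
  thus "poly p (\<sigma> \<theta>) = 0" using assms(1) by simp
 qed
 hence le: "p \<noteq> 0 \<Longrightarrow> n \<le> card {z. poly p z = 0}" using card_image[OF \<theta>(3)] card_mono[OF poly_roots_finite] by metis
 have "p = 0"
 proof (rule ccontr)
  assume "p \<noteq> 0"
  have "degree p \<le> n - 1" unfolding p_def by (intro degree_sum_le) (auto intro: order_trans[OF degree_monom_le])
  hence "degree p < n" using n_pos by linarith
  thus False using le[OF \<open>p \<noteq> 0\<close>] card_poly_roots_bound[OF \<open>p \<noteq> 0\<close>] by linarith
 qed
 moreover have "coeff p j = of_int (c j)" using assms(2) by (simp add: p_def coeff_sum)
 ultimately show ?thesis by simp
qed

text \<open>
 One real coordinate per embedding: the real part of \<open>\<sigma> x\<close> when \<open>\<sigma> \<theta>\<close> lies in the closed upper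
 half plane, the imaginary part otherwise. A conjugate pair thus contributes both coordinates of one
 complex number, and a real embedding contributes its only coordinate.
\<close>

definition coord :: "(complex \<Rightarrow> complex) \<Rightarrow> complex \<Rightarrow> real" where
 "coord \<sigma> x = (if Im (\<sigma> \<theta>) \<ge> 0 then Re (\<sigma> x) else Im (\<sigma> x))"

lemma coord_small:
 assumes small: "\<And>\<sigma>. \<sigma> \<in> outer_emb \<Longrightarrow> \<bar>coord \<sigma> x\<bar> \<le> \<delta>" and x: "x \<in> F" and s: "\<sigma> \<in> outer_emb"
 shows "cmod (\<sigma> x) \<le> 2 * \<delta>"
proof -
 let ?s = "\<lambda>x\<in>F. cnj (\<sigma> x)"
 have se: "\<sigma> \<in> emb F" using s by (simp add: outer_emb_def)
 have s': "?s \<in> outer_emb" by (rule cnj_outer[OF s])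
 have "\<delta> \<ge> 0" using small[OF s] by (meson abs_ge_zero order_trans)
 have "\<bar>Re (\<sigma> x)\<bar> \<le> \<delta> \<and> \<bar>Im (\<sigma> x)\<bar> \<le> \<delta>"
 proof (cases "Im (\<sigma> \<theta>) = 0")
  case True
  \<comment> \<open>\<sigma> and its complex conjugate agree at \<theta>, hence everywhere, since
    \<theta> separates embeddings. So \<sigma> x is real and its only coordinate bounds it.\<close>
  hence "\<sigma> \<theta> = ?s \<theta>" using \<theta>(1) by (simp add: complex_eq_iff)
  hence "\<sigma> = ?s" using \<theta>(3) se cnj_emb[OF se] by (auto simp: inj_on_def)
  from fun_cong[OF this, of x] have "\<sigma> x = cnj (\<sigma> x)" using x by (metis restrict_apply')
  hence "Im (\<sigma> x) = 0" by (simp add: complex_eq_iff)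
  thus ?thesis using small[OF s] True \<open>\<delta> \<ge> 0\<close> by (simp add: coord_def)
 next
  case False
  thus ?thesis using small[OF s] small[OF s'] x \<theta>(1) by (cases "Im (\<sigma> \<theta>) > 0") (auto simp: coord_def)
 qed
 thus ?thesis using cmod_le[of "\<sigma> x"] by linarith
qed

lemma coord_diff: "\<sigma> \<in> emb F \<Longrightarrow> coord \<sigma> (comb c - comb d) = coord \<sigma> (comb c) - coord \<sigma> (comb d)"
 using embedding.e_diff[OF embedding, of \<sigma> "comb c" "comb d"] comb_mem by (simp add: coord_def)

text \<open>With B = t^r and q = t^n there are (B + 1)^n coefficient vectors, but only q^r = B^n
  boxes for the r outer coordinates. The difference of two vectors in one box is the required
  combination.\<close>

lemma exists_small_comb:
 fixes t :: nat
 assumes "t > 0"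
 shows "\<exists>d. (\<exists>j<n. d j \<noteq> 0) \<and> (\<forall>j<n. \<bar>d j\<bar> \<le> int t ^ r) \<and>
   (\<forall>\<sigma>\<in>outer_emb. cmod (\<sigma> (comb d)) \<le> 4 * C / real t ^ (n - r))"
proof -
 define B where "B = int t ^ r"
 define q where "q = t ^ n"
 \<comment> \<open>The width of a cell when the interval of length 2 * C * B that contains a
   coordinate is cut into q cells.\<close>
 define \<delta> where "\<delta> = 2 * C * real_of_int B / real q"
 have pos: "B > 0" "q > 0" "\<delta> > 0" using assms C_pos by (auto simp: B_def q_def \<delta>_def)
 let ?A = "PiE {..<n} (\<lambda>_. {0..B})"
 let ?X = "PiE outer_emb (\<lambda>_. {0..<int q})"
 let ?f = "\<lambda>c. \<lambda>\<sigma>\<in>outer_emb. \<lfloor>(coord \<sigma> (comb c) + C * real_of_int B) / \<delta>\<rfloor>"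
 have fo: "finite outer_emb" using finite_emb by (simp add: outer_emb_def)
 have rn: "r \<le> n" by (rule card_mono[OF finite_emb]) (auto simp: outer_emb_def)
 have cA: "card ?A = nat (B + 1) ^ n" using pos by (simp add: card_PiE)
 have cX: "card ?X = q ^ r" using fo by (simp add: card_PiE)
 have "q ^ r = nat B ^ n" by (simp add: q_def B_def nat_power_eq mult.commute flip: power_mult)
 also have "\<dots> < nat (B + 1) ^ n" using pos n_pos by (intro power_strict_mono) auto
 finally have lt: "card ?X < card ?A" by (simp add: cA cX)
 have range: "?f ` ?A \<subseteq> ?X"
 proof (rule image_subsetI, rule restrict_PiE_iff[THEN iffD2], rule ballI)
  fix c \<sigma> assume c: "c \<in> ?A" and s: "\<sigma> \<in> outer_emb"
  have se: "\<sigma> \<in> emb F" using s by (simp add: outer_emb_def)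
  have "\<bar>c j\<bar> \<le> B" if "j < n" for j using c that by (auto simp: PiE_iff)
  hence b: "cmod (\<sigma> (comb c)) < C * of_int B" using se pos by (intro emb_comb_bound) auto
  have "\<bar>coord \<sigma> (comb c)\<bar> < C * of_int B"
   using b abs_Re_le_cmod[of "\<sigma> (comb c)"] abs_Im_le_cmod[of "\<sigma> (comb c)"] by (auto simp: coord_def)
  hence "0 < coord \<sigma> (comb c) + C * real_of_int B" "coord \<sigma> (comb c) + C * real_of_int B < real q * \<delta>"
   using pos by (auto simp: \<delta>_def)
  hence "0 \<le> (coord \<sigma> (comb c) + C * real_of_int B) / \<delta>" "(coord \<sigma> (comb c) + C * real_of_int B) / \<delta> < real q"
   using pos by (auto simp: pos_divide_less_eq)
  thus "\<lfloor>(coord \<sigma> (comb c) + C * real_of_int B) / \<delta>\<rfloor> \<in> {0..<int q}" by (auto simp: floor_less_iff)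
 qed
 obtain a b where ab: "a \<in> ?A" "b \<in> ?A" "a \<noteq> b" "?f a = ?f b" by (rule pigeonhole_obtain[OF range _ lt]) (auto intro!: finite_PiE fo)
 define d where "d j = a j - b j" for j
 have "\<exists>j<n. d j \<noteq> 0"
 proof (rule ccontr)
  assume "\<not> (\<exists>j<n. d j \<noteq> 0)"
  hence "a = b" using ab(1,2) by (intro PiE_ext[of a "{..<n}" _ b]) (auto simp: d_def)
  with ab(3) show False by simp
 qed
 moreover have "\<bar>d j\<bar> \<le> int t ^ r" if "j < n" for j
 proof -
  have "a j \<in> {0..B}" "b j \<in> {0..B}" using ab(1,2) that by (auto simp: PiE_iff)
  thus ?thesis by (auto simp: d_def B_def)
 qed
 moreover have "cmod (\<sigma> (comb d)) \<le> 4 * C / real t ^ (n - r)" if s: "\<sigma> \<in> outer_emb" for \<sigma>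
 proof -
  have "cmod (\<sigma> (comb d)) \<le> 2 * \<delta>"
  proof (rule coord_small[OF _ comb_mem s])
   fix \<tau> assume t: "\<tau> \<in> outer_emb"
   hence te: "\<tau> \<in> emb F" by (simp add: outer_emb_def)
   let ?u = "(coord \<tau> (comb a) + C * real_of_int B) / \<delta>" and ?v = "(coord \<tau> (comb b) + C * real_of_int B) / \<delta>"
   have "\<lfloor>?u\<rfloor> = \<lfloor>?v\<rfloor>" using fun_cong[OF ab(4), of \<tau>] t by simp
   hence "\<bar>?u - ?v\<bar> < 1" by linarith
   moreover have "?u - ?v = coord \<tau> (comb d) / \<delta>" unfolding d_def comb_diff coord_diff[OF te] by (simp flip: diff_divide_distrib)
   ultimately show "\<bar>coord \<tau> (comb d)\<bar> \<le> \<delta>" using pos by (simp add: abs_if field_simps split: if_splits)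
  qed
  also have "2 * \<delta> = 4 * C / real t ^ (n - r)" using assms rn by (simp add: \<delta>_def B_def q_def power_diff field_simps)
  finally show ?thesis .
 qed
 ultimately show ?thesis by blast
qed

text \<open>Each of the n - r other conjugates is at most C * t^r and each of the r outer ones at
  most 4 * C / t^(n - r). The powers of t cancel, so the bound does not depend on t.\<close>

lemma norm_comb_bound:
 assumes t: "t > 0" and d: "\<And>j. j < n \<Longrightarrow> \<bar>d j\<bar> \<le> int t ^ r"
  "\<And>\<sigma>. \<sigma> \<in> outer_emb \<Longrightarrow> cmod (\<sigma> (comb d)) \<le> 4 * C / real t ^ (n - r)"
 shows "cmod (\<Prod>\<sigma>\<in>emb F. \<sigma> (comb d)) \<le> (4 * C) ^ r * C ^ (n - r)"
proof -
 have sub: "outer_emb \<subseteq> emb F" by (auto simp: outer_emb_def)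
 have fo: "finite outer_emb" using finite_subset[OF sub finite_emb] .
 have c: "card (emb F - outer_emb) = n - r" by (rule card_Diff_subset[OF fo sub])
 have "cmod (\<Prod>\<sigma>\<in>emb F. \<sigma> (comb d)) = (\<Prod>\<sigma>\<in>emb F. cmod (\<sigma> (comb d)))" by (rule prod_norm[symmetric])
 also have "\<dots> = (\<Prod>\<sigma>\<in>emb F - outer_emb. cmod (\<sigma> (comb d))) * (\<Prod>\<sigma>\<in>outer_emb. cmod (\<sigma> (comb d)))"
  by (rule prod.subset_diff[OF sub finite_emb])
 also have "\<dots> \<le> (\<Prod>\<sigma>\<in>emb F - outer_emb. C * real t ^ r) * (\<Prod>\<sigma>\<in>outer_emb. 4 * C / real t ^ (n - r))"
 proof (intro mult_mono prod_mono)
  fix \<sigma> assume "\<sigma> \<in> emb F - outer_emb"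
  hence "cmod (\<sigma> (comb d)) < C * of_int (int t ^ r)" using d(1) t by (intro emb_comb_bound) auto
  thus "0 \<le> cmod (\<sigma> (comb d)) \<and> cmod (\<sigma> (comb d)) \<le> C * real t ^ r" by simp
 qed (use d C_pos in \<open>auto intro!: prod_nonneg\<close>)
 also have "\<dots> = (4 * C) ^ r * C ^ (n - r)" using t by (simp add: c power_mult_distrib power_divide mult.commute flip: power_mult)
 finally show ?thesis .
qed

text \<open>The norms are bounded, so infinitely many of the small elements \<open>z t\<close> share
  one norm and one coefficient vector modulo m. The quotient of two of them, with the second
  parameter large, is the unit.\<close>

lemma exists_unit:
 fixes k :: nat
 assumes k: "k > 0" and outer: "outer_emb \<noteq> {}"
 shows "\<exists>u\<in>F. u \<noteq> 0 \<and> algebraic_int u \<and> algebraic_int (inverse u) \<and> algebraic_int ((u - 1) / of_nat k) \<and>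
  cmod u > 1 \<and> (\<forall>\<sigma>\<in>outer_emb. cmod (\<sigma> u) < 1)"
proof -
 \<comment> \<open>Bounds the norms of all \<open>z t\<close>, so that each of them divides the
   factorial in m.\<close>
 define K where "K = nat \<lceil>(4 * C) ^ r * C ^ (n - r)\<rceil>"
 define m where "m = int k * fact K"
 have m: "m > 0" using k by (simp add: m_def)
 have "\<forall>t. \<exists>d. t > 0 \<longrightarrow> (\<exists>j<n. d j \<noteq> 0) \<and> (\<forall>j<n. \<bar>d j\<bar> \<le> int t ^ r) \<and>
   (\<forall>\<sigma>\<in>outer_emb. cmod (\<sigma> (comb d)) \<le> 4 * C / real t ^ (n - r))"
  using exists_small_comb by blast
 then obtain D where D: "\<And>t. t > 0 \<Longrightarrow> \<exists>j<n. D t j \<noteq> 0" "\<And>t j. t > 0 \<Longrightarrow> j < n \<Longrightarrow> \<bar>D t j\<bar> \<le> int t ^ r"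
  "\<And>t \<sigma>. t > 0 \<Longrightarrow> \<sigma> \<in> outer_emb \<Longrightarrow> cmod (\<sigma> (comb (D t))) \<le> 4 * C / real t ^ (n - r)"
  by metis
 define z where "z t = comb (D t)" for t
 have z: "z t \<in> F" "algebraic_int (z t)" for t using comb_mem comb_int by (simp_all add: z_def)
 have z0: "z t \<noteq> 0" if "t > 0" for t using D(1)[OF that] comb_zero[of "D t"] by (auto simp: z_def)
 define N where "N t = (\<Prod>\<sigma>\<in>emb F. \<sigma> (z t))" for t
 have "\<exists>a::int. N t = of_int a" for t using norm_integer[OF z] unfolding N_def by (auto elim: Ints_cases)
 then obtain A :: "nat \<Rightarrow> int" where A: "\<And>t. N t = of_int (A t)" by metis
 have N0: "N t \<noteq> 0" if "t > 0" for t unfolding N_def using finite_emb z0[OF that] z embedding.e_zero_iff[OF embedding] by auto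
 have Abound: "\<bar>A t\<bar> \<le> int K" if "t > 0" for t
 proof -
  have "real_of_int \<bar>A t\<bar> = cmod (N t)" by (simp add: A)
  also have "\<dots> \<le> (4 * C) ^ r * C ^ (n - r)" unfolding N_def z_def using D(2,3) that by (intro norm_comb_bound[of t]) auto
  also have "\<dots> \<le> real K" unfolding K_def by linarith
  finally show ?thesis by linarith
 qed
 define cls where "cls t = (A t, \<lambda>j\<in>{..<n}. D t j mod m)" for t
 have "cls ` {0<..} \<subseteq> {- int K..int K} \<times> PiE {..<n} (\<lambda>_. {0..<m})"
 proof (rule image_subsetI)
  fix t :: nat assume "t \<in> {0<..}"
  hence "A t \<in> {- int K..int K}" using Abound[of t] by (simp add: abs_le_iff)
  moreover have "(\<lambda>j\<in>{..<n}. D t j mod m) \<in> PiE {..<n} (\<lambda>_. {0..<m})" using m by (intro restrict_PiE_iff[THEN iffD2]) simp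
  ultimately show "cls t \<in> {- int K..int K} \<times> PiE {..<n} (\<lambda>_. {0..<m})" unfolding cls_def by (rule SigmaI)
 qed
 moreover have "finite ({- int K..int K} \<times> PiE {..<n} (\<lambda>_. {0..<m}))" by (intro finite_cartesian_product finite_PiE) auto
 ultimately have "finite (cls ` {0<..})" by (rule finite_subset)
 then obtain t1 where t1: "t1 > 0" "infinite {t \<in> {0<..}. cls t = cls t1}"
  using pigeonhole_infinite[of "{0<..} :: nat set" cls] infinite_Ioi by auto
 have fo: "finite outer_emb" using finite_emb by (simp add: outer_emb_def)
 \<comment> \<open>A positive lower bound for the outer conjugates of \<open>z t1\<close>; any t2 >
   4 * C / \<epsilon> makes those of \<open>z t2\<close> strictly smaller.\<close>
 define \<epsilon> where "\<epsilon> = Min ((\<lambda>\<sigma>. cmod (\<sigma> (z t1))) ` outer_emb)"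
 have \<epsilon>: "\<epsilon> > 0" "\<And>\<sigma>. \<sigma> \<in> outer_emb \<Longrightarrow> \<epsilon> \<le> cmod (\<sigma> (z t1))"
  using fo outer z0[OF t1(1)] z embedding.e_zero_iff[OF embedding] by (auto simp: \<epsilon>_def outer_emb_def)
 obtain t2 where t2: "t2 > 0" "cls t2 = cls t1" "real t2 > 4 * C / \<epsilon>"
 proof -
  have "\<exists>t\<in>{t \<in> {0<..}. cls t = cls t1}. t > nat \<lceil>4 * C / \<epsilon>\<rceil>"
   using t1(2) by (meson finite_nat_set_iff_bounded_le not_le)
  then obtain t where "t > 0" "cls t = cls t1" "t > nat \<lceil>4 * C / \<epsilon>\<rceil>" by auto
  thus ?thesis by (intro that[of t]) linarith+
 qed
 have rn: "r < n" using id_emb by (intro psubset_card_mono finite_emb) (auto simp: outer_emb_def)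
 have small: "cmod (\<sigma> (z t2)) < cmod (\<sigma> (z t1))" if "\<sigma> \<in> outer_emb" for \<sigma>
 proof -
  have "cmod (\<sigma> (z t2)) \<le> 4 * C / real t2 ^ (n - r)" using D(3)[OF t2(1) that] by (simp add: z_def)
  also have "\<dots> \<le> 4 * C / real t2" using t2(1) rn C_pos self_le_power[of "real t2" "n - r"] by (intro divide_left_mono) auto
  also have "\<dots> < \<epsilon>" using t2(1,3) \<epsilon>(1) by (simp add: field_simps)
  finally show ?thesis using \<epsilon>(2)[OF that] by simp
 qed
 have AA: "A t2 = A t1" using t2(2) by (simp add: cls_def)
 have "A t1 \<noteq> 0" using N0[OF t1(1)] A[of t1] by auto
 hence "nat \<bar>A t1\<bar> dvd fact K" using Abound[OF t1(1)] by (intro dvd_fact) auto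
 hence "A t1 dvd fact K" by (metis abs_dvd_iff int_dvd_int_iff nat_0_le abs_ge_zero of_nat_fact)
 then obtain s where s: "fact K = A t1 * s" by (rule dvdE)
 have "m dvd D t2 j - D t1 j" if "j < n" for j using arg_cong[OF t2(2), of "\<lambda>c. snd c j"] that by (simp add: cls_def mod_eq_dvd_iff)
 hence "\<forall>j. \<exists>w. j < n \<longrightarrow> D t2 j - D t1 j = m * w" by (auto simp: dvd_def)
 then obtain w where w: "\<And>j. j < n \<Longrightarrow> D t2 j - D t1 j = m * w j" by metis
 have "z t2 - z t1 = comb (\<lambda>j. D t2 j - D t1 j)" by (simp add: z_def comb_diff)
 also have "\<dots> = comb (\<lambda>j. m * w j)" unfolding comb_def using w by (intro sum.cong) auto
 finally have diff: "z t2 - z t1 = of_int m * comb w" by (simp add: comb_scale)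
 \<comment> \<open>The norm divided by the element is the product of its other conjugates and
   therefore integral, although it is not visibly a combination of powers of \<theta>.\<close>
 have quot: "algebraic_int (of_int (A t) / z t)" if t: "t > 0" for t
 proof -
  have "N t = z t * (\<Prod>\<sigma>\<in>emb F - {\<lambda>x\<in>F. x}. \<sigma> (z t))"
   unfolding N_def using prod.remove[OF finite_emb id_emb, of "\<lambda>\<sigma>. \<sigma> (z t)"] z by simp
  hence "of_int (A t) / z t = (\<Prod>\<sigma>\<in>emb F - {\<lambda>x\<in>F. x}. \<sigma> (z t))" using A z0[OF t] by simp
  moreover have "algebraic_int (\<Prod>\<sigma>\<in>emb F - {\<lambda>x\<in>F. x}. \<sigma> (z t))"
   by (rule algebraic_int_prod, rule embedding.e_algebraic_int[OF embedding z]) simp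
  ultimately show ?thesis by simp
 qed
 define u where "u = z t2 / z t1"
 \<comment> \<open>m is k * s times the norm of \<open>z t1\<close>: the norm cancels the
   denominator \<open>z t1\<close>, and the factor k is left over for the congruence.\<close>
 have u1: "(u - 1) / of_nat k = of_int s * comb w * (of_int (A t1) / z t1)"
 proof -
  have "u - 1 = of_int m * comb w / z t1" using diff z0[OF t1(1)] by (simp add: u_def field_simps)
  thus ?thesis using k by (simp add: m_def s field_simps)
 qed
 have u1i: "algebraic_int ((u - 1) / of_nat k)" unfolding u1 by (intro algebraic_int_mult comb_int quot t1 algebraic_int_of_int)
 have "u = 1 + of_nat k * ((u - 1) / of_nat k)" using k by simp
 moreover have "algebraic_int (1 + of_nat k * ((u - 1) / of_nat k))"
  by (intro algebraic_int_add algebraic_int_mult u1i algebraic_int_of_nat algebraic_int_1)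
 ultimately have ui: "algebraic_int u" by metis
 have "inverse u - 1 = - (of_int m * comb w) / z t2" using diff z0[OF t1(1)] z0[OF t2(1)] by (simp add: u_def field_simps)
 also have "\<dots> = of_int (- (int k * s)) * comb w * (of_int (A t2) / z t2)" by (simp add: m_def s AA field_simps)
 finally have "inverse u = 1 + of_int (- (int k * s)) * comb w * (of_int (A t2) / z t2)" by (simp add: algebra_simps)
 moreover have "algebraic_int (1 + of_int (- (int k * s)) * comb w * (of_int (A t2) / z t2))"
  by (intro algebraic_int_add algebraic_int_mult comb_int quot t2 algebraic_int_of_int algebraic_int_1)
 ultimately have uinv: "algebraic_int (inverse u)" by metis
 have u: "u \<in> F" "u \<noteq> 0" using z z0 t1 t2 by (auto simp: u_def intro: divide_mem)
 have us: "cmod (\<sigma> u) < 1" if so: "\<sigma> \<in> outer_emb" for \<sigma>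
 proof -
  interpret embedding F \<sigma> by (rule embedding) (use so in \<open>simp add: outer_emb_def\<close>)
  have "\<sigma> (z t1) \<noteq> 0" using e_zero_iff z z0 t1 by simp
  thus ?thesis using small[OF so] z by (simp add: u_def e_divide norm_divide)
 qed
 \<comment> \<open>The outer conjugates are below 1 and the others have modulus |u|, so |u| at most
   1 would push the norm below 1.\<close>
 have ugt: "cmod u > 1"
 proof (rule ccontr)
  assume "\<not> cmod u > 1"
  hence le: "cmod (\<sigma> u) \<le> 1" if "\<sigma> \<in> emb F" for \<sigma>
   using us[of \<sigma>] that u(1) by (cases "\<sigma> \<in> outer_emb") (auto simp: outer_emb_def less_imp_le)
  obtain \<sigma> where so: "\<sigma> \<in> outer_emb" using outer by blast
  hence se: "\<sigma> \<in> emb F" by (simp add: outer_emb_def)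
  have "(\<Prod>\<sigma>\<in>emb F. cmod (\<sigma> u)) = cmod (\<sigma> u) * (\<Prod>\<tau>\<in>emb F - {\<sigma>}. cmod (\<tau> u))"
   by (rule prod.remove[OF finite_emb se])
  also have "\<dots> \<le> cmod (\<sigma> u) * 1" using le by (intro mult_left_mono prod_le_1) auto
  also have "\<dots> < 1" using us[OF so] by simp
  finally show False using norm_ge_1[OF u(1) ui u(2)] by simp
 qed
 show ?thesis by (intro bexI[of _ u] conjI ballI u ui uinv u1i us ugt)
qed

end

context complex_number_field
begin

theorem exists_unit_outer:
 fixes k :: nat
 assumes "k > 0" "outer_emb \<noteq> {}"
 shows "\<exists>u\<in>F. u \<noteq> 0 \<and> algebraic_int u \<and> algebraic_int (inverse u) \<and> algebraic_int ((u - 1) / of_nat k) \<and>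
  cmod u > 1 \<and> (\<forall>\<sigma>\<in>outer_emb. cmod (\<sigma> u) < 1)"
proof -
 obtain \<theta> where \<theta>: "\<theta> \<in> F" "algebraic_int \<theta>" "inj_on (\<lambda>\<sigma>. \<sigma> \<theta>) (emb F)"
  using exists_separating_integer by blast
 let ?S = "(\<lambda>(\<sigma>,j). card (emb F) * cmod (\<sigma> \<theta>) ^ j) ` (emb F \<times> {..<card (emb F)})"
 have fin: "finite ?S" using finite_emb by simp
 have "card (emb F) * cmod (\<sigma> \<theta>) ^ j < Max ?S + 1" if "\<sigma> \<in> emb F" "j < card (emb F)" for \<sigma> j
 proof -
  have "card (emb F) * cmod (\<sigma> \<theta>) ^ j \<in> ?S" using that by force
  from Max_ge[OF fin this] show ?thesis by simp
 qed
 then interpret separated_number_field F \<theta> "Max ?S + 1" by unfold_locales (rule \<theta> | simp)+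
 show ?thesis by (rule exists_unit[OF assms])
qed

end

section \<open>Convolution on a finite group and units modulo constant functions\<close>

definition gconv :: "('g, 'n) monoid_scheme \<Rightarrow> ('g \<Rightarrow> complex) \<Rightarrow> ('g \<Rightarrow> complex) \<Rightarrow> 'g \<Rightarrow> complex" where
 "gconv G u v x = (\<Sum>y\<in>carrier G. u y * v (inv\<^bsub>G\<^esub> y \<otimes>\<^bsub>G\<^esub> x))"

text \<open>
 \<open>RG\<^sub>t\<close> has only trivial units, for a subring \<open>R\<close> of \<open>\<complex>\<close>: functions \<open>u\<close>, \<open>v\<close> represent inverse
 elements of \<open>RG\<^sub>t\<close> when both products differ from \<open>1\<close> by a constant function.
\<close>

definition inverse_mod_Sigma :: "('g, 'n) monoid_scheme \<Rightarrow> ('g \<Rightarrow> complex) \<Rightarrow> ('g \<Rightarrow> complex) \<Rightarrow> bool" where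
 "inverse_mod_Sigma G u v \<longleftrightarrow>
  (\<exists>c. \<forall>x\<in>carrier G. gconv G u v x = (if x = \<one>\<^bsub>G\<^esub> then 1 else 0) + c) \<and>
  (\<exists>c. \<forall>x\<in>carrier G. gconv G v u x = (if x = \<one>\<^bsub>G\<^esub> then 1 else 0) + c)"

text \<open>The constant d ranges over all complex numbers. Once G has two elements it is a value of
  u, so it lies in R whenever u takes values in R.\<close>

definition trivial_mod_Sigma :: "complex set \<Rightarrow> ('g, 'n) monoid_scheme \<Rightarrow> ('g \<Rightarrow> complex) \<Rightarrow> bool" where
 "trivial_mod_Sigma R G u \<longleftrightarrow>
  (\<exists>r\<in>R. \<exists>g\<in>carrier G. \<exists>d. r \<noteq> 0 \<and> inverse r \<in> R \<and> (\<forall>x\<in>carrier G. u x = (if x = g then r else 0) + d))"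

definition complex_only_trivial_units :: "complex set \<Rightarrow> ('g, 'n) monoid_scheme \<Rightarrow> bool" where
 "complex_only_trivial_units R G \<longleftrightarrow>
  (\<forall>u v. u \<in> carrier G \<rightarrow> R \<longrightarrow> v \<in> carrier G \<rightarrow> R \<longrightarrow> inverse_mod_Sigma G u v \<longrightarrow> trivial_mod_Sigma R G u)"

context group
begin

lemma sum_left_translate:
 assumes "a \<in> carrier G"
 shows "(\<Sum>y\<in>carrier G. f (a \<otimes> y)) = (\<Sum>y\<in>carrier G. f y)"
 by (rule sum.reindex_bij_witness[of _ "\<lambda>y. inv a \<otimes> y" "\<lambda>y. a \<otimes> y"])
   (use assms in \<open>simp_all add: m_assoc[symmetric]\<close>)

lemma sum_right_translate:
 assumes "a \<in> carrier G"
 shows "(\<Sum>y\<in>carrier G. f (y \<otimes> a)) = (\<Sum>y\<in>carrier G. f y)"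
 by (rule sum.reindex_bij_witness[of _ "\<lambda>y. y \<otimes> inv a" "\<lambda>y. y \<otimes> a"])
   (use assms in \<open>simp_all add: m_assoc\<close>)

lemma sum_inverse: "(\<Sum>y\<in>carrier G. f (inv y)) = (\<Sum>y\<in>carrier G. f y)"
 by (rule sum.reindex_bij_witness[of _ "\<lambda>y. inv y" "\<lambda>y. inv y"]) simp_all

lemma gconv_assoc:
 assumes x: "x \<in> carrier G"
 shows "gconv G (gconv G a b) c x = gconv G a (gconv G b c) x"
proof -
 have "gconv G (gconv G a b) c x
   = (\<Sum>z\<in>carrier G. \<Sum>y\<in>carrier G. a z * (b (inv z \<otimes> y) * c (inv y \<otimes> x)))"
  unfolding gconv_def sum_distrib_right by (subst sum.swap) (simp add: mult.assoc)
 also have "\<dots> = (\<Sum>z\<in>carrier G. \<Sum>y\<in>carrier G. a z * (b y * c (inv y \<otimes> (inv z \<otimes> x))))"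
 proof (rule sum.cong[OF refl])
  fix z assume z: "z \<in> carrier G"
  have "(\<Sum>y\<in>carrier G. a z * (b (inv z \<otimes> y) * c (inv y \<otimes> x)))
    = (\<Sum>y\<in>carrier G. (\<lambda>y. a z * (b y * c (inv y \<otimes> (inv z \<otimes> x)))) (inv z \<otimes> y))"
  proof (intro sum.cong refl)
   fix y assume y: "y \<in> carrier G"
   have "z \<otimes> (inv z \<otimes> x) = x" using x z by (simp add: m_assoc[symmetric])
   hence "inv (inv z \<otimes> y) \<otimes> (inv z \<otimes> x) = inv y \<otimes> x" using x y z by (simp add: inv_mult_group m_assoc)
   thus "a z * (b (inv z \<otimes> y) * c (inv y \<otimes> x))
    = a z * (b (inv z \<otimes> y) * c (inv (inv z \<otimes> y) \<otimes> (inv z \<otimes> x)))" by simp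
  qed
  also have "\<dots> = (\<Sum>y\<in>carrier G. a z * (b y * c (inv y \<otimes> (inv z \<otimes> x))))" by (rule sum_left_translate) (use z in simp)
  finally show "(\<Sum>y\<in>carrier G. a z * (b (inv z \<otimes> y) * c (inv y \<otimes> x)))
    = (\<Sum>y\<in>carrier G. a z * (b y * c (inv y \<otimes> (inv z \<otimes> x))))" .
 qed
 also have "\<dots> = gconv G a (gconv G b c) x" by (simp add: gconv_def sum_distrib_left)
 finally show ?thesis .
qed

lemma gconv_cong:
 assumes "x \<in> carrier G" "\<And>y. y \<in> carrier G \<Longrightarrow> a y = a' y" "\<And>y. y \<in> carrier G \<Longrightarrow> b y = b' y"
 shows "gconv G a b x = gconv G a' b' x"
 unfolding gconv_def using assms by (intro sum.cong) auto

lemma gconv_delta_left: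
 assumes "finite (carrier G)" "x \<in> carrier G" "g \<in> carrier G"
 shows "gconv G (\<lambda>y. if y = g then r else 0) b x = r * b (inv g \<otimes> x)"
 using assms by (simp add: gconv_def if_distrib[of "\<lambda>t. t * _"] sum.delta cong: if_cong)

lemma gconv_delta_right:
 assumes "finite (carrier G)" "x \<in> carrier G" "g \<in> carrier G"
 shows "gconv G a (\<lambda>y. if y = g then r else 0) x = a (x \<otimes> inv g) * r"
proof -
 have "inv y \<otimes> x = g \<longleftrightarrow> y = x \<otimes> inv g" if "y \<in> carrier G" for y
 proof
  assume "inv y \<otimes> x = g"
  hence "x \<otimes> inv g = x \<otimes> inv (inv y \<otimes> x)" by simp
  also have "\<dots> = y" using that assms by (simp add: inv_mult_group m_assoc[symmetric])
  finally show "y = x \<otimes> inv g" by simp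
 qed (use that assms in \<open>simp add: inv_mult_group m_assoc\<close>)
 hence "gconv G a (\<lambda>y. if y = g then r else 0) x = (\<Sum>y\<in>carrier G. if y = x \<otimes> inv g then a y * r else 0)"
  unfolding gconv_def by (intro sum.cong) auto
 thus ?thesis using assms by (simp add: sum.delta)
qed

lemma gconv_const_right:
 "x \<in> carrier G \<Longrightarrow> gconv G a (\<lambda>_. c) x = (\<Sum>y\<in>carrier G. a y) * c"
 by (simp add: gconv_def sum_distrib_right)

lemma gconv_const_left:
 assumes x: "x \<in> carrier G" shows "gconv G (\<lambda>_. c) b x = c * (\<Sum>y\<in>carrier G. b y)"
proof -
 have "gconv G (\<lambda>_. c) b x = c * (\<Sum>y\<in>carrier G. b (inv y \<otimes> x))" by (simp add: gconv_def sum_distrib_left)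
 also have "(\<Sum>y\<in>carrier G. b (inv y \<otimes> x)) = (\<Sum>y\<in>carrier G. b (y \<otimes> x))" by (rule sum_inverse)
 also have "\<dots> = (\<Sum>y\<in>carrier G. b y)" by (rule sum_right_translate[OF x])
 finally show ?thesis .
qed

lemma gconv_linear:
 "gconv G (\<lambda>y. a y + a' y) b x = gconv G a b x + gconv G a' b x"
 "gconv G a (\<lambda>y. b y + b' y) x = gconv G a b x + gconv G a b' x"
 "gconv G (\<lambda>y. a y - a' y) b x = gconv G a b x - gconv G a' b x"
 "gconv G a (\<lambda>y. b y - b' y) x = gconv G a b x - gconv G a b' x"
 "gconv G (\<lambda>y. r * a y) b x = r * gconv G a b x"
 "gconv G a (\<lambda>y. r * b y) x = r * gconv G a b x"
 by (simp_all add: gconv_def algebra_simps sum.distrib sum_subtractf sum_distrib_left)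

end

section \<open>Transfer from the reduced group ring to complex functions\<close>

text \<open>Since \<phi> is injective, identities in the group ring can be checked on complex
  values, where the product becomes \<open>gconv\<close>.\<close>

locale complex_group_ring = R: cring R + group G
 for R :: "('r, 'm) ring_scheme" and G :: "('g, 'n) monoid_scheme" (structure) +
 fixes \<phi> :: "'r \<Rightarrow> complex"
 assumes fin: "finite (carrier G)"
  and \<phi>_one: "\<phi> \<one>\<^bsub>R\<^esub> = 1"
  and \<phi>_add: "a \<in> carrier R \<Longrightarrow> b \<in> carrier R \<Longrightarrow> \<phi> (a \<oplus>\<^bsub>R\<^esub> b) = \<phi> a + \<phi> b"
  and \<phi>_mult: "a \<in> carrier R \<Longrightarrow> b \<in> carrier R \<Longrightarrow> \<phi> (a \<otimes>\<^bsub>R\<^esub> b) = \<phi> a * \<phi> b"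
  and \<phi>_inj: "inj_on \<phi> (carrier R)"
begin

abbreviation RG where "RG \<equiv> group_ring R G"
abbreviation RGt where "RGt \<equiv> reduced_group_ring R G"
abbreviation rg_mult (infixl "\<star>" 70) where "a \<star> b \<equiv> a \<otimes>\<^bsub>RG\<^esub> b"
abbreviation rg_add (infixl "\<boxplus>" 65) where "a \<boxplus> b \<equiv> a \<oplus>\<^bsub>RG\<^esub> b"
abbreviation cls where "cls u \<equiv> Sigma_ideal R G +>\<^bsub>RG\<^esub> u"

lemma \<phi>_zero: "\<phi> \<zero>\<^bsub>R\<^esub> = 0" using \<phi>_add[of "\<zero>\<^bsub>R\<^esub>" "\<zero>\<^bsub>R\<^esub>"] by simp

lemma \<phi>_minus: "a \<in> carrier R \<Longrightarrow> \<phi> (\<ominus>\<^bsub>R\<^esub> a) = - \<phi> a"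
 using \<phi>_add[of a "\<ominus>\<^bsub>R\<^esub> a"] by (simp add: R.r_neg \<phi>_zero eq_neg_iff_add_eq_0 add.commute)

lemma \<phi>_finsum:
 "finite A \<Longrightarrow> f \<in> A \<rightarrow> carrier R \<Longrightarrow> \<phi> (finsum R f A) = (\<Sum>a\<in>A. \<phi> (f a))"
proof (induction A rule: finite_induct)
 case (insert a A)
 hence "f \<in> A \<rightarrow> carrier R" "f a \<in> carrier R" by auto
 thus ?case using insert by (simp add: R.finsum_insert \<phi>_add R.finsum_closed)
qed (simp add: \<phi>_zero)

lemma RG_carrier: "carrier RG = carrier G \<rightarrow>\<^sub>E carrier R" by (simp add: group_ring_def)

lemma RG_mem: "a \<in> carrier RG \<Longrightarrow> x \<in> carrier G \<Longrightarrow> a x \<in> carrier R" by (auto simp: RG_carrier)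

lemma RG_eqI:
 assumes "a \<in> carrier RG" "b \<in> carrier RG" "\<And>x. x \<in> carrier G \<Longrightarrow> \<phi> (a x) = \<phi> (b x)"
 shows "a = b"
 using assms \<phi>_inj by (intro PiE_ext[of a "carrier G" _ b]) (auto simp: RG_carrier inj_on_def PiE_iff)

lemma RG_mult_closed: "a \<in> carrier RG \<Longrightarrow> b \<in> carrier RG \<Longrightarrow> a \<star> b \<in> carrier RG"
 using fin RG_mem by (auto simp: group_ring_def intro!: R.finsum_closed R.m_closed)

lemma RG_add_closed: "a \<in> carrier RG \<Longrightarrow> b \<in> carrier RG \<Longrightarrow> a \<boxplus> b \<in> carrier RG"
 using RG_mem by (auto simp: group_ring_def)

lemma RG_one_closed: "\<one>\<^bsub>RG\<^esub> \<in> carrier RG" and RG_zero_closed: "\<zero>\<^bsub>RG\<^esub> \<in> carrier RG"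
 by (auto simp: group_ring_def)

lemma \<phi>_RG_mult:
 assumes "a \<in> carrier RG" "b \<in> carrier RG" "x \<in> carrier G"
 shows "\<phi> ((a \<star> b) x) = gconv G (\<lambda>y. \<phi> (a y)) (\<lambda>y. \<phi> (b y)) x"
proof -
 have "a y \<in> carrier R" "b (inv y \<otimes> x) \<in> carrier R" if "y \<in> carrier G" for y using that assms by (auto intro!: RG_mem)
 thus ?thesis using assms(3) fin by (simp add: group_ring_def gconv_def \<phi>_finsum \<phi>_mult)
qed

lemma \<phi>_RG_add:
 assumes "a \<in> carrier RG" "b \<in> carrier RG" "x \<in> carrier G"
 shows "\<phi> ((a \<boxplus> b) x) = \<phi> (a x) + \<phi> (b x)"
 using assms RG_mem by (simp add: group_ring_def \<phi>_add)

lemma \<phi>_RG_one: "x \<in> carrier G \<Longrightarrow> \<phi> (\<one>\<^bsub>RG\<^esub> x) = (if x = \<one> then 1 else 0)"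
 and \<phi>_RG_zero: "x \<in> carrier G \<Longrightarrow> \<phi> (\<zero>\<^bsub>RG\<^esub> x) = 0"
 by (auto simp: group_ring_def \<phi>_one \<phi>_zero)

lemma ring_RG: "ring RG"
proof (rule ringI)
 show "abelian_group RG"
 proof (rule abelian_groupI)
  fix a assume a: "a \<in> carrier RG"
  let ?b = "\<lambda>x\<in>carrier G. \<ominus>\<^bsub>R\<^esub> (a x)"
  have b: "?b \<in> carrier RG" using RG_mem[OF a] by (auto simp: RG_carrier)
  thus "\<exists>b\<in>carrier RG. b \<boxplus> a = \<zero>\<^bsub>RG\<^esub>" using a RG_mem[OF a]
   by (intro bexI[of _ ?b] RG_eqI) (auto simp: \<phi>_RG_add \<phi>_RG_zero \<phi>_minus RG_add_closed RG_zero_closed)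
 qed (auto intro!: RG_eqI simp: \<phi>_RG_add \<phi>_RG_zero RG_add_closed RG_zero_closed)
 show "monoid RG"
 proof (rule monoidI)
  fix a b c assume abc: "a \<in> carrier RG" "b \<in> carrier RG" "c \<in> carrier RG"
  show "a \<star> b \<star> c = a \<star> (b \<star> c)"
  proof (rule RG_eqI)
   fix x assume x: "x \<in> carrier G"
   have "\<phi> ((a \<star> b \<star> c) x) = gconv G (gconv G (\<lambda>y. \<phi> (a y)) (\<lambda>y. \<phi> (b y))) (\<lambda>y. \<phi> (c y)) x"
    using abc x by (auto simp: \<phi>_RG_mult RG_mult_closed intro!: gconv_cong)
   also have "\<dots> = gconv G (\<lambda>y. \<phi> (a y)) (gconv G (\<lambda>y. \<phi> (b y)) (\<lambda>y. \<phi> (c y))) x"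
    by (rule gconv_assoc[OF x])
   also have "\<dots> = \<phi> ((a \<star> (b \<star> c)) x)" using abc x by (auto simp: \<phi>_RG_mult RG_mult_closed intro!: gconv_cong)
   finally show "\<phi> ((a \<star> b \<star> c) x) = \<phi> ((a \<star> (b \<star> c)) x)" .
  qed (use abc in \<open>auto intro!: RG_mult_closed\<close>)
 next
  fix a assume a: "a \<in> carrier RG"
  have one: "gconv G (\<lambda>y. \<phi> (\<one>\<^bsub>RG\<^esub> y)) b x = gconv G (\<lambda>y. if y = \<one> then 1 else 0) b x"
   "gconv G b (\<lambda>y. \<phi> (\<one>\<^bsub>RG\<^esub> y)) x = gconv G b (\<lambda>y. if y = \<one> then 1 else 0) x" if "x \<in> carrier G" for b x
   using that by (auto intro!: gconv_cong simp: \<phi>_RG_one)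
  show "\<one>\<^bsub>RG\<^esub> \<star> a = a" "a \<star> \<one>\<^bsub>RG\<^esub> = a"
   using a fin by (auto intro!: RG_eqI simp: \<phi>_RG_mult RG_mult_closed RG_one_closed one gconv_delta_left gconv_delta_right)
 qed (auto intro: RG_mult_closed RG_one_closed)
next
 fix a b c assume abc: "a \<in> carrier RG" "b \<in> carrier RG" "c \<in> carrier RG"
 note cl = RG_mult_closed RG_add_closed
 show "(a \<boxplus> b) \<star> c = a \<star> c \<boxplus> b \<star> c"
 proof (rule RG_eqI)
  fix x assume x: "x \<in> carrier G"
  have "\<phi> (((a \<boxplus> b) \<star> c) x) = gconv G (\<lambda>y. \<phi> (a y) + \<phi> (b y)) (\<lambda>y. \<phi> (c y)) x"
   using abc x by (auto simp: \<phi>_RG_mult \<phi>_RG_add cl intro!: gconv_cong)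
  thus "\<phi> (((a \<boxplus> b) \<star> c) x) = \<phi> ((a \<star> c \<boxplus> b \<star> c) x)"
   using abc x by (simp add: \<phi>_RG_mult \<phi>_RG_add cl gconv_linear)
 qed (use abc in \<open>auto intro!: cl\<close>)
 show "c \<star> (a \<boxplus> b) = c \<star> a \<boxplus> c \<star> b"
 proof (rule RG_eqI)
  fix x assume x: "x \<in> carrier G"
  have "\<phi> ((c \<star> (a \<boxplus> b)) x) = gconv G (\<lambda>y. \<phi> (c y)) (\<lambda>y. \<phi> (a y) + \<phi> (b y)) x"
   using abc x by (auto simp: \<phi>_RG_mult \<phi>_RG_add cl intro!: gconv_cong)
  thus "\<phi> ((c \<star> (a \<boxplus> b)) x) = \<phi> ((c \<star> a \<boxplus> c \<star> b) x)"
   using abc x by (simp add: \<phi>_RG_mult \<phi>_RG_add cl gconv_linear)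
 qed (use abc in \<open>auto intro!: cl\<close>)
qed

sublocale RG: ring RG by (rule ring_RG)

lemma finsum_RG_apply:
 assumes "finite A" "f \<in> A \<rightarrow> carrier RG" "x \<in> carrier G"
 shows "\<phi> (finsum RG f A x) = (\<Sum>a\<in>A. \<phi> (f a x))"
 using assms(1,2)
proof (induction A rule: finite_induct)
 case (insert a A)
 hence "f \<in> A \<rightarrow> carrier RG" "f a \<in> carrier RG" by auto
 thus ?case using insert assms(3) by (simp add: RG.finsum_insert \<phi>_RG_add RG.finsum_closed)
qed (simp add: \<phi>_RG_zero assms(3))

lemma monom_closed: "r \<in> carrier R \<Longrightarrow> gr_monom R G r g \<in> carrier RG" by (auto simp: gr_monom_def RG_carrier)

lemma \<phi>_monom: "x \<in> carrier G \<Longrightarrow> \<phi> (gr_monom R G r g x) = (if x = g then \<phi> r else 0)"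
 by (simp add: gr_monom_def \<phi>_zero)

definition const :: "'r \<Rightarrow> 'g \<Rightarrow> 'r" where "const c = (\<lambda>x\<in>carrier G. c)"

lemma const_closed: "c \<in> carrier R \<Longrightarrow> const c \<in> carrier RG" by (auto simp: const_def RG_carrier)

lemma \<phi>_const: "x \<in> carrier G \<Longrightarrow> \<phi> (const c x) = \<phi> c" by (simp add: const_def)

lemma gr_Sigma_eq: "gr_Sigma R G = const \<one>\<^bsub>R\<^esub>"
proof (rule RG_eqI)
 show "gr_Sigma R G \<in> carrier RG" unfolding gr_Sigma_def by (intro RG.finsum_closed) (auto intro: monom_closed)
 fix x assume x: "x \<in> carrier G"
 have "\<phi> (gr_Sigma R G x) = (\<Sum>g\<in>carrier G. \<phi> (gr_monom R G \<one>\<^bsub>R\<^esub> g x))"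
  unfolding gr_Sigma_def using fin x by (intro finsum_RG_apply) (auto intro: monom_closed)
 also have "\<dots> = 1" using fin x by (simp add: \<phi>_monom \<phi>_one sum.delta)
 finally show "\<phi> (gr_Sigma R G x) = \<phi> (const \<one>\<^bsub>R\<^esub> x)" using x by (simp add: \<phi>_const \<phi>_one)
qed (simp add: const_closed)

lemma const_mult:
 assumes a: "a \<in> carrier RG" and c: "c \<in> carrier R"
 shows "\<exists>d\<in>carrier R. const c \<star> a = const d" "\<exists>d\<in>carrier R. a \<star> const c = const d"
proof -
 let ?s = "finsum R a (carrier G)"
 have aR: "a \<in> carrier G \<rightarrow> carrier R" using a by (auto simp: RG_carrier)
 have s: "?s \<in> carrier R" using aR by (rule R.finsum_closed)
 have \<phi>s: "\<phi> ?s = (\<Sum>y\<in>carrier G. \<phi> (a y))" by (rule \<phi>_finsum[OF fin aR])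
 have const: "gconv G (\<lambda>y. \<phi> (const c y)) b x = gconv G (\<lambda>_. \<phi> c) b x"
  "gconv G b (\<lambda>y. \<phi> (const c y)) x = gconv G b (\<lambda>_. \<phi> c) x" if "x \<in> carrier G" for b x
  using that by (auto intro!: gconv_cong simp: \<phi>_const)
 have "const c \<star> a = const (c \<otimes>\<^bsub>R\<^esub> ?s)"
  using a c s by (intro RG_eqI) (auto simp: RG_mult_closed const_closed \<phi>_RG_mult const gconv_const_left \<phi>_const \<phi>_mult \<phi>s)
 thus "\<exists>d\<in>carrier R. const c \<star> a = const d" using c s by blast
 have "a \<star> const c = const (?s \<otimes>\<^bsub>R\<^esub> c)"
  using a c s by (intro RG_eqI) (auto simp: RG_mult_closed const_closed \<phi>_RG_mult const gconv_const_right \<phi>_const \<phi>_mult \<phi>s)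
 thus "\<exists>d\<in>carrier R. a \<star> const c = const d" using c s by blast
qed

lemma ideal_const: "ideal (const ` carrier R) RG"
proof (rule idealI[OF ring_RG])
 show "subgroup (const ` carrier R) (add_monoid RG)"
 proof (rule RG.add.subgroupI)
  show "const ` carrier R \<subseteq> carrier RG" by (auto intro: const_closed)
  show "const ` carrier R \<noteq> {}" by auto
 next
  fix a assume "a \<in> const ` carrier R"
  then obtain c where c: "c \<in> carrier R" "a = const c" by auto
  have "const (\<ominus>\<^bsub>R\<^esub> c) \<boxplus> a = \<zero>\<^bsub>RG\<^esub>"
   using c by (intro RG_eqI) (auto simp: \<phi>_RG_add const_closed \<phi>_const \<phi>_minus \<phi>_RG_zero)
  hence "\<ominus>\<^bsub>RG\<^esub> a = const (\<ominus>\<^bsub>R\<^esub> c)" using c by (intro RG.minus_equality) (auto intro: const_closed)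
  thus "\<ominus>\<^bsub>RG\<^esub> a \<in> const ` carrier R" using c by auto
 next
  fix a b assume "a \<in> const ` carrier R" "b \<in> const ` carrier R"
  then obtain c d where c: "c \<in> carrier R" "a = const c" "d \<in> carrier R" "b = const d" by auto
  have "a \<boxplus> b = const (c \<oplus>\<^bsub>R\<^esub> d)"
   using c by (intro RG_eqI) (auto simp: \<phi>_RG_add const_closed \<phi>_const \<phi>_add)
  thus "a \<boxplus> b \<in> const ` carrier R" using c by auto
 qed
qed (use const_mult in blast)+

text \<open>Convolution with a constant gives a constant, so the constants form a two-sided ideal;
  and each constant c is the product of c at the identity with Sigma.\<close>

lemma Sigma_ideal_eq: "Sigma_ideal R G = const ` carrier R"
proof
 have S: "gr_Sigma R G \<in> carrier RG" by (simp add: gr_Sigma_eq const_closed)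
 show "Sigma_ideal R G \<subseteq> const ` carrier R"
  unfolding Sigma_ideal_def by (rule RG.genideal_minimal[OF ideal_const]) (auto simp: gr_Sigma_eq)
 show "const ` carrier R \<subseteq> Sigma_ideal R G"
 proof clarify
  fix c assume c: "c \<in> carrier R"
  interpret I: ideal "Sigma_ideal R G" RG unfolding Sigma_ideal_def using S by (intro RG.genideal_ideal) auto
  have "const c = gr_monom R G c \<one> \<star> gr_Sigma R G"
  proof (rule RG_eqI)
   fix x assume x: "x \<in> carrier G"
   have "\<phi> ((gr_monom R G c \<one> \<star> gr_Sigma R G) x) = gconv G (\<lambda>y. if y = \<one> then \<phi> c else 0) (\<lambda>_. 1) x"
    using x c S by (auto simp: \<phi>_RG_mult monom_closed \<phi>_monom gr_Sigma_eq \<phi>_const \<phi>_one intro!: gconv_cong)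
   thus "\<phi> (const c x) = \<phi> ((gr_monom R G c \<one> \<star> gr_Sigma R G) x)" using x fin by (simp add: gconv_delta_left \<phi>_const)
  qed (use c S in \<open>auto intro!: const_closed RG_mult_closed monom_closed\<close>)
  moreover have "gr_Sigma R G \<in> Sigma_ideal R G" unfolding Sigma_ideal_def using S RG.genideal_self'[of "gr_Sigma R G"] by simp
  ultimately show "const c \<in> Sigma_ideal R G" using I.I_l_closed monom_closed[OF c] by simp
 qed
qed

sublocale I: ideal "Sigma_ideal R G" RG using ideal_const by (simp add: Sigma_ideal_eq)

lemma coset_eq_iff:
 assumes a: "a \<in> carrier RG" and b: "b \<in> carrier RG"
 shows "cls a = cls b \<longleftrightarrow>
  (\<exists>c\<in>carrier R. \<forall>x\<in>carrier G. \<phi> (a x) = \<phi> (b x) + \<phi> c)"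
proof -
 have "cls a = cls b \<longleftrightarrow> (\<exists>c\<in>carrier R. a = const c \<boxplus> b)"
 proof
  assume "cls a = cls b"
  hence "a \<in> cls b" using I.a_rcos_self[OF a] by simp
  thus "\<exists>c\<in>carrier R. a = const c \<boxplus> b" by (auto simp: a_r_coset_def' Sigma_ideal_eq)
 next
  assume "\<exists>c\<in>carrier R. a = const c \<boxplus> b"
  hence "a \<in> cls b" by (auto simp: a_r_coset_def' Sigma_ideal_eq)
  thus "cls a = cls b" using RG.a_repr_independence[OF _ b additive_subgroup.a_subgroup[OF I.is_additive_subgroup]] by simp
 qed
 also have "\<dots> \<longleftrightarrow> (\<exists>c\<in>carrier R. \<forall>x\<in>carrier G. \<phi> (a x) = \<phi> (b x) + \<phi> c)"
 proof (intro bex_cong refl)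
  fix c assume c: "c \<in> carrier R"
  show "(a = const c \<boxplus> b) \<longleftrightarrow> (\<forall>x\<in>carrier G. \<phi> (a x) = \<phi> (b x) + \<phi> c)"
   using RG_eqI[of a "const c \<boxplus> b"] a b c const_closed[OF c] by (auto simp: \<phi>_RG_add \<phi>_const add.commute)
 qed
 finally show ?thesis .
qed

definition one_mod_Sigma :: "('g \<Rightarrow> 'r) \<Rightarrow> ('g \<Rightarrow> 'r) \<Rightarrow> bool" where
 "one_mod_Sigma u v \<longleftrightarrow> (\<exists>c\<in>carrier R. \<forall>x\<in>carrier G. gconv G (\<lambda>y. \<phi> (u y)) (\<lambda>y. \<phi> (v y)) x = (if x = \<one> then 1 else 0) + \<phi> c)"

lemma Units_reduced_iff:
 "U \<in> Units (RGt) \<longleftrightarrow>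
  (\<exists>u\<in>carrier RG. \<exists>v\<in>carrier RG. U = cls u \<and>
   one_mod_Sigma u v \<and>
   one_mod_Sigma v u)"
proof -
 let ?I = "Sigma_ideal R G"
 have car: "carrier (RGt) = {cls u | u. u \<in> carrier RG}" by (auto simp: reduced_group_ring_def FactRing_def A_RCOSETS_def')
 have mult: "(cls u) \<otimes>\<^bsub>RGt\<^esub> (cls v) = cls (u \<star> v)" if "u \<in> carrier RG" "v \<in> carrier RG" for u v
  using that I.rcoset_mult_add[of u v] by (simp add: reduced_group_ring_def FactRing_def)
 have one: "\<one>\<^bsub>RGt\<^esub> = cls \<one>\<^bsub>RG\<^esub>" by (simp add: reduced_group_ring_def FactRing_def)
 have key: "(cls u) \<otimes>\<^bsub>RGt\<^esub> (cls v) = \<one>\<^bsub>RGt\<^esub> \<longleftrightarrow>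
   one_mod_Sigma u v"
  if "u \<in> carrier RG" "v \<in> carrier RG" for u v
  unfolding mult[OF that] one one_mod_Sigma_def using that
  by (subst coset_eq_iff) (auto simp: RG_mult_closed RG_one_closed \<phi>_RG_mult \<phi>_RG_one)
 show ?thesis
 proof
  assume "U \<in> Units (RGt)"
  then obtain W where "U \<in> carrier (RGt)" "W \<in> carrier (RGt)"
   and p: "W \<otimes>\<^bsub>RGt\<^esub> U = \<one>\<^bsub>RGt\<^esub>" "U \<otimes>\<^bsub>RGt\<^esub> W = \<one>\<^bsub>RGt\<^esub>"
   by (simp add: Units_def) blast
  then obtain u v where uv: "u \<in> carrier RG" "v \<in> carrier RG" "U = cls u" "W = cls v" unfolding car by blast
  show "\<exists>u\<in>carrier RG. \<exists>v\<in>carrier RG. U = cls u \<and>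
   one_mod_Sigma u v \<and>
   one_mod_Sigma v u"
   using p unfolding uv(3,4) key[OF uv(1,2)] key[OF uv(2,1)] by (intro bexI[OF _ uv(1)] bexI[OF _ uv(2)] conjI refl)
 next
  assume "\<exists>u\<in>carrier RG. \<exists>v\<in>carrier RG. U = cls u \<and>
   one_mod_Sigma u v \<and>
   one_mod_Sigma v u"
  then obtain u v where uv: "u \<in> carrier RG" "v \<in> carrier RG" "U = cls u"
   and p: "one_mod_Sigma u v"
    "one_mod_Sigma v u"
   by blast
  have "U \<in> carrier (RGt)" "cls v \<in> carrier (RGt)" unfolding car using uv by blast+
  thus "U \<in> Units (RGt)" using p unfolding key[OF uv(1,2), symmetric] key[OF uv(2,1), symmetric] uv(3) Units_def by blast
 qed
qed

theorem only_trivial_units_iff: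
 assumes card: "card (carrier G) > 1"
 shows "only_trivial_units R G \<longleftrightarrow> complex_only_trivial_units (\<phi> ` carrier R) G"
proof
 assume triv: "only_trivial_units R G"
 show "complex_only_trivial_units (\<phi> ` carrier R) G" unfolding complex_only_trivial_units_def
 proof (intro allI impI)
  fix u v assume u: "u \<in> carrier G \<rightarrow> \<phi> ` carrier R" and v: "v \<in> carrier G \<rightarrow> \<phi> ` carrier R"
   and inv: "inverse_mod_Sigma G u v"
  define u' where "u' = (\<lambda>x\<in>carrier G. inv_into (carrier R) \<phi> (u x))"
  define v' where "v' = (\<lambda>x\<in>carrier G. inv_into (carrier R) \<phi> (v x))"
  have u': "u' \<in> carrier RG" "\<And>x. x \<in> carrier G \<Longrightarrow> \<phi> (u' x) = u x"
   using u by (auto simp: u'_def RG_carrier Pi_iff inv_into_into f_inv_into_f)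
  have v': "v' \<in> carrier RG" "\<And>x. x \<in> carrier G \<Longrightarrow> \<phi> (v' x) = v x"
   using v by (auto simp: v'_def RG_carrier Pi_iff inv_into_into f_inv_into_f)
  have conv: "one_mod_Sigma a b" if ab: "a \<in> carrier RG" "b \<in> carrier RG"
    and c: "\<forall>x\<in>carrier G. gconv G (\<lambda>y. \<phi> (a y)) (\<lambda>y. \<phi> (b y)) x = (if x = \<one> then 1 else 0) + c" for a b c
  proof -
   \<comment> \<open>At an element other than the identity the product takes the value c, so c comes
     from R although \<open>inverse_mod_Sigma\<close> allows any complex number.\<close>
   have "carrier G \<noteq> {\<one>}" using card by auto
   then obtain x where x: "x \<in> carrier G" "x \<noteq> \<one>" by blast
   have "c = \<phi> ((a \<star> b) x)" using c x ab by (simp add: \<phi>_RG_mult)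
   thus ?thesis unfolding one_mod_Sigma_def using c RG_mem[OF RG_mult_closed[OF ab] x(1)] by (intro bexI[of _ "(a \<star> b) x"]) auto
  qed
  have eq: "gconv G (\<lambda>y. \<phi> (u' y)) (\<lambda>y. \<phi> (v' y)) x = gconv G u v x"
   "gconv G (\<lambda>y. \<phi> (v' y)) (\<lambda>y. \<phi> (u' y)) x = gconv G v u x" if "x \<in> carrier G" for x
   using that u' v' by (auto intro!: gconv_cong)
  obtain c1 c2 where "\<forall>x\<in>carrier G. gconv G u v x = (if x = \<one> then 1 else 0) + c1"
   "\<forall>x\<in>carrier G. gconv G v u x = (if x = \<one> then 1 else 0) + c2"
   using inv unfolding inverse_mod_Sigma_def by blast
  hence "one_mod_Sigma u' v'"
   "one_mod_Sigma v' u'"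
   using conv[OF u'(1) v'(1), of c1] conv[OF v'(1) u'(1), of c2] eq by simp_all
  hence "cls u' \<in> Units (RGt)" unfolding Units_reduced_iff by (intro bexI[OF _ u'(1)] bexI[OF _ v'(1)] conjI refl)
  then obtain r g where rg: "r \<in> Units R" "g \<in> carrier G" "cls u' = cls (gr_monom R G r g)"
   using triv unfolding only_trivial_units_def trivial_units_def by blast
  have rc: "r \<in> carrier R" "inv\<^bsub>R\<^esub> r \<in> carrier R" "r \<otimes>\<^bsub>R\<^esub> inv\<^bsub>R\<^esub> r = \<one>\<^bsub>R\<^esub>" using rg(1) by auto
  have r1: "\<phi> r * \<phi> (inv\<^bsub>R\<^esub> r) = 1" using \<phi>_mult[OF rc(1,2)] rc(3) \<phi>_one by simp
  hence "inverse (\<phi> r) = \<phi> (inv\<^bsub>R\<^esub> r)" by (rule inverse_unique)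
  moreover obtain c where "\<forall>x\<in>carrier G. \<phi> (u' x) = \<phi> (gr_monom R G r g x) + \<phi> c"
   using rg(3) coset_eq_iff[OF u'(1) monom_closed[OF rc(1)]] by blast
  ultimately show "trivial_mod_Sigma (\<phi> ` carrier R) G u" unfolding trivial_mod_Sigma_def using rg(2) rc r1 u'(2)
   by (intro bexI[of _ "\<phi> r"] bexI[of _ g] exI[of _ "\<phi> c"]) (auto simp: \<phi>_monom)
 qed
next
 assume triv: "complex_only_trivial_units (\<phi> ` carrier R) G"
 show "only_trivial_units R G" unfolding only_trivial_units_def
 proof (intro Set.set_eqI iffI)
  fix U assume "U \<in> Units (RGt)"
  then obtain u v where uv: "u \<in> carrier RG" "v \<in> carrier RG" "U = cls u"
   and inv: "inverse_mod_Sigma G (\<lambda>y. \<phi> (u y)) (\<lambda>y. \<phi> (v y))"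
   unfolding Units_reduced_iff one_mod_Sigma_def inverse_mod_Sigma_def by blast
  have "(\<lambda>y. \<phi> (u y)) \<in> carrier G \<rightarrow> \<phi> ` carrier R" "(\<lambda>y. \<phi> (v y)) \<in> carrier G \<rightarrow> \<phi> ` carrier R"
   using RG_mem uv by auto
  hence "trivial_mod_Sigma (\<phi> ` carrier R) G (\<lambda>y. \<phi> (u y))" using triv inv unfolding complex_only_trivial_units_def by blast
  then obtain r s g d where r: "r \<in> carrier R" "s \<in> carrier R" "\<phi> r \<noteq> 0" "inverse (\<phi> r) = \<phi> s" "g \<in> carrier G"
   and d: "\<forall>x\<in>carrier G. \<phi> (u x) = (if x = g then \<phi> r else 0) + d"
   unfolding trivial_mod_Sigma_def by (auto simp: image_iff)
  have "\<phi> (r \<otimes>\<^bsub>R\<^esub> s) = \<phi> \<one>\<^bsub>R\<^esub>" using r by (simp add: \<phi>_mult \<phi>_one flip: r(4))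
  hence "r \<otimes>\<^bsub>R\<^esub> s = \<one>\<^bsub>R\<^esub>" using \<phi>_inj r by (auto simp: inj_on_def)
  hence rU: "r \<in> Units R" using r R.m_comm[of r s] by (auto simp: Units_def)
  have "card {g} < card (carrier G)" using card by simp
  then obtain x where x: "x \<in> carrier G" "x \<noteq> g" by (metis card_mono finite.emptyI finite.insertI not_le singletonI subsetI)
  hence "d = \<phi> (u x)" using d by simp
  hence "cls u = cls (gr_monom R G r g)" using coset_eq_iff[OF uv(1) monom_closed[OF r(1)]] d RG_mem[OF uv(1) x(1)] by (auto simp: \<phi>_monom)
  thus "U \<in> trivial_units R G" unfolding trivial_units_def uv(3) using rU r(5) by blast
 next
  fix U assume "U \<in> trivial_units R G"
  then obtain r g where r: "r \<in> Units R" "g \<in> carrier G" "U = cls (gr_monom R G r g)" unfolding trivial_units_def by blast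
  have rc: "r \<in> carrier R" "inv\<^bsub>R\<^esub> r \<in> carrier R" "r \<otimes>\<^bsub>R\<^esub> inv\<^bsub>R\<^esub> r = \<one>\<^bsub>R\<^esub>" using r(1) by auto
  have r1: "\<phi> r * \<phi> (inv\<^bsub>R\<^esub> r) = 1" using \<phi>_mult[OF rc(1,2)] rc(3) \<phi>_one by simp
  have eq: "gconv G (\<lambda>y. \<phi> (gr_monom R G s h y)) (\<lambda>y. \<phi> (gr_monom R G t k y)) x
    = \<phi> s * (if inv h \<otimes> x = k then \<phi> t else 0)" if "x \<in> carrier G" "h \<in> carrier G" for s h t k x
  proof -
   have "gconv G (\<lambda>y. \<phi> (gr_monom R G s h y)) (\<lambda>y. \<phi> (gr_monom R G t k y)) x
    = gconv G (\<lambda>y. if y = h then \<phi> s else 0) (\<lambda>y. if y = k then \<phi> t else 0) x"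
    using that by (intro gconv_cong) (auto simp: \<phi>_monom)
   thus ?thesis using gconv_delta_left[OF fin that] by simp
  qed
  have i: "inv g \<otimes> x = inv g \<longleftrightarrow> x = \<one>" "g \<otimes> x = g \<longleftrightarrow> x = \<one>" if "x \<in> carrier G" for x
   using that r(2) by simp_all
  have z: "\<zero>\<^bsub>R\<^esub> \<in> carrier R" by simp
  let ?m = "gr_monom R G r g" and ?n = "gr_monom R G (inv\<^bsub>R\<^esub> r) (inv g)"
  have E1: "one_mod_Sigma ?m ?n" unfolding one_mod_Sigma_def by (rule bexI[OF _ z]) (use r(2) r1 in \<open>simp add: eq i \<phi>_zero\<close>)
  have E2: "one_mod_Sigma ?n ?m" unfolding one_mod_Sigma_def
   by (rule bexI[OF _ z]) (use r(2) r1 in \<open>simp add: eq i \<phi>_zero mult.commute\<close>)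
  show "U \<in> Units (RGt)" unfolding Units_reduced_iff by (rule bexI[of _ ?m], rule bexI[of _ ?n])
     (intro conjI r(3) E1 E2 monom_closed rc)+
 qed
qed

end

section \<open>Parseval's identity and functions with one exceptional value\<close>

text \<open>The n row sums add up to less than 2 * n, so some row x has sum below 2 and at most one
  value of f differs from f x. The total then forces the deviation to have modulus 1.\<close>

lemma concentrated_function:
 fixes f :: "'a \<Rightarrow> complex"
 assumes A: "finite A" "card A = n" "n \<ge> 2"
  and sep: "\<And>x y. x \<in> A \<Longrightarrow> y \<in> A \<Longrightarrow> f x \<noteq> f y \<Longrightarrow> (cmod (f x - f y))\<^sup>2 \<ge> 1"
  and tot: "(\<Sum>x\<in>A. \<Sum>y\<in>A. (cmod (f x - f y))\<^sup>2) = 2 * (real n - 1)"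
 shows "\<exists>a\<in>A. \<exists>d. cmod (f a - d) = 1 \<and> (\<forall>x\<in>A. x \<noteq> a \<longrightarrow> f x = d)"
proof -
 have "\<exists>x\<in>A. (\<Sum>y\<in>A. (cmod (f x - f y))\<^sup>2) < 2"
 proof (rule ccontr)
  assume "\<not> (\<exists>x\<in>A. (\<Sum>y\<in>A. (cmod (f x - f y))\<^sup>2) < 2)"
  hence "2 \<le> (\<Sum>y\<in>A. (cmod (f x - f y))\<^sup>2)" if "x \<in> A" for x using that by (meson not_less)
  hence "(\<Sum>x\<in>A. 2) \<le> (\<Sum>x\<in>A. \<Sum>y\<in>A. (cmod (f x - f y))\<^sup>2)" by (rule sum_mono)
  hence "2 * real n \<le> 2 * (real n - 1)" unfolding tot sum_constant A(2) by (simp only: mult.commute)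
  thus False by simp
 qed
 then obtain x where x: "x \<in> A" "(\<Sum>y\<in>A. (cmod (f x - f y))\<^sup>2) < 2" by blast
 define S where "S = {y\<in>A. f y \<noteq> f x}"
 have "real (card S) = (\<Sum>y\<in>S. 1)" by simp
 also have "\<dots> \<le> (\<Sum>y\<in>S. (cmod (f x - f y))\<^sup>2)" using x(1) by (intro sum_mono sep) (auto simp: S_def)
 also have "\<dots> \<le> (\<Sum>y\<in>A. (cmod (f x - f y))\<^sup>2)" using A by (intro sum_mono2) (auto simp: S_def)
 finally have "real (card S) < 2" using x(2) by (rule le_less_trans)
 hence "card S < 2" by simp
 moreover have "S \<noteq> {}"
 proof
  assume "S = {}"
  hence "f y = f x" if "y \<in> A" for y using that by (auto simp: S_def)
  hence "(\<Sum>x\<in>A. \<Sum>y\<in>A. (cmod (f x - f y))\<^sup>2) = 0" by simp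
  thus False unfolding tot using A(3) by simp
 qed
 hence "card S > 0" using A(1) by (simp add: card_gt_0_iff S_def)
 ultimately have "card S = 1" by simp
 then obtain a where a: "S = {a}" by (meson card_1_singletonE)
 define d where "d = f x"
 have d: "f y = d" if "y \<in> A" "y \<noteq> a" for y using a that by (auto simp: S_def d_def)
 have aA: "a \<in> A" using a by (auto simp: S_def)
 have fA: "finite (A - {a})" "card (A - {a}) = n - 1" using A aA by auto
 have inner: "(\<Sum>y\<in>A. (cmod (f z - f y))\<^sup>2) = (cmod (f a - d))\<^sup>2" if z: "z \<in> A - {a}" for z
 proof -
  have "(\<Sum>y\<in>A. (cmod (f z - f y))\<^sup>2) = (cmod (f z - f a))\<^sup>2 + (\<Sum>y\<in>A - {a}. (cmod (f z - f y))\<^sup>2)"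
   by (rule sum.remove[OF A(1) aA])
  also have "(\<Sum>y\<in>A - {a}. (cmod (f z - f y))\<^sup>2) = 0" using d z by (intro sum.neutral) auto
  finally show ?thesis using d z by (simp add: norm_minus_commute)
 qed
 have outer: "(\<Sum>y\<in>A. (cmod (f a - f y))\<^sup>2) = (real n - 1) * (cmod (f a - d))\<^sup>2"
 proof -
  have "(\<Sum>y\<in>A. (cmod (f a - f y))\<^sup>2) = (cmod (f a - f a))\<^sup>2 + (\<Sum>y\<in>A - {a}. (cmod (f a - f y))\<^sup>2)"
   by (rule sum.remove[OF A(1) aA])
  also have "(\<Sum>y\<in>A - {a}. (cmod (f a - f y))\<^sup>2) = (\<Sum>y\<in>A - {a}. (cmod (f a - d))\<^sup>2)" using d by (intro sum.cong) auto
  finally show ?thesis using fA A(3) by (simp)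
 qed
 have "(\<Sum>x\<in>A. \<Sum>y\<in>A. (cmod (f x - f y))\<^sup>2) = (real n - 1) * (cmod (f a - d))\<^sup>2 + (\<Sum>z\<in>A - {a}. (cmod (f a - d))\<^sup>2)"
  using sum.remove[OF A(1) aA, of "\<lambda>x. \<Sum>y\<in>A. (cmod (f x - f y))\<^sup>2"] inner outer by simp
 also have "\<dots> = 2 * (real n - 1) * (cmod (f a - d))\<^sup>2" using fA A(3) by (simp)
 finally have "2 * (real n - 1) * (cmod (f a - d))\<^sup>2 = 2 * (real n - 1)" using tot by simp
 hence "(cmod (f a - d))\<^sup>2 = 1" using A(3) by simp
 hence "cmod (f a - d) = 1 \<or> cmod (f a - d) = -1" by (simp only: power2_eq_1_iff)
 hence "cmod (f a - d) = 1" using norm_ge_zero[of "f a - d"] by linarith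
 thus ?thesis using d aA by (intro bexI[of _ a] exI[of _ d]) simp_all
qed

lemma sum_cmod_diff_squared:
 fixes f :: "'a \<Rightarrow> complex"
 assumes "finite A"
 shows "(\<Sum>x\<in>A. \<Sum>y\<in>A. (cmod (f x - f y))\<^sup>2) = 2 * (card A * (\<Sum>x\<in>A. (cmod (f x))\<^sup>2) - (cmod (\<Sum>x\<in>A. f x))\<^sup>2)"
proof -
 have 1: "(cmod (f x - f y))\<^sup>2 = (cmod (f x))\<^sup>2 + (cmod (f y))\<^sup>2 - 2 * (Re (f x) * Re (f y) + Im (f x) * Im (f y))" for x y
  unfolding cmod_power2 by (simp add: power2_eq_square algebra_simps)
 have 2: "(\<Sum>x\<in>A. \<Sum>y\<in>A. 2 * (Re (f x) * Re (f y) + Im (f x) * Im (f y)))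
   = 2 * ((\<Sum>x\<in>A. Re (f x))\<^sup>2 + (\<Sum>x\<in>A. Im (f x))\<^sup>2)"
  by (simp only: power2_eq_square sum_distrib_left[symmetric] sum_distrib_right[symmetric] sum.distrib)
 have "(\<Sum>x\<in>A. \<Sum>y\<in>A. (cmod (f x - f y))\<^sup>2) = card A * (\<Sum>x\<in>A. (cmod (f x))\<^sup>2) + card A * (\<Sum>x\<in>A. (cmod (f x))\<^sup>2)
   - 2 * ((\<Sum>x\<in>A. Re (f x))\<^sup>2 + (\<Sum>x\<in>A. Im (f x))\<^sup>2)"
  unfolding 1 sum_subtractf 2 by (simp add: sum.distrib sum_distrib_left[symmetric])
 thus ?thesis unfolding cmod_power2[of "sum f A"] Re_sum Im_sum by simp
qed

text \<open>
 A family of homomorphisms from \<open>G\<close> to the unit circle, with values in \<open>D\<close>, whose sum is the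
 character of the regular representation; for abelian \<open>G\<close> this is the family of all characters.
\<close>

definition char_system :: "complex set \<Rightarrow> ('g, 'n) monoid_scheme \<Rightarrow> bool" where
 "char_system D G \<longleftrightarrow> (\<exists>(I :: nat set) \<chi>. finite I \<and>
  (\<forall>i\<in>I. \<forall>g\<in>carrier G. \<chi> i g \<in> D \<and> cmod (\<chi> i g) = 1 \<and> (\<forall>h\<in>carrier G. \<chi> i (g \<otimes>\<^bsub>G\<^esub> h) = \<chi> i g * \<chi> i h)) \<and>
  (\<forall>g\<in>carrier G. (\<Sum>i\<in>I. \<chi> i g) = (if g = \<one>\<^bsub>G\<^esub> then of_nat (card (carrier G)) else 0)))"

locale character_family = group G for G :: "('g, 'n) monoid_scheme" (structure) +
 fixes D :: "complex set" and I :: "nat set" and \<chi> :: "nat \<Rightarrow> 'g \<Rightarrow> complex"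
 assumes finG: "finite (carrier G)" and finI: "finite I"
  and \<chi>_mem: "i \<in> I \<Longrightarrow> g \<in> carrier G \<Longrightarrow> \<chi> i g \<in> D"
  and \<chi>_norm: "i \<in> I \<Longrightarrow> g \<in> carrier G \<Longrightarrow> cmod (\<chi> i g) = 1"
  and \<chi>_mult: "i \<in> I \<Longrightarrow> g \<in> carrier G \<Longrightarrow> h \<in> carrier G \<Longrightarrow> \<chi> i (g \<otimes> h) = \<chi> i g * \<chi> i h"
  and \<chi>_sum: "g \<in> carrier G \<Longrightarrow> (\<Sum>i\<in>I. \<chi> i g) = (if g = \<one> then of_nat (card (carrier G)) else 0)"
begin

definition tr :: "nat \<Rightarrow> ('g \<Rightarrow> complex) \<Rightarrow> complex" where "tr i u = (\<Sum>g\<in>carrier G. u g * \<chi> i g)"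

lemma \<chi>_one: "i \<in> I \<Longrightarrow> \<chi> i \<one> = 1" using \<chi>_mult[of i \<one> \<one>] \<chi>_norm[of i \<one>] by auto

lemma \<chi>_inv: assumes "i \<in> I" "g \<in> carrier G" shows "\<chi> i (inv g) = cnj (\<chi> i g)"
proof -
 have "\<chi> i g * \<chi> i (inv g) = 1" using \<chi>_mult[of i g "inv g"] assms \<chi>_one by simp
 moreover have "\<chi> i g * cnj (\<chi> i g) = 1" using \<chi>_norm[OF assms] by (simp add: complex_norm_square[symmetric])
 ultimately show ?thesis by (metis mult_cancel_left mult_zero_left zero_neq_one)
qed

lemma tr_gconv:
 assumes i: "i \<in> I" shows "tr i (gconv G u v) = tr i u * tr i v"
proof -
 have "tr i (gconv G u v) = (\<Sum>y\<in>carrier G. \<Sum>x\<in>carrier G. u y * v (inv y \<otimes> x) * \<chi> i x)"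
  unfolding tr_def gconv_def sum_distrib_right by (rule sum.swap)
 also have "\<dots> = (\<Sum>y\<in>carrier G. \<Sum>z\<in>carrier G. u y * v z * \<chi> i (y \<otimes> z))"
 proof (rule sum.cong[OF refl])
  fix y assume y: "y \<in> carrier G"
  have "(\<Sum>x\<in>carrier G. u y * v (inv y \<otimes> x) * \<chi> i x)
    = (\<Sum>x\<in>carrier G. (\<lambda>z. u y * v z * \<chi> i (y \<otimes> z)) (inv y \<otimes> x))"
   using y by (intro sum.cong refl) (simp add: m_assoc[symmetric])
  also have "\<dots> = (\<Sum>z\<in>carrier G. u y * v z * \<chi> i (y \<otimes> z))" by (rule sum_left_translate) (use y in simp)
  finally show "(\<Sum>x\<in>carrier G. u y * v (inv y \<otimes> x) * \<chi> i x) = (\<Sum>z\<in>carrier G. u y * v z * \<chi> i (y \<otimes> z))" .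
 qed
 also have "\<dots> = tr i u * tr i v" unfolding tr_def sum_product using i by (intro sum.cong refl) (simp add: \<chi>_mult mult_ac)
 finally show ?thesis .
qed

lemma sum_nontrivial:
 assumes i: "i \<in> I" and g: "g \<in> carrier G" "\<chi> i g \<noteq> 1"
 shows "(\<Sum>x\<in>carrier G. \<chi> i x) = 0"
proof -
 have "(\<Sum>x\<in>carrier G. \<chi> i x) = (\<Sum>x\<in>carrier G. \<chi> i (g \<otimes> x))" by (rule sum_left_translate[OF g(1), symmetric])
 also have "\<dots> = \<chi> i g * (\<Sum>x\<in>carrier G. \<chi> i x)" using i g by (simp add: \<chi>_mult sum_distrib_left)
 finally show ?thesis using g(2) by (simp)
qed

lemma parseval:
 "(\<Sum>i\<in>I. (cmod (tr i u))\<^sup>2) = card (carrier G) * (\<Sum>g\<in>carrier G. (cmod (u g))\<^sup>2)"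
proof -
 have "complex_of_real (\<Sum>i\<in>I. (cmod (tr i u))\<^sup>2) = (\<Sum>i\<in>I. tr i u * cnj (tr i u))"
  by (simp only: of_real_sum complex_norm_square)
 also have "\<dots> = (\<Sum>i\<in>I. \<Sum>g\<in>carrier G. \<Sum>h\<in>carrier G. u g * cnj (u h) * \<chi> i (g \<otimes> inv h))"
  unfolding tr_def cnj_sum sum_product by (intro sum.cong refl) (simp add: \<chi>_mult \<chi>_inv mult_ac)
 also have "\<dots> = (\<Sum>g\<in>carrier G. \<Sum>h\<in>carrier G. u g * cnj (u h) * (\<Sum>i\<in>I. \<chi> i (g \<otimes> inv h)))"
  unfolding sum_distrib_left by (subst sum.swap, rule sum.cong[OF refl], rule sum.swap)
 also have "\<dots> = (\<Sum>g\<in>carrier G. \<Sum>h\<in>carrier G. if h = g then u g * cnj (u g) * of_nat (card (carrier G)) else 0)"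
 proof (intro sum.cong refl)
  fix g h assume gh: "g \<in> carrier G" "h \<in> carrier G"
  have "g \<otimes> inv h = \<one> \<longleftrightarrow> h = g" using gh inv_solve_right'[of \<one> g h] by auto
  thus "u g * cnj (u h) * (\<Sum>i\<in>I. \<chi> i (g \<otimes> inv h)) = (if h = g then u g * cnj (u g) * of_nat (card (carrier G)) else 0)"
   using gh by (simp add: \<chi>_sum)
 qed
 also have "\<dots> = (\<Sum>g\<in>carrier G. u g * cnj (u g) * of_nat (card (carrier G)))" using finG by (intro sum.cong refl) (simp add: sum.delta)
 also have "\<dots> = complex_of_real (card (carrier G) * (\<Sum>g\<in>carrier G. (cmod (u g))\<^sup>2))"
  unfolding of_real_mult of_real_sum complex_norm_square by (simp add: sum_distrib_left mult_ac)
 finally show ?thesis by (simp only: of_real_eq_iff)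
qed

lemma card_I: "card I = card (carrier G)"
proof -
 have "of_nat (card I) = (\<Sum>i\<in>I. \<chi> i \<one>)" by (simp add: \<chi>_one)
 thus ?thesis using \<chi>_sum[OF one_closed] by (metis of_nat_eq_iff)
qed

text \<open>Summing all characters over G in both orders gives |G| on one side and |G| times the
  number of trivial characters on the other.\<close>

lemma unique_trivial: "\<exists>i\<in>I. (\<forall>g\<in>carrier G. \<chi> i g = 1) \<and> (\<forall>j\<in>I - {i}. \<exists>g\<in>carrier G. \<chi> j g \<noteq> 1)"
proof -
 let ?n = "card (carrier G)"
 define T where "T = {i\<in>I. \<forall>g\<in>carrier G. \<chi> i g = 1}"
 have n: "?n > 0" using finG card_gt_0_iff by blast
 have "(of_nat ?n :: complex) = (\<Sum>g\<in>carrier G. if g = \<one> then of_nat ?n else 0)" using finG by (simp)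
 also have "\<dots> = (\<Sum>g\<in>carrier G. \<Sum>i\<in>I. \<chi> i g)" by (intro sum.cong refl) (simp add: \<chi>_sum)
 also have "\<dots> = (\<Sum>i\<in>I. \<Sum>g\<in>carrier G. \<chi> i g)" by (rule sum.swap)
 also have "\<dots> = (\<Sum>i\<in>I. if i \<in> T then of_nat ?n else 0)" using sum_nontrivial by (intro sum.cong refl) (auto simp: T_def)
 also have "\<dots> = (\<Sum>i\<in>T. of_nat ?n)" using finI by (intro sum.mono_neutral_cong_right) (auto simp: T_def)
 also have "\<dots> = of_nat (card T * ?n)" by simp
 finally have "?n = card T * ?n" by (metis of_nat_eq_iff)
 hence "card T = 1" using n by simp
 then obtain i where "T = {i}" by (meson card_1_singletonE)
 thus ?thesis unfolding T_def by (intro bexI[of _ i]) blast+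
qed

text \<open>A nontrivial character sums to 0 over G, so it does not see the constant c.\<close>

lemma tr_inverse:
 assumes i: "i \<in> I" "\<exists>g\<in>carrier G. \<chi> i g \<noteq> 1"
  and c: "\<forall>x\<in>carrier G. gconv G u v x = (if x = \<one> then 1 else 0) + c"
 shows "tr i u * tr i v = 1"
proof -
 have "tr i u * tr i v = tr i (gconv G u v)" by (rule tr_gconv[OF i(1), symmetric])
 also have "\<dots> = (\<Sum>x\<in>carrier G. ((if x = \<one> then 1 else 0) + c) * \<chi> i x)" unfolding tr_def using c by (intro sum.cong) auto
 also have "\<dots> = (\<Sum>x\<in>carrier G. (if x = \<one> then \<chi> i x else 0)) + c * (\<Sum>x\<in>carrier G. \<chi> i x)"
  by (simp add: ring_distribs sum.distrib sum_distrib_left if_distrib[of "\<lambda>t. t * _"] cong: if_cong)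
 also have "(\<Sum>x\<in>carrier G. \<chi> i x) = 0" using sum_nontrivial i by blast
 finally show ?thesis using finG i(1) by (simp add: \<chi>_one)
qed

end

text \<open>Integrality of |x|^2 gives nonzero elements modulus at least 1 and units modulus exactly
  1. The instances are the integers and the integers of imaginary quadratic fields.\<close>

locale discrete_ring =
 fixes D :: "complex set"
 assumes zero_D: "0 \<in> D" and one_D: "1 \<in> D"
  and diff_D: "x \<in> D \<Longrightarrow> y \<in> D \<Longrightarrow> x - y \<in> D" and mult_D: "x \<in> D \<Longrightarrow> y \<in> D \<Longrightarrow> x * y \<in> D"
  and norm_D: "x \<in> D \<Longrightarrow> \<exists>k::nat. (cmod x)\<^sup>2 = k"
begin

lemma sum_D: "(\<And>i. i \<in> A \<Longrightarrow> f i \<in> D) \<Longrightarrow> sum f A \<in> D"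
proof (induction A rule: infinite_finite_induct)
 case (insert a A)
 hence "f a - (0 - sum f A) \<in> D" by (intro diff_D zero_D) auto
 thus ?case using insert by simp
qed (auto simp: zero_D)

lemma norm_ge_1_D: assumes "x \<in> D" "x \<noteq> 0" shows "(cmod x)\<^sup>2 \<ge> 1"
proof -
 obtain k :: nat where k: "(cmod x)\<^sup>2 = k" using norm_D[OF assms(1)] by blast
 have "k \<noteq> 0"
 proof
  assume "k = 0"
  hence "(cmod x)\<^sup>2 = 0" using k by simp
  with assms(2) show False by simp
 qed
 thus ?thesis using k by simp
qed

lemma unit_norm_D: assumes "x \<in> D" "y \<in> D" "x * y = 1" shows "(cmod x)\<^sup>2 = 1"
proof -
 have "x \<noteq> 0" "y \<noteq> 0" using assms by auto
 hence "(cmod x)\<^sup>2 \<ge> 1" "(cmod y)\<^sup>2 \<ge> 1" using norm_ge_1_D assms by auto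
 moreover have "(cmod x)\<^sup>2 * (cmod y)\<^sup>2 = 1" using assms(3) by (metis norm_mult norm_one power_mult_distrib power_one)
 ultimately show ?thesis using mult_left_mono[of 1 "(cmod y)\<^sup>2" "(cmod x)\<^sup>2"] by simp
qed

end

text \<open>
 By Parseval, a function whose nontrivial Fourier coefficients all have modulus 1 is constant up to
 one value.
\<close>

lemma (in group) concentrated_if_parseval:
 assumes fin: "finite (carrier G)" and card: "card (carrier G) > 1" and D: "discrete_ring D"
  and R: "R \<subseteq> D" "\<And>x y. x \<in> R \<Longrightarrow> y \<in> R \<Longrightarrow> x - y \<in> R" "\<And>x. x \<in> R \<Longrightarrow> cmod x = 1 \<Longrightarrow> inverse x \<in> R"
  and u: "u \<in> carrier G \<rightarrow> R"
  and parseval: "card (carrier G) * (\<Sum>g\<in>carrier G. (cmod (u g))\<^sup>2)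
   = (cmod (\<Sum>g\<in>carrier G. u g))\<^sup>2 + (real (card (carrier G)) - 1)"
 shows "trivial_mod_Sigma R G u"
proof -
 interpret D: discrete_ring D by fact
 have uR: "u x \<in> R" if "x \<in> carrier G" for x using u that by auto
 obtain a d where a: "a \<in> carrier G" "cmod (u a - d) = 1" "\<forall>x\<in>carrier G. x \<noteq> a \<longrightarrow> u x = d"
 proof -
  have "\<exists>a\<in>carrier G. \<exists>d. cmod (u a - d) = 1 \<and> (\<forall>x\<in>carrier G. x \<noteq> a \<longrightarrow> u x = d)"
  proof (rule concentrated_function[OF fin refl])
   show "card (carrier G) \<ge> 2" using card by simp
   show "(cmod (u x - u y))\<^sup>2 \<ge> 1" if "x \<in> carrier G" "y \<in> carrier G" "u x \<noteq> u y" for x y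
    using D.norm_ge_1_D[of "u x - u y"] R(1) R(2)[OF uR uR] that by auto
   show "(\<Sum>x\<in>carrier G. \<Sum>y\<in>carrier G. (cmod (u x - u y))\<^sup>2) = 2 * (real (card (carrier G)) - 1)"
    unfolding sum_cmod_diff_squared[OF fin] parseval by simp
  qed
  thus ?thesis using that by blast
 qed
 have "card {a} < card (carrier G)" using card by simp
 then obtain x where x: "x \<in> carrier G" "x \<noteq> a" by (metis card_mono finite.emptyI finite.insertI not_le singletonI subsetI)
 hence "u a - d \<in> R" using R(2)[OF uR[OF a(1)] uR[OF x(1)]] a(3) by simp
 thus ?thesis unfolding trivial_mod_Sigma_def using a R(3) by (intro bexI[of _ "u a - d"] bexI[of _ a] exI[of _ d]) auto
qed

text \<open>The Fourier coefficients at nontrivial characters are units of D and have modulus 1,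
  which is the Parseval condition. D only has to contain the characters and the values of u, so R
  may be smaller.\<close>

theorem (in group) char_system_only_trivial_units:
 assumes fin: "finite (carrier G)" and card: "card (carrier G) > 1" and D: "discrete_ring D"
  and cs: "char_system D G"
  and R: "R \<subseteq> D" "\<And>x y. x \<in> R \<Longrightarrow> y \<in> R \<Longrightarrow> x - y \<in> R" "\<And>x. x \<in> R \<Longrightarrow> cmod x = 1 \<Longrightarrow> inverse x \<in> R"
 shows "complex_only_trivial_units R G"
 unfolding complex_only_trivial_units_def
proof (intro allI impI)
 fix u v assume u: "u \<in> carrier G \<rightarrow> R" and v: "v \<in> carrier G \<rightarrow> R" and inv: "inverse_mod_Sigma G u v"
 interpret D: discrete_ring D by fact
 obtain I :: "nat set" and \<chi> where I: "finite I"
  "\<forall>i\<in>I. \<forall>g\<in>carrier G. \<chi> i g \<in> D \<and> cmod (\<chi> i g) = 1 \<and> (\<forall>h\<in>carrier G. \<chi> i (g \<otimes> h) = \<chi> i g * \<chi> i h)"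
  "\<forall>g\<in>carrier G. (\<Sum>i\<in>I. \<chi> i g) = (if g = \<one> then of_nat (card (carrier G)) else 0)"
  using cs unfolding char_system_def by blast
 interpret character_family G D I \<chi>
  by unfold_locales (use fin I in simp_all)
 have trD: "tr i w \<in> D" if "i \<in> I" "w \<in> carrier G \<rightarrow> R" for i w
  unfolding tr_def using that R(1) by (intro D.sum_D D.mult_D \<chi>_mem) auto
 obtain c where c: "\<forall>x\<in>carrier G. gconv G u v x = (if x = \<one> then 1 else 0) + c" using inv unfolding inverse_mod_Sigma_def by blast
 obtain i0 where i0: "i0 \<in> I" "\<forall>g\<in>carrier G. \<chi> i0 g = 1" "\<forall>j\<in>I - {i0}. \<exists>g\<in>carrier G. \<chi> j g \<noteq> 1"
  using unique_trivial by blast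
 have nontriv: "(cmod (tr j u))\<^sup>2 = 1" if j: "j \<in> I - {i0}" for j
  using D.unit_norm_D[of "tr j u" "tr j v"] tr_inverse[OF _ _ c, of j] trD u v i0(3) j by auto
 have "card (carrier G) * (\<Sum>g\<in>carrier G. (cmod (u g))\<^sup>2) = (cmod (tr i0 u))\<^sup>2 + (\<Sum>j\<in>I - {i0}. (cmod (tr j u))\<^sup>2)"
  unfolding parseval[symmetric] by (rule sum.remove[OF I(1) i0(1)])
 also have "(\<Sum>j\<in>I - {i0}. (cmod (tr j u))\<^sup>2) = real (card (carrier G)) - 1"
  using nontriv i0(1) I(1) card_I card by (simp add: of_nat_diff)
 also have "tr i0 u = (\<Sum>g\<in>carrier G. u g)" unfolding tr_def using i0(2) by (intro sum.cong) auto
 finally show "trivial_mod_Sigma R G u" by (intro concentrated_if_parseval[OF fin card D R u])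
qed

lemma char_system_iso:
 assumes G: "group G" and H: "group H" and iso: "G \<cong> H" and cs: "char_system D H"
 shows "char_system D G"
proof -
 obtain f where f: "f \<in> hom G H" "bij_betw f (carrier G) (carrier H)" using iso by (auto simp: is_iso_def iso_def)
 interpret f: group_hom G H f using G H f(1) by (simp add: group_hom_def group_hom_axioms_def)
 obtain I :: "nat set" and \<chi> where I: "finite I"
  "\<forall>i\<in>I. \<forall>g\<in>carrier H. \<chi> i g \<in> D \<and> cmod (\<chi> i g) = 1 \<and> (\<forall>h\<in>carrier H. \<chi> i (g \<otimes>\<^bsub>H\<^esub> h) = \<chi> i g * \<chi> i h)"
  "\<forall>g\<in>carrier H. (\<Sum>i\<in>I. \<chi> i g) = (if g = \<one>\<^bsub>H\<^esub> then of_nat (card (carrier H)) else 0)"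
  using cs unfolding char_system_def by blast
 have one: "f g = \<one>\<^bsub>H\<^esub> \<longleftrightarrow> g = \<one>\<^bsub>G\<^esub>" if "g \<in> carrier G" for g
  using f(2) that f.hom_one f.G.one_closed by (metis bij_betw_imp_inj_on inj_onD)
 show ?thesis unfolding char_system_def by (intro exI[of _ I] exI[of _ "\<lambda>i. \<chi> i \<circ> f"])
    (use I one bij_betw_same_card[OF f(2)] in \<open>auto simp: f.hom_mult\<close>)
qed

lemma char_system_prod:
 assumes G: "char_system D G" and H: "char_system D H"
  and D: "\<And>x y. x \<in> D \<Longrightarrow> y \<in> D \<Longrightarrow> x * y \<in> D"
 shows "char_system D (G \<times>\<times> H)"
proof -
 obtain I :: "nat set" and \<chi> where I: "finite I"
  "\<forall>i\<in>I. \<forall>g\<in>carrier G. \<chi> i g \<in> D \<and> cmod (\<chi> i g) = 1 \<and> (\<forall>h\<in>carrier G. \<chi> i (g \<otimes>\<^bsub>G\<^esub> h) = \<chi> i g * \<chi> i h)"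
  "\<forall>g\<in>carrier G. (\<Sum>i\<in>I. \<chi> i g) = (if g = \<one>\<^bsub>G\<^esub> then of_nat (card (carrier G)) else 0)"
  using G unfolding char_system_def by blast
 obtain J :: "nat set" and \<psi> where J: "finite J"
  "\<forall>i\<in>J. \<forall>g\<in>carrier H. \<psi> i g \<in> D \<and> cmod (\<psi> i g) = 1 \<and> (\<forall>h\<in>carrier H. \<psi> i (g \<otimes>\<^bsub>H\<^esub> h) = \<psi> i g * \<psi> i h)"
  "\<forall>g\<in>carrier H. (\<Sum>i\<in>J. \<psi> i g) = (if g = \<one>\<^bsub>H\<^esub> then of_nat (card (carrier H)) else 0)"
  using H unfolding char_system_def by blast
 \<comment> \<open>Characters are indexed by natural numbers, so a pair of indices is encoded as one
   number.\<close>
 define \<xi> where "\<xi> k = (\<lambda>(g,h). \<chi> (fst (prod_decode k)) g * \<psi> (snd (prod_decode k)) h)" for k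
 have sum: "(\<Sum>k\<in>prod_encode ` (I \<times> J). \<xi> k (g,h)) = (\<Sum>i\<in>I. \<chi> i g) * (\<Sum>j\<in>J. \<psi> j h)" for g h
 proof -
  have "(\<Sum>k\<in>prod_encode ` (I \<times> J). \<xi> k (g,h)) = (\<Sum>(i,j)\<in>I \<times> J. \<chi> i g * \<psi> j h)"
   by (subst sum.reindex) (auto simp: \<xi>_def inj_on_def split_def)
  thus ?thesis by (simp add: sum_product sum.cartesian_product)
 qed
 show ?thesis unfolding char_system_def
 proof (intro exI[of _ "prod_encode ` (I \<times> J)"] exI[of _ \<xi>] conjI)
  show "finite (prod_encode ` (I \<times> J))" using I J by simp
  show "\<forall>i\<in>prod_encode ` (I \<times> J). \<forall>g\<in>carrier (G \<times>\<times> H). \<xi> i g \<in> D \<and> cmod (\<xi> i g) = 1 \<and>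
    (\<forall>h\<in>carrier (G \<times>\<times> H). \<xi> i (g \<otimes>\<^bsub>G \<times>\<times> H\<^esub> h) = \<xi> i g * \<xi> i h)"
   using I(2) J(2) D by (auto simp: \<xi>_def norm_mult)
  show "\<forall>g\<in>carrier (G \<times>\<times> H). (\<Sum>i\<in>prod_encode ` (I \<times> J). \<xi> i g)
    = (if g = \<one>\<^bsub>G \<times>\<times> H\<^esub> then of_nat (card (carrier (G \<times>\<times> H))) else 0)"
   using I(3) J(3) by (auto simp: sum card_cartesian_product)
 qed
qed

section \<open>Characters of powers of cyclic groups, and transport along isomorphisms\<close>

lemma char_system_integer_mod_group:
 assumes k: "k > 0" and z: "\<zeta> ^ k = 1" "\<And>a. 0 < a \<Longrightarrow> a < k \<Longrightarrow> \<zeta> ^ a \<noteq> 1" and D: "\<And>a. \<zeta> ^ a \<in> D"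
 shows "char_system D (integer_mod_group k)"
proof -
 have zmod: "\<zeta> ^ a = \<zeta> ^ (a mod k)" for a
 proof -
  have "\<zeta> ^ a = \<zeta> ^ (k * (a div k) + a mod k)" by simp
  also have "\<dots> = \<zeta> ^ (a mod k)" by (simp only: power_add power_mult z(1) power_one mult_1_left)
  finally show ?thesis .
 qed
 have "cmod \<zeta> ^ k = 1 ^ k" using z(1) by (metis norm_one norm_power power_one)
 hence nz: "cmod \<zeta> = 1" using k power_eq_imp_eq_base[of "cmod \<zeta>" k 1] by simp
 have car: "carrier (integer_mod_group k) = {0..<int k}" using k by (simp add: carrier_integer_mod_group)
 define \<chi> where "\<chi> i a = (\<zeta> ^ nat a) ^ i" for i :: nat and a :: int
 have sum: "(\<Sum>i<k. \<chi> i a) = (if a = 0 then of_nat k else 0)" if a: "a \<in> {0..<int k}" for a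
 proof (cases "a = 0")
  case False
  hence "\<zeta> ^ nat a \<noteq> 1" using a by (intro z(2)) auto
  moreover have "(\<zeta> ^ nat a) ^ k = 1" by (metis power_mult mult.commute power_one z(1))
  ultimately show ?thesis using False by (simp add: \<chi>_def geometric_sum)
 qed (simp add: \<chi>_def)
 have mult: "\<chi> i ((a + b) mod int k) = \<chi> i a * \<chi> i b" if "a \<in> {0..<int k}" "b \<in> {0..<int k}" for i a b
 proof -
  have "nat ((a + b) mod int k) = (nat a + nat b) mod k" using that by (simp add: nat_mod_distrib nat_add_distrib)
  hence "\<zeta> ^ nat ((a + b) mod int k) = \<zeta> ^ (nat a + nat b)" using zmod by metis
  thus ?thesis by (simp add: \<chi>_def power_add power_mult_distrib)
 qed
 show ?thesis unfolding char_system_def by (intro exI[of _ "{..<k}"] exI[of _ \<chi>])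
    (use sum mult D nz in \<open>auto simp: car \<chi>_def norm_power simp flip: power_mult\<close>)
qed

lemma cyclic_power_Suc_iso: "cyclic_power k (Suc n) \<cong> integer_mod_group k \<times>\<times> cyclic_power k n"
proof -
 let ?C = "carrier (integer_mod_group k)"
 let ?f = "\<lambda>x :: nat \<Rightarrow> int. (x n, restrict x {..<n})"
 have car: "carrier (cyclic_power k m) = PiE {..<m} (\<lambda>_. ?C)" for m by (simp add: cyclic_power_def)
 have hom: "?f \<in> hom (cyclic_power k (Suc n)) (integer_mod_group k \<times>\<times> cyclic_power k n)"
 proof (rule homI)
  fix x assume x: "x \<in> carrier (cyclic_power k (Suc n))"
  have "x i \<in> ?C" if "i < Suc n" for i using x that unfolding car by (intro PiE_mem[of x "{..<Suc n}"]) simp_all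
  thus "?f x \<in> carrier (integer_mod_group k \<times>\<times> cyclic_power k n)" by (simp add: car restrict_PiE_iff)
 next
  fix x y :: "nat \<Rightarrow> int"
  show "?f (x \<otimes>\<^bsub>cyclic_power k (Suc n)\<^esub> y) = ?f x \<otimes>\<^bsub>integer_mod_group k \<times>\<times> cyclic_power k n\<^esub> ?f y"
   by (simp add: cyclic_power_def restrict_def fun_eq_iff)
 qed
 have inj: "inj_on ?f (carrier (cyclic_power k (Suc n)))"
 proof (rule inj_onI)
  fix x y assume xy: "x \<in> carrier (cyclic_power k (Suc n))" "y \<in> carrier (cyclic_power k (Suc n))" and eq: "?f x = ?f y"
  show "x = y"
  proof (rule PiE_ext[OF xy[unfolded car]])
   fix i assume i: "i \<in> {..<Suc n}"
   have e: "x n = y n" "restrict x {..<n} = restrict y {..<n}" using eq by simp_all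
   show "x i = y i"
   proof (cases "i = n")
    case False
    hence "i \<in> {..<n}" using i by simp
    thus ?thesis using fun_cong[OF e(2), of i] by simp
   qed (use e in simp)
  qed
 qed
 have surj: "?f ` carrier (cyclic_power k (Suc n)) = carrier (integer_mod_group k \<times>\<times> cyclic_power k n)"
 proof
  show "?f ` carrier (cyclic_power k (Suc n)) \<subseteq> carrier (integer_mod_group k \<times>\<times> cyclic_power k n)"
   using hom by (auto simp only: hom_def)
  show "carrier (integer_mod_group k \<times>\<times> cyclic_power k n) \<subseteq> ?f ` carrier (cyclic_power k (Suc n))"
  proof
   fix z assume "z \<in> carrier (integer_mod_group k \<times>\<times> cyclic_power k n)"
   then obtain a y where z: "z = (a,y)" "a \<in> ?C" "y \<in> PiE {..<n} (\<lambda>_. ?C)" by (auto simp only: DirProd_def car partial_object.simps)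
   let ?x = "\<lambda>i\<in>{..<Suc n}. if i = n then a else y i"
   have "y i \<in> ?C" if "i < n" for i using z(3) that by (intro PiE_mem[of y "{..<n}"]) simp_all
   hence "(if i = n then a else y i) \<in> ?C" if "i < Suc n" for i using z(2) that by (cases "i = n") simp_all
   hence x: "?x \<in> carrier (cyclic_power k (Suc n))" unfolding car restrict_PiE_iff by blast
   have "restrict ?x {..<n} = y"
   proof (rule ext)
    fix i show "restrict ?x {..<n} i = y i" by (cases "i < n") (simp_all add: PiE_arb[OF z(3)])
   qed
   thus "z \<in> ?f ` carrier (cyclic_power k (Suc n))" using x z(1) by (intro image_eqI[of _ _ ?x]) simp_all
  qed
 qed
 show ?thesis using hom inj surj unfolding is_iso_def iso_def bij_betw_def by blast
qed

lemma group_cyclic_power: "group (cyclic_power k n)" by (simp add: cyclic_power_def)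

lemma cyclic_power_0: "carrier (cyclic_power k 0) = {\<lambda>_. undefined}" "\<one>\<^bsub>cyclic_power k 0\<^esub> = (\<lambda>_. undefined)"
 by (auto simp: cyclic_power_def)

lemma char_system_cyclic_power:
 assumes k: "k > 0" and z: "\<zeta> ^ k = 1" "\<And>a. 0 < a \<Longrightarrow> a < k \<Longrightarrow> \<zeta> ^ a \<noteq> 1"
  and D: "1 \<in> D" "\<zeta> \<in> D" "\<And>x y. x \<in> D \<Longrightarrow> y \<in> D \<Longrightarrow> x * y \<in> D"
 shows "char_system D (cyclic_power k n)"
proof (induction n)
 case 0
 show ?case unfolding char_system_def by (intro exI[of _ "{0}"] exI[of _ "\<lambda>_ _. 1"]) (auto simp: cyclic_power_0 D)
next
 case (Suc n)
 have "char_system D (integer_mod_group k)"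
 proof (rule char_system_integer_mod_group[OF k z(1)])
  show "\<zeta> ^ a \<noteq> 1" if "0 < a" "a < k" for a using z(2) that .
  show "\<zeta> ^ a \<in> D" for a by (induction a) (auto intro: D)
 qed
 hence "char_system D (integer_mod_group k \<times>\<times> cyclic_power k n)" by (intro char_system_prod Suc D(3))
 thus ?case by (intro char_system_iso[OF group_cyclic_power _ cyclic_power_Suc_iso]) (auto intro: DirProd_group group_cyclic_power)
qed

lemma complex_only_trivial_units_iso:
 assumes G: "group G" and H: "group H" and iso: "G \<cong> H" and triv: "complex_only_trivial_units R H"
 shows "complex_only_trivial_units R G"
proof -
 obtain f where f: "f \<in> hom H G" "bij_betw f (carrier H) (carrier G)" using group.iso_sym[OF G iso] by (auto simp: is_iso_def iso_def)
 interpret f: group_hom H G f using G H f(1) by (simp add: group_hom_def group_hom_axioms_def)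
 have conv: "gconv H (u \<circ> f) (v \<circ> f) x = gconv G u v (f x)" if "x \<in> carrier H" for u v x
 proof -
  have "gconv H (u \<circ> f) (v \<circ> f) x = (\<Sum>y\<in>carrier H. (\<lambda>y. u y * v (inv\<^bsub>G\<^esub> y \<otimes>\<^bsub>G\<^esub> f x)) (f y))"
   unfolding gconv_def using that by (intro sum.cong) (auto simp: f.hom_mult f.hom_inv)
  also have "\<dots> = gconv G u v (f x)" unfolding gconv_def by (rule sum.reindex_bij_betw[OF f(2)])
  finally show ?thesis .
 qed
 have one: "f g = \<one>\<^bsub>G\<^esub> \<longleftrightarrow> g = \<one>\<^bsub>H\<^esub>" if "g \<in> carrier H" for g
  using f(2) that f.hom_one f.G.one_closed by (metis bij_betw_imp_inj_on inj_onD)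
 show ?thesis unfolding complex_only_trivial_units_def
 proof (intro allI impI)
  fix u v assume u: "u \<in> carrier G \<rightarrow> R" and v: "v \<in> carrier G \<rightarrow> R" and inv: "inverse_mod_Sigma G u v"
  have fc: "f x \<in> carrier G" if "x \<in> carrier H" for x using that by simp
  have "u \<circ> f \<in> carrier H \<rightarrow> R" "v \<circ> f \<in> carrier H \<rightarrow> R" using u v fc by auto
  moreover have "inverse_mod_Sigma H (u \<circ> f) (v \<circ> f)" using inv fc by (auto simp: inverse_mod_Sigma_def conv one)
  ultimately have "trivial_mod_Sigma R H (u \<circ> f)" using triv unfolding complex_only_trivial_units_def by blast
  then obtain r h d where r: "r \<in> R" "h \<in> carrier H" "r \<noteq> 0" "inverse r \<in> R"
   and d: "\<And>x. x \<in> carrier H \<Longrightarrow> u (f x) = (if x = h then r else 0) + d"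
   unfolding trivial_mod_Sigma_def by auto
  have "u y = (if y = f h then r else 0) + d" if "y \<in> carrier G" for y
  proof -
   obtain x where x: "x \<in> carrier H" "y = f x" using f(2) \<open>y \<in> carrier G\<close> by (auto simp: bij_betw_def)
   have "f x = f h \<longleftrightarrow> x = h" using f(2) x(1) r(2) by (auto simp: bij_betw_def inj_on_def)
   thus ?thesis using d[OF x(1)] x(2) by simp
  qed
  thus "trivial_mod_Sigma R G u" unfolding trivial_mod_Sigma_def using r by (intro bexI[of _ r] bexI[of _ "f h"] exI[of _ d]) auto
 qed
qed

section \<open>The quaternion group times a group with integral characters\<close>

lemma quaternion_carrier: "carrier quaternion_group = {(1, 0, 0, 0), (-1, 0, 0, 0), (0, 1, 0, 0), (0, -1, 0, 0),
         (0, 0, 1, 0), (0, 0, -1, 0), (0, 0, 0, 1), (0, 0, 0, -1)}"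
 and quaternion_mult: "x \<otimes>\<^bsub>quaternion_group\<^esub> y = hamilton_mult x y"
 and quaternion_one: "\<one>\<^bsub>quaternion_group\<^esub> = (1, 0, 0, 0)"
 by (simp_all add: quaternion_group_def)

interpretation Q8: group quaternion_group by (rule group_quaternion_group)

lemma quaternion_inv:
 assumes "(a, b, c, d) \<in> carrier quaternion_group"
 shows "inv\<^bsub>quaternion_group\<^esub> (a, b, c, d) = (a, -b, -c, -d)"
proof (rule Q8.inv_equality[OF _ assms])
 show "(a, -b, -c, -d) \<otimes>\<^bsub>quaternion_group\<^esub> (a, b, c, d) = \<one>\<^bsub>quaternion_group\<^esub>"
  using assms unfolding quaternion_carrier by (auto simp: quaternion_mult quaternion_one)
 show "(a, -b, -c, -d) \<in> carrier quaternion_group" using assms unfolding quaternion_carrier by auto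
qed

lemma sum_quaternion:
 "(\<Sum>q\<in>carrier quaternion_group. f q) = f (1,0,0,0) + f (-1,0,0,0) + f (0,1,0,0) + f (0,-1,0,0)
  + f (0,0,1,0) + f (0,0,-1,0) + f (0,0,0,1) + f (0,0,0,-1)"
 for f :: "_ \<Rightarrow> 'a :: comm_monoid_add"
 unfolding quaternion_carrier by (simp add: add_ac)

text \<open>The reduced norm of the image of w in the quaternion algebra, under the map that
  identifies the central group element -1 with the scalar -1.\<close>

definition quat_norm :: "(int \<times> int \<times> int \<times> int \<Rightarrow> complex) \<Rightarrow> complex" where
 "quat_norm w = (w (1,0,0,0) - w (-1,0,0,0))\<^sup>2 + (w (0,1,0,0) - w (0,-1,0,0))\<^sup>2
  + (w (0,0,1,0) - w (0,0,-1,0))\<^sup>2 + (w (0,0,0,1) - w (0,0,0,-1))\<^sup>2"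

text \<open>For s and t in {1, -1} these are the four linear characters, given by i \<mapsto> s and
  j \<mapsto> t.\<close>

definition quat_char :: "complex \<Rightarrow> complex \<Rightarrow> int \<times> int \<times> int \<times> int \<Rightarrow> complex" where
 "quat_char s t = (\<lambda>(a,b,c,d). if a \<noteq> 0 then 1 else if b \<noteq> 0 then s else if c \<noteq> 0 then t else s * t)"

lemma gconv_quaternion:
 assumes "x \<in> carrier quaternion_group"
 shows "gconv quaternion_group u v x =
  u (1,0,0,0) * v (hamilton_mult (1,0,0,0) x) + u (-1,0,0,0) * v (hamilton_mult (-1,0,0,0) x)
  + u (0,1,0,0) * v (hamilton_mult (0,-1,0,0) x) + u (0,-1,0,0) * v (hamilton_mult (0,1,0,0) x)
  + u (0,0,1,0) * v (hamilton_mult (0,0,-1,0) x) + u (0,0,-1,0) * v (hamilton_mult (0,0,1,0) x)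
  + u (0,0,0,1) * v (hamilton_mult (0,0,0,-1) x) + u (0,0,0,-1) * v (hamilton_mult (0,0,0,1) x)"
proof -
 have i: "inv\<^bsub>quaternion_group\<^esub> (a, b, c, d) = (a, -b, -c, -d)" if "(a, b, c, d) \<in> carrier quaternion_group" for a b c d
  by (rule quaternion_inv[OF that])
 show ?thesis unfolding gconv_def sum_quaternion quaternion_mult by (simp add: i quaternion_carrier)
qed

text \<open>Euler's four-square identity: on the vectors of differences, convolution is quaternion
  multiplication.\<close>

lemma quat_norm_gconv: "quat_norm (gconv quaternion_group u v) = quat_norm u * quat_norm v"
proof -
 have m: "(1,0,0,0) \<in> carrier quaternion_group" "(-1,0,0,0) \<in> carrier quaternion_group"
  "(0,1,0,0) \<in> carrier quaternion_group" "(0,-1,0,0) \<in> carrier quaternion_group"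
  "(0,0,1,0) \<in> carrier quaternion_group" "(0,0,-1,0) \<in> carrier quaternion_group"
  "(0,0,0,1) \<in> carrier quaternion_group" "(0,0,0,-1) \<in> carrier quaternion_group"
  by (simp_all add: quaternion_carrier)
 let ?w = "gconv quaternion_group u v"
 define a b c d where "a = u (1,0,0,0) - u (-1,0,0,0)" and "b = u (0,1,0,0) - u (0,-1,0,0)"
  and "c = u (0,0,1,0) - u (0,0,-1,0)" and "d = u (0,0,0,1) - u (0,0,0,-1)"
 define a' b' c' d' where "a' = v (1,0,0,0) - v (-1,0,0,0)" and "b' = v (0,1,0,0) - v (0,-1,0,0)"
  and "c' = v (0,0,1,0) - v (0,0,-1,0)" and "d' = v (0,0,0,1) - v (0,0,0,-1)"
 note defs = a_def b_def c_def d_def a'_def b'_def c'_def d'_def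
 have "?w (1,0,0,0) - ?w (-1,0,0,0) = a * a' - b * b' - c * c' - d * d'" unfolding m[THEN gconv_quaternion] defs by (simp add: algebra_simps)
 moreover have "?w (0,1,0,0) - ?w (0,-1,0,0) = a * b' + b * a' + c * d' - d * c'"
  unfolding m[THEN gconv_quaternion] defs by (simp add: algebra_simps)
 moreover have "?w (0,0,1,0) - ?w (0,0,-1,0) = a * c' - b * d' + c * a' + d * b'"
  unfolding m[THEN gconv_quaternion] defs by (simp add: algebra_simps)
 moreover have "?w (0,0,0,1) - ?w (0,0,0,-1) = a * d' + b * c' - c * b' + d * a'"
  unfolding m[THEN gconv_quaternion] defs by (simp add: algebra_simps)
 ultimately have "quat_norm ?w = (a * a' - b * b' - c * c' - d * d')\<^sup>2 + (a * b' + b * a' + c * d' - d * c')\<^sup>2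
   + (a * c' - b * d' + c * a' + d * b')\<^sup>2 + (a * d' + b * c' - c * b' + d * a')\<^sup>2"
  by (simp add: quat_norm_def)
 also have "\<dots> = (a\<^sup>2 + b\<^sup>2 + c\<^sup>2 + d\<^sup>2) * (a'\<^sup>2 + b'\<^sup>2 + c'\<^sup>2 + d'\<^sup>2)"
  by (simp add: power2_eq_square algebra_simps)
 finally show ?thesis by (simp add: quat_norm_def defs)
qed

text \<open>Parseval with squares in place of absolute squares: the four linear characters, and the
  four-square norm with weight 4. For integer values both kinds of squares agree.\<close>

lemma quat_parseval:
 "8 * (\<Sum>q\<in>carrier quaternion_group. (w q)\<^sup>2) =
  (\<Sum>s\<in>{1,-1}. \<Sum>t\<in>{1,-1}. (\<Sum>q\<in>carrier quaternion_group. w q * quat_char s t q)\<^sup>2) + 4 * quat_norm w"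
 by (simp add: sum_quaternion quat_char_def quat_norm_def power2_eq_square algebra_simps)

lemma quat_char_mult:
 assumes "q \<in> carrier quaternion_group" "q' \<in> carrier quaternion_group" "s \<in> {1,-1}" "t \<in> {1,-1}"
 shows "quat_char s t (hamilton_mult q q') = quat_char s t q * quat_char s t q'"
proof -
 have "s = 1 \<or> s = -1" "t = 1 \<or> t = -1" using assms by auto
 hence "\<forall>q\<in>carrier quaternion_group. \<forall>q'\<in>carrier quaternion_group.
   quat_char s t (hamilton_mult q q') = quat_char s t q * quat_char s t q'"
  unfolding quaternion_carrier by (elim disjE) (simp_all add: quat_char_def)
 thus ?thesis using assms by blast
qed

lemma quat_char_sum: "(s, t) \<noteq> (1, 1) \<Longrightarrow> s \<in> {1,-1} \<Longrightarrow> t \<in> {1,-1} \<Longrightarrow> (\<Sum>q\<in>carrier quaternion_group. quat_char s t q) = 0"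
 by (auto simp: sum_quaternion quat_char_def)

lemma (in group) sum_hom_gconv:
 fixes \<chi> :: "'a \<Rightarrow> complex"
 assumes mult: "\<And>g h. g \<in> carrier G \<Longrightarrow> h \<in> carrier G \<Longrightarrow> \<chi> (g \<otimes> h) = \<chi> g * \<chi> h"
 shows "(\<Sum>x\<in>carrier G. gconv G u v x * \<chi> x) = (\<Sum>x\<in>carrier G. u x * \<chi> x) * (\<Sum>x\<in>carrier G. v x * \<chi> x)"
proof -
 have "(\<Sum>x\<in>carrier G. gconv G u v x * \<chi> x) = (\<Sum>y\<in>carrier G. \<Sum>x\<in>carrier G. u y * v (inv y \<otimes> x) * \<chi> x)"
  unfolding gconv_def sum_distrib_right by (rule sum.swap)
 also have "\<dots> = (\<Sum>y\<in>carrier G. \<Sum>z\<in>carrier G. u y * v z * \<chi> (y \<otimes> z))"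
 proof (rule sum.cong[OF refl])
  fix y assume y: "y \<in> carrier G"
  have "(\<Sum>x\<in>carrier G. u y * v (inv y \<otimes> x) * \<chi> x)
    = (\<Sum>x\<in>carrier G. (\<lambda>z. u y * v z * \<chi> (y \<otimes> z)) (inv y \<otimes> x))"
   using y by (intro sum.cong refl) (simp add: m_assoc[symmetric])
  also have "\<dots> = (\<Sum>z\<in>carrier G. u y * v z * \<chi> (y \<otimes> z))" by (rule sum_left_translate) (use y in simp)
  finally show "(\<Sum>x\<in>carrier G. u y * v (inv y \<otimes> x) * \<chi> x) = (\<Sum>z\<in>carrier G. u y * v z * \<chi> (y \<otimes> z))" .
 qed
 also have "\<dots> = (\<Sum>x\<in>carrier G. u x * \<chi> x) * (\<Sum>x\<in>carrier G. v x * \<chi> x)"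
  unfolding sum_product by (intro sum.cong refl) (simp add: mult mult_ac)
 finally show ?thesis .
qed

lemma discrete_ring_Ints: "discrete_ring \<int>"
proof
 fix x :: complex assume "x \<in> \<int>"
 then obtain k where "x = of_int k" by (auto elim: Ints_cases)
 hence "(cmod x)\<^sup>2 = real (nat (k\<^sup>2))" by simp
 thus "\<exists>k::nat. (cmod x)\<^sup>2 = real k" by blast
qed auto

lemma Ints_cmod_squared: "x \<in> \<int> \<Longrightarrow> complex_of_real ((cmod x)\<^sup>2) = x\<^sup>2"
 by (elim Ints_cases) (simp only: norm_of_int power2_abs of_real_power of_real_of_int_eq)

lemma Ints_inverse_norm_1: "x \<in> \<int> \<Longrightarrow> cmod x = 1 \<Longrightarrow> inverse x \<in> (\<int> :: complex set)"
proof -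
 assume "x \<in> \<int>" "cmod x = 1"
 then obtain k where "x = of_int k" "\<bar>k\<bar> = 1" by (auto elim!: Ints_cases simp flip: of_int_abs)
 thus ?thesis by (cases "k \<ge> 0") auto
qed

text \<open>The Fourier transform is taken in E alone, which gives an integer function on the
  quaternion group for each character of E. Its four-square norm is a nonnegative integer and a
  unit, hence 1. Its sums against linear characters are integer units, except for the trivial
  character of the whole product. Added up, these values are the Parseval condition.\<close>

theorem quaternion_only_trivial_units:
 fixes E :: "('e, 'n) monoid_scheme"
 assumes E: "group E" "finite (carrier E)" and cs: "char_system \<int> E"
 shows "complex_only_trivial_units \<int> (quaternion_group \<times>\<times> E)"
 unfolding complex_only_trivial_units_def
proof (intro allI impI)
 let ?Q = "quaternion_group" and ?H = "quaternion_group \<times>\<times> E"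
 interpret E: group E by fact
 interpret H: group ?H by (rule DirProd_group) (simp_all add: E Q8.is_group)
 interpret Z: discrete_ring "\<int>" by (rule discrete_ring_Ints)
 fix u v assume u: "u \<in> carrier ?H \<rightarrow> \<int>" and v: "v \<in> carrier ?H \<rightarrow> \<int>" and inv: "inverse_mod_Sigma ?H u v"
 obtain I :: "nat set" and \<chi> where I: "finite I"
  "\<forall>i\<in>I. \<forall>g\<in>carrier E. \<chi> i g \<in> \<int> \<and> cmod (\<chi> i g) = 1 \<and> (\<forall>h\<in>carrier E. \<chi> i (g \<otimes>\<^bsub>E\<^esub> h) = \<chi> i g * \<chi> i h)"
  "\<forall>g\<in>carrier E. (\<Sum>i\<in>I. \<chi> i g) = (if g = \<one>\<^bsub>E\<^esub> then of_nat (card (carrier E)) else 0)"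
  using cs unfolding char_system_def by blast
 interpret C: character_family E "\<int>" I \<chi>
  by unfold_locales (use E I in simp_all)
 have finQ: "finite (carrier ?Q)" and cQ: "card (carrier ?Q) = 8" by (simp_all add: quaternion_carrier)
 have sumH: "(\<Sum>x\<in>carrier ?H. f x) = (\<Sum>q\<in>carrier ?Q. \<Sum>e\<in>carrier E. f (q,e))" for f :: "_ \<Rightarrow> complex"
  by (simp add: sum.cartesian_product)
 define w where "w j f q = C.tr j (\<lambda>e. f (q,e))" for j q and f :: "(int \<times> int \<times> int \<times> int) \<times> 'e \<Rightarrow> complex"
 have wI: "w j f q \<in> \<int>" if "f \<in> carrier ?H \<rightarrow> \<int>" "j \<in> I" "q \<in> carrier ?Q" for j f q
  unfolding w_def C.tr_def using that C.\<chi>_mem by (intro Ints_sum Ints_mult) auto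
 have w_gconv: "w j (gconv ?H f g) q = gconv ?Q (w j f) (w j g) q" if j: "j \<in> I" and q: "q \<in> carrier ?Q" for j f g q
 proof -
  have "gconv ?H f g (q,e) = (\<Sum>p\<in>carrier ?Q. gconv E (\<lambda>e. f (p,e)) (\<lambda>e. g (inv\<^bsub>?Q\<^esub> p \<otimes>\<^bsub>?Q\<^esub> q, e)) e)"
   if "e \<in> carrier E" for e
   unfolding gconv_def sumH by (intro sum.cong refl) (simp add: inv_DirProd Q8.is_group E)
  hence "w j (gconv ?H f g) q = C.tr j (\<lambda>e. \<Sum>p\<in>carrier ?Q. gconv E (\<lambda>e. f (p,e)) (\<lambda>e. g (inv\<^bsub>?Q\<^esub> p \<otimes>\<^bsub>?Q\<^esub> q, e)) e)"
   unfolding w_def C.tr_def by (intro sum.cong) auto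
  also have "\<dots> = (\<Sum>p\<in>carrier ?Q. C.tr j (gconv E (\<lambda>e. f (p,e)) (\<lambda>e. g (inv\<^bsub>?Q\<^esub> p \<otimes>\<^bsub>?Q\<^esub> q, e))))"
   unfolding C.tr_def sum_distrib_right by (rule sum.swap)
  finally show ?thesis unfolding C.tr_gconv[OF j] by (simp add: gconv_def w_def)
 qed
 obtain c1 c2 where c1: "\<forall>x\<in>carrier ?H. gconv ?H u v x = (if x = \<one>\<^bsub>?H\<^esub> then 1 else 0) + c1"
  using inv unfolding inverse_mod_Sigma_def by blast
 have norm1: "quat_norm (w j u) = 1" if j: "j \<in> I" for j
 proof -
  \<comment> \<open>The constant contributes the same amount at every q, so it cancels in the
    differences of \<open>quat_norm\<close>, whether or not the character of E is trivial.\<close>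
  have wc: "w j (gconv ?H u v) q = (if q = (1,0,0,0) then 1 else 0) + c1 * (\<Sum>e\<in>carrier E. \<chi> j e)" if q: "q \<in> carrier ?Q" for q
  proof -
   have "w j (gconv ?H u v) q = (\<Sum>e\<in>carrier E. (if e = \<one>\<^bsub>E\<^esub> then (if q = (1,0,0,0) then \<chi> j e else 0) else 0) + c1 * \<chi> j e)"
    unfolding w_def C.tr_def using q c1 by (intro sum.cong) (auto simp: quaternion_one ring_distribs)
   also have "\<dots> = (if q = (1,0,0,0) then 1 else 0) + c1 * (\<Sum>e\<in>carrier E. \<chi> j e)"
    using E(2) C.\<chi>_one[OF j] by (simp add: sum.distrib sum_distrib_left sum.delta)
   finally show ?thesis .
  qed
  have "quat_norm (w j u) * quat_norm (w j v) = quat_norm (gconv ?Q (w j u) (w j v))" by (rule quat_norm_gconv[symmetric])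
  also have "\<dots> = quat_norm (w j (gconv ?H u v))" unfolding quat_norm_def by (simp add: w_gconv[OF j] quaternion_carrier)
  also have "\<dots> = 1" unfolding quat_norm_def by (simp add: wc quaternion_carrier)
  finally have prod: "quat_norm (w j u) * quat_norm (w j v) = 1" .
  have nat: "\<exists>k\<ge>0. quat_norm (w j f) = of_int k" if f: "f \<in> carrier ?H \<rightarrow> \<int>" for f
  proof -
   have "\<exists>h. \<forall>q\<in>carrier ?Q. w j f q = of_int (h q)"
   proof (intro bchoice ballI)
    fix q assume "q \<in> carrier ?Q"
    hence "w j f q \<in> \<int>" by (rule wI[OF f j])
    then obtain y where "w j f q = of_int y" by (rule Ints_cases)
    thus "\<exists>y. w j f q = of_int y" by (rule exI)
   qed
   then obtain h where h: "\<forall>q\<in>carrier ?Q. w j f q = of_int (h q)" by blast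
   show ?thesis by (intro exI[of _ "(h (1,0,0,0) - h (-1,0,0,0))\<^sup>2 + (h (0,1,0,0) - h (0,-1,0,0))\<^sup>2
     + (h (0,0,1,0) - h (0,0,-1,0))\<^sup>2 + (h (0,0,0,1) - h (0,0,0,-1))\<^sup>2"])
     (use h in \<open>simp add: quat_norm_def quaternion_carrier\<close>)
  qed
  obtain k l where k: "k \<ge> 0" "quat_norm (w j u) = of_int k" and l: "l \<ge> 0" "quat_norm (w j v) = of_int l"
   using nat[OF u] nat[OF v] by blast
  have "of_int (k * l) = (of_int 1 :: complex)" using prod k l by simp
  hence "k * l = 1" by (simp only: of_int_eq_iff)
  hence "k = 1" using k(1) by (auto simp: zmult_eq_1_iff)
  thus ?thesis using k by simp
 qed
 define L where "L j s t f = (\<Sum>x\<in>carrier ?H. f x * (quat_char s t (fst x) * \<chi> j (snd x)))" for j s t and f :: "_ \<Rightarrow> complex"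
 have Lw: "L j s t f = (\<Sum>q\<in>carrier ?Q. w j f q * quat_char s t q)" for j s t f
  unfolding L_def sumH w_def C.tr_def by (simp add: sum_distrib_right sum_distrib_left mult_ac)
 have L1: "(L j s t u)\<^sup>2 = 1" if j: "j \<in> I" and st: "s \<in> {1,-1}" "t \<in> {1,-1}"
  and nontriv: "(s,t) \<noteq> (1,1) \<or> (\<exists>e\<in>carrier E. \<chi> j e \<noteq> 1)" for j s t
 proof -
  let ?\<xi> = "\<lambda>x. quat_char s t (fst x) * \<chi> j (snd x)"
  have "L j s t u * L j s t v = (\<Sum>x\<in>carrier ?H. gconv ?H u v x * ?\<xi> x)" unfolding L_def
  proof (rule H.sum_hom_gconv[symmetric])
   fix g h assume "g \<in> carrier ?H" "h \<in> carrier ?H"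
   moreover obtain q e where g: "g = (q, e)" by (rule prod.exhaust)
   moreover obtain q' e' where h: "h = (q', e')" by (rule prod.exhaust)
   ultimately have m: "q \<in> carrier ?Q" "e \<in> carrier E" "q' \<in> carrier ?Q" "e' \<in> carrier E" by simp_all
   have "quat_char s t (q \<otimes>\<^bsub>?Q\<^esub> q') = quat_char s t q * quat_char s t q'"
    unfolding quaternion_mult by (rule quat_char_mult[OF m(1,3) st])
   thus "?\<xi> (g \<otimes>\<^bsub>?H\<^esub> h) = ?\<xi> g * ?\<xi> h" unfolding g h using C.\<chi>_mult[OF j m(2,4)] by (simp add: mult_ac)
  qed
  also have "\<dots> = (\<Sum>x\<in>carrier ?H. (if x = \<one>\<^bsub>?H\<^esub> then ?\<xi> x else 0) + c1 * ?\<xi> x)"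
  proof (rule sum.cong[OF refl])
   fix x assume x: "x \<in> carrier ?H"
   have aux: "((if P then 1 else 0) + c) * y = (if P then y else 0) + c * y" for P and c y :: complex by (simp add: ring_distribs)
   show "gconv ?H u v x * ?\<xi> x = (if x = \<one>\<^bsub>?H\<^esub> then ?\<xi> x else 0) + c1 * ?\<xi> x" by (simp only: bspec[OF c1 x] aux)
  qed
  also have "\<dots> = ?\<xi> \<one>\<^bsub>?H\<^esub> + c1 * (\<Sum>x\<in>carrier ?H. ?\<xi> x)"
   using E(2) finQ H.one_closed by (simp add: sum.distrib sum_distrib_left sum.delta)
  also have "(\<Sum>x\<in>carrier ?H. ?\<xi> x) = (\<Sum>q\<in>carrier ?Q. quat_char s t q) * (\<Sum>e\<in>carrier E. \<chi> j e)"
   unfolding sumH sum_product by simp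
  also have "\<dots> = 0" using nontriv quat_char_sum[OF _ st] C.sum_nontrivial[OF j] by auto
  finally have "L j s t u * L j s t v = 1" using C.\<chi>_one[OF j] by (simp add: quat_char_def quaternion_one)
  moreover have LI: "L j s t f \<in> \<int>" if f: "f \<in> carrier ?H \<rightarrow> \<int>" for f
   unfolding Lw using wI[OF f j] st by (intro Ints_sum Ints_mult) (auto simp: quat_char_def split: prod.split)
  ultimately have "(cmod (L j s t u))\<^sup>2 = 1" using Z.unit_norm_D LI[OF u] LI[OF v] by blast
  thus ?thesis using Ints_cmod_squared[OF LI[OF u]] by simp
 qed
 obtain i0 where i0: "i0 \<in> I" "\<forall>g\<in>carrier E. \<chi> i0 g = 1" "\<forall>j\<in>I - {i0}. \<exists>g\<in>carrier E. \<chi> j g \<noteq> 1"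
  using C.unique_trivial by blast
 have cH: "card (carrier ?H) = 8 * card (carrier E)" by (simp add: card_cartesian_product cQ)
 \<comment> \<open>Each character of E contributes 4 from the linear characters and 4 from the norm.
   Only at \<open>i0\<close> does the square of the total sum replace one of the ones.\<close>
 have sq: "8 * (\<Sum>q\<in>carrier ?Q. (w j u q)\<^sup>2) = 8 + (if j = i0 then (\<Sum>x\<in>carrier ?H. u x)\<^sup>2 - 1 else 0)" if j: "j \<in> I" for j
 proof (cases "j = i0")
  case False
  hence "\<exists>e\<in>carrier E. \<chi> j e \<noteq> 1" using i0 j by blast
  thus ?thesis unfolding quat_parseval Lw[symmetric] using False by (simp add: L1[OF j] norm1[OF j])
 next
  case True
  have "L j 1 1 u = (\<Sum>x\<in>carrier ?H. u x)" unfolding L_def using i0(2) True by (intro sum.cong) (auto simp: quat_char_def split: prod.split)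
  moreover have "(L j 1 (-1) u)\<^sup>2 = 1" "(L j (-1) 1 u)\<^sup>2 = 1" "(L j (-1) (-1) u)\<^sup>2 = 1" by (rule L1[OF j]; simp)+
  ultimately show ?thesis unfolding quat_parseval Lw[symmetric] norm1[OF j] using True by simp
 qed
 have uI: "(\<Sum>x\<in>carrier ?H. u x) \<in> \<int>" using u by (intro Ints_sum) auto
 define S where "S q = (\<Sum>e\<in>carrier E. (cmod (u (q,e)))\<^sup>2)" for q
 have S: "(\<Sum>x\<in>carrier ?H. (cmod (u x))\<^sup>2) = (\<Sum>q\<in>carrier ?Q. S q)" unfolding S_def by (simp add: sum.cartesian_product)
 have "complex_of_real (card (carrier ?H) * (\<Sum>x\<in>carrier ?H. (cmod (u x))\<^sup>2))
   = 8 * (\<Sum>q\<in>carrier ?Q. complex_of_real (card (carrier E) * S q))"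
  unfolding S cH by (simp add: sum_distrib_left mult.assoc)
 also have "\<dots> = 8 * (\<Sum>q\<in>carrier ?Q. \<Sum>j\<in>I. (w j u q)\<^sup>2)"
  unfolding S_def C.parseval[symmetric] of_real_sum using Ints_cmod_squared wI[OF u]
  by (intro arg_cong2[of _ _ _ _ "(*)"] sum.cong refl) (simp add: w_def)
 also have "\<dots> = (\<Sum>j\<in>I. 8 * (\<Sum>q\<in>carrier ?Q. (w j u q)\<^sup>2))" unfolding sum_distrib_left by (rule sum.swap)
 also have "\<dots> = (\<Sum>j\<in>I. 8 + (if j = i0 then (\<Sum>x\<in>carrier ?H. u x)\<^sup>2 - 1 else 0))" by (intro sum.cong refl sq)
 also have "\<dots> = 8 * of_nat (card (carrier E)) + ((\<Sum>x\<in>carrier ?H. u x)\<^sup>2 - 1)"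
  using I(1) i0(1) by (simp add: sum.distrib sum.delta C.card_I)
 also have "\<dots> = complex_of_real ((cmod (\<Sum>x\<in>carrier ?H. u x))\<^sup>2 + (real (card (carrier ?H)) - 1))"
  unfolding cH of_real_add Ints_cmod_squared[OF uI] by simp
 finally have pars: "card (carrier ?H) * (\<Sum>x\<in>carrier ?H. (cmod (u x))\<^sup>2)
   = (cmod (\<Sum>x\<in>carrier ?H. u x))\<^sup>2 + (real (card (carrier ?H)) - 1)"
  by (simp only: of_real_eq_iff)
 have "card (carrier E) > 0" using E(2) E.one_closed card_gt_0_iff by blast
 hence "card (carrier ?H) > 1" unfolding cH by simp
 thus "trivial_mod_Sigma \<int> ?H u" using pars u finQ E(2) Ints_inverse_norm_1
  by (intro H.concentrated_if_parseval[OF _ _ discrete_ring_Ints]) auto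
qed

section \<open>Imaginary quadratic fields and their integers\<close>

text \<open>The field generated by a square root of -d, in real coordinates. The values d = 1 and d
  = 3 give the Gaussian and Eisenstein cases.\<close>

definition quad_field :: "int \<Rightarrow> complex set" where
 "quad_field d = {z. Re z \<in> \<rat> \<and> Im z / sqrt (of_int d) \<in> \<rat>}"

definition quad_int :: "int \<Rightarrow> complex set" where
 "quad_int d = {z \<in> quad_field d. algebraic_int z}"

lemma squarefree_int:
 assumes "squarefree n" shows "squarefree (int n)"
proof (rule squarefreeI)
 fix x :: int assume "x\<^sup>2 dvd int n"
 hence "int ((nat \<bar>x\<bar>)\<^sup>2) dvd int n" by simp
 hence "(nat \<bar>x\<bar>)\<^sup>2 dvd n" by (simp only: int_dvd_int_iff)
 hence "nat \<bar>x\<bar> dvd 1" using squarefreeD[OF assms] by blast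
 thus "x dvd 1" by simp
qed

lemma of_real_Rats: "x \<in> \<rat> \<Longrightarrow> complex_of_real x \<in> \<rat>"
proof (elim Rats_cases)
 fix q assume q: "x = of_rat q"
 show "complex_of_real x \<in> \<rat>"
 proof (cases q)
  case (Fract a b)
  hence "complex_of_real x = of_int a / of_int b" by (simp add: q of_rat_rat)
  thus ?thesis by (simp only: Rats_divide Rats_of_int)
 qed
qed

lemma rational_real_algebraic_int:
 assumes "algebraic_int (complex_of_real x)" "x \<in> \<rat>" shows "x \<in> \<int>"
proof -
 obtain k where "complex_of_real x = of_int k" using rational_algebraic_int_is_int[OF assms(1) of_real_Rats[OF assms(2)]] by (rule Ints_cases)
 hence "complex_of_real x = complex_of_real (of_int k)" by simp
 thus ?thesis unfolding of_real_eq_iff by simp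
qed

lemma Re_Rats: "z \<in> \<rat> \<Longrightarrow> Re z \<in> \<rat>"
proof (elim Rats_cases)
 fix q assume q: "z = of_rat q"
 show "Re z \<in> \<rat>"
 proof (cases q)
  case (Fract a b)
  hence "z = complex_of_real (of_int a / of_int b)" by (simp add: q of_rat_rat)
  hence "Re z = of_int a / of_int b" by (simp only: Re_complex_of_real)
  thus ?thesis by (simp only: Rats_divide Rats_of_int)
 qed
qed

context
 fixes d :: int assumes d: "d > 0"
begin

lemma sqrt_d: "sqrt (of_int d) \<noteq> 0" "sqrt (of_int d) * sqrt (of_int d) = of_int d" using d by simp_all

lemma quad_field_diff:
 assumes "x \<in> quad_field d" "y \<in> quad_field d" shows "x - y \<in> quad_field d"
 using assms unfolding quad_field_def by (simp add: diff_divide_distrib Rats_diff)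

lemma quad_field_mult:
 assumes "x \<in> quad_field d" "y \<in> quad_field d" shows "x * y \<in> quad_field d"
proof -
 define p q where "p = Im x / sqrt (of_int d)" and "q = Im y / sqrt (of_int d)"
 have r: "Re x \<in> \<rat>" "Re y \<in> \<rat>" "p \<in> \<rat>" "q \<in> \<rat>" using assms by (simp_all add: quad_field_def p_def q_def)
 have i: "Im x = p * sqrt (of_int d)" "Im y = q * sqrt (of_int d)" using sqrt_d(1) by (simp_all add: p_def q_def)
 have "Re (x * y) = Re x * Re y - p * q * (sqrt (of_int d) * sqrt (of_int d))" by (simp only: times_complex.sel i mult_ac)
 hence "Re (x * y) \<in> \<rat>" unfolding sqrt_d(2) using r by (simp only: Rats_diff Rats_mult Rats_of_int)
 moreover have "Im (x * y) / sqrt (of_int d) = Re x * q + p * Re y" using sqrt_d(1) by (simp only: times_complex.sel i) (simp add: field_simps)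
 hence "Im (x * y) / sqrt (of_int d) \<in> \<rat>" using r by (simp only: Rats_add Rats_mult)
 ultimately show ?thesis by (simp add: quad_field_def)
qed

lemma quad_field_cnj: "x \<in> quad_field d \<Longrightarrow> cnj x \<in> quad_field d" by (simp add: quad_field_def)

lemma quad_field_of_Rats: "x \<in> \<rat> \<Longrightarrow> complex_of_real x \<in> quad_field d" by (simp add: quad_field_def)

lemma quad_field_norm:
 assumes "x \<in> quad_field d" shows "(cmod x)\<^sup>2 \<in> \<rat>"
proof -
 have "x * cnj x \<in> quad_field d" by (intro quad_field_mult quad_field_cnj assms)
 hence "complex_of_real ((cmod x)\<^sup>2) \<in> quad_field d" by (simp only: complex_norm_square)
 thus ?thesis by (simp only: quad_field_def mem_Collect_eq Re_complex_of_real)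
qed

lemma subfield_quad_field: "subfield (quad_field d) complex_field"
proof (rule subfield_complexI[OF _ quad_field_diff quad_field_mult])
 show "1 \<in> quad_field d" by (simp add: quad_field_def)
 fix x assume x: "x \<in> quad_field d"
 have "inverse x = complex_of_real (inverse ((cmod x)\<^sup>2)) * cnj x"
 proof (cases "x = 0")
  case False
  hence "complex_of_real ((cmod x)\<^sup>2) \<noteq> 0" by simp
  thus ?thesis using False unfolding of_real_inverse complex_norm_square by (simp add: field_simps)
 qed simp
 thus "inverse x \<in> quad_field d" using quad_field_norm[OF x] by (simp only: quad_field_mult quad_field_cnj quad_field_of_Rats Rats_inverse x)
qed

lemma sqrt_mem_quad_field: "\<i> * complex_of_real (sqrt (real_of_int d)) \<in> quad_field d" using sqrt_d(1) by (simp add: quad_field_def)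

lemma quad_field_subset:
 assumes S: "subfield S complex_field" and i: "\<i> * complex_of_real (sqrt (real_of_int d)) \<in> S"
 shows "quad_field d \<subseteq> S"
proof
 fix z assume z: "z \<in> quad_field d"
 obtain p q where pq: "Re z = of_rat p" "Im z / sqrt (of_int d) = of_rat q" using z by (auto simp: quad_field_def elim!: Rats_cases)
 have c: "complex_of_real (of_rat r) \<in> S" for r
 proof -
  have "complex_of_real (of_rat r) \<in> \<rat>" by (rule of_real_Rats) simp
  then obtain r' where "complex_of_real (of_rat r) = of_rat r'" by (rule Rats_cases)
  thus ?thesis using subfield_of_rat_mem[OF S] by simp
 qed
 have "Im z = of_rat q * sqrt (of_int d)" using pq(2) sqrt_d(1) by (simp add: field_simps)
 hence "z = complex_of_real (of_rat p) + complex_of_real (of_rat q) * (\<i> * complex_of_real (sqrt (real_of_int d)))"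
  using pq(1) by (simp add: complex_eq_iff)
 thus "z \<in> S" using subfield_complexD(2,3)[OF S] c i by presburger
qed

lemma carrier_imaginary_quadratic_field: "carrier (imaginary_quadratic_field d) = quad_field d"
proof -
 interpret C: field complex_field by (rule field_complex_field)
 let ?G = "generate_field complex_field {\<i> * complex_of_real (sqrt (real_of_int d))}"
 have "?G \<subseteq> quad_field d" by (rule C.generate_field_min_subfield1) (use subfield_quad_field sqrt_mem_quad_field in simp_all)
 moreover have "subfield ?G complex_field" by (rule C.generate_field_is_subfield) simp
 hence "quad_field d \<subseteq> ?G" by (rule quad_field_subset) (rule generate_field.incl, simp)
 ultimately show ?thesis by (simp add: imaginary_quadratic_field_def)
qed

lemma quad_int_diff: "x \<in> quad_int d \<Longrightarrow> y \<in> quad_int d \<Longrightarrow> x - y \<in> quad_int d"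
 by (simp add: quad_int_def quad_field_diff algebraic_int_diff)

lemma quad_int_mult: "x \<in> quad_int d \<Longrightarrow> y \<in> quad_int d \<Longrightarrow> x * y \<in> quad_int d"
 by (simp add: quad_int_def quad_field_mult algebraic_int_mult)

lemma quad_int_cnj: "x \<in> quad_int d \<Longrightarrow> cnj x \<in> quad_int d" by (simp add: quad_int_def quad_field_cnj)

lemma quad_int_trace:
 assumes "x \<in> quad_int d" shows "2 * Re x \<in> \<int>"
proof (rule rational_real_algebraic_int)
 show "algebraic_int (complex_of_real (2 * Re x))" unfolding complex_add_cnj[symmetric]
  using assms quad_int_cnj[OF assms] by (simp only: quad_int_def mem_Collect_eq algebraic_int_add)
 show "2 * Re x \<in> \<rat>" using assms unfolding quad_int_def quad_field_def by (intro Rats_mult) simp_all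
qed

text \<open>The product x * cnj x is both rational and an algebraic integer.\<close>

lemma quad_int_norm:
 assumes "x \<in> quad_int d" shows "\<exists>k::nat. (cmod x)\<^sup>2 = of_nat k"
proof -
 have "(cmod x)\<^sup>2 \<in> \<int>"
 proof (rule rational_real_algebraic_int)
  show "algebraic_int (complex_of_real ((cmod x)\<^sup>2))" unfolding complex_norm_square
   using assms quad_int_cnj[OF assms] by (simp only: quad_int_def mem_Collect_eq algebraic_int_mult)
  show "(cmod x)\<^sup>2 \<in> \<rat>" by (rule quad_field_norm) (use assms in \<open>simp add: quad_int_def\<close>)
 qed
 then obtain k where k: "(cmod x)\<^sup>2 = of_int k" by (rule Ints_cases)
 hence "real_of_int k \<ge> 0" by (metis zero_le_power2)
 hence "(cmod x)\<^sup>2 = of_nat (nat k)" using k by simp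
 thus ?thesis by blast
qed

lemma discrete_ring_quad_int: "discrete_ring (quad_int d)"
proof
 show "0 \<in> quad_int d" "1 \<in> quad_int d" by (simp_all add: quad_int_def quad_field_def)
 fix x y assume "x \<in> quad_int d" "y \<in> quad_int d"
 thus "x - y \<in> quad_int d" "x * y \<in> quad_int d" by (rule quad_int_diff quad_int_mult; assumption)+
qed (rule quad_int_norm)

lemma quad_int_inverse_norm_1:
 assumes "x \<in> quad_int d" "cmod x = 1" shows "inverse x \<in> quad_int d"
proof -
 have "x * cnj x = 1" using assms(2) by (simp flip: complex_norm_square)
 hence "inverse x = cnj x" by (rule inverse_unique)
 thus ?thesis using quad_int_cnj[OF assms(1)] by simp
qed

lemma quad_int_of_int: "of_int k \<in> quad_int d" by (simp add: quad_int_def quad_field_def)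

text \<open>\<open>eval\<close> and \<open>univ_poly\<close> agree with those of the complex field,
  and the multiples of 1 in K are the usual integers. The definition thus becomes the criterion by
  monic integer lists.\<close>

lemma carrier_ring_of_integers_quadratic:
 "carrier (ring_of_integers (imaginary_quadratic_field d)) = quad_int d"
proof -
 define K where "K = imaginary_quadratic_field d"
 have K: "K = complex_field\<lparr>carrier := quad_field d\<rparr>"
  using carrier_imaginary_quadratic_field unfolding K_def by (simp add: imaginary_quadratic_field_def)
 interpret C: field complex_field by (rule field_complex_field)
 have sr: "subring (quad_field d) complex_field" by (rule subfieldE(1)[OF subfield_quad_field])
 interpret R: ring K unfolding K by (rule cf.subring_is_ring[OF sr])
 have cons: "ring.eval K = ring.eval complex_field" "univ_poly K = univ_poly complex_field"
  unfolding K by (rule cf.eval_consistent[OF sr], rule cf.univ_poly_consistent[OF sr])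
 have n: "add_pow K (n::nat) \<one>\<^bsub>K\<^esub> = of_nat n" for n
 proof (induction n)
  case 0
  have "add_pow K (0::nat) \<one>\<^bsub>K\<^esub> = \<zero>\<^bsub>K\<^esub>" by (rule R.add.nat_pow_0)
  thus ?case unfolding K by simp
 next
  case (Suc n)
  have "add_pow K (Suc n) \<one>\<^bsub>K\<^esub> = add_pow K n \<one>\<^bsub>K\<^esub> \<oplus>\<^bsub>K\<^esub> \<one>\<^bsub>K\<^esub>" by (rule R.add.nat_pow_Suc)
  thus ?case unfolding Suc.IH by (simp add: K)
 qed
 have neg: "\<ominus>\<^bsub>K\<^esub> (of_nat n) = - of_nat n" for n
 proof (rule R.minus_equality)
  show "- of_nat n \<oplus>\<^bsub>K\<^esub> of_nat n = \<zero>\<^bsub>K\<^esub>" by (simp add: K)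
  show "of_nat n \<in> carrier K" "- of_nat n \<in> carrier K" by (simp_all add: K quad_field_def)
 qed
 have "add_pow K (k::int) \<one>\<^bsub>K\<^esub> = (if k < 0 then \<ominus>\<^bsub>K\<^esub> (add_pow K (nat (- k)) \<one>\<^bsub>K\<^esub>) else add_pow K (nat k) \<one>\<^bsub>K\<^esub>)" for k
  unfolding add_pow_def a_inv_def by (rule int_pow_def2)
 hence i: "add_pow K (k::int) \<one>\<^bsub>K\<^esub> = of_int k" for k unfolding n neg by simp
 have ev: "ring.eval complex_field p x = poly (Poly (rev p)) x" for p x by (simp add: complex_field_eval)
 have "x \<in> carrier (ring_of_integers K) \<longleftrightarrow> x \<in> quad_int d" for x
 proof -
  have "(\<exists>p\<in>carrier (univ_poly K (range (\<lambda>k::int. add_pow K k \<one>\<^bsub>K\<^esub>))). p \<noteq> [] \<and> hd p = \<one>\<^bsub>K\<^esub> \<and> ring.eval K p x = \<zero>\<^bsub>K\<^esub>)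
   \<longleftrightarrow> (\<exists>ks :: int list. ks \<noteq> [] \<and> hd ks = 1 \<and> poly (Poly (rev (map of_int ks))) x = 0)"
   (is "?L \<longleftrightarrow> ?R")
  proof
   assume ?L
   then obtain p where p: "p \<in> carrier (univ_poly complex_field (range of_int))" "p \<noteq> []" "hd p = 1"
    "poly (Poly (rev p)) x = 0" unfolding i cons ev by (auto simp: K)
   have sp: "set p \<subseteq> range of_int" using p(1,2) by (auto simp: univ_poly_def polynomial_def)
   have "\<exists>ks :: int list. p = map of_int ks" using sp
   proof (induction p)
    case (Cons a p)
    then obtain k ks where "a = of_int k" "p = map of_int ks" by auto
    thus ?case by (intro exI[of _ "k # ks"]) simp
   qed simp
   then obtain ks :: "int list" where ks: "p = map of_int ks" by blast
   hence "of_int (hd ks) = (of_int 1 :: complex)" using p(2,3) by (simp add: hd_map)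
   hence "hd ks = 1" by (simp only: of_int_eq_iff)
   thus ?R using p ks by auto
  next
   assume ?R
   then obtain ks :: "int list" where ks: "ks \<noteq> []" "hd ks = 1" "poly (Poly (rev (map of_int ks))) x = 0" by blast
   let ?p = "map of_int ks :: complex list"
   have "hd ?p = 1" "?p \<noteq> []" "set ?p \<subseteq> range of_int" using ks by (auto simp: hd_map)
   hence "?p \<in> carrier (univ_poly complex_field (range of_int))" by (simp add: univ_poly_def polynomial_def)
   thus ?L unfolding i cons ev using ks by (intro bexI[of _ ?p]) (auto simp: K hd_map)
  qed
  thus ?thesis unfolding ring_of_integers_def quad_int_def algebraic_int_iff_monic_list by (simp add: K)
 qed
 thus ?thesis unfolding K_def by blast
qed

end

lemma quad_field_eqI:
 assumes "d > 0" "d' > 0" "sqrt (of_int d') / sqrt (of_int d) \<in> \<rat>" shows "quad_field d = quad_field d'"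
proof -
 define r where "r = sqrt (of_int d') / sqrt (of_int d)"
 have r: "r \<in> \<rat>" "r \<noteq> 0" using assms by (simp_all add: r_def)
 have 1: "y / sqrt (of_int d) = y / sqrt (of_int d') * r" and 2: "y / sqrt (of_int d') = y / sqrt (of_int d) / r" for y
  using assms(1,2) by (simp_all add: r_def field_simps)
 have "y / sqrt (of_int d) \<in> \<rat> \<longleftrightarrow> y / sqrt (of_int d') \<in> \<rat>" for y
  using 1[of y] 2[of y] r(1) by (metis Rats_mult Rats_divide)
 thus ?thesis by (simp add: quad_field_def)
qed

lemma \<i>_mem_quad_int: "\<i> \<in> quad_int 1" by (simp add: quad_int_def quad_field_def)

definition omega :: complex where "omega = (-1 + \<i> * complex_of_real (sqrt 3)) / 2"

lemma omega_square: "omega\<^sup>2 = - 1 - omega"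
proof -
 have "complex_of_real (sqrt 3) * complex_of_real (sqrt 3) = 3" by (simp flip: of_real_mult)
 hence "(\<i> * complex_of_real (sqrt 3)) * (\<i> * complex_of_real (sqrt 3)) = - 3" by (simp add: algebra_simps)
 then obtain s where s: "s * s = -3" "s = \<i> * complex_of_real (sqrt 3)" by blast
 have "omega\<^sup>2 = (s * s - 2 * s + 1) / 4" by (simp add: omega_def power2_eq_square field_simps flip: s(2))
 also have "\<dots> = - 1 - (- 1 + s) / 2" unfolding s(1) by (simp add: field_simps)
 finally show ?thesis by (simp add: omega_def s(2))
qed

lemma omega_cube: "omega ^ 3 = 1"
proof -
 have "omega ^ 3 = omega * omega\<^sup>2" by (simp add: power3_eq_cube power2_eq_square)
 also have "\<dots> = - omega - omega\<^sup>2" unfolding omega_square by (simp add: algebra_simps power2_eq_square[symmetric] omega_square)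
 finally show ?thesis by (simp add: omega_square)
qed

lemma Re_omega: "Re omega = - 1 / 2" and Im_omega: "Im omega = sqrt 3 / 2" by (simp_all add: omega_def)

lemma algebraic_int_omega: "algebraic_int omega"
proof -
 show ?thesis by (rule algebraic_int_root[where p = "monom 1 3" and y = 1]) (simp_all add: poly_monom degree_monom_eq omega_cube)
qed

lemma omega_mem_quad_int: "omega \<in> quad_int 3" by (simp add: quad_int_def quad_field_def Re_omega Im_omega algebraic_int_omega)

lemma generate_ring_of_int: 
 assumes "S = generate_ring complex_field H" shows "of_int k \<in> S" "x \<in> S \<Longrightarrow> y \<in> S \<Longrightarrow> x + y \<in> S" "x \<in> S \<Longrightarrow> y \<in> S \<Longrightarrow> x * y \<in> S" 
proof -
 have one: "1 \<in> S" using generate_ring.one[of complex_field H] by (simp add: assms)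
 show add: "x \<in> S \<Longrightarrow> y \<in> S \<Longrightarrow> x + y \<in> S" for x y using generate_ring.eng_add[of x complex_field H y] by (simp add: assms)
 show "x \<in> S \<Longrightarrow> y \<in> S \<Longrightarrow> x * y \<in> S" using generate_ring.eng_mult[of x complex_field H y] by (simp add: assms)
 have min: "x \<in> S \<Longrightarrow> - x \<in> S" for x using generate_ring.a_inv[of x complex_field H] by (simp add: assms complex_field_neg)
 have zero: "0 \<in> S" using add[OF one min[OF one]] by simp
 have n: "of_nat n \<in> S" for n by (induction n) (simp_all add: add one zero)
 show "of_int k \<in> S"
 proof (cases "k \<ge> 0")
  case True thus ?thesis using n[of "nat k"] by simp
 next
  case False thus ?thesis using min[OF n[of "nat (- k)"]] by simp
 qed
qed

lemma generate_ring_subset: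
 assumes "H \<subseteq> T" "1 \<in> T" "\<And>x y. x \<in> T \<Longrightarrow> y \<in> T \<Longrightarrow> x - y \<in> T" "\<And>x y. x \<in> T \<Longrightarrow> y \<in> T \<Longrightarrow> x * y \<in> T"
 shows "generate_ring complex_field H \<subseteq> T"
proof
 have zero: "0 \<in> T" using assms(3)[OF assms(2,2)] by simp
 have min: "- x \<in> T" if "x \<in> T" for x using assms(3)[OF zero that] by simp
 have add: "x + y \<in> T" if "x \<in> T" "y \<in> T" for x y using assms(3)[OF that(1) min[OF that(2)]] by simp
 fix x assume "x \<in> generate_ring complex_field H"
 thus "x \<in> T" by (induction rule: generate_ring.induct) (use assms(1,2) in \<open>auto simp: complex_field_neg intro: min add assms(4)\<close>)
qed

text \<open>The traces a of z and b of \<i> * z are integers, and a^2 + b^2 is 4 times the norm of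
  z. Squares are 0 or 1 modulo 4, so a and b are even.\<close>

lemma carrier_gaussian_integers: "carrier gaussian_integers = quad_int 1"
proof -
 let ?S = "generate_ring complex_field {\<i>}"
 note S = generate_ring_of_int[of ?S "{\<i>}", OF refl]
 have "?S \<subseteq> quad_int 1"
  by (rule generate_ring_subset) (use \<i>_mem_quad_int quad_int_of_int[of 1 1] in \<open>auto intro: quad_int_diff quad_int_mult\<close>)
 moreover have "quad_int 1 \<subseteq> ?S"
 proof
  fix z assume z: "z \<in> quad_int 1"
  have "2 * Re z \<in> \<int>" by (rule quad_int_trace[OF _ z]) simp
  then obtain a where a: "2 * Re z = of_int a" by (rule Ints_cases)
  have "2 * Re (\<i> * z) \<in> \<int>" by (rule quad_int_trace[OF _ quad_int_mult[OF _ \<i>_mem_quad_int z]]) simp_all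
  then obtain b where b: "2 * Re (\<i> * z) = of_int b" by (rule Ints_cases)
  obtain k where k: "(cmod z)\<^sup>2 = real k" using quad_int_norm[OF _ z] by auto
  have ab: "Re z = of_int a / 2" "Im z = - of_int b / 2" using a b by simp_all
  have "(of_int a / 2)\<^sup>2 + (- of_int b / 2)\<^sup>2 = real k" using k unfolding cmod_power2 ab .
  hence "real_of_int (a\<^sup>2 + b\<^sup>2) = real_of_int (4 * int k)" by (simp add: power_divide)
  hence k4: "a\<^sup>2 + b\<^sup>2 = 4 * int k" by (simp only: of_int_eq_iff)
  have sq: "c\<^sup>2 mod 4 = (if even c then 0 else 1)" for c :: int
  proof (cases "even c")
   case False
   then obtain e where "c = 2 * e + 1" by (rule oddE)
   hence "c\<^sup>2 = 4 * (e\<^sup>2 + e) + 1" by (simp add: power2_eq_square algebra_simps)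
   thus ?thesis using False by presburger
  qed (auto elim!: evenE simp: power2_eq_square)
  have "(a\<^sup>2 mod 4 + b\<^sup>2 mod 4) mod 4 = 0" using k4 by (simp add: mod_add_eq)
  hence "even a" "even b" unfolding sq by (auto split: if_splits)
  then obtain p q where "a = 2 * p" "b = 2 * q" by (auto elim!: evenE)
  hence "z = of_int p + of_int (-q) * \<i>" using ab by (simp add: complex_eq_iff)
  thus "z \<in> ?S" using S(1) S(2) S(3) generate_ring.incl[of \<i> "{\<i>}" complex_field] by blast
 qed
 ultimately show ?thesis by (simp add: gaussian_integers_def)
qed

text \<open>The traces of z and omega * z give 2 * Re z = a and Im z = (m / 6) * sqrt 3 with
  integers a and m. The norm yields 3 * a^2 + m^2 = 12 * k, which forces 3 to divide m; the
  definition of m then gives the parity needed to write z in 1 and omega.\<close>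

lemma carrier_eisenstein_integers: "carrier eisenstein_integers = quad_int 3"
proof -
 let ?S = "generate_ring complex_field {omega}"
 note S = generate_ring_of_int[of ?S "{omega}", OF refl]
 have "?S \<subseteq> quad_int 3"
  by (rule generate_ring_subset) (use omega_mem_quad_int quad_int_of_int[of 3 1] in \<open>auto intro: quad_int_diff quad_int_mult\<close>)
 moreover have "quad_int 3 \<subseteq> ?S"
 proof
  fix z assume z: "z \<in> quad_int 3"
  have oz: "omega * z \<in> quad_int 3" by (rule quad_int_mult[OF _ omega_mem_quad_int z]) simp
  have "2 * Re z \<in> \<int>" by (rule quad_int_trace[OF _ z]) simp
  then obtain a where a: "2 * Re z = of_int a" by (rule Ints_cases)
  have "2 * Re (omega * z) \<in> \<int>" by (rule quad_int_trace[OF _ oz]) simp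
  then obtain c where c: "2 * Re (omega * z) = of_int c" by (rule Ints_cases)
  define t where "t = Im z / sqrt 3"
  have t: "Im z = t * sqrt 3" by (simp add: t_def)
  have s3: "sqrt 3 * (sqrt 3 * x) = 3 * x" for x :: real by (simp flip: mult.assoc)
  have c': "- Re z - 3 * t = of_int c" using c by (simp add: Re_omega Im_omega t algebra_simps s3)
  obtain k where k: "(cmod z)\<^sup>2 = real k" using quad_int_norm[OF _ z] by auto
  define m where "m = - a - 2 * c"
  have rt: "Re z = of_int a / 2" "t = of_int m / 6" using a c' by (simp_all add: m_def)
  have "(Re z)\<^sup>2 + 3 * t\<^sup>2 = real k" using k unfolding cmod_power2 t by (simp add: power_mult_distrib)
  hence "3 * (of_int a)\<^sup>2 + (of_int m)\<^sup>2 = 12 * real k" unfolding rt by (simp add: power_divide field_simps)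
  hence "real_of_int (m\<^sup>2) = real_of_int (3 * (4 * int k - a\<^sup>2))" by simp
  hence "m\<^sup>2 = 3 * (4 * int k - a\<^sup>2)" by (simp only: of_int_eq_iff)
  hence m3: "3 dvd m * m" by (simp add: power2_eq_square)
  have "3 dvd m"
  proof (rule ccontr)
   assume "\<not> 3 dvd m"
   hence "m mod 3 = 1 \<or> m mod 3 = 2" by presburger
   hence "m * m mod 3 = 1"
   proof
    assume "m mod 3 = 1" thus ?thesis using mod_mult_eq[of m 3 m] by simp
   next
    assume "m mod 3 = 2" thus ?thesis using mod_mult_eq[of m 3 m] by simp
   qed
   thus False using m3 by presburger
  qed
  then obtain y where y: "m = 3 * y" by (rule dvdE)
  have ay: "a + y = 2 * (- c - y)" unfolding m_def using y[unfolded m_def] by (simp add: algebra_simps)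
  have "real_of_int (a + y) = real_of_int (2 * (- c - y))" by (simp only: ay)
  hence "Re z = of_int (- c - y) - of_int y / 2" using rt(1) by simp
  moreover have "Im z = of_int y * (sqrt 3 / 2)" unfolding t rt y by simp
  ultimately have "z = of_int (- c - y) + of_int y * omega" by (simp add: complex_eq_iff Re_omega Im_omega)
  thus "z \<in> ?S" using S(1) S(2) S(3) generate_ring.incl[of omega "{omega}" complex_field] by blast
 qed
 ultimately show ?thesis by (simp add: eisenstein_integers_def omega_def)
qed

section \<open>Fields whose only embeddings are the inclusion and its conjugate\<close>

context complex_number_field
begin

lemma emb_if_no_outer:
 assumes "outer_emb = {}"
 shows "emb F = {\<lambda>x\<in>F. x, \<lambda>x\<in>F. cnj x}"
proof -
 have "(\<lambda>x\<in>F. cnj x) = (\<lambda>x\<in>F. cnj ((\<lambda>x\<in>F. x) x))" by auto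
 hence "(\<lambda>x\<in>F. cnj x) \<in> emb F" using cnj_emb[OF id_emb] by simp
 thus ?thesis using assms id_emb unfolding outer_emb_def by blast
qed

text \<open>With the inclusion as the only embedding, an element is its own norm.\<close>

lemma real_field_eq_Rats:
 assumes "outer_emb = {}" "F \<subseteq> \<real>" shows "F = \<rat>"
proof
 have "(\<lambda>x\<in>F. cnj x) = (\<lambda>x\<in>F. x)" using assms(2) by (auto simp: fun_eq_iff Reals_cnj_iff subset_iff)
 hence e: "emb F = {\<lambda>x\<in>F. x}" using emb_if_no_outer[OF assms(1)] by simp
 show "F \<subseteq> \<rat>"
 proof
  fix x assume x: "x \<in> F"
  show "x \<in> \<rat>" using norm_rational[OF x] x unfolding e by simp
 qed
qed (use Rats_mem in blast)

lemma nonreal_field_norm: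
 assumes "outer_emb = {}" "\<not> F \<subseteq> \<real>" "x \<in> F" shows "x * cnj x \<in> \<rat>"
proof -
 have "(\<lambda>x\<in>F. x) \<noteq> (\<lambda>x\<in>F. cnj x)"
 proof
  assume eq: "(\<lambda>x\<in>F. x) = (\<lambda>x\<in>F. cnj x)"
  have "cnj x = x" if "x \<in> F" for x using fun_cong[OF eq, of x] that by simp
  thus False using assms(2) by (auto simp: Reals_cnj_iff)
 qed
 thus ?thesis using norm_rational[OF assms(3)] assms(3) unfolding emb_if_no_outer[OF assms(1)] by simp
qed

lemma nonreal_field_Re:
 assumes "outer_emb = {}" "\<not> F \<subseteq> \<real>" "x \<in> F"
 shows "Re x \<in> \<rat>"
proof -
 note n = nonreal_field_norm[OF assms(1,2)]
 \<comment> \<open>Comparing the norms of x + 1 and x isolates the trace.\<close>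
 have "(x + 1) * cnj (x + 1) - x * cnj x - 1 \<in> \<rat>" by (intro Rats_diff n add_mem assms one_mem Rats_1)
 moreover have "(x + 1) * cnj (x + 1) - x * cnj x - 1 = x + cnj x" by (simp add: algebra_simps)
 ultimately have "complex_of_real (2 * Re x) \<in> \<rat>" by (simp only: complex_add_cnj)
 hence "2 * Re x \<in> \<rat>" using Re_Rats[of "complex_of_real (2 * Re x)"] by (simp only: Re_complex_of_real)
 hence "(2 * Re x) / 2 \<in> \<rat>" by (intro Rats_divide) simp_all
 thus "Re x \<in> \<rat>" by simp
qed

text \<open>The product of two purely imaginary elements of F is rational, so all of them are
  rational multiples of one \<i> * y. Writing y^2 = a / b gives (y * b)^2 = a * b, and d is the
  square-free part of a * b.\<close>

theorem nonreal_field_eq_quad_field: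
 assumes "outer_emb = {}" "\<not> F \<subseteq> \<real>"
 shows "\<exists>d>0. squarefree d \<and> F = quad_field d"
proof -
 note Re = nonreal_field_Re[OF assms]
 have Rm: "complex_of_real r \<in> F" if "r \<in> \<rat>" for r by (rule Rats_mem[OF of_real_Rats[OF that]])
 have Imm: "\<i> * complex_of_real (Im x) \<in> F" if "x \<in> F" for x
 proof -
  have "x - complex_of_real (Re x) \<in> F" by (intro diff_mem that Rm Re)
  moreover have "x - complex_of_real (Re x) = \<i> * complex_of_real (Im x)" by (simp add: complex_eq_iff)
  ultimately show ?thesis by simp
 qed
 obtain x where x: "x \<in> F" "x \<notin> \<real>" using assms(2) by blast
 define y where "y = Im x"
 have y: "y \<noteq> 0" "\<i> * complex_of_real y \<in> F" using x Imm by (auto simp: y_def complex_is_Real_iff)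
 have yy: "z * y \<in> \<rat>" if "\<i> * complex_of_real z \<in> F" for z
 proof -
  have "(\<i> * complex_of_real z) * (\<i> * complex_of_real y) \<in> F" by (intro mult_mem that y)
  hence "Re ((\<i> * complex_of_real z) * (\<i> * complex_of_real y)) \<in> \<rat>" by (rule Re)
  hence "- (z * y) \<in> \<rat>" by simp
  thus ?thesis by (simp only: Rats_minus_iff)
 qed
 obtain a b where ab: "b > 0" "y * y = of_int a / of_int b" using yy[OF y(2)] Rats_cases' by metis
 have "y * y > 0" using y by (simp add: zero_less_mult_iff) linarith
 hence a: "a > 0" using ab by (simp add: zero_less_divide_iff)
 define n where "n = nat (a * b)"
 define d where "d = squarefree_part n"
 define s where "s = square_part n"
 have "a * b > 0" using a ab by (intro mult_pos_pos)
 hence n0: "n \<noteq> 0" by (simp add: n_def)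
 have n: "n = d * s\<^sup>2" unfolding d_def s_def by (rule squarefree_decompose)
 have ds: "d > 0" "s > 0" using n n0 by auto
 have sf: "squarefree d" unfolding d_def by simp
 have "(y * of_int b)\<^sup>2 = (y * y) * of_int b * of_int b" by (simp add: power2_eq_square)
 also have "\<dots> = of_int (a * b)" using ab by simp
 also have "\<dots> = real n" using a ab by (simp add: n_def)
 also have "\<dots> = (sqrt (real d) * real s)\<^sup>2" by (simp add: n power_mult_distrib)
 finally have "\<bar>y * of_int b\<bar> = \<bar>sqrt (real d) * real s\<bar>" by (simp only: abs_eq_iff power2_eq_iff)
 hence sq: "sqrt (real d) = \<bar>y\<bar> * (of_int b / real s)" using ab ds by (simp add: abs_mult field_simps)
 \<comment> \<open>The root of d is positive, so the sign of y goes into r.\<close>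
 define r where "r = (if y > 0 then of_int b / real s else - (of_int b / real s))"
 have r: "r \<in> \<rat>" "r \<noteq> 0" "sqrt (real d) = y * r" using ab ds y sq by (auto simp: r_def Rats_divide Rats_of_int)
 have q: "F = quad_field (int d)"
 proof
  have "\<i> * complex_of_real y * complex_of_real r \<in> F" by (intro mult_mem y Rm r)
  moreover have "\<i> * complex_of_real y * complex_of_real r = \<i> * complex_of_real (sqrt (real_of_int (int d)))" using r by simp
  ultimately have "\<i> * complex_of_real (sqrt (real_of_int (int d))) \<in> F" by simp
  moreover have "subfield F complex_field" by (rule subfield_complexI) (use one_mem diff_mem mult_mem inverse_mem in blast)+
  ultimately show "quad_field (int d) \<subseteq> F" using quad_field_subset[of "int d" F] ds by simp
  show "F \<subseteq> quad_field (int d)"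
  proof
   fix z assume z: "z \<in> F"
   have "Im z * y \<in> \<rat>" by (intro yy Imm z)
   hence "Im z * y / (y * y) / r \<in> \<rat>" by (intro Rats_divide r(1) yy[OF y(2)])
   moreover have "Im z * y / (y * y) / r = Im z / sqrt (real_of_int (int d))" using r y by simp
   ultimately show "z \<in> quad_field (int d)" using Re[OF z] by (simp add: quad_field_def)
  qed
 qed
 have "squarefree (int d)" by (rule squarefree_int[OF sf])
 thus ?thesis using q ds by (intro exI[of _ "int d"]) simp
qed

end

section \<open>Cyclic subgroups and their complements in finite groups\<close>

context group
begin

text \<open>In a finite group the powers with natural exponents already form the cyclic
  subgroup.\<close>

abbreviation powers :: "'a \<Rightarrow> 'a set" where "powers g \<equiv> range (\<lambda>i::nat. g [^] i)"

lemma nat_pow_mod: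
 assumes "x \<in> carrier G" "x [^] (n::nat) = \<one>" shows "x [^] (k mod n) = x [^] k"
proof -
 have "x [^] k = x [^] (n * (k div n) + k mod n)" by simp
 also have "\<dots> = (x [^] n) [^] (k div n) \<otimes> x [^] (k mod n)" using assms(1) by (simp only: nat_pow_mult[symmetric] nat_pow_pow)
 finally show ?thesis using assms by simp
qed

lemma finite_subgroupI:
 assumes "finite (carrier G)" "A \<subseteq> carrier G" "\<one> \<in> A" "\<And>x y. x \<in> A \<Longrightarrow> y \<in> A \<Longrightarrow> x \<otimes> y \<in> A"
 shows "subgroup A G"
proof (rule subgroupI)
 fix x assume x: "x \<in> A"
 hence xc: "x \<in> carrier G" using assms(2) by blast
 have p: "x [^] k \<in> A" for k :: nat by (induction k) (auto intro: assms x)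
 have "Coset.order G > 0" using assms(1) order_gt_0_iff_finite by blast
 then obtain k where k: "Coset.order G = Suc k" using gr0_conv_Suc by blast
 have "x [^] k \<otimes> x = \<one>" using pow_order_eq_1[OF xc] k by simp
 hence "inv x = x [^] k" using xc by (intro inv_equality) auto
 thus "inv x \<in> A" using p by simp
qed (use assms in auto)

lemma internal_direct_product:
 assumes A: "subgroup A G" and B: "subgroup B G" and comm: "\<And>a b. a \<in> A \<Longrightarrow> b \<in> B \<Longrightarrow> a \<otimes> b = b \<otimes> a"
  and int: "A \<inter> B \<subseteq> {\<one>}" and gen: "\<And>x. x \<in> carrier G \<Longrightarrow> \<exists>a\<in>A. \<exists>b\<in>B. x = a \<otimes> b"
 shows "G \<cong> G\<lparr>carrier := A\<rparr> \<times>\<times> G\<lparr>carrier := B\<rparr>"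
proof -
 interpret A: subgroup A G by fact
 interpret B: subgroup B G by fact
 let ?P = "G\<lparr>carrier := A\<rparr> \<times>\<times> G\<lparr>carrier := B\<rparr>"
 let ?f = "\<lambda>(a,b). a \<otimes> b"
 have P: "group ?P" by (intro DirProd_group subgroup_imp_group A B)
 have "?f \<in> hom ?P G"
 proof (rule homI)
  fix x y assume "x \<in> carrier ?P" "y \<in> carrier ?P"
  then obtain a b a' b' where x: "x = (a,b)" "y = (a',b')" and m: "a \<in> A" "a' \<in> A" "b \<in> B" "b' \<in> B" by auto
  note c = A.mem_carrier[OF m(1)] A.mem_carrier[OF m(2)] B.mem_carrier[OF m(3)] B.mem_carrier[OF m(4)]
  have "a \<otimes> a' \<otimes> (b \<otimes> b') = a \<otimes> (a' \<otimes> b) \<otimes> b'" using c by (simp add: m_assoc)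
  also have "a' \<otimes> b = b \<otimes> a'" using comm m by blast
  also have "a \<otimes> (b \<otimes> a') \<otimes> b' = a \<otimes> b \<otimes> (a' \<otimes> b')" using c by (simp add: m_assoc)
  finally show "?f (x \<otimes>\<^bsub>?P\<^esub> y) = ?f x \<otimes> ?f y" unfolding x by simp
 qed (auto intro: A.mem_carrier B.mem_carrier)
 moreover have "bij_betw ?f (carrier ?P) (carrier G)" unfolding bij_betw_def
 proof
  show "inj_on ?f (carrier ?P)"
  proof (rule inj_onI)
   fix x y assume "x \<in> carrier ?P" "y \<in> carrier ?P" and eq: "?f x = ?f y"
   then obtain a b a' b' where x: "x = (a,b)" "y = (a',b')" and m: "a \<in> A" "a' \<in> A" "b \<in> B" "b' \<in> B" by auto
   note c = A.mem_carrier[OF m(1)] A.mem_carrier[OF m(2)] B.mem_carrier[OF m(3)] B.mem_carrier[OF m(4)]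
   have "a \<otimes> b = a' \<otimes> b'" using eq x by simp
   hence "inv a' \<otimes> (a \<otimes> b) \<otimes> inv b = inv a' \<otimes> (a' \<otimes> b') \<otimes> inv b" by simp
   hence "inv a' \<otimes> a \<otimes> (b \<otimes> inv b) = inv a' \<otimes> a' \<otimes> (b' \<otimes> inv b)"
    using c by (simp only: m_assoc m_closed inv_closed)
   hence e: "inv a' \<otimes> a = b' \<otimes> inv b" using c by simp
   have "inv a' \<otimes> a \<in> A" "b' \<otimes> inv b \<in> B" using m by auto
   hence "inv a' \<otimes> a \<in> A \<inter> B" using e by simp
   hence one: "inv a' \<otimes> a = \<one>" using int by blast
   hence "inv a = inv a'" using c by (intro inv_equality) simp_all
   hence "inv (inv a) = inv (inv a')" by simp
   hence "a = a'" using c by simp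
   moreover have "b' \<otimes> inv b = \<one>" using one e by simp
   hence "inv (inv b) = b'" using c by (intro inv_equality) simp_all
   hence "b' = b" using c by simp
   ultimately show "x = y" using x by simp
  qed
  show "?f ` carrier ?P = carrier G"
  proof
   show "carrier G \<subseteq> ?f ` carrier ?P"
   proof
    fix x assume "x \<in> carrier G"
    then obtain a b where "a \<in> A" "b \<in> B" "x = a \<otimes> b" using gen by blast
    thus "x \<in> ?f ` carrier ?P" by (intro image_eqI[of _ _ "(a,b)"]) simp_all
   qed
  qed (auto intro: A.mem_carrier B.mem_carrier)
 qed
 ultimately have "?P \<cong> G" by (auto simp: is_iso_def iso_def)
 thus ?thesis by (rule group.iso_sym[OF P])
qed

lemma power_set_subgroup:
 assumes fin: "finite (carrier G)" and g: "g \<in> carrier G" shows "subgroup (powers g) G"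
 by (rule finite_subgroupI[OF fin]) (use g in \<open>auto simp: nat_pow_mult intro: range_eqI[of _ _ 0]\<close>)

lemma cyclic_subgroup_iso:
 assumes g: "g \<in> carrier G" and n: "n > 0" "g [^] n = \<one>" "\<And>i. 0 < i \<Longrightarrow> i < n \<Longrightarrow> g [^] (i::nat) \<noteq> \<one>"
 shows "G\<lparr>carrier := powers g\<rparr> \<cong> integer_mod_group n"
proof -
 let ?Z = "G\<lparr>carrier := powers g\<rparr>" and ?I = "integer_mod_group n"
 define f where "f = (\<lambda>a::int. g [^] nat a)"
 have car: "carrier ?I = {0..<int n}" using n(1) by (simp add: carrier_integer_mod_group)
 have gmod: "g [^] (k mod n) = g [^] k" for k by (rule nat_pow_mod[OF g n(2)])
 have fhom: "f \<in> hom ?I ?Z"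
 proof (rule homI)
  fix a b assume a: "a \<in> carrier ?I" and b: "b \<in> carrier ?I"
  have ab: "0 \<le> a" "0 \<le> b" using a b unfolding car by simp_all
  have "nat ((a + b) mod int n) = (nat a + nat b) mod n"
   using ab by (simp only: nat_mod_distrib nat_add_distrib nat_int of_nat_0_le_iff add_nonneg_nonneg)
  hence "f (a \<otimes>\<^bsub>?I\<^esub> b) = g [^] (nat a + nat b)" unfolding f_def mult_integer_mod_group by (simp only: gmod)
  thus "f (a \<otimes>\<^bsub>?I\<^esub> b) = f a \<otimes>\<^bsub>?Z\<^esub> f b" using g by (simp add: f_def nat_pow_mult)
 qed (simp add: f_def)
 have *: "i = j" if ij: "g [^] i = g [^] j" "i \<le> j" "j < n" for i j :: nat
 proof (rule ccontr)
  assume "i \<noteq> j"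
  have "g [^] i \<otimes> g [^] (j - i) = g [^] j" using nat_pow_mult[OF g, of i "j - i"] ij(2) by simp
  hence "g [^] i \<otimes> g [^] (j - i) = g [^] i \<otimes> \<one>" using ij(1) g by simp
  hence "g [^] (j - i) = \<one>" using l_cancel[of "g [^] i" "g [^] (j - i)" \<one>] g by simp
  moreover have "0 < j - i" "j - i < n" using ij(2,3) \<open>i \<noteq> j\<close> by linarith+
  ultimately show False using n(3) by blast
 qed
 have inj: "inj_on f (carrier ?I)"
 proof (rule inj_onI)
  fix a b assume ab: "a \<in> carrier ?I" "b \<in> carrier ?I" "f a = f b"
  have ge: "0 \<le> a" "0 \<le> b" "nat a < n" "nat b < n" using ab(1,2) unfolding car by auto
  have e: "g [^] nat a = g [^] nat b" using ab(3) by (simp only: f_def)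
  have "nat a = nat b"
  proof (cases "nat a \<le> nat b")
   case True thus ?thesis using *[OF e True ge(4)] by simp
  next
   case False thus ?thesis using *[OF e[symmetric] _ ge(3)] by simp
  qed
  thus "a = b" using ge by linarith
 qed
 have img: "f ` carrier ?I = powers g"
 proof
  show "f ` carrier ?I \<subseteq> powers g" unfolding f_def by blast
  show "powers g \<subseteq> f ` carrier ?I"
  proof (rule image_subsetI)
   fix i :: nat
   have "f (int (i mod n)) = g [^] i" unfolding f_def nat_int by (rule gmod)
   moreover have "int (i mod n) \<in> carrier ?I" unfolding car using n(1) by simp
   ultimately show "g [^] i \<in> f ` carrier ?I" by (metis imageI)
  qed
 qed
 have "f \<in> iso ?I ?Z" using fhom inj img by (simp add: iso_def bij_betw_def)
 hence "?I \<cong> ?Z" by (rule is_isoI)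
 thus ?thesis by (rule group.iso_sym[rotated]) simp
qed

end

lemma (in comm_group) adjoin_subgroup:
 assumes fin: "finite (carrier G)" and M: "subgroup M G" and x: "x \<in> carrier G"
 shows "subgroup {m \<otimes> x [^] i | m i :: nat. m \<in> M} G" (is "subgroup ?W G")
proof (rule finite_subgroupI[OF fin])
 interpret M: subgroup M G by fact
 have Mc: "m \<in> carrier G" if "m \<in> M" for m using that by simp
 show "?W \<subseteq> carrier G" using x by auto
 show "\<one> \<in> ?W" using M.one_closed by (intro CollectI exI[of _ "\<one>"] exI[of _ 0]) simp
 fix y y' assume "y \<in> ?W" "y' \<in> ?W"
 then obtain m i m' j where y: "m \<in> M" "m' \<in> M" "y = m \<otimes> x [^] (i::nat)" "y' = m' \<otimes> x [^] (j::nat)" by auto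
 have "y \<otimes> y' = (m \<otimes> m') \<otimes> x [^] (i + j)" using y x by (simp add: m_ac flip: nat_pow_mult)
 thus "y \<otimes> y' \<in> ?W" using y by blast
qed

text \<open>A subgroup M maximal among those that meet <g> trivially is a complement. If M<g> were
  proper, some z outside it would have its p-th power in M, and M could be enlarged by z. The
  element g has the maximal order p^e, and \<open>bezout\<close> expresses that p is prime.\<close>

lemma (in comm_group) prime_power_complement:
 fixes p :: nat
 assumes fin: "finite (carrier G)" and p: "p > 1"
  and bezout: "\<And>j. \<not> p dvd j \<Longrightarrow> \<exists>a b. a * j = b * p + (1::nat)" and expo: "\<And>x. x \<in> carrier G \<Longrightarrow> x [^] (p ^ e) = \<one>"
  and g: "g \<in> carrier G" and e: "e > 0" and ord: "g [^] (p ^ (e - 1)) \<noteq> \<one>"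
 shows "\<exists>M. subgroup M G \<and> M \<inter> powers g \<subseteq> {\<one>} \<and>
  (\<forall>x\<in>carrier G. \<exists>m\<in>M. \<exists>i::nat. x = m \<otimes> g [^] i)"
proof -
 let ?Z = "powers g"
 define S where "S = {M. subgroup M G \<and> M \<inter> ?Z \<subseteq> {\<one>}}"
 have "finite S" by (rule finite_subset[of _ "Pow (carrier G)"]) (auto simp: S_def fin dest: subgroup.mem_carrier)
 moreover have "{\<one>} \<in> S" by (simp add: S_def triv_subgroup)
 ultimately have "Max (card ` S) \<in> card ` S" by (intro Max_in) auto
 then obtain M where M1: "M \<in> S" "card M = Max (card ` S)" by (metis imageE)
 have M: "M \<in> S" "\<And>N. N \<in> S \<Longrightarrow> card N \<le> card M" using M1 \<open>finite S\<close> by simp_all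
 interpret M: subgroup M G using M(1) by (simp add: S_def)
 have MZ: "m = \<one>" if "m \<in> M" "m \<in> ?Z" for m using M(1) that by (auto simp: S_def)
 define W where "W = {m \<otimes> g [^] i | m i :: nat. m \<in> M}"
 have Mc: "m \<in> carrier G" if "m \<in> M" for m using that by simp
 have W: "subgroup W G" unfolding W_def by (rule adjoin_subgroup[OF fin M.subgroup_axioms g])
 interpret W: subgroup W G by (rule W)
 have Wpow: "x [^] (k::nat) \<in> W" if "x \<in> W" for x k using that by (induction k) auto
 have MW: "m \<in> W" if "m \<in> M" for m unfolding W_def using that by (intro CollectI exI[of _ m] exI[of _ 0]) simp
 have gW: "g [^] (i::nat) \<in> W" for i unfolding W_def using g by (intro CollectI exI[of _ "\<one>"] exI[of _ i]) simp
 have "carrier G \<subseteq> W"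
 proof (rule ccontr)
  assume "\<not> carrier G \<subseteq> W"
  then obtain x where x: "x \<in> carrier G" "x \<notin> W" by blast
  have "x [^] (p ^ e) \<in> W" using expo[OF x(1)] by simp
  define i where "i = (LEAST i. x [^] (p ^ i) \<in> W)"
  have i: "x [^] (p ^ i) \<in> W" unfolding i_def by (rule LeastI) fact
  have "i \<noteq> 0"
  proof
   assume "i = 0"
   thus False using i x by simp
  qed
  then obtain i' where i': "i = Suc i'" using not0_implies_Suc by blast
  \<comment> \<open>The last element outside W in the sequence of iterated p-th powers of x.\<close>
  define y where "y = x [^] (p ^ i')"
  have "x [^] (p ^ i') \<notin> W" using not_less_Least[of i' "\<lambda>i. x [^] (p ^ i) \<in> W"] i' unfolding i_def by simp
  moreover have "y [^] p = x [^] (p ^ i)" using x(1) by (simp add: y_def i' nat_pow_pow mult.commute)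
  ultimately have y: "y \<in> carrier G" "y \<notin> W" "y [^] p \<in> W" using x(1) i by (simp_all add: y_def)
  obtain m j where mj: "m \<in> M" "y [^] p = m \<otimes> g [^] (j::nat)" using y(3) by (auto simp: W_def)
  \<comment> \<open>The exponent p^e kills y. This puts a power of g into M, so that power is
    trivial, which is possible only if p divides j.\<close>
  have "\<one> = y [^] (p ^ e)" using expo y by simp
  also have "\<dots> = (y [^] p) [^] (p ^ (e - 1))" using y(1) e by (simp add: nat_pow_pow flip: power_Suc)
  also have "\<dots> = m [^] (p ^ (e - 1)) \<otimes> g [^] (j * p ^ (e - 1))"
   unfolding mj(2) using mj(1) g by (simp add: pow_mult_distrib[OF m_comm] nat_pow_pow)
  finally have one: "m [^] (p ^ (e - 1)) \<otimes> g [^] (j * p ^ (e - 1)) = \<one>" by simp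
  have mM: "m [^] (k::nat) \<in> M" for k using mj(1) by (induction k) auto
  have "g [^] (j * p ^ (e - 1)) \<otimes> m [^] (p ^ (e - 1)) = m [^] (p ^ (e - 1)) \<otimes> g [^] (j * p ^ (e - 1))"
   by (intro m_comm nat_pow_closed g Mc mj(1))
  with one have "g [^] (j * p ^ (e - 1)) \<otimes> m [^] (p ^ (e - 1)) = \<one>" by (simp only:)
  hence "inv (m [^] (p ^ (e - 1))) = g [^] (j * p ^ (e - 1))" using mj(1) g by (intro inv_equality) simp_all
  hence "g [^] (j * p ^ (e - 1)) \<in> M" using M.m_inv_closed[OF mM[of "p ^ (e - 1)"]] by simp
  hence gj: "g [^] (j * p ^ (e - 1)) = \<one>" using MZ by blast
  have "p dvd j"
  proof (rule ccontr)
   assume "\<not> p dvd j"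
   then obtain a b where ab: "a * j = b * p + 1" using bezout by blast
   have "(g [^] (j * p ^ (e - 1))) [^] a = g [^] (p ^ (e - 1) * (a * j))" using g by (simp add: nat_pow_pow mult_ac)
   also have "\<dots> = g [^] (p ^ e * b + p ^ (e - 1))" unfolding ab using e by (simp add: algebra_simps flip: power_Suc)
   also have "\<dots> = (g [^] (p ^ e)) [^] b \<otimes> g [^] (p ^ (e - 1))" using g by (simp only: nat_pow_mult[symmetric] nat_pow_pow nat_pow_closed)
   finally show False using gj ord expo[OF g] g by simp
  qed
  then obtain k where k: "j = p * k" by (rule dvdE)
  \<comment> \<open>Dividing y by g^k removes the factor g^j = (g^k)^p from its p-th power and
    leaves m.\<close>
  define z where "z = y \<otimes> inv (g [^] k)"
  have z: "z \<in> carrier G" using y g by (simp add: z_def)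
  have "z [^] p = y [^] p \<otimes> inv ((g [^] k) [^] p)" unfolding z_def using y g by (simp add: pow_mult_distrib[OF m_comm] nat_pow_inv)
  also have "\<dots> = m \<otimes> g [^] j \<otimes> inv (g [^] j)" using g mj by (simp add: nat_pow_pow k mult.commute)
  also have "\<dots> = m" using g mj by (simp add: m_assoc)
  finally have zp: "z [^] p \<in> M" using mj by simp
  have zW: "z \<notin> W"
  proof
   assume "z \<in> W"
   hence "z \<otimes> g [^] k \<in> W" using gW by blast
   moreover have "z \<otimes> g [^] k = y" using y g by (simp add: z_def m_assoc)
   ultimately show False using y by simp
  qed
  define N where "N = {m \<otimes> z [^] i | m i :: nat. m \<in> M}"
  have N: "subgroup N G" unfolding N_def by (rule adjoin_subgroup[OF fin M.subgroup_axioms z])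
  have "N \<inter> ?Z \<subseteq> {\<one>}"
  proof
   fix t assume t: "t \<in> N \<inter> ?Z"
   then obtain m' i where mi: "m' \<in> M" "t = m' \<otimes> z [^] (i::nat)" by (auto simp: N_def)
   have tW: "t \<in> W" using t gW by auto
   have "z [^] i = inv m' \<otimes> t" using mi z by (simp add: m_assoc[symmetric])
   hence zi: "z [^] i \<in> W" using MW[OF mi(1)] tW by simp
   \<comment> \<open>Otherwise some multiple of i is 1 modulo p, and z itself would lie in
     W.\<close>
   have "p dvd i"
   proof (rule ccontr)
    assume "\<not> p dvd i"
    then obtain a b where ab: "a * i = b * p + 1" using bezout by blast
    have "(z [^] i) [^] a = z [^] (b * p + 1)" using z ab by (simp add: nat_pow_pow mult.commute)
    also have "\<dots> = (z [^] p) [^] b \<otimes> z" using z by (simp add: nat_pow_pow mult.commute flip: nat_pow_mult)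
    finally have "z = inv ((z [^] p) [^] b) \<otimes> (z [^] i) [^] a" using z by (simp add: m_assoc[symmetric])
    moreover have "inv ((z [^] p) [^] b) \<otimes> (z [^] i) [^] a \<in> W" by (intro W.m_closed W.m_inv_closed Wpow MW zp zi)
    ultimately show False using zW by simp
   qed
   then obtain l where "i = p * l" by (rule dvdE)
   hence "z [^] i = (z [^] p) [^] l" using z by (simp add: nat_pow_pow)
   moreover have "(z [^] p) [^] l \<in> M" using zp by (induction l) auto
   ultimately have "t \<in> M" using mi by simp
   thus "t \<in> {\<one>}" using t MZ by blast
  qed
  hence "N \<in> S" using N by (simp add: S_def)
  hence "card N \<le> card M" by (rule M(2))
  moreover have "M \<subseteq> N"
  proof
   fix m assume "m \<in> M"
   thus "m \<in> N" unfolding N_def by (intro CollectI exI[of _ m] exI[of _ 0]) simp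
  qed
  moreover have "z \<in> N" unfolding N_def using z M.one_closed by (intro CollectI exI[of _ "\<one>"] exI[of _ 1]) simp
  moreover have "z \<notin> M" using zW MW by blast
  moreover have "finite N" using subgroup.subset[OF N] fin finite_subset by blast
  ultimately show False using card_seteq[of N M] by blast
 qed
 hence "\<forall>x\<in>carrier G. \<exists>m\<in>M. \<exists>i::nat. x = m \<otimes> g [^] i" by (auto simp: W_def)
 thus ?thesis using M(1) unfolding S_def by blast
qed

section \<open>Unipotent units and units supported on a cyclic subgroup\<close>

text \<open>The group ring element p(g) as a function on G; exponents that give the same group
  element are collected.\<close>

definition power_poly :: "('g, 'n) monoid_scheme \<Rightarrow> 'g \<Rightarrow> complex poly \<Rightarrow> 'g \<Rightarrow> complex" where
 "power_poly G g p x = (\<Sum>i\<le>Polynomial.degree p. if g [^]\<^bsub>G\<^esub> i = x then poly.coeff p i else 0)"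

text \<open>The value of u at the character g \<mapsto> \<zeta> of <g>, where \<zeta> is a root of
  unity of order dividing \<open>ord g\<close>.\<close>

definition fourier :: "('g, 'n) monoid_scheme \<Rightarrow> 'g \<Rightarrow> ('g \<Rightarrow> complex) \<Rightarrow> complex \<Rightarrow> complex" where
 "fourier G g u \<zeta> = (\<Sum>l<group.ord G g. u (g [^]\<^bsub>G\<^esub> l) * \<zeta> ^ l)"

lemma root_of_unity_power_mod: "\<zeta> ^ k = 1 \<Longrightarrow> \<zeta> ^ (n mod k) = \<zeta> ^ n" for \<zeta> :: "'a :: monoid_mult"
proof -
 assume z: "\<zeta> ^ k = 1"
 have "\<zeta> ^ n = \<zeta> ^ (k * (n div k) + n mod k)" by simp
 also have "\<dots> = \<zeta> ^ (n mod k)" unfolding power_add power_mult z by simp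
 finally show ?thesis by simp
qed

context group
begin

lemma gconv_add_left: "gconv G (\<lambda>t. a t + b t) c x = gconv G a c x + gconv G b c x" by (simp add: gconv_def sum.distrib ring_distribs)

lemma gconv_add_right: "gconv G c (\<lambda>t. a t + b t) x = gconv G c a x + gconv G c b x" by (simp add: gconv_def sum.distrib ring_distribs)

lemma gconv_minus_right: "gconv G c (\<lambda>t. - b t) x = - gconv G c b x" by (simp add: gconv_def sum_negf)

lemma gconv_minus_left: "gconv G (\<lambda>t. - b t) c x = - gconv G b c x" by (simp add: gconv_def sum_negf)

text \<open>The inverse of 1 + y is 1 - y. Both the bicyclic units and the unit that excludes the
  quaternion group enter through this lemma.\<close>

lemma square_zero_trivial:
 assumes fin: "finite (carrier G)" and triv: "complex_only_trivial_units R G"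
  and R: "1 \<in> R" "\<And>a b. a \<in> R \<Longrightarrow> b \<in> R \<Longrightarrow> a - b \<in> R"
  and y: "\<And>x. x \<in> carrier G \<Longrightarrow> y x \<in> R" "\<And>x. x \<in> carrier G \<Longrightarrow> gconv G y y x = 0"
 shows "trivial_mod_Sigma R G (\<lambda>x. (if x = \<one> then 1 else 0) + y x)"
proof -
 let ?\<delta> = "\<lambda>x. if x = \<one> then 1 else 0 :: complex"
 let ?u = "\<lambda>x. ?\<delta> x + y x" and ?v = "\<lambda>x. ?\<delta> x + - y x"
 have z: "0 \<in> R" using R(2)[OF R(1,1)] by simp
 have neg: "- a \<in> R" if "a \<in> R" for a using R(2)[OF z that] by simp
 have add: "a + b \<in> R" if "a \<in> R" "b \<in> R" for a b using R(2)[OF that(1) neg[OF that(2)]] by simp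
 have d: "?\<delta> x \<in> R" for x using z R(1) by simp
 have l: "gconv G ?\<delta> c x = c x" if "x \<in> carrier G" for c x using gconv_delta_left[OF fin that one_closed, of 1 c] that by simp
 have r: "gconv G c ?\<delta> x = c x" if "x \<in> carrier G" for c x using gconv_delta_right[OF fin that one_closed, of c 1] that by simp
 have "gconv G ?u ?v x = ?\<delta> x + 0" "gconv G ?v ?u x = ?\<delta> x + 0" if x: "x \<in> carrier G" for x
  unfolding gconv_add_left gconv_add_right gconv_minus_left gconv_minus_right l[OF x] r[OF x] y(2)[OF x] by simp_all
 hence "inverse_mod_Sigma G ?u ?v" unfolding inverse_mod_Sigma_def by blast
 moreover have "?u \<in> carrier G \<rightarrow> R" using add[OF d y(1)] by (rule funcsetI)
 moreover have "?v \<in> carrier G \<rightarrow> R" using add[OF d neg[OF y(1)]] by (rule funcsetI)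
 ultimately show ?thesis using triv unfolding complex_only_trivial_units_def by blast
qed

text \<open>The bicyclic units \<open>1 + (1 - h) g \<Sigma>\<^sub>\<langle>\<^sub>h\<^sub>\<rangle>\<close>.\<close>

lemma cyclic_subgroup_normal:
 assumes fin: "finite (carrier G)" and triv: "complex_only_trivial_units R G"
  and R: "1 \<in> R" "\<And>a b. a \<in> R \<Longrightarrow> b \<in> R \<Longrightarrow> a - b \<in> R"
  and g: "g \<in> carrier G" and h: "h \<in> carrier G"
 shows "inv g \<otimes> h \<otimes> g \<in> powers h"
proof (rule ccontr)
 define H where "H = powers h"
 interpret H: subgroup H G unfolding H_def by (rule power_set_subgroup[OF fin h])
 assume "inv g \<otimes> h \<otimes> g \<notin> powers h"
 hence n: "inv g \<otimes> h \<otimes> g \<notin> H" by (simp add: H_def)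
 have hH: "h \<in> H" unfolding H_def using h by (intro range_eqI[of _ _ 1]) simp
 have gH: "g \<notin> H"
 proof
  assume "g \<in> H"
  hence "inv g \<otimes> h \<otimes> g \<in> H" using hH by (intro H.m_closed H.m_inv_closed)
  thus False using n by simp
 qed
 have Hi: "x \<in> H" if "inv x \<in> H" "x \<in> carrier G" for x using H.m_inv_closed[OF that(1)] that(2) by simp
 have Hr: "x \<otimes> h \<in> H \<longleftrightarrow> x \<in> H" if "x \<in> carrier G" for x
 proof
  assume "x \<otimes> h \<in> H"
  hence "(x \<otimes> h) \<otimes> inv h \<in> H" by (rule H.m_closed[OF _ H.m_inv_closed[OF hH]])
  thus "x \<in> H" using that h by (simp add: m_assoc)
 qed (use hH in \<open>intro H.m_closed\<close>)
 \<comment> \<open>The indicator of the coset gH, that is g times the sum of H; the next line forms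
   (1 - h) times it.\<close>
 define f where "f s = (if inv g \<otimes> s \<in> H then 1 else 0 :: complex)" for s
 define y where "y s = f s - f (inv h \<otimes> s)" for s
 have fh: "f (s \<otimes> h) = f s" if "s \<in> carrier G" for s unfolding f_def using Hr[of "inv g \<otimes> s"] that g h by (simp add: m_assoc)
 have yh: "y (s \<otimes> h) = y s" if "s \<in> carrier G" for s
  unfolding y_def using fh[of s] fh[of "inv h \<otimes> s"] that h by (simp add: m_assoc)
 \<comment> \<open>y is invariant under right translation by h, so the factor 1 - h at the left of
   the second y annihilates it.\<close>
 have "gconv G y y x = 0" if x: "x \<in> carrier G" for x
 proof -
  have "gconv G y y x = (\<Sum>t\<in>carrier G. y t * f (inv t \<otimes> x)) - (\<Sum>t\<in>carrier G. y t * f (inv h \<otimes> (inv t \<otimes> x)))"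
   unfolding gconv_def y_def[of "inv _ \<otimes> _"] by (simp add: right_diff_distrib sum_subtractf)
  also have "(\<Sum>t\<in>carrier G. y t * f (inv h \<otimes> (inv t \<otimes> x))) = (\<Sum>t\<in>carrier G. (\<lambda>s. y s * f (inv s \<otimes> x)) (t \<otimes> h))"
   by (rule sum.cong[OF refl]) (use x h in \<open>simp add: yh inv_mult_group m_assoc\<close>)
  also have "\<dots> = (\<Sum>t\<in>carrier G. y t * f (inv t \<otimes> x))" by (rule sum_right_translate[OF h])
  finally show ?thesis by simp
 qed
 moreover have "0 \<in> R" using R(2)[OF R(1,1)] by simp
 hence "f s \<in> R" for s using R(1) by (simp add: f_def)
 hence "y s \<in> R" for s unfolding y_def by (intro R(2))
 ultimately have "trivial_mod_Sigma R G (\<lambda>x. (if x = \<one> then 1 else 0) + y x)" by (intro square_zero_trivial[OF fin triv R])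
 then obtain r a d where t: "\<And>x. x \<in> carrier G \<Longrightarrow> (if x = \<one> then 1 else 0) + y x = (if x = a then r else 0) + d"
  unfolding trivial_mod_Sigma_def by blast
 have n': "inv g \<otimes> inv h \<otimes> g \<notin> H"
 proof
  assume "inv g \<otimes> inv h \<otimes> g \<in> H"
  hence "inv (inv g \<otimes> inv h \<otimes> g) \<in> H" by (rule H.m_inv_closed)
  thus False using n g h by (simp add: inv_mult_group m_assoc)
 qed
 have c: "g \<otimes> h \<in> carrier G" "h \<otimes> g \<in> carrier G" "h \<otimes> g \<otimes> h \<in> carrier G" using g h by simp_all
 have "f g = 1" using g by (simp add: f_def H.one_closed)
 moreover have fg0: "f (inv h \<otimes> g) = 0" using n' g h by (simp add: f_def m_assoc)
 moreover have fhg: "f (h \<otimes> g) = 0" using n g h by (simp add: f_def m_assoc)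
 moreover have "f (inv h \<otimes> (h \<otimes> g)) = f g" using g h by (simp add: m_assoc[symmetric])
 ultimately have yv: "y g = 1" "y (h \<otimes> g) = -1" by (simp_all add: y_def)
 have yv': "y (g \<otimes> h) = 1" "y (h \<otimes> g \<otimes> h) = -1" using yh[OF g] yh[OF c(2)] yv by simp_all
 have g1: "g \<noteq> \<one>" using gH H.one_closed by auto
 have gh1: "g \<otimes> h \<noteq> \<one>"
 proof
  assume "g \<otimes> h = \<one>"
  hence "g \<otimes> h \<in> H" using H.one_closed by simp
  thus False using Hr[OF g] gH by simp
 qed
 have hg1: "h \<otimes> g \<noteq> \<one>"
 proof
  assume "h \<otimes> g = \<one>"
  hence "g \<otimes> h = \<one>" using inv_comm[OF _ h g] by simp
  thus False using gh1 by simp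
 qed
 have hgh1: "h \<otimes> g \<otimes> h \<noteq> \<one>"
 proof
  assume "h \<otimes> g \<otimes> h = \<one>"
  hence "h \<otimes> (g \<otimes> h) = \<one>" using g h by (simp add: m_assoc)
  hence "g \<otimes> h \<otimes> h = \<one>" using inv_comm[OF _ h c(1)] by simp
  hence "g \<otimes> h \<otimes> h \<in> H" using H.one_closed by simp
  thus False using Hr[OF c(1)] Hr[OF g] gH by simp
 qed
 have h1: "h \<noteq> \<one>" using n g H.one_closed by auto
 have ne: "g \<otimes> h \<noteq> g" "h \<otimes> g \<otimes> h \<noteq> h \<otimes> g" using h1 g h by (simp_all add: r_cancel_one)
 \<comment> \<open>A trivial unit is constant except at one point, so it cannot take the value 1 at
   two points and -1 at two others.\<close>
 have v: "1 = (if g = a then r else 0) + d" "1 = (if g \<otimes> h = a then r else 0) + d"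
  "-1 = (if h \<otimes> g = a then r else 0) + d" "-1 = (if h \<otimes> g \<otimes> h = a then r else 0) + d"
  using t[OF g] t[OF c(1)] t[OF c(2)] t[OF c(3)] yv yv' g1 gh1 hg1 hgh1 by simp_all
 have "d = 1" using v(1,2) ne(1) by (cases "g = a") auto
 moreover have "d = -1" using v(3,4) ne(2) by (cases "h \<otimes> g = a") auto
 ultimately show False by simp
qed

text \<open>(a + \<i> * b)^2 = a^2 - b^2 + \<i> * (a * b + b * a) = \<i> * (1 + z) * a * b, and the
  central factor 1 - z annihilates 1 + z. Hence y = (1 - z) * (a + \<i> * b) has square 0.\<close>

lemma quaternion_not_gaussian:
 assumes fin: "finite (carrier G)" and triv: "complex_only_trivial_units R G"
  and R: "1 \<in> R" "\<i> \<in> R" "\<And>a b. a \<in> R \<Longrightarrow> b \<in> R \<Longrightarrow> a - b \<in> R"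
  and c: "a \<in> carrier G" "b \<in> carrier G" "z \<in> carrier G"
  and rel: "a \<otimes> a = z" "b \<otimes> b = z" "z \<otimes> z = \<one>" "b \<otimes> a = z \<otimes> (a \<otimes> b)" and z: "z \<noteq> \<one>"
 shows False
proof -
 have az: "a \<otimes> z = z \<otimes> a" "b \<otimes> z = z \<otimes> b" using c rel(1,2) by (metis m_assoc)+
 have zz: "z \<otimes> (z \<otimes> x) = x" if "x \<in> carrier G" for x using that c rel(3) by (simp add: m_assoc[symmetric])
 define f where "f s = (if s = a then 1 else 0 :: complex) + (if s = z \<otimes> a then -1 else 0)" for s
 define k where "k s = (if s = b then \<i> else 0) + (if s = z \<otimes> b then - \<i> else 0)" for s
 define y where "y s = f s + k s" for s
 have inv_eq: "inv s \<otimes> x = w \<longleftrightarrow> x = s \<otimes> w" if "s \<in> carrier G" "x \<in> carrier G" "w \<in> carrier G" for s x w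
  using that by (metis inv_solve_left)
 have "gconv G y y x = 0" if x: "x \<in> carrier G" for x
 proof -
  have "gconv G y y x = y (inv a \<otimes> x) + - y (inv (z \<otimes> a) \<otimes> x) + (\<i> * y (inv b \<otimes> x) + - \<i> * y (inv (z \<otimes> b) \<otimes> x))"
   unfolding y_def[of "_ :: 'a", abs_def] f_def[abs_def] k_def[abs_def] gconv_add_left
   using c x by (simp add: gconv_delta_left[OF fin])
  note conv = this
  have l: "a \<otimes> (z \<otimes> w) = z \<otimes> (a \<otimes> w)" "b \<otimes> (z \<otimes> w) = z \<otimes> (b \<otimes> w)" if "w \<in> carrier G" for w
   using that c az by (simp_all add: m_assoc[symmetric])
  have m: "a \<otimes> (z \<otimes> a) = \<one>" "a \<otimes> (z \<otimes> b) = z \<otimes> (a \<otimes> b)" "z \<otimes> a \<otimes> a = \<one>" "z \<otimes> a \<otimes> (z \<otimes> a) = z"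
   "z \<otimes> a \<otimes> b = z \<otimes> (a \<otimes> b)" "z \<otimes> a \<otimes> (z \<otimes> b) = a \<otimes> b" "b \<otimes> (z \<otimes> a) = a \<otimes> b" "b \<otimes> (z \<otimes> b) = \<one>"
   "z \<otimes> b \<otimes> a = a \<otimes> b" "z \<otimes> b \<otimes> (z \<otimes> a) = z \<otimes> (a \<otimes> b)" "z \<otimes> b \<otimes> b = \<one>" "z \<otimes> b \<otimes> (z \<otimes> b) = z"
   using c by (simp_all add: m_assoc l rel zz)
  define E where "E w = (if x = w then 1 else 0 :: complex)" for w
  have yE: "y (inv s \<otimes> x) = E (s \<otimes> a) - E (s \<otimes> (z \<otimes> a)) + \<i> * E (s \<otimes> b) - \<i> * E (s \<otimes> (z \<otimes> b))"
   if s: "s \<in> carrier G" for s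
   unfolding y_def f_def k_def E_def using s x c by (simp add: inv_eq)
  note conv
  moreover have "y (inv a \<otimes> x) = E z - E \<one> + \<i> * E (a \<otimes> b) - \<i> * E (z \<otimes> (a \<otimes> b))"
   using yE[OF c(1)] unfolding m rel(1) .
  moreover have "y (inv (z \<otimes> a) \<otimes> x) = E \<one> - E z + \<i> * E (z \<otimes> (a \<otimes> b)) - \<i> * E (a \<otimes> b)"
   using yE[OF m_closed[OF c(3,1)]] unfolding m .
  moreover have "y (inv b \<otimes> x) = E (z \<otimes> (a \<otimes> b)) - E (a \<otimes> b) + \<i> * E z - \<i> * E \<one>"
   using yE[OF c(2)] unfolding m rel(2,4) .
  moreover have "y (inv (z \<otimes> b) \<otimes> x) = E (a \<otimes> b) - E (z \<otimes> (a \<otimes> b)) + \<i> * E \<one> - \<i> * E z"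
   using yE[OF m_closed[OF c(3,2)]] unfolding m .
  moreover have "\<i> * (\<i> * w) = - w" for w by (simp flip: mult.assoc)
  ultimately show ?thesis by (simp add: algebra_simps)
 qed
 moreover have R0: "0 \<in> R" using R(3)[OF R(1,1)] by simp
 have neg: "- s \<in> R" if "s \<in> R" for s using R(3)[OF R0 that] by simp
 have add: "s + t \<in> R" if "s \<in> R" "t \<in> R" for s t using R(3)[OF that(1) neg[OF that(2)]] by simp
 have "y s \<in> R" for s unfolding y_def f_def k_def by (intro add) (simp_all add: R R0 neg)
 ultimately have "trivial_mod_Sigma R G (\<lambda>x. (if x = \<one> then 1 else 0) + y x)" by (intro square_zero_trivial[OF fin triv R(1,3)])
 then obtain r e d where t: "\<And>x. x \<in> carrier G \<Longrightarrow> (if x = \<one> then 1 else 0) + y x = (if x = e then r else 0) + d"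
  unfolding trivial_mod_Sigma_def by blast
 have nc: "a \<otimes> b \<noteq> b \<otimes> a"
 proof
  assume "a \<otimes> b = b \<otimes> a"
  hence "z \<otimes> (a \<otimes> b) = a \<otimes> b" using rel(4) by simp
  hence "z = \<one>" using l_cancel_one[of "a \<otimes> b" z] c by simp
  thus False using z by simp
 qed
 have ab: "a \<noteq> b" using nc by auto
 have zb: "a \<noteq> z \<otimes> b"
 proof
  assume e: "a = z \<otimes> b"
  have "a \<otimes> b = b \<otimes> a" unfolding e using c az by (simp add: m_assoc[symmetric])
  thus False using nc by simp
 qed
 have za: "b \<noteq> z \<otimes> a" using zb zz[of a] c zz[of b] by metis
 have a1: "a \<noteq> \<one>" "b \<noteq> \<one>" using rel z c by auto
 have za1: "z \<otimes> a \<noteq> \<one>" "z \<otimes> b \<noteq> \<one>" using zz[of a] zz[of b] c nc az by auto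
 have zaa: "z \<otimes> a \<noteq> a" "z \<otimes> b \<noteq> b" "z \<otimes> a \<noteq> z \<otimes> b" using z c ab by (simp_all add: l_cancel_one)
 have "y a = 1" "y b = \<i>" "y (z \<otimes> a) = -1" "y \<one> = 0" using ab zb za a1 za1 zaa by (simp_all add: y_def f_def k_def eq_commute)
 \<comment> \<open>The value 1 occurs at a and at the identity, so it is the constant d. Then b and
   z * a, with values \<i> and -1, would both be the exceptional point.\<close>
 hence v: "1 = (if a = e then r else 0) + d" "1 = (if \<one> = e then r else 0) + d"
  "\<i> = (if b = e then r else 0) + d" "-1 = (if z \<otimes> a = e then r else 0) + d"
  using t[of a] t[of b] t[of "z \<otimes> a"] t[of \<one>] c a1 za1 by simp_all
 have "d = 1" using v(1,2) a1 by (cases "a = e") auto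
 hence "b = e" "z \<otimes> a = e" using v(3,4) by (auto split: if_splits simp: complex_eq_iff)
 thus False using za by simp
qed

context
 fixes g assumes fin: "finite (carrier G)" and g: "g \<in> carrier G"
begin

lemma ord_pos: "ord g > 0" using ord_ge_1[OF fin g] by simp

lemma pow_eq_iff_mod: "l < ord g \<Longrightarrow> g [^] (n::nat) = g [^] l \<longleftrightarrow> l = n mod ord g"
proof -
 assume l: "l < ord g"
 have m: "g [^] n = g [^] (n mod ord g)" using nat_pow_mod[OF g pow_ord_eq_1[OF g]] by simp
 have "n mod ord g < ord g" using ord_pos by simp
 hence "g [^] (n mod ord g) = g [^] l \<longleftrightarrow> n mod ord g = l"
  using l by (intro inj_on_eq_iff[OF ord_inj[OF g]]) (simp_all only: atLeastAtMost_iff, arith+)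
 thus ?thesis using m by auto
qed

lemma sum_power_delta:
 assumes z: "\<zeta> ^ ord g = (1::complex)"
 shows "(\<Sum>l < ord g. (if g [^] (n::nat) = g [^] l then c else 0) * \<zeta> ^ l) = c * \<zeta> ^ n"
proof -
 have "(\<Sum>l < ord g. (if g [^] n = g [^] l then c else 0) * \<zeta> ^ l) = (\<Sum>l < ord g. if l = n mod ord g then c * \<zeta> ^ l else 0)"
  by (intro sum.cong refl) (simp add: pow_eq_iff_mod)
 also have "\<dots> = c * \<zeta> ^ (n mod ord g)" using ord_pos by (simp add: sum.delta)
 finally show ?thesis by (simp only: root_of_unity_power_mod[OF z])
qed

lemma fourier_power_poly: "\<zeta> ^ ord g = 1 \<Longrightarrow> fourier G g (power_poly G g p) \<zeta> = poly p \<zeta>"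
proof -
 assume z: "\<zeta> ^ ord g = 1"
 have "fourier G g (power_poly G g p) \<zeta>
   = (\<Sum>i\<le>Polynomial.degree p. \<Sum>l < ord g. (if g [^] i = g [^] l then poly.coeff p i else 0) * \<zeta> ^ l)"
  unfolding fourier_def power_poly_def sum_distrib_right by (rule sum.swap)
 thus ?thesis unfolding sum_power_delta[OF z] by (simp add: poly_altdef)
qed

lemma power_poly_outside: "x \<notin> powers g \<Longrightarrow> power_poly G g p x = 0" unfolding power_poly_def by (rule sum.neutral) auto

lemma gconv_power_poly:
 assumes x: "x \<in> carrier G"
 shows "gconv G (power_poly G g p) (power_poly G g q) x =
  (\<Sum>j\<le>Polynomial.degree p. \<Sum>i\<le>Polynomial.degree q. if g [^] (j + i) = x then poly.coeff p j * poly.coeff q i else 0)"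
proof -
 have "gconv G (power_poly G g p) (power_poly G g q) x =
   (\<Sum>j\<le>Polynomial.degree p. \<Sum>y\<in>carrier G. (if g [^] j = y then poly.coeff p j else 0) * power_poly G g q (inv y \<otimes> x))"
  unfolding gconv_def power_poly_def[of G g p] sum_distrib_right by (rule sum.swap)
 also have "\<dots> = (\<Sum>j\<le>Polynomial.degree p. poly.coeff p j * power_poly G g q (inv (g [^] j) \<otimes> x))"
 proof (rule sum.cong[OF refl])
  fix j
  have "(\<Sum>y\<in>carrier G. (if g [^] j = y then poly.coeff p j else 0) * power_poly G g q (inv y \<otimes> x))
    = (\<Sum>y\<in>carrier G. if g [^] j = y then poly.coeff p j * power_poly G g q (inv y \<otimes> x) else 0)"
   by (intro sum.cong refl) simp
  also have "\<dots> = poly.coeff p j * power_poly G g q (inv (g [^] j) \<otimes> x)" using fin g by (simp add: sum.delta')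
  finally show "(\<Sum>y\<in>carrier G. (if g [^] j = y then poly.coeff p j else 0) * power_poly G g q (inv y \<otimes> x))
    = poly.coeff p j * power_poly G g q (inv (g [^] j) \<otimes> x)" .
 qed
 also have "\<dots> = (\<Sum>j\<le>Polynomial.degree p. \<Sum>i\<le>Polynomial.degree q. if g [^] (j + i) = x then poly.coeff p j * poly.coeff q i else 0)"
 proof (rule sum.cong[OF refl])
  fix j
  have e: "g [^] i = inv (g [^] j) \<otimes> x \<longleftrightarrow> g [^] (j + i) = x" for i :: nat
  proof -
   have "g [^] (j + i) = g [^] j \<otimes> g [^] i" using g by (simp add: nat_pow_mult)
   moreover have "g [^] i = inv (g [^] j) \<otimes> x \<longleftrightarrow> x = g [^] j \<otimes> g [^] i"
    using g x by (intro inv_solve_left) simp_all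
   ultimately show ?thesis by auto
  qed
  show "poly.coeff p j * power_poly G g q (inv (g [^] j) \<otimes> x) =
   (\<Sum>i\<le>Polynomial.degree q. if g [^] (j + i) = x then poly.coeff p j * poly.coeff q i else 0)"
   unfolding power_poly_def e sum_distrib_left by (intro sum.cong refl) simp
 qed
 finally show ?thesis .
qed

lemma fourier_gconv:
 assumes z: "\<zeta> ^ ord g = 1"
 shows "fourier G g (gconv G (power_poly G g p) (power_poly G g q)) \<zeta> = poly p \<zeta> * poly q \<zeta>"
proof -
 have "fourier G g (gconv G (power_poly G g p) (power_poly G g q)) \<zeta> =
  (\<Sum>l < ord g. \<Sum>j\<le>Polynomial.degree p. \<Sum>i\<le>Polynomial.degree q. (if g [^] (j + i) = g [^] l then poly.coeff p j * poly.coeff q i else 0) * \<zeta> ^ l)"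
  unfolding fourier_def using g by (simp add: gconv_power_poly sum_distrib_right)
 also have "\<dots> = (\<Sum>j\<le>Polynomial.degree p. \<Sum>l < ord g. \<Sum>i\<le>Polynomial.degree q. (if g [^] (j + i) = g [^] l then poly.coeff p j * poly.coeff q i else 0) * \<zeta> ^ l)"
  by (rule sum.swap)
 also have "\<dots> = (\<Sum>j\<le>Polynomial.degree p. \<Sum>i\<le>Polynomial.degree q. \<Sum>l < ord g. (if g [^] (j + i) = g [^] l then poly.coeff p j * poly.coeff q i else 0) * \<zeta> ^ l)"
  by (intro sum.cong[OF refl] sum.swap)
 also have "\<dots> = (\<Sum>j\<le>Polynomial.degree p. \<Sum>i\<le>Polynomial.degree q. (poly.coeff p j * \<zeta> ^ j) * (poly.coeff q i * \<zeta> ^ i))"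
  unfolding sum_power_delta[OF z] power_add by (intro sum.cong refl) (simp add: mult_ac)
 also have "\<dots> = poly p \<zeta> * poly q \<zeta>" unfolding poly_altdef sum_product ..
 finally show ?thesis .
qed

lemma gconv_power_poly_outside:
 assumes "x \<in> carrier G" "x \<notin> powers g"
 shows "gconv G (power_poly G g p) (power_poly G g q) x = 0"
 unfolding gconv_power_poly[OF assms(1)] using assms(2) by (intro sum.neutral ballI) auto

lemma sum_root_of_unity:
 assumes "\<zeta> ^ ord g = (1::complex)" "\<zeta> \<noteq> 1" shows "(\<Sum>l < ord g. \<zeta> ^ l) = 0"
 using assms by (simp add: geometric_sum)

text \<open>The values at all roots of unity of order dividing \<open>ord g\<close> determine a
  polynomial of degree below \<open>ord g\<close>, whose coefficients are the values of u on
  <g>.\<close>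

lemma fourier_inj:
 assumes eq: "\<And>\<zeta>. \<zeta> ^ ord g = 1 \<Longrightarrow> fourier G g u \<zeta> = fourier G g v \<zeta>" and x: "x \<in> powers g"
 shows "u x = v x"
proof -
 define P where "P w = (\<Sum>l < ord g. monom (w (g [^] l)) l)" for w :: "'a \<Rightarrow> complex"
 have pP: "poly (P w) \<zeta> = fourier G g w \<zeta>" for w \<zeta> unfolding P_def fourier_def by (simp add: poly_sum poly_monom)
 have deg: "Polynomial.degree (P w) < ord g" for w
 proof -
  have "Polynomial.degree (P w) \<le> ord g - 1" unfolding P_def by (rule degree_sum_le) (auto intro: order_trans[OF degree_monom_le])
  thus ?thesis using ord_pos by simp
 qed
 have card: "card {\<zeta> :: complex. \<zeta> ^ ord g = 1} = ord g" by (rule card_roots_unity_eq) (use ord_pos in simp)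
 have "P u = P v" by (rule poly_eqI_degree[of "{\<zeta>. \<zeta> ^ ord g = 1}"]) (use eq deg card in \<open>simp_all add: pP\<close>)
 obtain n :: nat where n: "x = g [^] n" using x by blast
 define l where "l = n mod ord g"
 have l: "l < ord g" "x = g [^] l" using ord_pos nat_pow_mod[OF g pow_ord_eq_1[OF g], of n] n by (simp_all add: l_def)
 have c: "poly.coeff (P w) l = w x" for w
 proof -
  have "poly.coeff (P w) l = (\<Sum>i < ord g. if i = l then w (g [^] i) else 0)" unfolding P_def by (simp add: coeff_sum)
  thus ?thesis using l by (simp add: sum.delta)
 qed
 show ?thesis using c[of u] c[of v] \<open>P u = P v\<close> by simp
qed

text \<open>If <g> = G, the value at \<zeta> = 1 is free and is absorbed by the constant. If <g> is
  proper, the value at 1 is prescribed as well and the constant is 0, in agreement with w = 0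
  outside <g>.\<close>

lemma delta_mod_const:
 assumes sup: "\<And>x. x \<in> carrier G \<Longrightarrow> x \<notin> powers g \<Longrightarrow> w x = 0"
  and one: "\<And>\<zeta>. \<zeta> ^ ord g = 1 \<Longrightarrow> \<zeta> \<noteq> 1 \<or> powers g \<noteq> carrier G \<Longrightarrow> fourier G g w \<zeta> = 1"
 shows "\<exists>c. \<forall>x\<in>carrier G. w x = (if x = \<one> then 1 else 0) + c"
proof -
 \<comment> \<open>On <g> the constant c contributes c * \<open>ord g\<close> at \<zeta> = 1 and 0
   at all other roots, so this choice gives agreement at 1.\<close>
 define c where "c = (fourier G g w 1 - 1) / of_nat (ord g)"
 have fd: "fourier G g (\<lambda>x. (if x = \<one> then 1 else 0) + c) \<zeta> = 1 + c * (\<Sum>l < ord g. \<zeta> ^ l)" if z: "\<zeta> ^ ord g = 1" for \<zeta>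
 proof -
  have "fourier G g (\<lambda>x. (if x = \<one> then 1 else 0) + c) \<zeta>
    = (\<Sum>l < ord g. (if g [^] (0::nat) = g [^] l then 1 else 0) * \<zeta> ^ l) + c * (\<Sum>l < ord g. \<zeta> ^ l)"
   unfolding fourier_def by (simp add: ring_distribs sum.distrib sum_distrib_left eq_commute)
  thus ?thesis unfolding sum_power_delta[OF z] by simp
 qed
 have f: "fourier G g w \<zeta> = fourier G g (\<lambda>x. (if x = \<one> then 1 else 0) + c) \<zeta>" if z: "\<zeta> ^ ord g = 1" for \<zeta>
 proof (cases "\<zeta> = 1")
  case True
  have "c * of_nat (ord g) = fourier G g w 1 - 1" using ord_pos by (simp add: c_def)
  moreover have "fourier G g (\<lambda>x. (if x = \<one> then 1 else 0) + c) 1 = 1 + c * of_nat (ord g)" using fd[of 1] by simp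
  ultimately show ?thesis unfolding True by simp
 next
  case False
  thus ?thesis unfolding fd[OF z] sum_root_of_unity[OF z False] using one[OF z] by simp
 qed
 have onH: "w x = (if x = \<one> then 1 else 0) + c" if "x \<in> powers g" for x by (rule fourier_inj[OF f that])
 show ?thesis
 proof (cases "powers g = carrier G")
  case True
  thus ?thesis using onH by blast
 next
  case False
  hence "fourier G g w 1 = 1" by (intro one) simp_all
  hence c0: "c = 0" by (simp add: c_def)
  have "\<one> \<in> powers g" by (rule range_eqI[of _ _ 0]) simp
  hence "w x = (if x = \<one> then 1 else 0) + c" if "x \<in> carrier G" for x using onH[of x] sup[OF that] c0 by (cases "x \<in> powers g") auto
  thus ?thesis by blast
 qed
qed

text \<open>p and q have to be inverse only at the characters that survive in the quotient: all
  characters of <g> if it is proper, the nontrivial ones if it is G.\<close>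

theorem cyclic_unit_trivial:
 assumes triv: "complex_only_trivial_units R G" and k: "ord g > 1"
  and R: "0 \<in> R" "\<And>a b. a \<in> R \<Longrightarrow> b \<in> R \<Longrightarrow> a + b \<in> R"
  and p: "\<And>i. poly.coeff p i \<in> R" and q: "\<And>i. poly.coeff q i \<in> R"
  and pq: "\<And>\<zeta>. \<zeta> ^ ord g = 1 \<Longrightarrow> \<zeta> \<noteq> 1 \<or> powers g \<noteq> carrier G \<Longrightarrow> poly p \<zeta> * poly q \<zeta> = 1"
 shows "\<exists>r\<in>R. \<exists>j. r \<noteq> 0 \<and> inverse r \<in> R \<and>
  (\<forall>\<zeta>. \<zeta> ^ ord g = 1 \<longrightarrow> \<zeta> \<noteq> 1 \<or> powers g \<noteq> carrier G \<longrightarrow> poly p \<zeta> = r * \<zeta> ^ j)"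
proof -
 let ?H = "powers g"
 let ?u = "power_poly G g p" and ?v = "power_poly G g q"
 have mem: "power_poly G g s x \<in> R" if s: "\<And>i. poly.coeff s i \<in> R" for s x
 proof -
  have "(\<Sum>i\<in>A. if g [^] (i::nat) = x then poly.coeff s i else 0) \<in> R" if "finite A" for A
   using that by (induction A rule: finite_induct) (simp_all add: R s)
  thus ?thesis unfolding power_poly_def by simp
 qed
 have "inverse_mod_Sigma G ?u ?v" unfolding inverse_mod_Sigma_def
 proof
  show "\<exists>c. \<forall>x\<in>carrier G. gconv G ?u ?v x = (if x = \<one> then 1 else 0) + c"
   by (rule delta_mod_const) (simp_all add: gconv_power_poly_outside fourier_gconv pq)
  show "\<exists>c. \<forall>x\<in>carrier G. gconv G ?v ?u x = (if x = \<one> then 1 else 0) + c"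
   by (rule delta_mod_const) (simp_all add: gconv_power_poly_outside fourier_gconv pq mult.commute[of "poly q _"])
 qed
 moreover have "?u \<in> carrier G \<rightarrow> R" "?v \<in> carrier G \<rightarrow> R" by (rule funcsetI, rule mem, rule p q)+
 ultimately have "trivial_mod_Sigma R G ?u" using triv unfolding complex_only_trivial_units_def by blast
 then obtain r a d where r: "r \<in> R" "r \<noteq> 0" "inverse r \<in> R" and a: "a \<in> carrier G"
  and u: "\<And>x. x \<in> carrier G \<Longrightarrow> ?u x = (if x = a then r else 0) + d"
  unfolding trivial_mod_Sigma_def by blast
 have fu: "poly p \<zeta> = (\<Sum>l < ord g. (if g [^] l = a then r else 0) * \<zeta> ^ l) + d * (\<Sum>l < ord g. \<zeta> ^ l)" if z: "\<zeta> ^ ord g = 1" for \<zeta>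
  unfolding fourier_power_poly[OF z, symmetric] fourier_def using g by (simp add: u ring_distribs sum.distrib sum_distrib_left)
 \<comment> \<open>Otherwise u is constant on <g>, and p would vanish at a nontrivial root of unity,
   where it is invertible.\<close>
 have aH: "a \<in> ?H"
 proof (rule ccontr)
  assume "a \<notin> ?H"
  hence ne: "g [^] l \<noteq> a" for l :: nat by blast
  have "card {\<zeta> :: complex. \<zeta> ^ ord g = 1} = ord g" by (rule card_roots_unity_eq) (use ord_pos in simp)
  hence "\<not> {\<zeta> :: complex. \<zeta> ^ ord g = 1} \<subseteq> {1}" using k card_mono[of "{1::complex}" "{\<zeta>. \<zeta> ^ ord g = 1}"] by auto
  then obtain \<zeta> :: complex where z: "\<zeta> ^ ord g = 1" "\<zeta> \<noteq> 1" by blast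
  have "poly p \<zeta> = 0" unfolding fu[OF z(1)] sum_root_of_unity[OF z] by (simp add: ne)
  thus False using pq[OF z(1)] z(2) by simp
 qed
 then obtain j :: nat where j: "a = g [^] j" by blast
 have "poly p \<zeta> = r * \<zeta> ^ j" if z: "\<zeta> ^ ord g = 1" and o: "\<zeta> \<noteq> 1 \<or> ?H \<noteq> carrier G" for \<zeta>
 proof -
  have "(\<Sum>l < ord g. (if g [^] l = a then r else 0) * \<zeta> ^ l) = r * \<zeta> ^ j"
   unfolding j using sum_power_delta[OF z, of j r] by (simp add: eq_commute)
  moreover have "d * (\<Sum>l < ord g. \<zeta> ^ l) = 0"
  proof (cases "\<zeta> = 1")
   case True
   \<comment> \<open>Outside <g> the function vanishes and a does not lie there, so d = 0.\<close>
   hence "?H \<noteq> carrier G" using o by simp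
   moreover have "?H \<subseteq> carrier G" using g by auto
   ultimately obtain x where x: "x \<in> carrier G" "x \<notin> ?H" by blast
   have "x \<noteq> a" using aH x(2) by blast
   hence "d = 0" using u[OF x(1)] power_poly_outside[OF x(2), of p] \<open>x \<noteq> a\<close> by simp
   thus ?thesis by simp
  qed (simp add: sum_root_of_unity[OF z])
  ultimately show ?thesis unfolding fu[OF z] by simp
 qed
 thus ?thesis using r by blast
qed

end

end

section \<open>Explicit units that exclude element orders\<close>

context complex_number_field
begin

definition ints :: "complex set" where "ints = {z \<in> F. algebraic_int z}"

lemma intsI: "z \<in> F \<Longrightarrow> algebraic_int z \<Longrightarrow> z \<in> ints" by (simp add: ints_def)
lemma ints_F: "z \<in> ints \<Longrightarrow> z \<in> F" by (simp add: ints_def)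
lemma ints_algebraic: "z \<in> ints \<Longrightarrow> algebraic_int z" by (simp add: ints_def)
lemma ints_add: "x \<in> ints \<Longrightarrow> y \<in> ints \<Longrightarrow> x + y \<in> ints" by (simp add: ints_def add_mem algebraic_int_add)
lemma ints_diff: "x \<in> ints \<Longrightarrow> y \<in> ints \<Longrightarrow> x - y \<in> ints" by (simp add: ints_def diff_mem algebraic_int_diff)
lemma ints_mult: "x \<in> ints \<Longrightarrow> y \<in> ints \<Longrightarrow> x * y \<in> ints" by (simp add: ints_def mult_mem algebraic_int_mult)
lemma ints_minus: "x \<in> ints \<Longrightarrow> - x \<in> ints" by (simp add: ints_def minus_mem)
lemma ints_of_int: "of_int k \<in> ints" by (simp add: ints_def of_int_mem)
lemma ints_of_nat: "of_nat k \<in> ints" by (simp add: ints_def of_nat_mem)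
lemma ints_0: "0 \<in> ints" using ints_of_int[of 0] by simp
lemma ints_1: "1 \<in> ints" using ints_of_int[of 1] by simp
lemma ints_numeral: "numeral n \<in> ints" using ints_of_int[of "numeral n"] by simp
lemma ints_sum: "(\<And>i. i \<in> A \<Longrightarrow> f i \<in> ints) \<Longrightarrow> sum f A \<in> ints"
 by (induction A rule: infinite_finite_induct) (simp_all add: ints_0 ints_add)

lemmas ints_intros = ints_add ints_diff ints_mult ints_minus ints_of_int ints_of_nat ints_0 ints_1 ints_numeral

definition coeffs_in :: "complex poly \<Rightarrow> bool" where "coeffs_in p \<longleftrightarrow> (\<forall>i. poly.coeff p i \<in> ints)"

lemma coeffs_in_add: "coeffs_in p \<Longrightarrow> coeffs_in q \<Longrightarrow> coeffs_in (p + q)" by (simp add: coeffs_in_def ints_add)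
lemma coeffs_in_diff: "coeffs_in p \<Longrightarrow> coeffs_in q \<Longrightarrow> coeffs_in (p - q)" by (simp add: coeffs_in_def ints_diff)
lemma coeffs_in_mult: "coeffs_in p \<Longrightarrow> coeffs_in q \<Longrightarrow> coeffs_in (p * q)"
 by (simp add: coeffs_in_def coeff_mult ints_sum ints_mult)
lemma coeffs_in_monom: "c \<in> ints \<Longrightarrow> coeffs_in (monom c n)" by (simp add: coeffs_in_def ints_0)
lemma coeffs_in_smult: "c \<in> ints \<Longrightarrow> coeffs_in p \<Longrightarrow> coeffs_in (Polynomial.smult c p)" by (simp add: coeffs_in_def ints_mult)
lemma coeffs_in_power: "coeffs_in p \<Longrightarrow> coeffs_in (p ^ n)"
 by (induction n) (simp_all add: coeffs_in_mult, use coeffs_in_monom[OF ints_1, of 0] in simp)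
lemma coeffs_in_sum: "(\<And>i. i \<in> A \<Longrightarrow> coeffs_in (f i)) \<Longrightarrow> coeffs_in (sum f A)"
 by (simp add: coeffs_in_def coeff_sum ints_sum)

lemmas coeffs_in_intros = coeffs_in_add coeffs_in_diff coeffs_in_mult coeffs_in_smult coeffs_in_power coeffs_in_sum coeffs_in_monom

text \<open>The unit and its inverse are both needed in the form 1 + k * x with integral x, since
  both supply coefficients for a pair of mutually inverse polynomials.\<close>

lemma exists_unit_pair:
 fixes k :: nat
 assumes k: "k > 0" and o: "outer_emb \<noteq> {}"
 shows "\<exists>u v a b. u * v = 1 \<and> u = 1 + of_nat k * a \<and> v = 1 + of_nat k * b \<and> a \<in> ints \<and> b \<in> ints \<and> v \<in> ints \<and> cmod u > 1 \<and>
  (\<forall>\<sigma>\<in>outer_emb. cmod (\<sigma> u) < 1)"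
proof -
 obtain u where u: "u \<in> F" "u \<noteq> 0" "algebraic_int u" "algebraic_int (inverse u)"
  "algebraic_int ((u - 1) / of_nat k)" "cmod u > 1" "\<forall>\<sigma>\<in>outer_emb. cmod (\<sigma> u) < 1"
  using exists_unit_outer[OF assms] by blast
 define a where "a = (u - 1) / of_nat k"
 have a: "a \<in> ints" unfolding a_def by (intro intsI divide_mem diff_mem one_mem of_nat_mem u)
 have v: "inverse u \<in> ints" by (intro intsI inverse_mem u)
 have ua: "u = 1 + of_nat k * a" using k by (simp add: a_def)
 have "inverse u = 1 + of_nat k * - (a * inverse u)"
 proof -
  have "u * (1 + of_nat k * - (a * inverse u)) = u - of_nat k * a" using u(2) by (simp add: algebra_simps)
  also have "\<dots> = 1" using ua by simp
  finally show ?thesis by (rule inverse_unique)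
 qed
 moreover have "- (a * inverse u) \<in> ints" by (intro ints_intros a v)
 moreover have "u * inverse u = 1" using u(2) by simp
 ultimately show ?thesis using ua a u(6,7) v by blast
qed

end

lemma exists_nontrivial_root: "k > 1 \<Longrightarrow> \<exists>\<zeta>::complex. \<zeta> ^ k = 1 \<and> \<zeta> \<noteq> 1"
proof -
 assume k: "k > 1"
 have "card {\<zeta> :: complex. \<zeta> ^ k = 1} = k" by (rule card_roots_unity_eq) (use k in simp)
 hence "\<not> {\<zeta> :: complex. \<zeta> ^ k = 1} \<subseteq> {1}" using k card_mono[of "{1::complex}" "{\<zeta>. \<zeta> ^ k = 1}"] by auto
 thus ?thesis by blast
qed

lemma root_of_unity_norm: "\<zeta> ^ k = 1 \<Longrightarrow> k > 0 \<Longrightarrow> cmod \<zeta> = 1" using power_eq_1_iff[of \<zeta> k] by auto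

lemma norm_mult_root: "\<zeta> ^ k = 1 \<Longrightarrow> k > 0 \<Longrightarrow> cmod (r * \<zeta> ^ j) = cmod r"
 by (simp add: norm_mult norm_power root_of_unity_norm)

text \<open>The sum over the cyclic subgroup: its value is k at 1 and 0 at every other k-th root of
  unity, so multiples of it correct the value at 1 alone.\<close>

definition cyc :: "nat \<Rightarrow> complex poly" where "cyc k = (\<Sum>i<k. monom 1 i)"

lemma poly_cyc: "poly (cyc k) \<zeta> = (\<Sum>i<k. \<zeta> ^ i)" by (simp add: cyc_def poly_sum poly_monom)

lemma cis_root: "k > 0 \<Longrightarrow> cis (2 * pi / real k) ^ k = 1" by (simp add: DeMoivre)

lemma norm_cis_minus_1: "(cmod (cis t - 1))\<^sup>2 = 2 - 2 * cos t"
 using sin_cos_squared_add[of t] unfolding cmod_power2 by (simp add: power2_eq_square algebra_simps)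

lemma norm_cis_plus_1: "(cmod (1 + cis t))\<^sup>2 = 2 + 2 * cos t"
 using sin_cos_squared_add[of t] unfolding cmod_power2 by (simp add: power2_eq_square algebra_simps)

text \<open>2 * a < k keeps both angles in the interval from 0 to pi, where the cosine is injective.
  Distinct cosines mean distinct moduli of cis t - 1 and of 1 + cis t.\<close>

lemma cos_neq:
 assumes "k \<ge> 5" "1 < a" "2 * a < (k::nat)" shows "cos (2 * pi * real a / real k) \<noteq> cos (2 * pi / real k)"
proof -
 have "2 * real a < real k" using assms(3) by linarith
 hence "2 * real a / real k \<le> 1" using assms(1) by (simp add: field_simps)
 hence "pi * (2 * real a / real k) \<le> pi * 1" by (intro mult_left_mono) simp_all
 hence "2 * pi * real a / real k \<le> pi" by (simp add: field_simps)
 moreover have "2 * pi * 1 / real k < 2 * pi * real a / real k" using assms by (intro divide_strict_right_mono mult_strict_left_mono) simp_all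
 ultimately have "cos (2 * pi * real a / real k) < cos (2 * pi * 1 / real k)" by (intro cos_monotone_0_pi) simp_all
 thus ?thesis by simp
qed

text \<open>For odd k take 2. For even k take the largest odd number a below k / 2: then k is 2 * a
  + 2 or 2 * a + 4, so a common divisor is odd and divides 4. For k = 6 this number would be
  1.\<close>

lemma exists_bass_multiplier:
 assumes "k \<ge> 5" "k \<noteq> 6" shows "\<exists>a. coprime a k \<and> 1 < a \<and> 2 * a < (k::nat)"
proof (cases "odd k")
 case True
 thus ?thesis using assms by (intro exI[of _ 2]) auto
next
 case False
 obtain l where l: "k = 2 * l" using False by (auto elim: evenE)
 define j where "j = l div 2"
 have j: "l = 2 * j \<or> l = 2 * j + 1" "j \<ge> 2" using assms l by (auto simp: j_def)
 then obtain i where i: "j = Suc (Suc i)" by (metis add_2_eq_Suc le_Suc_ex)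
 define a where "a = 2 * i + 3"
 have "coprime a k"
 proof (rule coprimeI)
  fix c assume c: "c dvd a" "c dvd k"
  have "k = 2 * a + 2 \<or> k = 2 * a + 4" using j(1) by (auto simp: l i a_def)
  hence "c dvd 2 \<or> c dvd 4" using c by (metis dvd_add_right_iff dvd_mult)
  hence c4: "c dvd 2 ^ 2" by (auto intro: dvd_trans[of c 2])
  have "odd c"
  proof
   assume "even c"
   hence "even a" using c(1) dvd_trans by blast
   thus False by (simp add: a_def)
  qed
  hence "coprime c 2" by (simp add: coprime_right_2_iff_odd)
  hence "coprime c (2 ^ 2)" by (simp only: coprime_power_right_iff) simp
  thus "is_unit c" using c4 by (metis coprime_absorb_left)
 qed
 moreover have "1 < a" "2 * a < k" using j(1) by (auto simp: l i a_def)
 ultimately show ?thesis by blast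
qed

lemma exists_power_1_mod:
 assumes "coprime a (k::nat)" "k > 0" shows "\<exists>m>0. int k dvd 1 - int a ^ m"
proof (intro exI conjI)
 show "totient k > 0" using assms(2) by simp
 have "[int a ^ totient k = 1] (mod int k)" using euler_theorem[OF assms(1)] by (simp flip: cong_int_iff)
 thus "int k dvd 1 - int a ^ totient k" by (simp add: cong_iff_dvd_diff dvd_diff_commute)
qed

locale trivial_unit_group = complex_number_field F + group G for F :: "complex set" and G :: "('g, 'n) monoid_scheme" (structure) +
 assumes finG: "finite (carrier G)" and triv: "complex_only_trivial_units ints G"
begin

text \<open>Of the values r * \<zeta>^j of a trivial unit only the modulus is kept, because the
  exclusions compare nothing else.\<close>

lemma unit_from_polys:
 assumes "g \<in> carrier G" "ord g > 1" "coeffs_in p" "coeffs_in q"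
  "\<And>\<zeta>. \<zeta> ^ ord g = 1 \<Longrightarrow> \<zeta> \<noteq> 1 \<or> powers g \<noteq> carrier G \<Longrightarrow> poly p \<zeta> * poly q \<zeta> = 1"
 obtains r where "r \<in> ints" "r \<noteq> 0" "inverse r \<in> ints"
  "\<And>\<zeta>::complex. \<zeta> ^ ord g = 1 \<Longrightarrow> \<zeta> \<noteq> 1 \<or> powers g \<noteq> carrier G \<Longrightarrow> cmod (poly p \<zeta>) = cmod r"
proof -
 have "\<exists>r\<in>ints. \<exists>j. r \<noteq> 0 \<and> inverse r \<in> ints \<and>
  (\<forall>\<zeta>. \<zeta> ^ ord g = 1 \<longrightarrow> \<zeta> \<noteq> 1 \<or> powers g \<noteq> carrier G \<longrightarrow> poly p \<zeta> = r * \<zeta> ^ j)"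
  by (rule cyclic_unit_trivial[where q = q, OF finG assms(1) triv assms(2) ints_0 ints_add])
   (use assms(3,4) in \<open>simp_all add: coeffs_in_def assms(5)\<close>)
 then obtain r j where r: "r \<in> ints" "r \<noteq> 0" "inverse r \<in> ints"
  "\<And>\<zeta>. \<zeta> ^ ord g = 1 \<Longrightarrow> \<zeta> \<noteq> 1 \<or> powers g \<noteq> carrier G \<Longrightarrow> poly p \<zeta> = r * \<zeta> ^ j" by blast
 show thesis
 proof (rule that[OF r(1-3)])
  fix \<zeta> :: complex assume z: "\<zeta> ^ ord g = 1" "\<zeta> \<noteq> 1 \<or> powers g \<noteq> carrier G"
  show "cmod (poly p \<zeta>) = cmod r" unfolding r(4)[OF z] by (rule norm_mult_root[OF z(1)]) (use assms(2) in simp)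
 qed
qed

lemma outer_generates:
 assumes o: "outer_emb \<noteq> {}" and g: "g \<in> carrier G" "g \<noteq> \<one>"
 shows "powers g = carrier G"
proof (rule ccontr)
 assume ne: "powers g \<noteq> carrier G"
 define k where "k = ord g"
 have "k \<noteq> 1" using ord_eq_1[OF g(1)] g(2) by (simp add: k_def)
 moreover have "k > 0" unfolding k_def by (rule ord_pos[OF finG g(1)])
 ultimately have k: "k > 1" by simp
 obtain u v a b where u: "u * v = 1" "u = 1 + of_nat k * a" "v = 1 + of_nat k * b" "a \<in> ints" "b \<in> ints" "cmod u > 1"
  using exists_unit_pair[OF \<open>k > 0\<close> o] by blast
 define P where "P a = monom 1 0 + Polynomial.smult a (cyc k)" for a
 have ci: "coeffs_in (P a)" if "a \<in> ints" for a unfolding P_def cyc_def by (intro coeffs_in_intros ints_1 that)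
 \<comment> \<open>With this a the value is u at 1 and 1 at every other root. As <g> is proper, the
   root 1 counts too.\<close>
 have ev: "poly (P a) \<zeta> = (if \<zeta> = 1 then 1 + of_nat k * a else 1)" if "\<zeta> ^ k = 1" for a \<zeta>
  using that by (simp add: P_def poly_monom poly_cyc geometric_sum)
 obtain r where r: "\<And>\<zeta>. \<zeta> ^ ord g = 1 \<Longrightarrow> \<zeta> \<noteq> 1 \<or> powers g \<noteq> carrier G \<Longrightarrow> cmod (poly (P a) \<zeta>) = cmod r"
  by (rule unit_from_polys[OF g(1) k[unfolded k_def] ci[OF u(4)] ci[OF u(5)]])
   (use u in \<open>simp_all add: ev flip: k_def\<close>)
 obtain \<zeta> :: complex where z: "\<zeta> ^ k = 1" "\<zeta> \<noteq> 1" using exists_nontrivial_root[OF k] by blast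
 have "cmod (P_poly) = cmod r" if "P_poly = poly (P a) \<zeta>" for P_poly using r[of \<zeta>] z that by (simp flip: k_def)
 hence "cmod r = 1" unfolding ev[OF z(1)] using z(2) by simp
 moreover have "cmod (poly (P a) 1) = cmod r" using r[of 1] ne by simp
 hence "cmod r = cmod u" using ev[of 1 a] u(2) by simp
 ultimately show False using u(6) by simp
qed

text \<open>For \<zeta> \<noteq> 1 the value 1 + \<zeta> is inverse to the sum of \<zeta>^(2 * i)
  over i < (k + 1) / 2, because \<zeta>^(k + 1) = \<zeta>. The value 2 at \<zeta> = 1 is exempt
  since g generates G. For k \<ge> 5 the moduli at the first primitive root and at its square
  differ.\<close>

lemma odd_cyclic:
 assumes g: "g \<in> carrier G" and gen: "powers g = carrier G" and odd: "odd (ord g)"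
 shows "ord g \<le> 3"
proof (rule ccontr)
 assume "\<not> ord g \<le> 3"
 define k where "k = ord g"
 have "k > 3" using \<open>\<not> ord g \<le> 3\<close> by (simp add: k_def)
 moreover have "k \<noteq> 4" using odd by (auto simp: k_def)
 ultimately have k: "k \<ge> 5" by simp
 obtain m' where "k = 2 * m' + 1" using odd unfolding k_def by (rule oddE)
 then obtain m where m: "k + 1 = 2 * m" by (intro that[of "m' + 1"]) simp
 define p where "p = monom 1 0 + monom (1::complex) 1"
 define q where "q = (\<Sum>i<m. monom (1::complex) (2 * i))"
 have ci: "coeffs_in p" "coeffs_in q" unfolding p_def q_def by (intro coeffs_in_intros ints_1)+
 have pq: "poly p \<zeta> * poly q \<zeta> = 1" if z: "\<zeta> ^ k = 1" "\<zeta> \<noteq> 1" for \<zeta>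
 proof -
  have q: "poly q \<zeta> = (\<Sum>i<m. (\<zeta>\<^sup>2) ^ i)" by (simp add: q_def poly_sum poly_monom power_mult)
  have "(1 - \<zeta>\<^sup>2) * poly q \<zeta> = 1 - (\<zeta>\<^sup>2) ^ m" unfolding q by (rule one_diff_power_eq[symmetric])
  also have "(\<zeta>\<^sup>2) ^ m = \<zeta> ^ (k + 1)" unfolding m by (simp only: power_mult)
  also have "\<dots> = \<zeta>" using z by simp
  finally have "(1 - \<zeta>) * (poly p \<zeta> * poly q \<zeta>) = (1 - \<zeta>) * 1"
   by (simp add: p_def poly_monom power2_eq_square algebra_simps)
  thus ?thesis using z(2) by (simp only: mult_cancel_left) simp
 qed
 obtain r where r: "\<And>\<zeta>. \<zeta> ^ ord g = 1 \<Longrightarrow> \<zeta> \<noteq> 1 \<or> powers g \<noteq> carrier G \<Longrightarrow> cmod (poly p \<zeta>) = cmod r"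
  by (rule unit_from_polys[OF g _ ci]) (use k gen in \<open>simp_all add: pq flip: k_def\<close>)
 have val: "(cmod (poly p (cis t)))\<^sup>2 = 2 + 2 * cos t" for t using norm_cis_plus_1[of t] by (simp add: p_def poly_monom)
 have ne1: "cis t \<noteq> 1" if "0 < t" "t \<le> pi" for t
 proof -
  have "cos t < cos 0" using that by (intro cos_monotone_0_pi) simp_all
  thus ?thesis by (auto simp: complex_eq_iff)
 qed
 let ?t = "2 * pi / real k"
 have t: "0 < ?t" "?t \<le> pi" "0 < 2 * ?t" "2 * ?t \<le> pi" using k by (simp_all add: field_simps)
 have c1: "cis ?t ^ k = 1" by (rule cis_root) (use k in simp)
 have "cis (2 * ?t) = (cis ?t)\<^sup>2" by (simp only: DeMoivre of_nat_numeral)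
 hence c2: "cis (2 * ?t) ^ k = 1" using c1 by (metis power_commutes power_mult power_one mult.commute)
 have "cmod (poly p (cis ?t)) = cmod (poly p (cis (2 * ?t)))"
  using r[of "cis ?t"] r[of "cis (2 * ?t)"] c1 c2 ne1[OF t(1,2)] ne1[OF t(3,4)] by (simp flip: k_def)
 hence "cos ?t = cos (2 * ?t)" using val[of ?t] val[of "2 * ?t"] by simp
 moreover have "cos (2 * pi * real 2 / real k) \<noteq> cos (2 * pi / real k)" by (rule cos_neq) (use k in simp_all)
 ultimately show False by (simp add: mult.commute)
qed

text \<open>The Bass cyclic units \<open>(1 + g + \<dots> + g\<^sup>a\<^sup>-\<^sup>1)\<^sup>m + ((1 - a\<^sup>m) / k) (1 + g + \<dots> + g\<^sup>k\<^sup>-\<^sup>1)\<close>.\<close>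

lemma ord_cases:
 assumes g: "g \<in> carrier G" and U: "\<And>r. r \<in> ints \<Longrightarrow> inverse r \<in> ints \<Longrightarrow> r \<noteq> 0 \<Longrightarrow> cmod r = 1"
 shows "ord g \<in> {1, 2, 3, 4, 6}"
proof (rule ccontr)
 assume n: "ord g \<notin> {1, 2, 3, 4, 6}"
 define k where "k = ord g"
 have "k > 0" unfolding k_def by (rule ord_pos[OF finG g])
 moreover have "k \<noteq> 1" "k \<noteq> 2" "k \<noteq> 3" "k \<noteq> 4" "k \<noteq> 6" using n by (simp_all add: k_def)
 ultimately have k: "k \<ge> 5" "k \<noteq> 6" "k > 0" by linarith+
 obtain a where a: "coprime a k" "1 < a" "2 * a < k" using exists_bass_multiplier[OF k(1,2)] by blast
 obtain m where m: "m > 0" "int k dvd 1 - int a ^ m" using exists_power_1_mod[OF a(1) k(3)] by blast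
 \<comment> \<open>An inverse of a modulo k, since a * b = a^m is 1 modulo k. The second geometric
   sum, in \<zeta>^a with b terms, then inverts the first.\<close>
 define b where "b = a ^ (m - 1)"
 have ab: "a * b = a ^ m" unfolding b_def by (subst mult.commute) (rule power_minus_mult[OF m(1)])
 have dvd_pow: "int k dvd 1 - x ^ n" if "int k dvd 1 - x" for x n
 proof -
  have "1 - x ^ n = (1 - x) * (\<Sum>i<n. x ^ i)" by (rule one_diff_power_eq)
  thus ?thesis using that by simp
 qed
 have bm: "int k dvd 1 - int b ^ m"
 proof -
  have "int b ^ m = (int a ^ m) ^ (m - 1)" by (simp add: b_def mult.commute flip: power_mult)
  thus ?thesis using dvd_pow[OF m(2)] by simp
 qed
 obtain c where c: "1 - int a ^ m = int k * c" using m(2) by (rule dvdE)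
 obtain d where d: "1 - int b ^ m = int k * d" using bm by (rule dvdE)
 \<comment> \<open>The multiple of \<open>cyc k\<close> changes only the value at 1, which becomes
   a^m + c * k = 1; the same holds for q with b and d.\<close>
 define p where "p = (\<Sum>i<a. monom (1::complex) i) ^ m + Polynomial.smult (of_int c) (cyc k)"
 define q where "q = (\<Sum>i<b. monom (1::complex) (a * i)) ^ m + Polynomial.smult (of_int d) (cyc k)"
 have ci: "coeffs_in p" "coeffs_in q" unfolding p_def q_def cyc_def by (intro coeffs_in_intros ints_1 ints_of_int)+
 have pp: "poly p \<zeta> = (\<Sum>i<a. \<zeta> ^ i) ^ m + of_int c * (\<Sum>i<k. \<zeta> ^ i)" for \<zeta>
  by (simp add: p_def poly_sum poly_monom poly_power poly_cyc)
 have qq: "poly q \<zeta> = (\<Sum>i<b. (\<zeta> ^ a) ^ i) ^ m + of_int d * (\<Sum>i<k. \<zeta> ^ i)" for \<zeta>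
  by (simp add: q_def poly_sum poly_monom poly_power poly_cyc power_mult)
 have zab: "\<zeta> ^ (a * b) = \<zeta>" if z: "\<zeta> ^ k = 1" for \<zeta> :: complex
 proof -
  have "a ^ m > 0" using a(2) by simp
  hence le: "1 \<le> a ^ m" by linarith
  have "int (a ^ m - 1) = int a ^ m - 1" unfolding of_nat_diff[OF le] by simp
  moreover have "int k dvd int a ^ m - 1" using m(2) by (simp only: dvd_diff_commute)
  ultimately have "int k dvd int (a ^ m - 1)" by simp
  hence "k dvd a ^ m - 1" by (simp only: int_dvd_int_iff)
  then obtain e where e: "a ^ m - 1 = k * e" by (rule dvdE)
  hence "a * b = k * e + 1" using \<open>a ^ m > 0\<close> ab by linarith
  thus ?thesis using z by (simp add: power_mult)
 qed
 have one: "\<zeta> = 1 \<Longrightarrow> poly p \<zeta> = 1" "\<zeta> = 1 \<Longrightarrow> poly q \<zeta> = 1" for \<zeta>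
 proof -
  have "complex_of_int (1 - int a ^ m) = of_int (int k * c)" "complex_of_int (1 - int b ^ m) = of_int (int k * d)" by (simp_all only: c d)
  hence "of_nat a ^ m + of_int c * of_nat k = (1::complex)" "of_nat b ^ m + of_int d * of_nat k = (1::complex)" by (simp_all add: algebra_simps)
  thus "\<zeta> = 1 \<Longrightarrow> poly p \<zeta> = 1" "\<zeta> = 1 \<Longrightarrow> poly q \<zeta> = 1" unfolding pp qq by simp_all
 qed
 have z0: "(\<Sum>i<k. \<zeta> ^ i) = 0" if "\<zeta> ^ k = 1" "\<zeta> \<noteq> 1" for \<zeta> :: complex using that by (simp add: geometric_sum)
 have pq: "poly p \<zeta> * poly q \<zeta> = 1" if z: "\<zeta> ^ k = 1" for \<zeta>
 proof (cases "\<zeta> = 1")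
  case False
  let ?s = "\<Sum>i<a. \<zeta> ^ i" and ?t = "\<Sum>i<b. (\<zeta> ^ a) ^ i"
  have "(1 - \<zeta>) * (?s * ?t) = (1 - \<zeta> ^ a) * ?t" by (simp only: one_diff_power_eq[of \<zeta> a] mult.assoc)
  also have "\<dots> = 1 - (\<zeta> ^ a) ^ b" by (rule one_diff_power_eq[symmetric])
  also have "\<dots> = (1 - \<zeta>) * 1" using zab[OF z] by (simp add: power_mult)
  finally have "?s * ?t = 1" using False by (simp only: mult_cancel_left) simp
  hence "?s ^ m * ?t ^ m = 1" by (simp flip: power_mult_distrib)
  thus ?thesis unfolding pp qq z0[OF z False] by simp
 qed (simp add: one)
 obtain r where r: "r \<in> ints" "r \<noteq> 0" "inverse r \<in> ints"
  "\<And>\<zeta>. \<zeta> ^ ord g = 1 \<Longrightarrow> \<zeta> \<noteq> 1 \<or> powers g \<noteq> carrier G \<Longrightarrow> cmod (poly p \<zeta>) = cmod r"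
  by (rule unit_from_polys[OF g _ ci]) (use k in \<open>simp_all add: pq flip: k_def\<close>)
 have r1: "cmod r = 1" by (rule U[OF r(1,3,2)])
 let ?t = "2 * pi / real k"
 let ?z = "cis ?t"
 have zk: "?z ^ k = 1" by (rule cis_root[OF k(3)])
 have t: "0 < ?t" "?t \<le> pi" using k by (simp_all add: field_simps)
 have z1: "?z \<noteq> 1"
 proof -
  have "cos ?t < cos 0" using t by (intro cos_monotone_0_pi) simp_all
  thus ?thesis by (auto simp: complex_eq_iff)
 qed
 have "cmod (poly p ?z) = 1" using r(4)[of ?z] zk z1 r1 by (simp flip: k_def)
 hence "cmod (\<Sum>i<a. ?z ^ i) ^ m = 1" unfolding pp z0[OF zk z1] by (simp add: norm_power)
 hence s1: "cmod (\<Sum>i<a. ?z ^ i) = 1" using m(1) power_eq_1_iff[of "cmod (\<Sum>i<a. ?z ^ i)" m] by simp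
 \<comment> \<open>Modulus 1 of the geometric sum says that 1 - \<zeta>^a and 1 - \<zeta> have the
   same modulus, which contradicts \<open>cos_neq\<close>.\<close>
 have "1 - ?z ^ a = (1 - ?z) * (\<Sum>i<a. ?z ^ i)" by (rule one_diff_power_eq)
 hence "cmod (1 - ?z ^ a) = cmod (1 - ?z)" by (simp add: norm_mult s1)
 hence "cmod (?z ^ a - 1) = cmod (?z - 1)" by (simp add: norm_minus_commute)
 moreover have "?z ^ a = cis (2 * pi * real a / real k)" by (simp add: DeMoivre mult_ac)
 ultimately have "cos (2 * pi * real a / real k) = cos ?t" using norm_cis_minus_1[of ?t] norm_cis_minus_1[of "2 * pi * real a / real k"] by simp
 thus False using cos_neq[OF k(1) a(2,3)] by simp
qed

text \<open>e is 3 times the idempotent of the character g \<mapsto> omega: its value is 3 at omega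
  and 0 at the other cube roots of unity. So 1 + a * e takes the value u at omega and 1 at omega^2,
  and neither root is the exempt root 1.\<close>

lemma no_order_3_outer:
 assumes o: "outer_emb \<noteq> {}" and om: "omega \<in> F" and g: "g \<in> carrier G" "ord g = 3"
 shows False
proof -
 obtain u v a b where u: "u * v = 1" "u = 1 + of_nat 3 * a" "v = 1 + of_nat 3 * b" "a \<in> ints" "b \<in> ints" "cmod u > 1"
  using exists_unit_pair[OF _ o, of 3] by auto
 have oi: "omega \<in> ints" by (intro intsI om algebraic_int_omega)
 define e where "e = monom 1 0 + monom (omega * omega) 1 + monom omega 2"
 have ce: "coeffs_in e" unfolding e_def by (intro coeffs_in_intros ints_intros oi)
 have ee: "poly e \<zeta> = 1 + omega * omega * \<zeta> + omega * (\<zeta> * \<zeta>)" for \<zeta> by (simp add: e_def poly_monom power2_eq_square)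
 have o3: "omega * (omega * omega) = 1" using omega_cube by (simp add: power3_eq_cube mult.assoc)
 have o2: "omega * omega = - 1 - omega" using omega_square by (simp add: power2_eq_square)
 have idem: "poly e \<zeta> * poly e \<zeta> = 3 * poly e \<zeta>" if z: "\<zeta> ^ 3 = 1" for \<zeta>
 proof -
  have z: "\<zeta> * (\<zeta> * \<zeta>) = 1" using z by (simp add: power3_eq_cube mult.assoc)
  have "\<zeta> * (\<zeta> * (\<zeta> * x)) = x" "omega * (omega * (omega * x)) = x" for x
   using arg_cong[OF z, of "\<lambda>y. y * x"] arg_cong[OF o3, of "\<lambda>y. y * x"] by (simp_all add: mult.assoc)
  thus ?thesis unfolding ee by (simp add: ring_distribs mult_ac z o3)
 qed
 have ab: "a + b + 3 * a * b = 0"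
 proof -
  have "(1 + 3 * a) * (1 + 3 * b) = 1" using u(1) unfolding u(2,3) by simp
  hence "3 * (a + b + 3 * a * b) = 0" by (simp add: algebra_simps)
  thus ?thesis by (simp only: mult_eq_0_iff) simp
 qed
 define P where "P a = monom 1 0 + Polynomial.smult a e" for a
 have ci: "coeffs_in (P a)" if "a \<in> ints" for a unfolding P_def by (intro coeffs_in_intros ints_1 that ce)
 have pv: "poly (P a) \<zeta> = 1 + a * poly e \<zeta>" for a \<zeta> by (simp add: P_def poly_monom)
 have pq: "poly (P a) \<zeta> * poly (P b) \<zeta> = 1" if "\<zeta> ^ 3 = 1" for \<zeta>
 proof -
  have "poly (P a) \<zeta> * poly (P b) \<zeta> = 1 + (a + b) * poly e \<zeta> + a * b * (poly e \<zeta> * poly e \<zeta>)"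
   unfolding pv by (simp add: algebra_simps)
  also have "\<dots> = 1 + (a + b + 3 * a * b) * poly e \<zeta>" unfolding idem[OF that] by (simp add: algebra_simps)
  finally show ?thesis unfolding ab by simp
 qed
 obtain r where r: "\<And>\<zeta>. \<zeta> ^ ord g = 1 \<Longrightarrow> \<zeta> \<noteq> 1 \<or> powers g \<noteq> carrier G \<Longrightarrow> cmod (poly (P a) \<zeta>) = cmod r"
  by (rule unit_from_polys[OF g(1) _ ci[OF u(4)] ci[OF u(5)]]) (use g(2) pq in simp_all)
 have on: "omega \<noteq> 1" using Re_omega by auto
 have e1: "poly e omega = 3" unfolding ee using o3 by (simp add: mult.assoc)
 have e2: "poly e (omega * omega) = 0"
 proof -
  have "poly e (omega * omega) = 1 + omega * (omega * (omega * omega)) + omega * (omega * omega) * (omega * omega)"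
   unfolding ee by (simp add: mult_ac)
  thus ?thesis unfolding o3 using o2 by simp
 qed
 have oo: "(omega * omega) ^ 3 = 1" by (simp add: power_mult_distrib omega_cube)
 have oon: "omega * omega \<noteq> 1" unfolding o2 using Im_omega by (auto simp: complex_eq_iff)
 have "cmod r = cmod u" using r[of omega] on by (simp add: g(2) omega_cube pv e1 u(2) mult.commute)
 moreover have "cmod r = 1" using r[of "omega * omega"] oon oo by (simp add: g(2) pv e2)
 ultimately show False using u(6) by simp
qed

end

section \<open>Units of a quadratic extension of a non-real field\<close>

lemma complex_number_field_generator_pair:
 assumes F: "complex_number_field F" and L: "L = {a + b * \<zeta> | a b. a \<in> F \<and> b \<in> F}" and z: "\<zeta> \<noteq> 0"
 shows "\<exists>B. finite B \<and> B \<subseteq> L \<and> (\<forall>x\<in>L. \<exists>q :: complex \<Rightarrow> rat. x = (\<Sum>b\<in>B. of_rat (q b) * b))"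
proof -
 interpret complex_number_field F by fact
 obtain B where B: "finite B" "B \<subseteq> F" "\<forall>x\<in>F. \<exists>q :: complex \<Rightarrow> rat. x = (\<Sum>b\<in>B. of_rat (q b) * b)"
  using finite_span by blast
 let ?B' = "(\<lambda>b. b * \<zeta>) ` B"
 have inj: "inj_on (\<lambda>b. b * \<zeta>) B" using z by (simp add: inj_on_def)
 have "B \<subseteq> L"
 proof
  fix b assume "b \<in> B"
  hence "b = b + 0 * \<zeta> \<and> b \<in> F \<and> 0 \<in> F" using B(2) zero_mem by auto
  thus "b \<in> L" unfolding L by blast
 qed
 moreover have "?B' \<subseteq> L"
 proof
  fix x assume "x \<in> ?B'"
  then obtain b where "b \<in> B" "x = b * \<zeta>" by blast
  hence "x = 0 + b * \<zeta> \<and> 0 \<in> F \<and> b \<in> F" using B(2) zero_mem by auto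
  thus "x \<in> L" unfolding L by blast
 qed
 moreover have "\<exists>q :: complex \<Rightarrow> rat. x = (\<Sum>b\<in>B \<union> ?B'. of_rat (q b) * b)" if x: "x \<in> L" for x
 proof -
  obtain c d where cd: "x = c + d * \<zeta>" "c \<in> F" "d \<in> F" using x unfolding L by blast
  obtain q r :: "complex \<Rightarrow> rat" where q: "c = (\<Sum>b\<in>B. of_rat (q b) * b)" "d = (\<Sum>b\<in>B. of_rat (r b) * b)"
   using B(3) cd by meson
  \<comment> \<open>B and its multiple by \<zeta> may overlap, so the two coefficients are
    added.\<close>
  define s where "s b = (if b \<in> B then q b else 0) + (if b \<in> ?B' then r (b / \<zeta>) else 0)" for b
  have "(\<Sum>b\<in>B \<union> ?B'. of_rat (s b) * b) = (\<Sum>b\<in>B \<union> ?B'. if b \<in> B then of_rat (q b) * b else 0)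
    + (\<Sum>b\<in>B \<union> ?B'. if b \<in> ?B' then of_rat (r (b / \<zeta>)) * b else 0)"
   unfolding s_def sum.distrib[symmetric] by (intro sum.cong refl) (simp add: of_rat_add ring_distribs)
  also have "(\<Sum>b\<in>B \<union> ?B'. if b \<in> B then of_rat (q b) * b else 0) = c"
   unfolding q(1) using B(1) by (intro sum.mono_neutral_cong_right) auto
  also have "(\<Sum>b\<in>B \<union> ?B'. if b \<in> ?B' then of_rat (r (b / \<zeta>)) * b else 0) = (\<Sum>b\<in>?B'. of_rat (r (b / \<zeta>)) * b)"
   using B(1) by (intro sum.mono_neutral_cong_right) auto
  also have "\<dots> = (\<Sum>b\<in>B. of_rat (r b) * (b * \<zeta>))" using z by (simp add: sum.reindex[OF inj])
  also have "\<dots> = d * \<zeta>" unfolding q(2) by (simp add: sum_distrib_right mult.assoc)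
  finally show ?thesis using cd(1) by (intro exI[of _ s]) simp
 qed
 ultimately show ?thesis using B(1) by (intro exI[of _ "B \<union> ?B'"]) blast
qed

text \<open>\<zeta> has trace e and norm 1 over F; the instances are omega with e = -1 and \<i> with
  e = 0. A non-real element of F distinguishes the automorphism over F from complex
  conjugation.\<close>

locale quadratic_extension = complex_number_field F for F :: "complex set" +
 fixes \<zeta> e :: complex
 assumes \<zeta>_notin: "\<zeta> \<notin> F" and e_ints: "e \<in> ints" and \<zeta>_square: "\<zeta> * \<zeta> = e * \<zeta> - 1" and \<zeta>_cnj: "cnj \<zeta> = e - \<zeta>"
  and nonreal: "\<exists>a\<in>F. cnj a \<noteq> a" and \<zeta>_int: "algebraic_int \<zeta>"
begin

definition ext :: "complex set" where "ext = {a + b * \<zeta> | a b. a \<in> F \<and> b \<in> F}"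

lemma e_mem: "e \<in> F" by (rule ints_F[OF e_ints])

lemma extI: "a \<in> F \<Longrightarrow> b \<in> F \<Longrightarrow> a + b * \<zeta> \<in> ext" unfolding ext_def by blast

lemma F_ext: "a \<in> F \<Longrightarrow> a \<in> ext" using extI[of a 0] zero_mem by simp

lemma \<zeta>_ext: "\<zeta> \<in> ext" using extI[OF zero_mem one_mem] by simp

lemma coords_zero:
 assumes "a \<in> F" "b \<in> F" "a + b * \<zeta> = 0" shows "a = 0 \<and> b = 0"
proof -
 have "b = 0"
 proof (rule ccontr)
  assume b: "b \<noteq> 0"
  have "b * \<zeta> = - a" using assms(3) by (simp add: eq_neg_iff_add_eq_0 add.commute)
  hence "\<zeta> = - a / b" using b by (simp add: field_simps)
  thus False using \<zeta>_notin divide_mem[OF minus_mem[OF assms(1)] assms(2)] by simp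
 qed
 thus ?thesis using assms(3) by simp
qed

lemma coords_unique:
 assumes "a \<in> F" "b \<in> F" "c \<in> F" "d \<in> F" "a + b * \<zeta> = c + d * \<zeta>" shows "a = c \<and> b = d"
proof -
 have "(a - c) + (b - d) * \<zeta> = 0" using assms(5) by (simp add: algebra_simps)
 thus ?thesis using coords_zero[OF diff_mem[OF assms(1,3)] diff_mem[OF assms(2,4)]] by simp
qed

lemma mult_coords: "(a + b * \<zeta>) * (c + d * \<zeta>) = (a * c - b * d) + (a * d + b * c + e * b * d) * \<zeta>"
proof -
 have "(a + b * \<zeta>) * (c + d * \<zeta>) = a * c + (a * d + b * c) * \<zeta> + b * d * (\<zeta> * \<zeta>)" by (simp add: algebra_simps)
 thus ?thesis unfolding \<zeta>_square by (simp add: algebra_simps)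
qed

lemma cnj_square: "cnj \<zeta> * cnj \<zeta> = e * cnj \<zeta> - 1"
proof -
 have "cnj \<zeta> * cnj \<zeta> = e * e - 2 * e * \<zeta> + \<zeta> * \<zeta>" unfolding \<zeta>_cnj by (simp add: algebra_simps)
 thus ?thesis unfolding \<zeta>_square \<zeta>_cnj by (simp add: algebra_simps)
qed

lemma mult_coords_cnj: "(a + b * cnj \<zeta>) * (c + d * cnj \<zeta>) = (a * c - b * d) + (a * d + b * c + e * b * d) * cnj \<zeta>"
proof -
 have "(a + b * cnj \<zeta>) * (c + d * cnj \<zeta>) = a * c + (a * d + b * c) * cnj \<zeta> + b * d * (cnj \<zeta> * cnj \<zeta>)" by (simp add: algebra_simps)
 thus ?thesis unfolding cnj_square by (simp add: algebra_simps)
qed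

lemma \<zeta>_nonzero: "\<zeta> \<noteq> 0" using \<zeta>_notin zero_mem by auto

sublocale ext: complex_number_field ext
proof
 show "1 \<in> ext" by (rule F_ext[OF one_mem])
 fix x y assume "x \<in> ext" "y \<in> ext"
 then obtain a b c d where x: "x = a + b * \<zeta>" "y = c + d * \<zeta>" and m: "a \<in> F" "b \<in> F" "c \<in> F" "d \<in> F"
  unfolding ext_def by blast
 have "(a - c) + (b - d) * \<zeta> \<in> ext" by (intro extI diff_mem m)
 thus "x - y \<in> ext" unfolding x by (simp add: algebra_simps)
 show "x * y \<in> ext" unfolding x mult_coords by (intro extI diff_mem add_mem mult_mem m e_mem)
next
 fix x assume "x \<in> ext"
 then obtain a b where x: "x = a + b * \<zeta>" and m: "a \<in> F" "b \<in> F" unfolding ext_def by blast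
 show "inverse x \<in> ext"
 proof (cases "x = 0")
  case False
  \<comment> \<open>The norm of x over F: because cnj \<zeta> = e - \<zeta>, the conjugate of x over
    F is (a + b * e) - b * \<zeta>.\<close>
  define N where "N = a * (a + b * e) + b * b"
  have N: "N \<in> F" unfolding N_def by (intro add_mem mult_mem m e_mem)
  have c: "a + b * e \<in> F" by (intro add_mem mult_mem m e_mem)
  have xN: "x * ((a + b * e) + (- b) * \<zeta>) = N" unfolding x mult_coords N_def by (simp add: algebra_simps)
  have "(a + b * e) + (- b) * \<zeta> \<noteq> 0"
  proof
   assume "(a + b * e) + (- b) * \<zeta> = 0"
   hence "a + b * e = 0" "b = 0" using coords_zero[OF c minus_mem[OF m(2)]] by auto
   thus False using False x by simp
  qed
  hence N0: "N \<noteq> 0" using False xN by auto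
  have "x * ((a + b * e) / N + (- b / N) * \<zeta>) = x * ((a + b * e) + (- b) * \<zeta>) / N" using N0 by (simp add: field_simps)
  also have "\<dots> = 1" unfolding xN using N0 by simp
  finally have "inverse x = (a + b * e) / N + (- b / N) * \<zeta>" by (rule inverse_unique)
  also have "\<dots> \<in> ext" by (intro extI divide_mem c N minus_mem m)
  finally show ?thesis .
 qed (use F_ext[OF zero_mem] in simp)
next
 show "\<exists>B. finite B \<and> B \<subseteq> ext \<and> (\<forall>x\<in>ext. \<exists>q :: complex \<Rightarrow> rat. x = (\<Sum>b\<in>B. of_rat (q b) * b))"
  by (rule complex_number_field_generator_pair[OF complex_number_field_axioms ext_def \<zeta>_nonzero])
qed

definition swap :: "complex \<Rightarrow> complex" where
 "swap = (\<lambda>x\<in>ext. THE y. \<exists>a\<in>F. \<exists>b\<in>F. x = a + b * \<zeta> \<and> y = a + b * cnj \<zeta>)"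

lemma swap_eq: "a \<in> F \<Longrightarrow> b \<in> F \<Longrightarrow> swap (a + b * \<zeta>) = a + b * cnj \<zeta>"
proof -
 assume m: "a \<in> F" "b \<in> F"
 have "(THE y. \<exists>a'\<in>F. \<exists>b'\<in>F. a + b * \<zeta> = a' + b' * \<zeta> \<and> y = a' + b' * cnj \<zeta>) = a + b * cnj \<zeta>"
 proof (rule the_equality)
  fix y assume "\<exists>a'\<in>F. \<exists>b'\<in>F. a + b * \<zeta> = a' + b' * \<zeta> \<and> y = a' + b' * cnj \<zeta>"
  then obtain a' b' where "a' \<in> F" "b' \<in> F" "a + b * \<zeta> = a' + b' * \<zeta>" "y = a' + b' * cnj \<zeta>" by blast
  thus "y = a + b * cnj \<zeta>" using coords_unique[OF m, of a' b'] by simp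
 qed (use m in blast)
 thus ?thesis using extI[OF m] by (simp add: swap_def)
qed

text \<open>It moves \<zeta>, so it is not the inclusion, and it fixes a non-real element of F, so
  it is not complex conjugation.\<close>

lemma swap_outer: "swap \<in> ext.outer_emb"
proof -
 have s1: "swap a = a" if "a \<in> F" for a using swap_eq[OF that zero_mem] by simp
 have sz: "swap \<zeta> = cnj \<zeta>" using swap_eq[OF zero_mem one_mem] by simp
 have "swap (x + y) = swap x + swap y \<and> swap (x * y) = swap x * swap y" if "x \<in> ext" "y \<in> ext" for x y
 proof -
  obtain a b c d where x: "x = a + b * \<zeta>" "y = c + d * \<zeta>" and m: "a \<in> F" "b \<in> F" "c \<in> F" "d \<in> F"
   using \<open>x \<in> ext\<close> \<open>y \<in> ext\<close> unfolding ext_def by blast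
  have "x + y = (a + c) + (b + d) * \<zeta>" unfolding x by (simp add: algebra_simps)
  hence "swap (x + y) = (a + c) + (b + d) * cnj \<zeta>" using swap_eq[OF add_mem[OF m(1,3)] add_mem[OF m(2,4)]] by simp
  also have "\<dots> = swap x + swap y" unfolding x swap_eq[OF m(1,2)] swap_eq[OF m(3,4)] by (simp add: algebra_simps)
  finally have "swap (x + y) = swap x + swap y" .
  moreover have "swap (x * y) = swap x * swap y" unfolding x mult_coords swap_eq[OF m(1,2)] swap_eq[OF m(3,4)] mult_coords_cnj
   by (intro swap_eq diff_mem add_mem mult_mem m e_mem)
  ultimately show ?thesis ..
 qed
 hence "swap \<in> emb ext" unfolding emb_def using s1[OF one_mem] by (simp add: swap_def)
 moreover have "swap \<noteq> (\<lambda>x\<in>ext. x)"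
 proof
  assume eq: "swap = (\<lambda>x\<in>ext. x)"
  hence "cnj \<zeta> = \<zeta>" using fun_cong[OF eq, of \<zeta>] sz \<zeta>_ext by simp
  hence "2 * \<zeta> = e" using \<zeta>_cnj by (simp add: algebra_simps)
  hence "\<zeta> = e / 2" by (simp add: field_simps)
  moreover have "e / 2 \<in> F" using e_mem numeral_mem by (intro divide_mem)
  ultimately have "\<zeta> \<in> F" by (rule back_subst[of "\<lambda>x. x \<in> F", OF _ sym, rotated])
  thus False using \<zeta>_notin by (rule notE[rotated])
 qed
 moreover have "swap \<noteq> (\<lambda>x\<in>ext. cnj x)"
 proof
  assume eq: "swap = (\<lambda>x\<in>ext. cnj x)"
  obtain a where a: "a \<in> F" "cnj a \<noteq> a" using nonreal by blast
  thus False using fun_cong[OF eq, of a] s1[OF a(1)] F_ext[OF a(1)] by simp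
 qed
 ultimately show ?thesis unfolding ext.outer_emb_def by simp
qed

text \<open>For w = a + b * \<zeta> the integral element (w - \<open>swap w\<close>) * (\<zeta> -
  cnj \<zeta>) is b times the discriminant -k. Hence k * b is integral, and then so is k *
  a.\<close>

lemma congruent_coords:
 fixes k :: nat
 assumes disc: "(\<zeta> - cnj \<zeta>) * (\<zeta> - cnj \<zeta>) = - of_nat k" and w: "w \<in> ext" "algebraic_int w"
 shows "\<exists>\<alpha>\<in>ints. \<exists>\<beta>\<in>ints. of_nat k * w = \<alpha> + \<beta> * \<zeta>"
proof -
 interpret s: embedding ext swap by (rule ext.embedding) (use swap_outer in \<open>simp add: ext.outer_emb_def\<close>)
 obtain a b where ab: "w = a + b * \<zeta>" "a \<in> F" "b \<in> F" using w(1) unfolding ext_def by blast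
 have sw: "algebraic_int (swap w)" by (rule s.e_algebraic_int[OF w])
 have zc: "algebraic_int (cnj \<zeta>)" using \<zeta>_int by simp
 have "(w - swap w) * (\<zeta> - cnj \<zeta>) = b * ((\<zeta> - cnj \<zeta>) * (\<zeta> - cnj \<zeta>))"
  unfolding ab(1) swap_eq[OF ab(2,3)] by (simp add: algebra_simps)
 hence "(w - swap w) * (\<zeta> - cnj \<zeta>) = - (of_nat k * b)" unfolding disc by simp
 moreover have "algebraic_int ((w - swap w) * (\<zeta> - cnj \<zeta>))" by (intro algebraic_int_mult algebraic_int_diff w(2) sw \<zeta>_int zc)
 ultimately have kb: "algebraic_int (of_nat k * b)" by simp
 have "of_nat k * a = of_nat k * w - of_nat k * b * \<zeta>" unfolding ab(1) by (simp add: algebra_simps)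
 moreover have "algebraic_int (of_nat k :: complex)" by simp
 hence "algebraic_int (of_nat k * w - of_nat k * b * \<zeta>)" by (intro algebraic_int_mult algebraic_int_diff w(2) kb \<zeta>_int)
 ultimately have ka: "algebraic_int (of_nat k * a)" by simp
 have "of_nat k * a \<in> ints" "of_nat k * b \<in> ints" by (intro intsI mult_mem of_nat_mem ab ka kb)+
 moreover have "of_nat k * w = of_nat k * a + of_nat k * b * \<zeta>" unfolding ab(1) by (simp add: algebra_simps)
 ultimately show ?thesis by blast
qed

end

text \<open>\<kappa> is k times the idempotent of the two characters \<zeta> and cnj \<zeta>. The
  unit is taken congruent to 1 modulo k^2: one factor k clears the denominators of its coordinates
  and the other is supplied by \<kappa>. The values at \<zeta> and cnj \<zeta> are u and
  \<open>swap u\<close>, with moduli above and below 1.\<close>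

lemma (in trivial_unit_group) no_quadratic_order:
 fixes k :: nat
 assumes Q: "quadratic_extension F \<zeta> e" and k: "k > 1" and disc: "(\<zeta> - cnj \<zeta>) * (\<zeta> - cnj \<zeta>) = - of_nat k"
  and root: "\<zeta> ^ k = 1" and \<kappa>: "coeffs_in \<kappa>" "poly \<kappa> \<zeta> = of_nat k" "poly \<kappa> (cnj \<zeta>) = of_nat k"
  "\<And>z. z ^ k = 1 \<Longrightarrow> poly \<kappa> z = 0 \<or> (poly \<kappa> z = of_nat k \<and> z * z = e * z - 1)"
  and g: "g \<in> carrier G" "ord g = k"
 shows False
proof -
 interpret Q: quadratic_extension F \<zeta> e by fact
 have k0: "k > 0" using k by simp
 obtain u v a b where u: "u * v = 1" "u = 1 + of_nat (k * k) * a" "v = 1 + of_nat (k * k) * b"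
   "a \<in> Q.ext.ints" "b \<in> Q.ext.ints" "cmod u > 1" and su: "\<forall>\<sigma>\<in>Q.ext.outer_emb. cmod (\<sigma> u) < 1"
 proof -
  have "k * k > 0" "Q.ext.outer_emb \<noteq> {}" using k0 Q.swap_outer by auto
  from Q.ext.exists_unit_pair[OF this] show thesis using that by blast
 qed
 obtain \<alpha> \<beta> where \<alpha>: "\<alpha> \<in> ints" "\<beta> \<in> ints" "of_nat k * a = \<alpha> + \<beta> * \<zeta>"
  using Q.congruent_coords[OF disc Q.ext.ints_F[OF u(4)] Q.ext.ints_algebraic[OF u(4)]] by blast
 obtain \<gamma> \<delta> where \<gamma>: "\<gamma> \<in> ints" "\<delta> \<in> ints" "of_nat k * b = \<gamma> + \<delta> * \<zeta>"
  using Q.congruent_coords[OF disc Q.ext.ints_F[OF u(5)] Q.ext.ints_algebraic[OF u(5)]] by blast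
 define A B C D where "A = 1 + of_nat k * \<alpha>" and "B = of_nat k * \<beta>" and "C = 1 + of_nat k * \<gamma>" and "D = of_nat k * \<delta>"
 have mem: "A \<in> F" "B \<in> F" "C \<in> F" "D \<in> F"
  unfolding A_def B_def C_def D_def by (intro add_mem mult_mem one_mem of_nat_mem ints_F \<alpha> \<gamma>)+
 have "u = 1 + of_nat k * (of_nat k * a)" unfolding u(2) by (simp add: mult.assoc)
 hence uA: "u = A + B * \<zeta>" unfolding \<alpha>(3) A_def B_def by (simp add: algebra_simps)
 have "v = 1 + of_nat k * (of_nat k * b)" unfolding u(3) by (simp add: mult.assoc)
 hence vC: "v = C + D * \<zeta>" unfolding \<gamma>(3) C_def D_def by (simp add: algebra_simps)
 have "(A * C - B * D) + (A * D + B * C + e * B * D) * \<zeta> = 1 + 0 * \<zeta>" using u(1) unfolding uA vC Q.mult_coords by simp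
 \<comment> \<open>These relations between coordinates in F serve for every root of z^2 = e * z - 1,
   so they make the polynomials inverse at \<zeta> and at cnj \<zeta> alike.\<close>
 hence co: "A * C - B * D = 1 \<and> A * D + B * C + e * B * D = 0" by (intro Q.coords_unique diff_mem add_mem mult_mem mem Q.e_mem one_mem zero_mem)
 define P where "P s t = monom 1 0 + (monom s 0 + monom t 1) * \<kappa>" for s t :: complex
 have pv: "poly (P s t) z = 1 + (s + t * z) * poly \<kappa> z" for s t z by (simp add: P_def poly_monom)
 have ci: "coeffs_in (P s t)" if "s \<in> ints" "t \<in> ints" for s t unfolding P_def by (intro coeffs_in_intros ints_1 that \<kappa>(1))
 have pq: "poly (P \<alpha> \<beta>) z * poly (P \<gamma> \<delta>) z = 1" if "z ^ k = 1" for z using \<kappa>(4)[OF that]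
 proof
  assume "poly \<kappa> z = 0"
  thus ?thesis by (simp add: pv)
 next
  assume z: "poly \<kappa> z = of_nat k \<and> z * z = e * z - 1"
  have "poly (P \<alpha> \<beta>) z = A + B * z" "poly (P \<gamma> \<delta>) z = C + D * z"
   unfolding pv A_def B_def C_def D_def using z by (simp_all add: algebra_simps)
  hence "poly (P \<alpha> \<beta>) z * poly (P \<gamma> \<delta>) z = A * C + (A * D + B * C) * z + B * D * (z * z)" by (simp add: algebra_simps)
  also have "z * z = e * z - 1" using z by blast
  also have "A * C + (A * D + B * C) * z + B * D * (e * z - 1) = (A * C - B * D) + (A * D + B * C + e * B * D) * z" by (simp add: algebra_simps)
  finally show ?thesis using co by simp
 qed
 obtain r where r: "\<And>z. z ^ ord g = 1 \<Longrightarrow> z \<noteq> 1 \<or> powers g \<noteq> carrier G \<Longrightarrow> cmod (poly (P \<alpha> \<beta>) z) = cmod r"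
  by (rule unit_from_polys[OF g(1) _ ci[OF \<alpha>(1,2)] ci[OF \<gamma>(1,2)]]) (use g(2) k pq in simp_all)
 have z1: "\<zeta> \<noteq> 1" "cnj \<zeta> \<noteq> 1" using Q.\<zeta>_notin one_mem by auto
 have "cnj (\<zeta> ^ k) = 1" unfolding root by simp
 hence rc: "cnj \<zeta> ^ k = 1" by simp
 have "poly (P \<alpha> \<beta>) \<zeta> = u" unfolding pv \<kappa>(2) uA A_def B_def by (simp add: algebra_simps)
 hence 1: "cmod u = cmod r" using r[of \<zeta>] root z1 g(2) by simp
 have "poly (P \<alpha> \<beta>) (cnj \<zeta>) = A + B * cnj \<zeta>" unfolding pv \<kappa>(3) A_def B_def by (simp add: algebra_simps)
 hence "poly (P \<alpha> \<beta>) (cnj \<zeta>) = Q.swap u" unfolding uA Q.swap_eq[OF mem(1,2)] .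
 hence "cmod (Q.swap u) = cmod r" using r[of "cnj \<zeta>"] rc z1 g(2) by simp
 hence "cmod r < 1" using su Q.swap_outer by force
 thus False using 1 u(6) by simp
qed

lemma cnj_omega: "cnj omega = - 1 - omega" by (simp add: complex_eq_iff Re_omega Im_omega)

text \<open>The polynomial \<kappa> is 3 - (1 + z + z^2), which is 0 at 1 and 3 at the primitive
  cube roots of unity; the discriminant of omega is -3.\<close>

lemma (in trivial_unit_group) no_order_3:
 assumes nr: "\<not> F \<subseteq> \<real>" and om: "omega \<notin> F" and g: "g \<in> carrier G" "ord g = 3"
 shows False
proof (rule no_quadratic_order[where \<zeta> = omega and e = "-1" and k = 3 and \<kappa> = "monom 2 0 - monom 1 1 - monom 1 2", OF _ _ _ _ _ _ _ _ g])
 have o2: "omega * omega = - 1 - omega" using omega_square by (simp add: power2_eq_square)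
 have nr': "\<exists>a\<in>F. cnj a \<noteq> a" using nr by (auto simp: Reals_cnj_iff)
 show "quadratic_extension F omega (-1)"
  by unfold_locales (use om nr' in \<open>simp_all add: o2 cnj_omega algebraic_int_omega ints_minus ints_1\<close>)
 have "(omega - cnj omega) * (omega - cnj omega) = 4 * (omega * omega) + 4 * omega + 1" unfolding cnj_omega by (simp add: algebra_simps)
 thus "(omega - cnj omega) * (omega - cnj omega) = - of_nat 3" unfolding o2 by (simp add: algebra_simps)
 show "omega ^ 3 = 1" by (rule omega_cube)
 show "coeffs_in (monom 2 0 - monom 1 1 - monom 1 2)" by (intro coeffs_in_intros ints_intros)
 have pk: "poly (monom 2 0 - monom 1 1 - monom 1 2) z = 2 - z - z * z" for z :: complex by (simp add: poly_monom power2_eq_square)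
 show "poly (monom 2 0 - monom 1 1 - monom 1 2) omega = of_nat 3" unfolding pk o2 by simp
 have "cnj omega * cnj omega = 1 + 2 * omega + omega * omega" unfolding cnj_omega by (simp add: algebra_simps)
 thus "poly (monom 2 0 - monom 1 1 - monom 1 2) (cnj omega) = of_nat 3" unfolding pk o2 cnj_omega by simp
 fix z :: complex assume z: "z ^ 3 = 1"
 have "(z - 1) * (z * z + z + 1) = 0" using z by (simp add: power3_eq_cube algebra_simps)
 hence "z = 1 \<or> z * z + z + 1 = 0" by simp
 thus "poly (monom 2 0 - monom 1 1 - monom 1 2) z = 0 \<or>
   (poly (monom 2 0 - monom 1 1 - monom 1 2) z = of_nat 3 \<and> z * z = - 1 * z - 1)"
 proof
  assume "z * z + z + 1 = 0"
  hence "z * z = - z - 1" by (simp add: eq_diff_eq eq_neg_iff_add_eq_0 add_ac)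
  thus ?thesis unfolding pk by simp
 next
  assume "z = 1"
  thus ?thesis unfolding pk by simp
 qed
qed simp

text \<open>The polynomial \<kappa> is 2 - 2 * z^2, which is 0 at 1 and -1 and 4 at \<i> and its
  conjugate; the discriminant is -4.\<close>

lemma (in trivial_unit_group) no_order_4:
 assumes nr: "\<not> F \<subseteq> \<real>" and om: "\<i> \<notin> F" and g: "g \<in> carrier G" "ord g = 4"
 shows False
proof (rule no_quadratic_order[where \<zeta> = \<i> and e = 0 and k = 4 and \<kappa> = "monom 2 0 - monom 2 2", OF _ _ _ _ _ _ _ _ g])
 have nr': "\<exists>a\<in>F. cnj a \<noteq> a" using nr by (auto simp: Reals_cnj_iff)
 show "quadratic_extension F \<i> 0" by unfold_locales (use om nr' in \<open>simp_all add: ints_0\<close>)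
 show "(\<i> - cnj \<i>) * (\<i> - cnj \<i>) = - of_nat 4" by (simp add: complex_eq_iff)
 show "\<i> ^ 4 = 1" by simp
 show "coeffs_in (monom 2 0 - monom 2 2)" by (intro coeffs_in_intros ints_intros)
 have pk: "poly (monom 2 0 - monom 2 2) z = 2 - 2 * (z * z)" for z :: complex by (simp add: poly_monom power2_eq_square)
 show "poly (monom 2 0 - monom 2 2) \<i> = of_nat 4" "poly (monom 2 0 - monom 2 2) (cnj \<i>) = of_nat 4" unfolding pk by simp_all
 fix z :: complex assume z: "z ^ 4 = 1"
 have "(z * z - 1) * (z * z + 1) = 0" using z by (simp add: power4_eq_xxxx algebra_simps)
 hence "z * z = 1 \<or> z * z = -1" by (simp add: eq_neg_iff_add_eq_0)
 thus "poly (monom 2 0 - monom 2 2) z = 0 \<or>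
   (poly (monom 2 0 - monom 2 2) z = of_nat 4 \<and> z * z = 0 * z - 1)"
  unfolding pk by (elim disjE) simp_all
qed simp

section \<open>Finite abelian groups of exponent dividing 4 or 6\<close>

lemma DirProd_trivial_left_iso:
 assumes T: "group T" "carrier T = {t}" and G: "group G" shows "G \<cong> T \<times>\<times> G\<lparr>carrier := carrier G\<rparr>"
proof -
 have t: "t = \<one>\<^bsub>T\<^esub>" using group.is_monoid[OF T(1), THEN monoid.one_closed] T(2) by simp
 hence tt: "t \<otimes>\<^bsub>T\<^esub> t = t" using group.is_monoid[OF T(1), THEN monoid.l_one, of t] T(2) by simp
 have "(\<lambda>x. (t, x)) \<in> iso G (T \<times>\<times> G\<lparr>carrier := carrier G\<rparr>)"
  unfolding iso_def hom_def bij_betw_def inj_on_def using T(2) tt by (auto intro: monoid.m_closed[OF group.is_monoid[OF G]])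
 thus ?thesis by (rule is_isoI)
qed

lemma DirProd_trivial_right_iso:
 assumes T: "group T" "carrier T = {t}" and G: "group G" shows "G \<times>\<times> T \<cong> G"
proof -
 have "fst \<in> iso (G \<times>\<times> T) G" unfolding iso_def hom_def bij_betw_def inj_on_def using T(2) by (auto simp: image_iff)
 thus ?thesis by (rule is_isoI)
qed

lemma (in group) subgroup_card_less:
 assumes "finite (carrier G)" "subgroup M G" "x \<in> carrier G" "x \<notin> M" shows "card M < card (carrier G)"
 using assms subgroup.subset[OF assms(2)] by (intro psubset_card_mono) auto

lemma DirProd_assoc_iso: "(G \<times>\<times> H) \<times>\<times> I \<cong> G \<times>\<times> (H \<times>\<times> I)"
proof -
 have "(\<lambda>((x,y),z). (x,(y,z))) \<in> iso ((G \<times>\<times> H) \<times>\<times> I) (G \<times>\<times> (H \<times>\<times> I))"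
  by (auto simp add: iso_def hom_def inj_on_def bij_betw_def image_iff)
 thus ?thesis by (rule is_isoI)
qed

lemma (in comm_group) subgroup_comm_group: "subgroup M G \<Longrightarrow> comm_group (G\<lparr>carrier := M\<rparr>)"
 by (rule group.group_comm_groupI[OF subgroup_imp_group]) (auto intro: m_comm subgroup.mem_carrier)

text \<open>By \<open>dv\<close> an order smaller than p^e would divide p^(e - 1), so g has order
  p^e and generates a factor of the full exponent.\<close>

lemma (in comm_group) split_cyclic_factor:
 fixes p e :: nat
 assumes fin: "finite (carrier G)" and p: "p > 1" and bezout: "\<And>j. \<not> p dvd j \<Longrightarrow> \<exists>a b. a * j = b * p + (1::nat)"
  and e: "e > 0" and dv: "\<And>i. i dvd p ^ e \<Longrightarrow> i < p ^ e \<Longrightarrow> i dvd p ^ (e - 1)"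
  and ex: "\<And>x. x \<in> carrier G \<Longrightarrow> x [^] (p ^ e) = \<one>" and g: "g \<in> carrier G" "g [^] (p ^ (e - 1)) \<noteq> \<one>"
 shows "\<exists>M. subgroup M G \<and> card M < card (carrier G) \<and> G \<cong> G\<lparr>carrier := M\<rparr> \<times>\<times> integer_mod_group (p ^ e)"
proof -
 let ?q = "p ^ e"
 let ?Z = "powers g"
 obtain M where M: "subgroup M G" "M \<inter> ?Z \<subseteq> {\<one>}" "\<forall>x\<in>carrier G. \<exists>m\<in>M. \<exists>i::nat. x = m \<otimes> g [^] i"
  using prime_power_complement[OF fin p bezout ex g(1) e g(2)] by blast
 have Mc: "M \<subseteq> carrier G" by (rule subgroup.subset[OF M(1)])
 have "ord g dvd ?q" using pow_eq_id[OF g(1)] ex[OF g(1)] by blast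
 moreover have "\<not> ord g dvd p ^ (e - 1)" using pow_eq_id[OF g(1)] g(2) by blast
 ultimately have ordg: "ord g \<ge> ?q" using dv not_le by blast
 have Z: "G\<lparr>carrier := ?Z\<rparr> \<cong> integer_mod_group ?q"
 proof (rule cyclic_subgroup_iso[OF g(1)])
  fix i :: nat assume i: "0 < i" "i < ?q"
  show "g [^] i \<noteq> \<one>"
  proof
   assume "g [^] i = \<one>"
   hence "ord g dvd i" using pow_eq_id[OF g(1)] by blast
   hence "ord g \<le> i" using i(1) by (intro dvd_imp_le)
   thus False using ordg i(2) by simp
  qed
 qed (use p ex[OF g(1)] in simp_all)
 have Zs: "subgroup ?Z G" by (rule power_set_subgroup[OF fin g(1)])
 have prod: "G \<cong> G\<lparr>carrier := M\<rparr> \<times>\<times> G\<lparr>carrier := ?Z\<rparr>"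
 proof (rule internal_direct_product[OF M(1) Zs _ M(2)])
  fix x y assume "x \<in> M" "y \<in> ?Z"
  hence "x \<in> carrier G" "y \<in> carrier G" using Mc g(1) by auto
  thus "x \<otimes> y = y \<otimes> x" by (rule m_comm)
 qed (use M(3) in blast)
 have g1: "g \<noteq> \<one>" using g(2) by auto
 have "g \<in> ?Z" using g(1) by (intro range_eqI[of _ _ 1]) simp
 hence gM: "g \<notin> M" using M(2) g1 by blast
 have "G \<cong> G\<lparr>carrier := M\<rparr> \<times>\<times> integer_mod_group ?q"
  by (rule iso_trans[OF prod group.DirProd_iso_trans[OF subgroup_imp_group[OF M(1)] iso_refl Z]])
 thus ?thesis using M(1) subgroup_card_less[OF fin M(1) g(1) gM] by blast
qed

text \<open>Induction on the group order: as long as some element is not killed by p^(e - 1), it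
  generates a cyclic factor that can be split off.\<close>

lemma homocyclic_decomposition:
 fixes G :: "('g, 'n) monoid_scheme" and p e :: nat
 assumes "comm_group G" "finite (carrier G)" and p: "p > 1" and bezout: "\<And>j. \<not> p dvd j \<Longrightarrow> \<exists>a b. a * j = b * p + (1::nat)"
  and e: "e > 0" and dv: "\<And>i. i dvd p ^ e \<Longrightarrow> i < p ^ e \<Longrightarrow> i dvd p ^ (e - 1)"
  and "\<And>x. x \<in> carrier G \<Longrightarrow> x [^]\<^bsub>G\<^esub> (p ^ e) = \<one>\<^bsub>G\<^esub>"
 shows "\<exists>m M. subgroup M G \<and> (\<forall>x\<in>M. x [^]\<^bsub>G\<^esub> (p ^ (e - 1)) = \<one>\<^bsub>G\<^esub>) \<and> G \<cong> cyclic_power (p ^ e) m \<times>\<times> G\<lparr>carrier := M\<rparr>"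
 using assms(1,2,7)
proof (induction "card (carrier G)" arbitrary: G rule: less_induct)
 case (less G)
 interpret G: comm_group G by (rule less(2))
 let ?q = "p ^ e"
 show ?case
 proof (cases "\<forall>x\<in>carrier G. x [^]\<^bsub>G\<^esub> (p ^ (e - 1)) = \<one>\<^bsub>G\<^esub>")
  case True
  have "G \<cong> cyclic_power ?q 0 \<times>\<times> G\<lparr>carrier := carrier G\<rparr>"
   by (rule DirProd_trivial_left_iso[OF group_cyclic_power _ G.is_group]) (simp add: cyclic_power_0)
  thus ?thesis using True G.subgroup_self by (intro exI[of _ 0] exI[of _ "carrier G"]) simp
 next
  case False
  then obtain g where g: "g \<in> carrier G" "g [^]\<^bsub>G\<^esub> (p ^ (e - 1)) \<noteq> \<one>\<^bsub>G\<^esub>" by blast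
  obtain M where M: "subgroup M G" "card M < card (carrier G)" "G \<cong> G\<lparr>carrier := M\<rparr> \<times>\<times> integer_mod_group (p ^ e)"
   using G.split_cyclic_factor[OF less(3) p bezout e dv less(4) g] by blast
  have Mc: "M \<subseteq> carrier G" by (rule subgroup.subset[OF M(1)])
  have "card (carrier (G\<lparr>carrier := M\<rparr>)) < card (carrier G)" using M(2) by simp
  moreover have cG: "comm_group (G\<lparr>carrier := M\<rparr>)" by (rule G.subgroup_comm_group[OF M(1)])
  moreover have "finite (carrier (G\<lparr>carrier := M\<rparr>))" using finite_subset[OF Mc less(3)] by simp
  moreover have "x [^]\<^bsub>G\<lparr>carrier := M\<rparr>\<^esub> ?q = \<one>\<^bsub>G\<lparr>carrier := M\<rparr>\<^esub>" if x: "x \<in> carrier (G\<lparr>carrier := M\<rparr>)" for x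
  proof -
   have "x \<in> carrier G" using x Mc by auto
   hence "x [^]\<^bsub>G\<^esub> ?q = \<one>\<^bsub>G\<^esub>" by (rule less(4))
   thus ?thesis by (simp flip: G.nat_pow_consistent)
  qed
  ultimately have "\<exists>m N. subgroup N (G\<lparr>carrier := M\<rparr>) \<and>
   (\<forall>x\<in>N. x [^]\<^bsub>G\<lparr>carrier := M\<rparr>\<^esub> (p ^ (e - 1)) = \<one>\<^bsub>G\<lparr>carrier := M\<rparr>\<^esub>) \<and>
   G\<lparr>carrier := M\<rparr> \<cong> cyclic_power ?q m \<times>\<times> (G\<lparr>carrier := M\<rparr>)\<lparr>carrier := N\<rparr>"
   by (rule less(1))
  then obtain m N where N: "subgroup N (G\<lparr>carrier := M\<rparr>)"
   "\<forall>x\<in>N. x [^]\<^bsub>G\<lparr>carrier := M\<rparr>\<^esub> (p ^ (e - 1)) = \<one>\<^bsub>G\<lparr>carrier := M\<rparr>\<^esub>"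
   "G\<lparr>carrier := M\<rparr> \<cong> cyclic_power ?q m \<times>\<times> (G\<lparr>carrier := M\<rparr>)\<lparr>carrier := N\<rparr>" by blast
  have NG: "subgroup N G" by (rule G.incl_subgroup[OF M(1) N(1)])
  let ?N = "G\<lparr>carrier := N\<rparr>" and ?C = "cyclic_power ?q m" and ?I = "integer_mod_group ?q"
  have N3: "G\<lparr>carrier := M\<rparr> \<cong> ?C \<times>\<times> ?N" using N(3) by simp
  have gr: "group ?N" "group ?C" "group ?I" "group (G\<lparr>carrier := M\<rparr>)"
   using G.subgroup_imp_group[OF NG] G.subgroup_imp_group[OF M(1)] group_cyclic_power by simp_all
  have 0: "G \<cong> (?C \<times>\<times> ?N) \<times>\<times> ?I" by (rule iso_trans[OF M(3) group.DirProd_iso_trans[OF gr(4) N3 iso_refl]])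
  have 1: "G \<cong> ?I \<times>\<times> (?C \<times>\<times> ?N)" by (rule iso_trans[OF 0 is_isoI[OF DirProd_commute_iso_set]])
  have 2: "?I \<times>\<times> (?C \<times>\<times> ?N) \<cong> (?I \<times>\<times> ?C) \<times>\<times> ?N"
   by (rule group.iso_sym[OF _ DirProd_assoc_iso]) (intro DirProd_group gr)
  have 3: "?I \<times>\<times> ?C \<cong> cyclic_power ?q (Suc m)" by (rule group.iso_sym[OF group_cyclic_power cyclic_power_Suc_iso])
  have "G \<cong> cyclic_power ?q (Suc m) \<times>\<times> ?N"
   by (rule iso_trans[OF iso_trans[OF 1 2] group.DirProd_iso_trans[OF DirProd_group[OF gr(3,2)] 3 iso_refl]])
  moreover have "\<forall>x\<in>N. x [^]\<^bsub>G\<^esub> (p ^ (e - 1)) = \<one>\<^bsub>G\<^esub>" using N(2) by (simp flip: G.nat_pow_consistent)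
  ultimately show ?thesis using NG by blast
 qed
qed

text \<open>For e = 1 the remaining factor has exponent p^0 = 1 and is trivial.\<close>

lemma (in comm_group) elementary_abelian:
 fixes p :: nat
 assumes "finite (carrier G)" "p = 2 \<or> p = 3" "\<And>x. x \<in> carrier G \<Longrightarrow> x [^] p = \<one>"
 shows "\<exists>m. G \<cong> cyclic_power p m"
proof -
 have bez: "\<exists>a b. a * j = b * p + (1::nat)" if "\<not> p dvd j" for j
 proof -
  have "p = 2 \<and> j mod 2 = 1 \<or> p = 3 \<and> j mod 3 = 1 \<or> p = 3 \<and> j mod 3 = 2" using that assms(2) by (elim disjE) (simp_all, presburger+)
  thus ?thesis
  proof (elim disjE conjE)
   assume "p = 3" "j mod 3 = 2"
   hence "2 * j = (2 * (j div 3) + 1) * p + 1" using div_mult_mod_eq[of j 3] by simp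
   thus ?thesis by blast
  next
   assume "p = 3" "j mod 3 = 1"
   hence "1 * j = (j div 3) * p + 1" using div_mult_mod_eq[of j 3] by simp
   thus ?thesis by blast
  next
   assume "p = 2" "j mod 2 = 1"
   hence "1 * j = (j div 2) * p + 1" using div_mult_mod_eq[of j 2] by simp
   thus ?thesis by blast
  qed
 qed
 have dv: "i dvd p ^ (1 - 1)" if i: "i dvd p ^ 1" "i < p ^ 1" for i
 proof -
  have "i \<noteq> 0" using i assms(2) by auto
  moreover have "i < 3" using i assms(2) by auto
  ultimately have "i = 1 \<or> i = 2" by linarith
  thus ?thesis using i assms(2) by auto
 qed
 obtain m M where M: "subgroup M G" "\<forall>x\<in>M. x [^] (p ^ (1 - 1)) = \<one>" "G \<cong> cyclic_power (p ^ 1) m \<times>\<times> G\<lparr>carrier := M\<rparr>"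
 proof -
  have "\<exists>m M. subgroup M G \<and> (\<forall>x\<in>M. x [^] (p ^ (1 - 1)) = \<one>) \<and> G \<cong> cyclic_power (p ^ 1) m \<times>\<times> G\<lparr>carrier := M\<rparr>"
   by (rule homocyclic_decomposition[OF comm_group_axioms assms(1) _ bez _ dv]) (use assms(2,3) in auto)
  thus thesis using that by blast
 qed
 have "x = \<one>" if x: "x \<in> M" for x
 proof -
  have "x [^] (1::nat) = \<one>" using M(2) x by simp
  thus ?thesis using subgroup.mem_carrier[OF M(1) x] by simp
 qed
 hence "M = {\<one>}" using subgroup.one_closed[OF M(1)] by blast
 hence "cyclic_power p m \<times>\<times> G\<lparr>carrier := M\<rparr> \<cong> cyclic_power p m"
  by (intro DirProd_trivial_right_iso[OF subgroup_imp_group[OF M(1)] _ group_cyclic_power]) simp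
 thus ?thesis using M(3) iso_trans by (metis power_one_right)
qed

text \<open>For e = 2 the remaining factor has exponent dividing 2 and is elementary
  abelian.\<close>

lemma (in comm_group) exponent_4_abelian:
 assumes "finite (carrier G)" "\<And>x. x \<in> carrier G \<Longrightarrow> x [^] (4::nat) = \<one>"
 shows "\<exists>m n. G \<cong> cyclic_power 4 m \<times>\<times> cyclic_power 2 n"
proof -
 have bez: "\<exists>a b. a * j = b * 2 + (1::nat)" if "\<not> 2 dvd j" for j
 proof -
  have "1 * j = (j div 2) * 2 + 1" using that by presburger
  thus ?thesis by blast
 qed
 have dv: "i dvd 2 ^ (2 - 1)" if i: "i dvd 2 ^ 2" "i < 2 ^ 2" for i :: nat
 proof -
  have "i dvd 4" "i < 4" using i by simp_all
  hence "i \<noteq> 0" "i \<noteq> 3" by auto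
  hence "i = 1 \<or> i = 2" using \<open>i < 4\<close> by linarith
  thus ?thesis by auto
 qed
 obtain m M where M: "subgroup M G" "\<forall>x\<in>M. x [^] (2 ^ (2 - 1) :: nat) = \<one>" "G \<cong> cyclic_power (2 ^ 2) m \<times>\<times> G\<lparr>carrier := M\<rparr>"
  using homocyclic_decomposition[OF comm_group_axioms assms(1) _ bez _ dv] assms(2) by force
 have "\<exists>n. G\<lparr>carrier := M\<rparr> \<cong> cyclic_power 2 n" by (rule comm_group.elementary_abelian[OF subgroup_comm_group[OF M(1)]])
   (use M(2) finite_subset[OF subgroup.subset[OF M(1)] assms(1)] nat_pow_consistent[of _ 2 M] in simp_all)
 then obtain n where "G\<lparr>carrier := M\<rparr> \<cong> cyclic_power 2 n" by blast
 hence "cyclic_power (2 ^ 2) m \<times>\<times> G\<lparr>carrier := M\<rparr> \<cong> cyclic_power (2 ^ 2) m \<times>\<times> cyclic_power 2 n"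
  by (intro group.DirProd_iso_trans[OF group_cyclic_power] iso_refl)
 hence "G \<cong> cyclic_power (2 ^ 2) m \<times>\<times> cyclic_power 2 n" using M(3) iso_trans by blast
 thus ?thesis by auto
qed

lemma (in comm_group) exponent_6_abelian:
 assumes "finite (carrier G)" "\<And>x. x \<in> carrier G \<Longrightarrow> x [^] (6::nat) = \<one>"
 shows "\<exists>m n. G \<cong> cyclic_power 3 m \<times>\<times> cyclic_power 2 n"
proof -
 define A where "A p = {x \<in> carrier G. x [^] (p::nat) = \<one>}" for p
 have A: "subgroup (A p) G" for p by (rule finite_subgroupI[OF assms(1)]) (auto simp: A_def pow_mult_distrib[OF m_comm])
 have "G \<cong> G\<lparr>carrier := A 3\<rparr> \<times>\<times> G\<lparr>carrier := A 2\<rparr>"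
 proof (rule internal_direct_product[OF A A])
  fix x assume x: "x \<in> carrier G"
  \<comment> \<open>The exponents 4 and 3 separate the two primary parts: x^4 is killed by 3 and x^3
    by 2.\<close>
  have "x = x [^] (7::nat)" using x assms(2)[OF x] nat_pow_Suc[of x 6] by simp
  also have "\<dots> = x [^] (4::nat) \<otimes> x [^] (3::nat)" using x by (simp add: nat_pow_mult)
  finally have "x = x [^] (4::nat) \<otimes> x [^] (3::nat)" .
  moreover have "x [^] (4::nat) \<in> A 3" using x nat_pow_pow[OF x, of 4 3] nat_pow_pow[OF x, of 6 2] assms(2)[OF x] by (simp add: A_def)
  moreover have "x [^] (3::nat) \<in> A 2" using x nat_pow_pow[OF x, of 3 2] assms(2)[OF x] by (simp add: A_def)
  ultimately show "\<exists>a\<in>A 3. \<exists>b\<in>A 2. x = a \<otimes> b" by blast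
 next
  show "A 3 \<inter> A 2 \<subseteq> {\<one>}"
  proof
   fix x assume "x \<in> A 3 \<inter> A 2"
   hence x: "x \<in> carrier G" "x [^] (3::nat) = \<one>" "x [^] (2::nat) = \<one>" by (auto simp: A_def)
   hence "x [^] (3::nat) = x" using nat_pow_Suc[of x 2] by (simp add: numeral_3_eq_3 numeral_2_eq_2)
   thus "x \<in> {\<one>}" using x by simp
  qed
 qed (auto simp: A_def m_comm)
 moreover have e: "\<exists>n. G\<lparr>carrier := A p\<rparr> \<cong> cyclic_power p n" if "p = 2 \<or> p = 3" for p
 proof (rule comm_group.elementary_abelian[OF subgroup_comm_group[OF A] _ that])
  show "finite (carrier (G\<lparr>carrier := A p\<rparr>))" using finite_subset[OF subgroup.subset[OF A] assms(1)] by simp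
  fix x assume "x \<in> carrier (G\<lparr>carrier := A p\<rparr>)"
  hence "x [^] p = \<one>" by (simp add: A_def)
  thus "x [^]\<^bsub>G\<lparr>carrier := A p\<rparr>\<^esub> p = \<one>\<^bsub>G\<lparr>carrier := A p\<rparr>\<^esub>" by (simp flip: nat_pow_consistent)
 qed
 obtain m n where "G\<lparr>carrier := A 3\<rparr> \<cong> cyclic_power 3 m" "G\<lparr>carrier := A 2\<rparr> \<cong> cyclic_power 2 n" using e by blast
 hence "G\<lparr>carrier := A 3\<rparr> \<times>\<times> G\<lparr>carrier := A 2\<rparr> \<cong> cyclic_power 3 m \<times>\<times> cyclic_power 2 n"
  by (rule group.DirProd_iso_trans[OF subgroup_imp_group[OF A]])
 ultimately show ?thesis using iso_trans by blast
qed

section \<open>Finite groups in which every cyclic subgroup is normal\<close>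

context group
begin

lemma conj_eq_imp_commute:
 assumes "a \<in> carrier G" "b \<in> carrier G" "inv b \<otimes> a \<otimes> b = c" "c \<in> carrier G" shows "a \<otimes> b = b \<otimes> c"
proof -
 have "b \<otimes> c = b \<otimes> (inv b \<otimes> (a \<otimes> b))" using assms by (simp add: m_assoc)
 also have "\<dots> = a \<otimes> b" using assms(1,2) by (simp add: m_assoc[symmetric])
 finally show ?thesis by simp
qed

end

locale dedekind = group G for G :: "('g, 'n) monoid_scheme" (structure) +
 assumes finD: "finite (carrier G)"
  and normal: "\<And>g h. g \<in> carrier G \<Longrightarrow> h \<in> carrier G \<Longrightarrow> inv g \<otimes> h \<otimes> g \<in> powers h"
begin

lemma conj_pow:
 assumes "a \<in> carrier G" "b \<in> carrier G" "k > 0" "a [^] (k::nat) = \<one>"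
 obtains i where "i < k" "a \<otimes> b = b \<otimes> a [^] i"
proof -
 obtain i :: nat where i: "inv b \<otimes> a \<otimes> b = a [^] i" using normal[OF assms(2,1)] by blast
 have "a \<otimes> b = b \<otimes> a [^] i" by (rule conj_eq_imp_commute[OF assms(1,2) i]) (use assms in simp)
 hence "a \<otimes> b = b \<otimes> a [^] (i mod k)" by (simp only: nat_pow_mod[OF assms(1,4)])
 thus thesis using that[of "i mod k"] assms(3) by simp
qed

text \<open>A normal subgroup of order 2 is central.\<close>

lemma involution_central:
 assumes a: "a \<in> carrier G" and b: "b \<in> carrier G" and "a \<otimes> a = \<one>" shows "a \<otimes> b = b \<otimes> a"
proof -
 have "a [^] (2::nat) = \<one>" using assms by (simp add: numeral_2_eq_2)
 then obtain i :: nat where i: "i < 2" "a \<otimes> b = b \<otimes> a [^] i" using conj_pow[OF a b, of 2] by (metis zero_less_numeral)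
 hence "i = 0 \<or> i = 1" by linarith
 thus ?thesis
 proof
  assume "i = 0"
  hence "a \<otimes> b = b" using i b by simp
  hence "a = \<one>" using l_cancel_one[of b a] a b by simp
  thus ?thesis using b by simp
 qed (use i a in simp)
qed

text \<open>If b inverts a, so does b^3, which is 1. Then a equals its inverse and, being killed by
  3, is trivial.\<close>

lemma order_3_commute:
 assumes a: "a \<in> carrier G" and b: "b \<in> carrier G" and a3: "a [^] (3::nat) = \<one>" and b3: "b [^] (3::nat) = \<one>"
 shows "a \<otimes> b = b \<otimes> a"
proof -
 obtain i :: nat where i: "i < 3" "a \<otimes> b = b \<otimes> a [^] i" using conj_pow[OF a b _ a3] by (metis zero_less_numeral)
 hence "i = 0 \<or> i = 1 \<or> i = 2" by linarith
 thus ?thesis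
 proof (elim disjE)
  assume "i = 0"
  hence "a \<otimes> b = b" using i b by simp
  hence "a = \<one>" using l_cancel_one[of b a] a b by simp
  thus ?thesis using b by simp
 next
  assume "i = 2"
  hence e: "a \<otimes> b = b \<otimes> (a \<otimes> a)" using i a by (simp add: numeral_2_eq_2)
  have aaa: "a \<otimes> (a \<otimes> a) = \<one>" using a3 a by (simp add: numeral_3_eq_3 m_assoc)
  have bbb: "b \<otimes> (b \<otimes> b) = \<one>" using b3 b by (simp add: numeral_3_eq_3 m_assoc)
  have e': "a \<otimes> (b \<otimes> x) = b \<otimes> (a \<otimes> (a \<otimes> x))" if "x \<in> carrier G" for x
   using that a b e by (simp add: m_assoc[symmetric])
  have aaa': "a \<otimes> (a \<otimes> (a \<otimes> x)) = x" if "x \<in> carrier G" for x using that a aaa by (simp add: m_assoc[symmetric])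
  have bbb': "b \<otimes> (b \<otimes> (b \<otimes> x)) = x" if "x \<in> carrier G" for x using that b bbb by (simp add: m_assoc[symmetric])
  have "a = a \<otimes> (b \<otimes> (b \<otimes> b))" using bbb a by simp
  also have "\<dots> = a \<otimes> a" using a b by (simp add: e e' aaa' bbb')
  finally have "a = \<one>" using l_cancel_one[of a a] a by simp
  thus ?thesis using b by simp
 qed (use i a in simp)
qed

text \<open>Each x is x^4 * x^3, an element killed by 3 times one killed by 2. The latter are
  central and the former commute with each other.\<close>

lemma exponent_6_commutative:
 assumes e6: "\<And>x. x \<in> carrier G \<Longrightarrow> x [^] (6::nat) = \<one>" shows "comm_group G"
proof (rule group_comm_groupI)
 have dec: "\<exists>s\<in>carrier G. \<exists>t\<in>carrier G. x = s \<otimes> t \<and> s [^] (3::nat) = \<one> \<and> t \<otimes> t = \<one>" if x: "x \<in> carrier G" for x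
 proof -
  have "x = x [^] (7::nat)" using x e6[OF x] nat_pow_Suc[of x 6] by simp
  also have "\<dots> = x [^] (4::nat) \<otimes> x [^] (3::nat)" using x by (simp add: nat_pow_mult)
  finally have "x = x [^] (4::nat) \<otimes> x [^] (3::nat)" .
  moreover have "(x [^] (4::nat)) [^] (3::nat) = \<one>" using nat_pow_pow[OF x, of 4 3] nat_pow_pow[OF x, of 6 2] e6[OF x] by simp
  moreover have "x [^] (3::nat) \<otimes> x [^] (3::nat) = \<one>" using x e6[OF x] by (simp add: nat_pow_mult)
  ultimately show ?thesis using x nat_pow_closed by blast
 qed
 fix x y assume x: "x \<in> carrier G" and y: "y \<in> carrier G"
 obtain s t where s: "s \<in> carrier G" "t \<in> carrier G" "x = s \<otimes> t" "s [^] (3::nat) = \<one>" "t \<otimes> t = \<one>" using dec[OF x] by blast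
 obtain s' t' where s': "s' \<in> carrier G" "t' \<in> carrier G" "y = s' \<otimes> t'" "s' [^] (3::nat) = \<one>" "t' \<otimes> t' = \<one>" using dec[OF y] by blast
 have 1: "s \<otimes> s' = s' \<otimes> s" by (rule order_3_commute[OF s(1) s'(1) s(4) s'(4)])
 have "x \<otimes> y = s \<otimes> (t \<otimes> s') \<otimes> t'" using s s' by (simp add: m_assoc)
 also have "t \<otimes> s' = s' \<otimes> t" by (rule involution_central[OF s(2) s'(1) s(5)])
 also have "s \<otimes> (s' \<otimes> t) \<otimes> t' = s \<otimes> s' \<otimes> (t \<otimes> t')" using s s' by (simp add: m_assoc)
 also have "t \<otimes> t' = t' \<otimes> t" by (rule involution_central[OF s(2) s'(2) s(5)])
 also have "s \<otimes> s' \<otimes> (t' \<otimes> t) = s' \<otimes> (s \<otimes> t') \<otimes> t" using s s' by (simp add: 1 m_assoc)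
 also have "s \<otimes> t' = t' \<otimes> s" by (rule involution_central[OF s'(2) s(1) s'(5), symmetric])
 also have "s' \<otimes> (t' \<otimes> s) \<otimes> t = y \<otimes> x" using s s' by (simp add: m_assoc)
 finally show "x \<otimes> y = y \<otimes> x" .
qed

text \<open>Otherwise there are commuting elements of orders 4 and 3, and the order of their product
  divides neither 4 nor 6.\<close>

lemma exponent_4_or_6:
 assumes ords: "\<And>x. x \<in> carrier G \<Longrightarrow> ord x \<in> {1, 2, 3, 4, 6}"
 shows "(\<forall>x\<in>carrier G. x [^] (6::nat) = \<one>) \<or> (\<forall>x\<in>carrier G. x [^] (4::nat) = \<one>)"
proof (rule ccontr)
 assume "\<not> ?thesis"
 then obtain x y where x: "x \<in> carrier G" "x [^] (6::nat) \<noteq> \<one>" and y: "y \<in> carrier G" "y [^] (4::nat) \<noteq> \<one>" by blast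
 have "ord x \<noteq> 1" "ord x \<noteq> 2" "ord x \<noteq> 3" "ord x \<noteq> 6" using x(2) unfolding pow_eq_id[OF x(1)] by auto
 hence ox: "ord x = 4" using ords[OF x(1)] by auto
 have "ord y \<noteq> 1" "ord y \<noteq> 2" "ord y \<noteq> 4" using y(2) unfolding pow_eq_id[OF y(1)] by auto
 hence oy: "ord y = 3 \<or> ord y = 6" using ords[OF y(1)] by auto
 \<comment> \<open>y has order 3 or 6, so its fourth power has order 3.\<close>
 define w where "w = y [^] (4::nat)"
 have w: "w \<in> carrier G" "w \<noteq> \<one>" using y by (simp_all add: w_def)
 have w3: "w [^] (3::nat) = \<one>" unfolding w_def nat_pow_pow[OF y(1)] pow_eq_id[OF y(1)] using oy by auto
 have x4: "x [^] (4::nat) = \<one>" unfolding pow_eq_id[OF x(1)] ox by simp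
 have x2: "x [^] (2::nat) \<noteq> \<one>" unfolding pow_eq_id[OF x(1)] ox by simp
 \<comment> \<open>The commutator of x and w lies in both normal subgroups <x> and <w>; it is killed
   by 4 and by 3, hence trivial.\<close>
 define c where "c = inv x \<otimes> (inv w \<otimes> x \<otimes> w)"
 obtain i :: nat where i: "inv w \<otimes> x \<otimes> w = x [^] i" using normal[OF w(1) x(1)] by blast
 obtain j :: nat where j: "inv x \<otimes> w \<otimes> x = w [^] j" using normal[OF x(1) w(1)] by blast
 have cx: "c [^] (4::nat) = \<one>"
 proof -
  have "c = x [^] (3::nat) \<otimes> x [^] i"
  proof -
   have "x [^] (3::nat) \<otimes> x = \<one>" using x4 nat_pow_Suc[of x 3] by simp
   hence "inv x = x [^] (3::nat)" using x(1) by (intro inv_equality) simp_all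
   thus ?thesis by (simp add: c_def i)
  qed
  also have "\<dots> = x [^] (3 + i)" using x(1) by (simp add: nat_pow_mult)
  finally have "c [^] (4::nat) = (x [^] (4::nat)) [^] (3 + i)" using x(1) by (simp add: nat_pow_pow mult.commute)
  thus ?thesis using x4 by simp
 qed
 have cw: "c [^] (3::nat) = \<one>"
 proof -
  have "inv (w [^] j) = inv (inv x \<otimes> w \<otimes> x)" using j by simp
  also have "\<dots> = inv x \<otimes> inv w \<otimes> x" using x(1) w(1) by (simp add: inv_mult_group m_assoc)
  finally have "c = inv (w [^] j) \<otimes> w" using x(1) w(1) by (simp add: c_def m_assoc)
  moreover have "inv (w [^] j) = w [^] (2 * j)"
  proof (rule inv_equality)
   have "w [^] (2 * j) \<otimes> w [^] j = (w [^] (3::nat)) [^] j" using w(1) by (simp add: nat_pow_pow nat_pow_mult)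
   thus "w [^] (2 * j) \<otimes> w [^] j = \<one>" using w3 by simp
  qed (use w in simp_all)
  ultimately have "c = w [^] (2 * j + 1)" using w(1) by simp
  hence "c [^] (3::nat) = (w [^] (3::nat)) [^] (2 * j + 1)" using w(1) by (simp only: nat_pow_pow mult.commute)
  thus ?thesis unfolding w3 by simp
 qed
 have cc: "c \<in> carrier G" using x w by (simp add: c_def)
 have "c [^] (4::nat) = c [^] (3::nat) \<otimes> c" using nat_pow_Suc[of c 3] by simp
 hence "c = \<one>" using cx cw cc by simp
 hence "x = inv w \<otimes> x \<otimes> w" unfolding c_def using x(1) w(1) by (metis inv_closed inv_equality inv_inv m_closed inv_comm)
 hence xw: "x \<otimes> w = w \<otimes> x" using conj_eq_imp_commute[OF x(1) w(1), of x] x(1) by simp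
 have pw: "(x \<otimes> w) [^] n = x [^] n \<otimes> w [^] n" for n :: nat by (rule pow_mult_distrib[OF xw x(1) w(1)])
 have "w [^] (4::nat) = w" using w3 w nat_pow_Suc[of w 3] by simp
 hence "(x \<otimes> w) [^] (4::nat) \<noteq> \<one>" unfolding pw x4 using w by simp
 moreover have "x [^] (6::nat) = x [^] (4::nat) \<otimes> x [^] (2::nat)" using nat_pow_mult[OF x(1), of 4 2] by simp
 hence "x [^] (6::nat) = x [^] (2::nat)" unfolding x4 using x(1) by simp
 moreover have "w [^] (6::nat) = (w [^] (3::nat)) [^] (2::nat)" using nat_pow_pow[OF w(1), of 3 2] by simp
 hence "w [^] (6::nat) = \<one>" unfolding w3 by simp
 ultimately have "x [^] (6::nat) \<otimes> w [^] (6::nat) = x [^] (2::nat)" "(x \<otimes> w) [^] (4::nat) \<noteq> \<one>" using x(1) by simp_all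
 hence "(x \<otimes> w) [^] (6::nat) \<noteq> \<one>" unfolding pw using x2 by simp
 moreover note \<open>(x \<otimes> w) [^] (4::nat) \<noteq> \<one>\<close>
 moreover have xwc: "x \<otimes> w \<in> carrier G" using x w by simp
 ultimately have "\<not> ord (x \<otimes> w) dvd 4" "\<not> ord (x \<otimes> w) dvd 6" using pow_eq_id[OF xwc] by simp_all
 thus False using ords[OF xwc] by auto
qed

text \<open>Conjugation sends a to some power a^i, and noncommutativity leaves only i = 3, so a and
  b invert each other. Then b * b = (a * b * a) * b = a * (b * a * b) = a * a.\<close>

lemma noncommuting_relations:
 assumes e4: "\<And>x. x \<in> carrier G \<Longrightarrow> x [^] (4::nat) = \<one>"
  and a: "a \<in> carrier G" and b: "b \<in> carrier G" and nc: "a \<otimes> b \<noteq> b \<otimes> a"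
 shows "a \<otimes> b \<otimes> a = b" "b \<otimes> b = a \<otimes> a" "a \<otimes> a \<noteq> \<one>" "a \<otimes> a \<otimes> (a \<otimes> a) = \<one>" "b \<otimes> a = a \<otimes> a \<otimes> (a \<otimes> b)"
proof -
 have key: "x \<otimes> y \<otimes> x = y \<and> x \<otimes> x \<noteq> \<one>" if x: "x \<in> carrier G" and y: "y \<in> carrier G" and n: "x \<otimes> y \<noteq> y \<otimes> x" for x y
 proof -
  have x2: "x \<otimes> x \<noteq> \<one>" using involution_central[OF x y] n by blast
  have x4: "x \<otimes> x \<otimes> x \<otimes> x = \<one>" using e4[OF x] x by (simp add: numeral_eq_Suc)
  obtain i :: nat where i: "i < 4" "x \<otimes> y = y \<otimes> x [^] i" using conj_pow[OF x y _ e4[OF x]] by (metis zero_less_numeral)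
  hence "i = 0 \<or> i = 1 \<or> i = 2 \<or> i = 3" by linarith
  hence "i = 3"
  proof (elim disjE)
   assume "i = 0"
   hence "x \<otimes> y = y" using i y by simp
   hence "x = \<one>" using l_cancel_one[of y x] x y by simp
   thus ?thesis using n y by simp
  next
   assume "i = 1"
   thus ?thesis using i n x by simp
  next
   assume "i = 2"
   hence e: "x \<otimes> y = y \<otimes> (x \<otimes> x)" using i x by (simp add: numeral_2_eq_2)
   have "x \<otimes> x \<otimes> y = x \<otimes> (y \<otimes> (x \<otimes> x))" using x y e by (simp add: m_assoc)
   also have "\<dots> = (x \<otimes> y) \<otimes> (x \<otimes> x)" using x y by (simp add: m_assoc)
   also have "\<dots> = y \<otimes> (x \<otimes> x \<otimes> x \<otimes> x)" unfolding e using x y by (simp add: m_assoc)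
   finally have "x \<otimes> x \<otimes> y = y" using x4 y by simp
   hence "x \<otimes> x = \<one>" using l_cancel_one[of y "x \<otimes> x"] x y by simp
   thus ?thesis using x2 by simp
  qed simp
  hence "x \<otimes> y \<otimes> x = y \<otimes> (x [^] (3::nat)) \<otimes> x" using i by simp
  also have "\<dots> = y \<otimes> (x \<otimes> x \<otimes> x \<otimes> x)" using x y by (simp add: numeral_eq_Suc m_assoc)
  finally show ?thesis using x4 y x2 by simp
 qed
 show aba: "a \<otimes> b \<otimes> a = b" and a2: "a \<otimes> a \<noteq> \<one>" using key[OF a b nc] by simp_all
 have bab: "b \<otimes> a \<otimes> b = a" using key[OF b a] nc by auto
 have "b \<otimes> b = (a \<otimes> b \<otimes> a) \<otimes> b" using aba by simp
 also have "\<dots> = a \<otimes> (b \<otimes> a \<otimes> b)" using a b by (simp add: m_assoc)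
 finally show bb: "b \<otimes> b = a \<otimes> a" using bab by simp
 show a4: "a \<otimes> a \<otimes> (a \<otimes> a) = \<one>" using e4[OF a] a by (simp add: numeral_eq_Suc m_assoc)
 have "a \<otimes> a \<otimes> (a \<otimes> b) \<otimes> a = a \<otimes> a \<otimes> (a \<otimes> b \<otimes> a)" using a b by (simp add: m_assoc)
 also have "\<dots> = b \<otimes> b \<otimes> b" using aba bb by simp
 also have "\<dots> = b \<otimes> (b \<otimes> b)" by (rule m_assoc[OF b b b])
 also have "b \<otimes> b = a \<otimes> a" by (rule bb)
 finally have "a \<otimes> a \<otimes> (a \<otimes> b) \<otimes> a = b \<otimes> a \<otimes> a" using a b by (simp add: m_assoc)
 thus "b \<otimes> a = a \<otimes> a \<otimes> (a \<otimes> b)" using r_cancel[of "b \<otimes> a" a "a \<otimes> a \<otimes> (a \<otimes> b)"] a b by simp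
qed

end

context dedekind
begin

text \<open>a and b generate a copy Q of the quaternion group. The common centralizer C of a and b
  has exponent 2, meets Q in {1, z} and satisfies G = QC. A complement M of <z> in C is therefore a
  complement of Q in G.\<close>

theorem exponent_4_noncommutative:
 assumes e4: "\<And>x. x \<in> carrier G \<Longrightarrow> x [^] (4::nat) = \<one>"
  and a: "a \<in> carrier G" and b: "b \<in> carrier G" and nc: "a \<otimes> b \<noteq> b \<otimes> a"
 shows "\<exists>n. G \<cong> quaternion_group \<times>\<times> cyclic_power 2 n"
proof -
 note rel = noncommuting_relations[OF e4 a b nc]
 have bab: "b \<otimes> a \<otimes> b = a" using noncommuting_relations(1)[OF e4 b a] nc by auto
 define z where "z = a \<otimes> a"
 have z: "z \<in> carrier G" "z \<noteq> \<one>" "z \<otimes> z = \<one>" using a rel by (simp_all add: z_def)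
 have aa: "a \<otimes> a = z" and bb: "b \<otimes> b = z" and ba: "b \<otimes> a = z \<otimes> (a \<otimes> b)" using rel by (simp_all add: z_def)
 have zc: "z \<otimes> x = x \<otimes> z" if "x \<in> carrier G" for x by (rule involution_central[OF z(1) that z(3)])
 note c = a b z(1)
 define \<psi> :: "int \<times> int \<times> int \<times> int \<Rightarrow> 'g" where
  "\<psi> = (\<lambda>(w,x,y,t). if w = 1 then \<one> else if w = -1 then z else if x = 1 then a else if x = -1 then z \<otimes> a
   else if y = 1 then b else if y = -1 then z \<otimes> b else if t = 1 then a \<otimes> b else z \<otimes> (a \<otimes> b))"
 have rules: "a \<otimes> z = z \<otimes> a" "b \<otimes> z = z \<otimes> b"
  "\<And>x. x \<in> carrier G \<Longrightarrow> z \<otimes> (z \<otimes> x) = x" "\<And>x. x \<in> carrier G \<Longrightarrow> a \<otimes> (z \<otimes> x) = z \<otimes> (a \<otimes> x)"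
  "\<And>x. x \<in> carrier G \<Longrightarrow> b \<otimes> (z \<otimes> x) = z \<otimes> (b \<otimes> x)" "\<And>x. x \<in> carrier G \<Longrightarrow> a \<otimes> (a \<otimes> x) = z \<otimes> x"
  "\<And>x. x \<in> carrier G \<Longrightarrow> b \<otimes> (b \<otimes> x) = z \<otimes> x" "\<And>x. x \<in> carrier G \<Longrightarrow> b \<otimes> (a \<otimes> x) = z \<otimes> (a \<otimes> (b \<otimes> x))"
 proof -
  show az: "a \<otimes> z = z \<otimes> a" and bz: "b \<otimes> z = z \<otimes> b" using zc[OF a] zc[OF b] by simp_all
  fix x assume x: "x \<in> carrier G"
  show "z \<otimes> (z \<otimes> x) = x" using m_assoc[OF z(1,1) x] z(3) x by simp
  show "a \<otimes> (z \<otimes> x) = z \<otimes> (a \<otimes> x)" using m_assoc[OF a z(1) x] m_assoc[OF z(1) a x] az by simp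
  show "b \<otimes> (z \<otimes> x) = z \<otimes> (b \<otimes> x)" using m_assoc[OF b z(1) x] m_assoc[OF z(1) b x] bz by simp
  show "a \<otimes> (a \<otimes> x) = z \<otimes> x" using m_assoc[OF a a x] aa by simp
  show "b \<otimes> (b \<otimes> x) = z \<otimes> x" using m_assoc[OF b b x] bb by simp
  have "b \<otimes> (a \<otimes> x) = z \<otimes> (a \<otimes> b) \<otimes> x" using m_assoc[OF b a x] ba by simp
  thus "b \<otimes> (a \<otimes> x) = z \<otimes> (a \<otimes> (b \<otimes> x))" using c x by (simp add: m_assoc)
 qed
 let ?Q = "quaternion_group"
 have \<psi>c: "\<psi> q \<in> carrier G" for q using c by (simp add: \<psi>_def split: prod.split)
 have \<psi>h: "\<psi> (hamilton_mult q q') = \<psi> q \<otimes> \<psi> q'" if q: "q \<in> carrier ?Q" and q': "q' \<in> carrier ?Q" for q q'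
  using q[unfolded quaternion_carrier] q'[unfolded quaternion_carrier]
  by (simp only: insert_iff empty_iff, elim disjE FalseE; simp add: \<psi>_def c m_assoc z(3) aa bb ba rules)
 have \<psi>hom: "\<psi> \<in> hom ?Q G" by (rule homI) (simp_all add: \<psi>c \<psi>h quaternion_mult)
 define C where "C = {x \<in> carrier G. x \<otimes> a = a \<otimes> x \<and> x \<otimes> b = b \<otimes> x}"
 have CI: "x \<in> C" if "x \<in> carrier G" "x \<otimes> a = a \<otimes> x" "x \<otimes> b = b \<otimes> x" for x
  using that unfolding C_def by blast
 have CD: "x \<in> carrier G" "x \<otimes> a = a \<otimes> x" "x \<otimes> b = b \<otimes> x" if "x \<in> C" for x
  using that unfolding C_def by blast+
 have Cs: "subgroup C G"
 proof (rule finite_subgroupI[OF finD])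
  fix x y assume "x \<in> C" "y \<in> C"
  hence x: "x \<in> carrier G" "y \<in> carrier G" "x \<otimes> a = a \<otimes> x" "x \<otimes> b = b \<otimes> x" "y \<otimes> a = a \<otimes> y" "y \<otimes> b = b \<otimes> y"
   by (simp_all add: C_def)
  have "x \<otimes> y \<otimes> w = w \<otimes> (x \<otimes> y)" if "w \<in> carrier G" "x \<otimes> w = w \<otimes> x" "y \<otimes> w = w \<otimes> y" for w
  proof -
   have "x \<otimes> y \<otimes> w = x \<otimes> (w \<otimes> y)" using x that by (simp add: m_assoc)
   also have "\<dots> = w \<otimes> x \<otimes> y" using m_assoc[of x w y] x that by simp
   finally show ?thesis using x that by (simp add: m_assoc)
  qed
  thus "x \<otimes> y \<in> C" using x a b by (simp add: C_def)
 qed (use a b in \<open>auto simp: C_def\<close>)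
 interpret C: subgroup C G by (rule Cs)
 have zC: "z \<in> C" by (rule CI[OF z(1) zc[OF a] zc[OF b]])
 have aC: "a \<notin> C" and bC: "b \<notin> C" using nc CD(3)[of a] CD(2)[of b] by (blast, metis)
 have abC: "a \<otimes> b \<notin> C"
 proof
  assume "a \<otimes> b \<in> C"
  hence "a \<otimes> (b \<otimes> a) = a \<otimes> (a \<otimes> b)" using CD(2) m_assoc[OF a b a] by simp
  thus False using nc l_cancel[of a "b \<otimes> a" "a \<otimes> b"] a b by simp
 qed
 have zx: "x \<in> C" if "z \<otimes> x \<in> C" "x \<in> carrier G" for x using C.m_closed[OF zC that(1)] rules(3)[OF that(2)] by simp
 have notC: "a \<notin> C" "b \<notin> C" "a \<otimes> b \<notin> C" "z \<otimes> a \<notin> C" "z \<otimes> b \<notin> C" "z \<otimes> (a \<otimes> b) \<notin> C"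
  using aC bC abC zx[OF _ a] zx[OF _ b] zx[OF _ m_closed[OF a b]] by blast+
 have "\<psi> q \<in> C \<Longrightarrow> \<psi> q = z \<or> q = (1,0,0,0)" if "q \<in> carrier ?Q" for q
  using that[unfolded quaternion_carrier] notC by (simp only: insert_iff empty_iff, elim disjE FalseE; simp add: \<psi>_def)
 note \<psi>C = this
 have inj: "inj_on \<psi> (carrier ?Q)"
 proof (subst inj_on_one_iff'[OF \<psi>hom Q8.is_group is_group], intro allI impI)
  fix q assume q: "q \<in> carrier ?Q" "\<psi> q = \<one>"
  thus "q = \<one>\<^bsub>?Q\<^esub>" using \<psi>C[OF q(1)] C.one_closed z(2) by (auto simp: quaternion_one)
 qed
 define Q where "Q = \<psi> ` carrier ?Q"
 interpret h: group_hom ?Q G \<psi> by (intro group_hom.intro Q8.is_group is_group group_hom_axioms.intro \<psi>hom)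
 have Qs: "subgroup Q G" unfolding Q_def by (rule h.img_is_subgroup)
 interpret Q: subgroup Q G by (rule Qs)
 have "\<psi> \<in> iso ?Q (G\<lparr>carrier := Q\<rparr>)" unfolding iso_iff using inj \<psi>hom by (auto simp: Q_def hom_def)
 hence Qiso: "G\<lparr>carrier := Q\<rparr> \<cong> ?Q" by (intro group.iso_sym[OF Q8.is_group] is_isoI)
 have "\<psi> (0,1,0,0) \<in> Q" "\<psi> (0,0,1,0) \<in> Q" "\<psi> (-1,0,0,0) \<in> Q" unfolding Q_def by (rule imageI, simp add: quaternion_carrier)+
 hence Qm: "a \<in> Q" "b \<in> Q" "z \<in> Q" by (simp_all add: \<psi>_def)
 \<comment> \<open>For x in C the element x * a does not commute with b either, so its square x^2 *
   a^2 equals b^2 = a^2.\<close>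
 have Cexp: "x \<otimes> x = \<one>" if x: "x \<in> C" for x
 proof -
  have xc: "x \<in> carrier G" "x \<otimes> a = a \<otimes> x" "x \<otimes> b = b \<otimes> x" by (rule CD[OF x])+
  have "(x \<otimes> a) \<otimes> b \<noteq> b \<otimes> (x \<otimes> a)"
  proof
   assume "(x \<otimes> a) \<otimes> b = b \<otimes> (x \<otimes> a)"
   also have "b \<otimes> (x \<otimes> a) = x \<otimes> (b \<otimes> a)" using m_assoc[of b x a] m_assoc[of x b a] xc a b by simp
   finally have "x \<otimes> (a \<otimes> b) = x \<otimes> (b \<otimes> a)" unfolding m_assoc[OF xc(1) a b] .
   thus False using nc l_cancel[of x "a \<otimes> b" "b \<otimes> a"] xc(1) a b by simp
  qed
  hence "b \<otimes> b = (x \<otimes> a) \<otimes> (x \<otimes> a)" using noncommuting_relations(2)[OF e4 m_closed[OF xc(1) a] b] by blast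
  also have "\<dots> = x \<otimes> (a \<otimes> x) \<otimes> a" using xc(1) a by (simp add: m_assoc)
  also have "a \<otimes> x = x \<otimes> a" using xc(2) by simp
  also have "x \<otimes> (x \<otimes> a) \<otimes> a = (x \<otimes> x) \<otimes> z" using xc(1) a z(1) by (simp add: m_assoc aa)
  finally have "(x \<otimes> x) \<otimes> z = z" using bb by simp
  thus ?thesis using l_cancel_one[of z "x \<otimes> x"] r_cancel_one[of z "x \<otimes> x"] xc(1) z(1) by simp
 qed
 have Ccentral: "x \<otimes> y = y \<otimes> x" if "x \<in> C" "y \<in> carrier G" for x y
  by (rule involution_central[OF C.mem_carrier[OF that(1)] that(2) Cexp[OF that(1)]])
 let ?C = "G\<lparr>carrier := C\<rparr>"
 have cgC: "comm_group ?C" by (rule group.group_comm_groupI[OF subgroup_imp_group[OF Cs]]) (simp add: Ccentral C.mem_carrier)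
 have finC: "finite (carrier ?C)" using finite_subset[OF C.subset finD] by simp
 have pow: "x [^]\<^bsub>?C\<^esub> (n::nat) = x [^] n" for x n by (simp flip: nat_pow_consistent)
 \<comment> \<open><z> is the intersection of Q and C, so its complement in C meets Q
   trivially.\<close>
 have "\<exists>M. subgroup M ?C \<and> M \<inter> range (\<lambda>i::nat. z [^]\<^bsub>?C\<^esub> i) \<subseteq> {\<one>\<^bsub>?C\<^esub>} \<and>
  (\<forall>x\<in>carrier ?C. \<exists>m\<in>M. \<exists>i::nat. x = m \<otimes>\<^bsub>?C\<^esub> z [^]\<^bsub>?C\<^esub> i)"
 proof (rule comm_group.prime_power_complement[OF cgC finC, of 2 1])
  fix j :: nat assume "\<not> 2 dvd j"
  hence "1 * j = (j div 2) * 2 + 1" by presburger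
  thus "\<exists>a b. a * j = b * 2 + 1" by blast
 next
  fix x assume "x \<in> carrier ?C"
  hence "x \<otimes> x = \<one>" "x \<in> carrier G" using Cexp C.mem_carrier by auto
  thus "x [^]\<^bsub>?C\<^esub> ((2::nat) ^ 1) = \<one>\<^bsub>?C\<^esub>" unfolding pow by (simp add: numeral_2_eq_2)
 next
  show "z [^]\<^bsub>?C\<^esub> ((2::nat) ^ (1 - 1)) \<noteq> \<one>\<^bsub>?C\<^esub>" unfolding pow using z by simp
 qed (use zC in simp_all)
 then obtain M where M: "subgroup M ?C" "M \<inter> powers z \<subseteq> {\<one>}"
  "\<forall>x\<in>C. \<exists>m\<in>M. \<exists>i::nat. x = m \<otimes> z [^] i" unfolding pow by auto
 have Ms: "subgroup M G" by (rule incl_subgroup[OF Cs M(1)])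
 interpret M: subgroup M G by (rule Ms)
 have MC: "M \<subseteq> C" using subgroup.subset[OF M(1)] by simp
 have zM: "z \<notin> M" 
 proof
  assume "z \<in> M"
  moreover have "z \<in> powers z" using z(1) by (intro range_eqI[of _ _ 1]) simp
  ultimately have "z \<in> {\<one>}" using M(2) by blast
  thus False using z(2) by simp
 qed
 have gen: "\<exists>q\<in>Q. \<exists>m\<in>M. x = q \<otimes> m" if x: "x \<in> carrier G" for x
 proof -
  \<comment> \<open>If x does not commute with a, it inverts a, and so does b; hence x * b commutes
    with a. Afterwards a corrects the commutation with b in the same way.\<close>
  have "\<exists>s\<in>{\<one>, b}. (x \<otimes> s) \<otimes> a = a \<otimes> (x \<otimes> s)"
  proof (cases "a \<otimes> x = x \<otimes> a")
   case False
   have axa: "a \<otimes> x \<otimes> a = x" by (rule noncommuting_relations(1)[OF e4 a x False])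
   have "a \<otimes> (x \<otimes> b) = a \<otimes> (x \<otimes> (a \<otimes> b \<otimes> a))" using rel(1) by simp
   also have "\<dots> = (a \<otimes> x \<otimes> a) \<otimes> (b \<otimes> a)" using a b x by (simp add: m_assoc)
   also have "\<dots> = (x \<otimes> b) \<otimes> a" unfolding axa using a b x by (simp add: m_assoc)
   finally show ?thesis by auto
  qed (use x a in auto)
  then obtain s where s: "s = \<one> \<or> s = b" "(x \<otimes> s) \<otimes> a = a \<otimes> (x \<otimes> s)" by blast
  have sc: "s \<in> carrier G" "s \<in> Q" using s(1) b Qm Q.one_closed by auto
  define y where "y = x \<otimes> s"
  have y: "y \<in> carrier G" "y \<otimes> a = a \<otimes> y" using x sc s by (simp_all add: y_def)
  have "\<exists>t\<in>{\<one>, a}. y \<otimes> t \<in> C"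
  proof (cases "b \<otimes> y = y \<otimes> b")
   case True
   hence "y \<otimes> \<one> \<in> C" using CI[OF y(1,2)] True y(1) by simp
   thus ?thesis by blast
  next
   case False
   have byb: "b \<otimes> y \<otimes> b = y" by (rule noncommuting_relations(1)[OF e4 b y(1) False])
   have "b \<otimes> (y \<otimes> a) = b \<otimes> (y \<otimes> (b \<otimes> a \<otimes> b))" using bab by simp
   also have "\<dots> = (b \<otimes> y \<otimes> b) \<otimes> (a \<otimes> b)" using a b y(1) by (simp add: m_assoc)
   also have "\<dots> = (y \<otimes> a) \<otimes> b" unfolding byb using a b y(1) by (simp add: m_assoc)
   finally have "(y \<otimes> a) \<otimes> b = b \<otimes> (y \<otimes> a)" by simp
   moreover have "(y \<otimes> a) \<otimes> a = a \<otimes> (y \<otimes> a)" using y a m_assoc[of a y a] by simp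
   ultimately have "y \<otimes> a \<in> C" using CI[OF m_closed[OF y(1) a]] by blast
   thus ?thesis by blast
  qed
  then obtain t where t: "t = \<one> \<or> t = a" "y \<otimes> t \<in> C" by blast
  have tc: "t \<in> carrier G" "t \<in> Q" using t(1) a Qm Q.one_closed by auto
  obtain m i where m: "m \<in> M" "y \<otimes> t = m \<otimes> z [^] (i::nat)" using M(3) t(2) by blast
  have mc: "m \<in> carrier G" using m(1) by simp
  have zQ: "z [^] i \<in> Q" by (induction i) (simp_all add: Qm)
  have zic: "z [^] i \<in> carrier G" using z(1) by simp
  define q where "q = z [^] i \<otimes> inv t \<otimes> inv s"
  have qQ: "q \<in> Q" unfolding q_def by (intro Q.m_closed Q.m_inv_closed zQ tc sc)
  have "x = y \<otimes> inv s" unfolding y_def using x sc by (simp add: m_assoc)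
  also have "y = y \<otimes> t \<otimes> inv t" using y tc by (simp add: m_assoc)
  also have "y \<otimes> t = m \<otimes> z [^] i" by (rule m(2))
  finally have "x = m \<otimes> q" unfolding q_def using mc zic tc sc by (simp add: m_assoc)
  also have "\<dots> = q \<otimes> m" using Ccentral[of m q] MC m(1) Q.mem_carrier[OF qQ] by blast
  finally show ?thesis using qQ m(1) by blast
 qed
 have prod: "G \<cong> G\<lparr>carrier := Q\<rparr> \<times>\<times> G\<lparr>carrier := M\<rparr>"
 proof (rule internal_direct_product[OF Qs Ms _ _ gen])
  fix q m assume "q \<in> Q" "m \<in> M"
  thus "q \<otimes> m = m \<otimes> q" using Ccentral[of m q] MC by auto
 next
  show "Q \<inter> M \<subseteq> {\<one>}"
  proof
   fix x assume x: "x \<in> Q \<inter> M"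
   then obtain q where q: "q \<in> carrier ?Q" "x = \<psi> q" by (auto simp: Q_def)
   have "x \<in> C" "x \<noteq> z" using x MC zM by auto
   hence "q = (1,0,0,0)" using \<psi>C[OF q(1)] q(2) by simp
   thus "x \<in> {\<one>}" using q(2) by (simp add: \<psi>_def)
  qed
 qed
 have cgM: "comm_group (G\<lparr>carrier := M\<rparr>)" by (rule group.group_comm_groupI[OF subgroup_imp_group[OF Ms]]) (use Ccentral MC in auto)
 have "\<exists>n. G\<lparr>carrier := M\<rparr> \<cong> cyclic_power 2 n"
 proof (rule comm_group.elementary_abelian[OF cgM])
  show "finite (carrier (G\<lparr>carrier := M\<rparr>))" using finite_subset[OF M.subset finD] by simp
  fix x assume "x \<in> carrier (G\<lparr>carrier := M\<rparr>)"
  hence "x \<otimes> x = \<one>" "x \<in> carrier G" using Cexp MC by auto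
  hence "x [^] (2::nat) = \<one>" by (simp add: numeral_2_eq_2)
  thus "x [^]\<^bsub>G\<lparr>carrier := M\<rparr>\<^esub> (2::nat) = \<one>\<^bsub>G\<lparr>carrier := M\<rparr>\<^esub>" by (simp flip: nat_pow_consistent)
 qed simp
 then obtain n where n: "G\<lparr>carrier := M\<rparr> \<cong> cyclic_power 2 n" by blast
 have "G \<cong> ?Q \<times>\<times> cyclic_power 2 n" by (rule iso_trans[OF prod group.DirProd_iso_trans[OF subgroup_imp_group[OF Qs] Qiso n]])
 thus ?thesis by blast
qed

end

section \<open>Groups of order 2 and 3\<close>

text \<open>At \<zeta> \<noteq> 1 the constant is multiplied by the sum of the powers of \<zeta>,
  which is 0.\<close>

lemma integer_mod_group_fourier:
 fixes \<zeta> :: complex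
 assumes k: "k > 0" and inv: "inverse_mod_Sigma (integer_mod_group k) u v" and z: "\<zeta> ^ k = 1" "\<zeta> \<noteq> 1"
 shows "(\<Sum>a\<in>{0..<int k}. u a * \<zeta> ^ nat a) * (\<Sum>a\<in>{0..<int k}. v a * \<zeta> ^ nat a) = 1"
proof -
 let ?G = "integer_mod_group k"
 interpret G: group ?G by simp
 have car: "carrier ?G = {0..<int k}" using k by (simp add: carrier_integer_mod_group)
 have one: "\<one>\<^bsub>?G\<^esub> = 0" by simp
 have mult: "\<zeta> ^ nat (a \<otimes>\<^bsub>?G\<^esub> b) = \<zeta> ^ nat a * \<zeta> ^ nat b" if "a \<in> carrier ?G" "b \<in> carrier ?G" for a b
 proof -
  have ab: "0 \<le> a" "0 \<le> b" using that unfolding car by simp_all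
  have "nat ((a + b) mod int k) = (nat a + nat b) mod k"
   using ab by (simp only: nat_mod_distrib nat_add_distrib nat_int of_nat_0_le_iff add_nonneg_nonneg)
  hence "\<zeta> ^ nat (a \<otimes>\<^bsub>?G\<^esub> b) = \<zeta> ^ ((nat a + nat b) mod k)" unfolding mult_integer_mod_group by (simp only:)
  also have "\<dots> = \<zeta> ^ (nat a + nat b)" by (rule root_of_unity_power_mod[OF z(1)])
  finally show ?thesis by (simp only: power_add)
 qed
 obtain c where c: "\<forall>x\<in>carrier ?G. gconv ?G u v x = (if x = \<one>\<^bsub>?G\<^esub> then 1 else 0) + c"
  using inv unfolding inverse_mod_Sigma_def by blast
 have "(\<Sum>a\<in>{0..<int k}. u a * \<zeta> ^ nat a) * (\<Sum>a\<in>{0..<int k}. v a * \<zeta> ^ nat a)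
   = (\<Sum>x\<in>carrier ?G. gconv ?G u v x * \<zeta> ^ nat x)"
  unfolding car[symmetric] by (rule G.sum_hom_gconv[symmetric]) (rule mult)
 also have "\<dots> = (\<Sum>x\<in>carrier ?G. (if x = 0 then 1 else 0) + c * \<zeta> ^ nat x)"
 proof (rule sum.cong[OF refl])
  fix x assume x: "x \<in> carrier ?G"
  show "gconv ?G u v x * \<zeta> ^ nat x = (if x = 0 then 1 else 0) + c * \<zeta> ^ nat x" unfolding bspec[OF c x] one by (simp add: ring_distribs)
 qed
 also have "\<dots> = 1 + c * (\<Sum>x\<in>{0..<int k}. \<zeta> ^ nat x)" unfolding car using k by (simp add: sum.distrib sum_distrib_left sum.delta)
 also have "(\<Sum>x\<in>{0..<int k}. \<zeta> ^ nat x) = (\<Sum>i<k. \<zeta> ^ i)" by (rule sum.reindex_bij_witness[of _ int nat]) auto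
 also have "\<dots> = 0" using z by (simp add: geometric_sum)
 finally show ?thesis by simp
qed

lemma interval_2: "{0..<int 2} = {0, 1}" and interval_3: "{0..<int 3} = {0, 1, 2}" by auto

text \<open>Evaluation at the only nontrivial character, -1, identifies the reduced group ring with
  R.\<close>

theorem order_2_only_trivial_units:
 assumes R: "\<And>a b. a \<in> R \<Longrightarrow> b \<in> R \<Longrightarrow> a - b \<in> R"
 shows "complex_only_trivial_units R (integer_mod_group 2)"
 unfolding complex_only_trivial_units_def
proof (intro allI impI)
 let ?G = "integer_mod_group 2"
 fix u v assume u: "u \<in> carrier ?G \<rightarrow> R" and v: "v \<in> carrier ?G \<rightarrow> R" and inv: "inverse_mod_Sigma ?G u v"
 have car: "carrier ?G = {0, 1}" using interval_2 by (simp add: carrier_integer_mod_group)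
 have "(u 0 - u 1) * (v 0 - v 1) = 1" using integer_mod_group_fourier[OF _ inv, of "-1"] unfolding interval_2 by simp
 hence i: "inverse (u 0 - u 1) = v 0 - v 1" "u 0 - u 1 \<noteq> 0" by (rule inverse_unique, auto)
 have "u 0 - u 1 \<in> R" "v 0 - v 1 \<in> R" using u v R unfolding car by auto
 moreover have "\<forall>x\<in>carrier ?G. u x = (if x = 0 then u 0 - u 1 else 0) + u 1" unfolding car by simp
 moreover have "0 \<in> carrier ?G" unfolding car by simp
 ultimately show "trivial_mod_Sigma R ?G u" unfolding trivial_mod_Sigma_def using i by metis
qed

text \<open>
 The bound comes from \<open>4 (x\<^sup>2 - x y + y\<^sup>2)\<^sup>3 - 27 (x y (x - y))\<^sup>2 = ((x + y) (2 x - y) (x - 2 y))\<^sup>2\<close>.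
\<close>

lemma hexagonal_product_bound:
 fixes x y :: real
 assumes "x\<^sup>2 - x * y + y\<^sup>2 = 1" shows "\<bar>x * y * (x - y)\<bar> < 1"
proof -
 have "4 * (x\<^sup>2 - x * y + y\<^sup>2) ^ 3 - 27 * (x * y * (x - y))\<^sup>2 = ((x + y) * (2 * x - y) * (x - 2 * y))\<^sup>2"
  by (simp add: power2_eq_square power3_eq_cube algebra_simps)
 hence "27 * (x * y * (x - y))\<^sup>2 \<le> 4" unfolding assms by (smt (verit) zero_le_power2 power_one)
 hence "(x * y * (x - y))\<^sup>2 < 1\<^sup>2" by simp
 thus ?thesis by (simp only: power2_less_imp_less abs_square_less_1 power_one)
qed

context complex_number_field
begin

lemma three_not_unit:
 assumes "a \<in> ints" "N' \<in> ints" "3 * a * a * N' = 1" shows False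
proof -
 define t where "t = a * a * N'"
 have t: "algebraic_int t" unfolding t_def by (rule ints_algebraic) (intro ints_mult assms)
 have "3 * t = 1" using assms(3) by (simp add: t_def mult.assoc)
 hence t3: "t = 1 / 3" by (simp add: field_simps)
 have "t \<in> \<rat>" unfolding t3 by simp
 hence "t \<in> \<int>" by (rule rational_algebraic_int_is_int[OF t])
 then obtain k where "t = of_int k" by (rule Ints_cases)
 hence "complex_of_int (3 * k) = of_int 1" using \<open>3 * t = 1\<close> by simp
 hence "3 * k = 1" by (simp only: of_int_eq_iff)
 thus False by presburger
qed

text \<open>The character value w = a + b * omega need not have norm 1, but w^2 / N does, and its
  coordinates A, B are integral. Once A * B * (A - B) = 0, only sixth roots of unity remain for w^2
  / N, and this restricts w itself.\<close>

theorem order_3_only_trivial_units: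
 assumes real: "\<And>\<sigma> x. \<sigma> \<in> emb F \<Longrightarrow> x \<in> F \<Longrightarrow> \<sigma> x \<in> \<real>"
 shows "complex_only_trivial_units ints (integer_mod_group 3)"
 unfolding complex_only_trivial_units_def
proof (intro allI impI)
 let ?G = "integer_mod_group 3"
 fix u v assume u: "u \<in> carrier ?G \<rightarrow> ints" and v: "v \<in> carrier ?G \<rightarrow> ints" and inv: "inverse_mod_Sigma ?G u v"
 have car: "carrier ?G = {0, 1, 2}" using interval_3 by (simp add: carrier_integer_mod_group)
 have um: "u 0 \<in> ints" "u 1 \<in> ints" "u 2 \<in> ints" and vm: "v 0 \<in> ints" "v 1 \<in> ints" "v 2 \<in> ints"
  using u v unfolding car by auto
 have R: "x \<in> \<real>" if "x \<in> ints" for x using real[OF id_emb ints_F[OF that]] ints_F[OF that] by simp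
 have cn: "cnj x = x" if "x \<in> ints" for x using R[OF that] by (simp add: Reals_cnj_iff)
 have o2: "omega * omega = - 1 - omega" using omega_square by (simp add: power2_eq_square)
 have on: "omega \<noteq> 1" using Re_omega by auto
 define a b where "a = u 0 - u 2" and "b = u 1 - u 2"
 define c d where "c = v 0 - v 2" and "d = v 1 - v 2"
 have m: "a \<in> ints" "b \<in> ints" "c \<in> ints" "d \<in> ints" unfolding a_def b_def c_def d_def by (intro ints_diff um vm)+
 have sum3: "(\<Sum>x\<in>{0..<int 3}. f x * omega ^ nat x) = (f 0 - f 2) + (f 1 - f 2) * omega" for f :: "int \<Rightarrow> complex"
  unfolding interval_3 by (simp add: omega_square algebra_simps)
 have w: "(a + b * omega) * (c + d * omega) = 1"
  using integer_mod_group_fourier[OF _ inv omega_cube on] unfolding sum3 a_def b_def c_def d_def by simp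
 define N N' where "N = a * a - a * b + b * b" and "N' = c * c - c * d + d * d"
 have co: "cnj omega = - 1 - omega" by (simp add: complex_eq_iff Re_omega Im_omega)
 have nrm: "(x + y * omega) * (x + y * cnj omega) = x * x - x * y + y * y" for x y
 proof -
  have "(x + y * omega) * (x + y * cnj omega) = x * x - x * y - y * y * omega - y * y * (omega * omega)" unfolding co by (simp add: algebra_simps)
  thus ?thesis unfolding o2 by (simp add: algebra_simps)
 qed
 have "cnj ((a + b * omega) * (c + d * omega)) = 1" unfolding w by simp
 hence w': "(a + b * cnj omega) * (c + d * cnj omega) = 1" using cn m by simp
 have "N * N' = ((a + b * omega) * (c + d * omega)) * ((a + b * cnj omega) * (c + d * cnj omega))"
  unfolding N_def N'_def nrm[symmetric] by (simp add: mult_ac)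
 hence NN: "N * N' = 1" unfolding w w' by simp
 have Nm: "N \<in> ints" "N' \<in> ints" unfolding N_def N'_def by (intro ints_intros m)+
 \<comment> \<open>The coordinates of w^2 / N in 1 and omega; N' is the inverse of N.\<close>
 define A B where "A = (a * a - b * b) * N'" and "B = (2 * a * b - b * b) * N'"
 have AB: "A \<in> ints" "B \<in> ints" unfolding A_def B_def by (intro ints_intros m Nm)+
 have "A * A - A * B + B * B = (N * N') * (N * N')" unfolding A_def B_def N_def by (simp add: algebra_simps)
 hence AB1: "A * A - A * B + B * B = 1" unfolding NN by simp
 define y where "y = A * B * (A - B)"
 have ym: "y \<in> ints" unfolding y_def by (intro ints_intros AB)
 have "y = 0"
 proof (rule conjugates_small_imp_zero[OF ints_F[OF ym] ints_algebraic[OF ym]])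
  fix \<sigma> assume s: "\<sigma> \<in> emb F"
  interpret s: embedding F \<sigma> by (rule embedding[OF s])
  obtain p where p: "\<sigma> A = complex_of_real p" using real[OF s ints_F[OF AB(1)]] by (rule Reals_cases)
  obtain q where q: "\<sigma> B = complex_of_real q" using real[OF s ints_F[OF AB(2)]] by (rule Reals_cases)
  note ABF = ints_F[OF AB(1)] ints_F[OF AB(2)]
  have "\<sigma> (A * A - A * B + B * B) = \<sigma> A * \<sigma> A - \<sigma> A * \<sigma> B + \<sigma> B * \<sigma> B"
   using ABF by (simp add: s.e_add s.e_diff s.e_mult mult_mem diff_mem)
  hence "complex_of_real (p * p - p * q + q * q) = complex_of_real 1" unfolding AB1 p q by simp
  hence "p * p - p * q + q * q = 1" by (simp only: of_real_eq_iff)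
  hence "\<bar>p * q * (p - q)\<bar> < 1" by (intro hexagonal_product_bound) (simp add: power2_eq_square)
  moreover have "\<sigma> y = complex_of_real (p * q * (p - q))" unfolding y_def using ABF by (simp add: s.e_diff s.e_mult mult_mem diff_mem p q)
  ultimately show "cmod (\<sigma> y) < 1" by (simp only: norm_of_real)
 qed
 hence cases: "A = 0 \<or> B = 0 \<or> A = B" by (simp add: y_def)
 have N'0: "N' \<noteq> 0" using NN by auto
 \<comment> \<open>N is a unit and 1 / 3 is not integral, so N cannot be 3 times a square. This
   removes the roots of unity that are not squares of shapes of w.\<close>
 have three: "N = 3 * x * x \<Longrightarrow> x \<in> ints \<Longrightarrow> False" for x using three_not_unit[of x N'] Nm(2) NN by simp
 have inv: "inverse x \<in> ints \<and> x \<noteq> 0" if "N = x * x" "x \<in> ints" for x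
 proof -
  have "x * (x * N') = 1" using NN that(1) by (simp add: mult.assoc)
  hence "inverse x = x * N'" "x \<noteq> 0" by (rule inverse_unique, auto)
  thus ?thesis using ints_mult[OF that(2) Nm(2)] by simp
 qed
 have sq: "s * s = t * t \<Longrightarrow> s = t \<or> s = - t" for s t :: complex by (simp add: square_eq_iff)
 \<comment> \<open>The shapes left are w = x, w = x * omega and w = a * (1 + omega) = x * omega^2
   with x = -a.\<close>
 have "\<exists>x\<in>ints. N = x * x \<and> (b = 0 \<and> x = a \<or> a = 0 \<and> x = b \<or> a = b \<and> x = - a)" using cases
 proof (elim disjE)
  assume "B = 0"
  hence "b * (2 * a - b) = 0" using N'0 by (simp add: B_def algebra_simps)
  hence "b = 0 \<or> b = 2 * a" by auto
  thus ?thesis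
  proof
   assume "b = 0"
   thus ?thesis using m(1) by (intro bexI[of _ a]) (simp_all add: N_def)
  next
   assume "b = 2 * a"
   hence "N = 3 * a * a" by (simp add: N_def algebra_simps)
   thus ?thesis using three m(1) by blast
  qed
 next
  assume "A = B"
  hence "a * a - b * b = 2 * a * b - b * b" using N'0 by (simp add: A_def B_def)
  hence "a * (a - 2 * b) = 0" by (simp add: algebra_simps)
  hence "a = 0 \<or> a = 2 * b" by auto
  thus ?thesis
  proof
   assume "a = 0"
   thus ?thesis using m(2) by (intro bexI[of _ b]) (simp_all add: N_def)
  next
   assume "a = 2 * b"
   hence "N = 3 * b * b" by (simp add: N_def algebra_simps)
   thus ?thesis using three m(2) by blast
  qed
 next
  assume "A = 0"
  hence "a * a = b * b" using N'0 by (simp add: A_def)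
  hence "a = b \<or> a = - b" by (rule sq)
  thus ?thesis
  proof
   assume "a = b"
   thus ?thesis using ints_minus[OF m(1)] by (intro bexI[of _ "- a"]) (simp_all add: N_def)
  next
   assume "a = - b"
   hence "N = 3 * b * b" by (simp add: N_def algebra_simps)
   thus ?thesis using three m(2) by blast
  qed
 qed
 then obtain x where x: "x \<in> ints" "N = x * x" and xc: "b = 0 \<and> x = a \<or> a = 0 \<and> x = b \<or> a = b \<and> x = - a" by blast
 have "\<exists>g\<in>carrier ?G. \<exists>d. \<forall>t\<in>carrier ?G. u t = (if t = g then x else 0) + d" using xc
 proof (elim disjE conjE)
  assume "b = 0" "x = a"
  thus ?thesis unfolding car by (intro bexI[of _ 0] exI[of _ "u 2"]) (simp_all add: a_def b_def)
 next
  assume "a = 0" "x = b"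
  thus ?thesis unfolding car by (intro bexI[of _ 1] exI[of _ "u 2"]) (simp_all add: a_def b_def)
 next
  assume "a = b" "x = - a"
  thus ?thesis unfolding car by (intro bexI[of _ 2] exI[of _ "u 0"]) (simp_all add: a_def b_def)
 qed
 thus "trivial_mod_Sigma ints ?G u" unfolding trivial_mod_Sigma_def using x(1) inv[OF x(2,1)] by blast
qed

end

section \<open>Integer rings up to isomorphism, and fields containing \<i> or omega\<close>

definition complex_hom :: "('r, 'm) ring_scheme \<Rightarrow> ('r \<Rightarrow> complex) \<Rightarrow> bool" where
 "complex_hom R \<phi> \<longleftrightarrow> \<phi> \<one>\<^bsub>R\<^esub> = 1 \<and>
  (\<forall>a\<in>carrier R. \<forall>b\<in>carrier R. \<phi> (a \<oplus>\<^bsub>R\<^esub> b) = \<phi> a + \<phi> b \<and> \<phi> (a \<otimes>\<^bsub>R\<^esub> b) = \<phi> a * \<phi> b) \<and> inj_on \<phi> (carrier R)"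

lemma ring_iso_image: "complex_hom R \<phi> \<Longrightarrow> R \<simeq> complex_field\<lparr>carrier := \<phi> ` carrier R\<rparr>"
proof -
 assume "complex_hom R \<phi>"
 hence "\<phi> \<in> ring_iso R (complex_field\<lparr>carrier := \<phi> ` carrier R\<rparr>)"
  by (auto simp: complex_hom_def ring_iso_def Ring.ring_hom_def bij_betw_def)
 thus ?thesis unfolding is_ring_iso_def by blast
qed

text \<open>The theorem describes rings up to isomorphism; this turns an isomorphism with a concrete
  ring into an embedding whose image is known exactly.\<close>

lemma complex_hom_of_ring_iso:
 fixes R :: "('r, 'm) ring_scheme" and T :: "('t, 'l) ring_scheme"
 assumes iso: "R \<simeq> T" and j: "complex_hom T j"
 shows "\<exists>\<psi>. complex_hom R \<psi> \<and> \<psi> ` carrier R = j ` carrier T"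
proof -
 obtain h where h: "h \<in> Ring.ring_hom R T" "bij_betw h (carrier R) (carrier T)" using iso unfolding is_ring_iso_def ring_iso_def by blast
 have hc: "h x \<in> carrier T" if "x \<in> carrier R" for x by (rule ring_hom_closed[OF h(1) that])
 have inj: "inj_on (j \<circ> h) (carrier R)" using comp_inj_on[of h "carrier R" j] h(2) j unfolding bij_betw_def complex_hom_def by simp
 have "(j \<circ> h) (a \<oplus>\<^bsub>R\<^esub> b) = (j \<circ> h) a + (j \<circ> h) b \<and> (j \<circ> h) (a \<otimes>\<^bsub>R\<^esub> b) = (j \<circ> h) a * (j \<circ> h) b"
  if "a \<in> carrier R" "b \<in> carrier R" for a b
  using ring_hom_add[OF h(1) that] ring_hom_mult[OF h(1) that] hc[OF that(1)] hc[OF that(2)] j unfolding complex_hom_def by simp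
 moreover have "(j \<circ> h) \<one>\<^bsub>R\<^esub> = 1" using ring_hom_one[OF h(1)] j unfolding complex_hom_def by simp
 ultimately have "complex_hom R (j \<circ> h)" unfolding complex_hom_def using inj by blast
 moreover have "(j \<circ> h) ` carrier R = j ` carrier T" using h(2) unfolding bij_betw_def by (simp only: image_comp[symmetric])
 ultimately show ?thesis by blast
qed

lemma complex_hom_of_int: "complex_hom \<Z> of_int" "of_int ` carrier \<Z> = \<int>" by (auto simp: complex_hom_def inj_on_def Ints_def)

lemma complex_hom_id: "complex_hom (complex_field\<lparr>carrier := S\<rparr>) (\<lambda>x. x)" by (simp add: complex_hom_def)

lemma sqrt_3_irrational: "sqrt 3 \<notin> \<rat>"
proof
 assume q: "sqrt 3 \<in> \<rat>"
 have "algebraic_int (3::real)" by simp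
 hence "algebraic_int (sqrt 3)" by (rule algebraic_int_sqrt)
 hence "sqrt 3 \<in> \<int>" using q by (rule rational_algebraic_int_is_int)
 then obtain k where k: "sqrt 3 = of_int k" by (rule Ints_cases)
 have "(sqrt 3)\<^sup>2 = 3" by simp
 hence "real_of_int (k * k) = real_of_int 3" unfolding k by (simp add: power2_eq_square)
 hence kk: "k * k = 3" by (simp only: of_int_eq_iff)
 have "\<bar>k\<bar> < 2"
 proof (rule ccontr)
  assume "\<not> \<bar>k\<bar> < 2"
  hence "2 * 2 \<le> \<bar>k\<bar> * \<bar>k\<bar>" by (intro mult_mono) simp_all
  thus False using kk by (simp only: abs_mult_self_eq)
 qed
 hence "k = -1 \<or> k = 0 \<or> k = 1" by linarith
 thus False using kk by auto
qed

context complex_number_field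
begin

text \<open>All conjugates of r have the modulus of r, so the modulus of the norm is a power of
  |r|.\<close>

lemma no_outer_unit_norm_ge:
 assumes o: "outer_emb = {}" and r: "r \<in> ints" "r \<noteq> 0" shows "cmod r \<ge> 1"
proof -
 have rF: "r \<in> F" by (rule ints_F[OF r(1)])
 have "cmod (\<sigma> r) = cmod r" if "\<sigma> \<in> emb F" for \<sigma> using that rF unfolding emb_if_no_outer[OF o] by auto
 hence "(\<Prod>\<sigma>\<in>emb F. cmod (\<sigma> r)) = cmod r ^ card (emb F)" by simp
 hence ge: "cmod r ^ card (emb F) \<ge> 1" using norm_ge_1[OF rF ints_algebraic[OF r(1)] r(2)] by simp
 show ?thesis
 proof (rule ccontr)
  assume "\<not> cmod r \<ge> 1"
  moreover have "card (emb F) > 0" using finite_emb id_emb card_gt_0_iff by blast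
  ultimately have "cmod r ^ card (emb F) < 1" by (intro power_Suc_less_one[of _ "card (emb F) - 1", simplified] | simp add: power_less_one_iff)+
  thus False using ge by simp
 qed
qed

lemma no_outer_unit_norm:
 assumes "outer_emb = {}" "r \<in> ints" "inverse r \<in> ints" "r \<noteq> 0" shows "cmod r = 1"
proof -
 have "cmod r \<ge> 1" by (rule no_outer_unit_norm_ge[OF assms(1,2,4)])
 moreover have "cmod (inverse r) \<ge> 1" by (rule no_outer_unit_norm_ge[OF assms(1,3)]) (use assms(4) in simp)
 hence "inverse (cmod r) \<ge> 1" by (simp add: norm_inverse)
 hence "cmod r \<le> 1" using assms(4) by (simp add: field_simps)
 ultimately show ?thesis by simp
qed

lemma ints_Rats: "F = \<rat> \<Longrightarrow> ints = \<int>"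
proof
 assume F: "F = \<rat>"
 show "ints \<subseteq> \<int>"
 proof
  fix x assume x: "x \<in> ints"
  have "x \<in> \<rat>" using ints_F[OF x] F by simp
  thus "x \<in> \<int>" by (rule rational_algebraic_int_is_int[OF ints_algebraic[OF x]])
 qed
 show "\<int> \<subseteq> ints" by (auto elim!: Ints_cases intro: ints_of_int)
qed

lemma ints_quad:
 assumes "F = quad_field d" shows "ints = quad_int d"
 unfolding ints_def quad_int_def by (simp only: assms)

text \<open>In the field generated by a square root of -d, the element \<i> makes the square root of
  d rational, so the field is that of d = 1. There omega would make the square root of 3
  rational.\<close>

lemma i_mem_imp: "outer_emb = {} \<Longrightarrow> \<not> F \<subseteq> \<real> \<Longrightarrow> \<i> \<in> F \<Longrightarrow> F = quad_field 1 \<and> omega \<notin> F"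
proof -
 assume h: "outer_emb = {}" "\<not> F \<subseteq> \<real>" "\<i> \<in> F"
 obtain d where d: "d > 0" "F = quad_field d" using nonreal_field_eq_quad_field[OF h(1,2)] by blast
 have "sqrt (of_int 1) / sqrt (of_int d) \<in> \<rat>" using h(3) unfolding d(2) quad_field_def by simp
 hence F: "F = quad_field 1" using quad_field_eqI[OF d(1), of 1] d(2) by simp
 have "omega \<notin> quad_field 1"
 proof
  assume "omega \<in> quad_field 1"
  hence "sqrt 3 / 2 \<in> \<rat>" by (simp add: quad_field_def Im_omega)
  hence "sqrt 3 / 2 * 2 \<in> \<rat>" by (intro Rats_mult) simp_all
  thus False using sqrt_3_irrational by simp
 qed
 thus ?thesis using F by simp
qed

lemma omega_mem_imp: "outer_emb = {} \<Longrightarrow> \<not> F \<subseteq> \<real> \<Longrightarrow> omega \<in> F \<Longrightarrow> F = quad_field 3"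
proof -
 assume h: "outer_emb = {}" "\<not> F \<subseteq> \<real>" "omega \<in> F"
 obtain d where d: "d > 0" "F = quad_field d" using nonreal_field_eq_quad_field[OF h(1,2)] by blast
 have "sqrt 3 / 2 / sqrt (of_int d) \<in> \<rat>" using h(3) unfolding d(2) quad_field_def by (simp add: Im_omega)
 hence "sqrt 3 / 2 / sqrt (of_int d) * 2 \<in> \<rat>" by (intro Rats_mult) simp_all
 hence "sqrt (of_int 3) / sqrt (of_int d) \<in> \<rat>" by simp
 thus ?thesis using quad_field_eqI[OF d(1), of 3] d(2) by simp
qed

end

section \<open>Classification of the groups with only trivial units\<close>

context trivial_unit_group
begin

lemma dedekind_group: "dedekind G" by unfold_locales (rule finG, rule cyclic_subgroup_normal[OF finG triv ints_1 ints_diff])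

text \<open>Every nontrivial element generates G. For even order this fails for the square of a
  generator unless the order is 2, and for odd order only 3 is left. Over a non-real F order 3 is
  excluded by one of two units, according as omega lies in F or not.\<close>

theorem outer_cases:
 assumes o: "outer_emb \<noteq> {}" and card: "card (carrier G) > 1"
 shows "G \<cong> integer_mod_group 2 \<or> (G \<cong> integer_mod_group 3 \<and> F \<subseteq> \<real>)"
proof -
 have "carrier G \<noteq> {\<one>}" using card by auto
 then obtain g where g: "g \<in> carrier G" "g \<noteq> \<one>" using one_closed by blast
 have gen: "powers h = carrier G" if "h \<in> carrier G" "h \<noteq> \<one>" for h by (rule outer_generates[OF o that])
 have k0: "ord g > 0" by (rule ord_pos[OF finG g(1)])
 have k1: "ord g \<noteq> 1" using ord_eq_1[OF g(1)] g(2) by simp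
 have "G\<lparr>carrier := powers g\<rparr> \<cong> integer_mod_group (ord g)"
 proof (rule cyclic_subgroup_iso[OF g(1) k0 pow_ord_eq_1[OF g(1)]])
  fix i :: nat assume i: "0 < i" "i < ord g"
  show "g [^] i \<noteq> \<one>"
  proof
   assume "g [^] i = \<one>"
   hence "ord g dvd i" using pow_eq_id[OF g(1)] by blast
   thus False using i by (simp add: nat_dvd_not_less)
  qed
 qed
 hence iso: "G \<cong> integer_mod_group (ord g)" unfolding gen[OF g] by simp
 show ?thesis
 proof (cases "even (ord g)")
  case True
  have "g \<otimes> g = \<one>"
  proof (rule ccontr)
   assume n: "g \<otimes> g \<noteq> \<one>"
   \<comment> \<open>If g * g generated G, the number 1 would be congruent to an even number modulo
     the even order of g.\<close>
   have "g \<in> range (\<lambda>i::nat. (g \<otimes> g) [^] i)" using gen[OF m_closed[OF g(1,1)] n] g(1) by simp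
   then obtain i :: nat where "g = (g \<otimes> g) [^] i" by blast
   also have "g \<otimes> g = g [^] (2::nat)" using g(1) by (simp add: numeral_2_eq_2)
   finally have "g [^] (2 * i) = g [^] (1::nat)" using g(1) by (simp add: nat_pow_pow)
   moreover have "1 < ord g" using k0 k1 by simp
   ultimately have "1 = (2 * i) mod ord g" using pow_eq_iff_mod[OF finG g(1)] by blast
   moreover have "even ((2 * i) mod ord g)" using True by (simp add: dvd_mod)
   ultimately show False by (metis odd_one)
  qed
  hence "g [^] (2::nat) = \<one>" using g(1) by (simp add: numeral_2_eq_2)
  hence "ord g dvd 2" using pow_eq_id[OF g(1)] by blast
  hence "ord g \<le> 2" by (rule dvd_imp_le) simp
  hence "ord g = 2" using k0 k1 by simp
  thus ?thesis using iso by simp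
 next
  case False
  have "ord g \<le> 3" by (rule odd_cyclic[OF g(1) gen[OF g] False])
  moreover have "ord g \<noteq> 2" using False by auto
  ultimately have k3: "ord g = 3" using k0 k1 by linarith
  have "F \<subseteq> \<real>"
  proof (rule ccontr)
   assume "\<not> F \<subseteq> \<real>"
   thus False using no_order_3[OF _ _ g(1) k3] no_order_3_outer[OF o _ g(1) k3] by blast
  qed
  thus ?thesis using iso k3 by simp
 qed
qed

text \<open>An element of order 6 has a square of order 3.\<close>

lemma order_2_or:
 assumes x: "x \<in> carrier G" and "ord x \<in> {1, 2, 3, 4, 6}" and no3: "\<And>y. y \<in> carrier G \<Longrightarrow> ord y \<noteq> 3"
 shows "ord x \<in> {1, 2, 4}"
proof -
 have "ord x \<noteq> 6"
 proof
  assume 6: "ord x = 6"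
  have c: "x [^] (2::nat) \<in> carrier G" using x by simp
  have "(x [^] (2::nat)) [^] (3::nat) = \<one>" using x pow_ord_eq_1[OF x] 6 by (simp add: nat_pow_pow)
  hence "ord (x [^] (2::nat)) dvd 3" using pow_eq_id[OF c] by blast
  hence "ord (x [^] (2::nat)) \<le> 3" by (rule dvd_imp_le) simp
  moreover have "ord (x [^] (2::nat)) \<noteq> 1"
  proof
   assume "ord (x [^] (2::nat)) = 1"
   hence "x [^] (2::nat) = \<one>" using ord_eq_1[OF c] by simp
   hence "(6::nat) dvd 2" using pow_eq_id[OF x] 6 by metis
   thus False by simp
  qed
  moreover have "ord (x [^] (2::nat)) \<noteq> 2" using \<open>ord (x [^] (2::nat)) dvd 3\<close> by auto
  moreover have "ord (x [^] (2::nat)) > 0" by (rule ord_pos[OF finG c])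
  ultimately have "ord (x [^] (2::nat)) = 3" by linarith
  thus False using no3[OF c] by simp
 qed
 thus ?thesis using assms(2) no3[OF x] by auto
qed

context
 assumes no: "outer_emb = {}"
begin

lemma ords: "x \<in> carrier G \<Longrightarrow> ord x \<in> {1, 2, 3, 4, 6}" by (erule ord_cases) (rule no_outer_unit_norm[OF no])

lemma exponents: "(\<forall>x\<in>carrier G. x [^] (6::nat) = \<one>) \<or> (\<forall>x\<in>carrier G. x [^] (4::nat) = \<one>)"
 by (rule dedekind.exponent_4_or_6[OF dedekind_group ords])

theorem rational_case:
 "\<exists>m n. G \<cong> cyclic_power 3 m \<times>\<times> cyclic_power 2 n \<or> G \<cong> cyclic_power 4 m \<times>\<times> cyclic_power 2 n \<or>
  G \<cong> quaternion_group \<times>\<times> cyclic_power 2 n"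
 using exponents
proof
 assume e: "\<forall>x\<in>carrier G. x [^] (6::nat) = \<one>"
 have c: "comm_group G" by (rule dedekind.exponent_6_commutative[OF dedekind_group]) (use e in blast)
 show ?thesis using comm_group.exponent_6_abelian[OF c finG] e by blast
next
 assume e: "\<forall>x\<in>carrier G. x [^] (4::nat) = \<one>"
 show ?thesis
 proof (cases "\<forall>a\<in>carrier G. \<forall>b\<in>carrier G. a \<otimes> b = b \<otimes> a")
  case True
  hence c: "comm_group G" by (intro group_comm_groupI) blast
  show ?thesis using comm_group.exponent_4_abelian[OF c finG] e by blast
 next
  case False
  then obtain a b where "a \<in> carrier G" "b \<in> carrier G" "a \<otimes> b \<noteq> b \<otimes> a" by blast
  thus ?thesis using dedekind.exponent_4_noncommutative[OF dedekind_group _ \<open>a \<in> carrier G\<close>] e by blast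
 qed
qed

theorem gaussian_case:
 assumes nr: "\<not> F \<subseteq> \<real>" and i: "\<i> \<in> F"
 shows "\<exists>m n. G \<cong> cyclic_power 4 m \<times>\<times> cyclic_power 2 n"
proof -
 have om: "omega \<notin> F" using i_mem_imp[OF no nr i] by blast
 have "ord x \<in> {1, 2, 4}" if "x \<in> carrier G" for x by (rule order_2_or[OF that ords[OF that]]) (use no_order_3[OF nr om] in blast)
 hence "ord x dvd 4" if "x \<in> carrier G" for x using that by fastforce
 hence e: "x [^] (4::nat) = \<one>" if "x \<in> carrier G" for x using pow_eq_id[OF that] that by blast
 have "a \<otimes> b = b \<otimes> a" if ab: "a \<in> carrier G" "b \<in> carrier G" for a b
 proof (rule ccontr)
  assume n: "a \<otimes> b \<noteq> b \<otimes> a"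
  note r = dedekind.noncommuting_relations[OF dedekind_group e ab n]
  have "\<i> \<in> ints" by (intro intsI i) simp
  thus False using quaternion_not_gaussian[OF finG triv ints_1 _ ints_diff ab m_closed[OF ab(1,1)] refl r(2,4,5,3)] by blast
 qed
 hence c: "comm_group G" by (rule group_comm_groupI)
 show ?thesis by (rule comm_group.exponent_4_abelian[OF c finG e])
qed

theorem eisenstein_case:
 assumes nr: "\<not> F \<subseteq> \<real>" and i: "\<i> \<notin> F"
 shows "\<exists>m n. G \<cong> cyclic_power 3 m \<times>\<times> cyclic_power 2 n"
proof -
 have "ord x \<in> {1, 2, 3, 6}" if "x \<in> carrier G" for x using ords[OF that] no_order_4[OF nr i that] by auto
 hence "ord x dvd 6" if "x \<in> carrier G" for x using that by fastforce
 hence e: "x [^] (6::nat) = \<one>" if "x \<in> carrier G" for x using pow_eq_id[OF that] that by blast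
 have c: "comm_group G" by (rule dedekind.exponent_6_commutative[OF dedekind_group e])
 show ?thesis by (rule comm_group.exponent_6_abelian[OF c finG e])
qed

theorem imaginary_quadratic_case:
 assumes nr: "\<not> F \<subseteq> \<real>" and i: "\<i> \<notin> F" and om: "omega \<notin> F"
 shows "\<exists>n. G \<cong> cyclic_power 2 n"
proof -
 have "ord x \<in> {1, 2, 4}" if "x \<in> carrier G" for x by (rule order_2_or[OF that ords[OF that]]) (use no_order_3[OF nr om] in blast)
 hence "ord x dvd 2" if "x \<in> carrier G" for x using no_order_4[OF nr i that] that by fastforce
 hence e: "x [^] (2::nat) = \<one>" if "x \<in> carrier G" for x using pow_eq_id[OF that] that by blast
 have "x \<otimes> x = \<one>" if "x \<in> carrier G" for x using e[OF that] that by (simp add: numeral_2_eq_2)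
 hence c: "comm_group G" by (intro group_comm_groupI dedekind.involution_central[OF dedekind_group])
 show ?thesis by (rule comm_group.elementary_abelian[OF c finG _ e]) simp
qed

end

end

section \<open>Character systems for the groups of the theorem\<close>

lemma minus_1_order: "(-1::complex) ^ 2 = 1" "0 < a \<Longrightarrow> a < 2 \<Longrightarrow> (-1::complex) ^ a \<noteq> 1"
proof -
 assume "0 < a" "a < 2"
 hence "a = 1" by simp
 thus "(-1::complex) ^ a \<noteq> 1" by simp
qed simp

lemma omega_order: "0 < a \<Longrightarrow> a < 3 \<Longrightarrow> omega ^ a \<noteq> 1"
proof -
 assume "0 < a" "a < 3"
 hence "a = 1 \<or> a = 2" by linarith
 thus "omega ^ a \<noteq> 1" using Im_omega omega_square by (auto simp: complex_eq_iff)
qed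

lemma i_order: "0 < a \<Longrightarrow> a < 4 \<Longrightarrow> \<i> ^ a \<noteq> 1"
proof -
 assume "0 < a" "a < 4"
 hence "a = 1 \<or> a = 2 \<or> a = 3" by linarith
 thus "\<i> ^ a \<noteq> 1" by (auto simp: complex_eq_iff power3_eq_cube)
qed

lemma char_system_2: "discrete_ring D \<Longrightarrow> char_system D (cyclic_power 2 n)"
proof -
 assume "discrete_ring D"
 then interpret discrete_ring D .
 have "0 - 1 \<in> D" by (intro diff_D zero_D one_D)
 thus ?thesis by (intro char_system_cyclic_power[of 2 "-1"]) (simp_all add: minus_1_order one_D mult_D)
qed

lemma char_system_3: "char_system (quad_int 3) (cyclic_power 3 m \<times>\<times> cyclic_power 2 n)"
proof -
 interpret discrete_ring "quad_int 3" by (rule discrete_ring_quad_int) simp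
 show ?thesis by (intro char_system_prod mult_D char_system_2 discrete_ring_axioms char_system_cyclic_power[of 3 omega])
   (simp_all add: omega_cube omega_order one_D mult_D omega_mem_quad_int)
qed

lemma char_system_4: "char_system (quad_int 1) (cyclic_power 4 m \<times>\<times> cyclic_power 2 n)"
proof -
 interpret discrete_ring "quad_int 1" by (rule discrete_ring_quad_int) simp
 show ?thesis by (intro char_system_prod mult_D char_system_2 discrete_ring_axioms char_system_cyclic_power[of 4 \<i>])
   (simp_all add: i_order one_D mult_D \<i>_mem_quad_int)
qed

lemma Ints_subset_quad_int: "d > 0 \<Longrightarrow> \<int> \<subseteq> quad_int d" by (auto elim!: Ints_cases intro: quad_int_of_int)

text \<open>Both choices of R use \<open>quad_int d\<close> as the ring of character values. In
  particular C_3 and C_4 over the integers have their characters in the Eisenstein and Gaussian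
  integers.\<close>

lemma quad_only_trivial_units:
 assumes G: "group G" "finite (carrier G)" "card (carrier G) > 1" and d: "d > 0"
  and H: "group H" "G \<cong> H" "char_system (quad_int d) H" and R: "R = quad_int d \<or> R = \<int>"
 shows "complex_only_trivial_units R G"
proof -
 interpret group G by fact
 show ?thesis
 proof (rule char_system_only_trivial_units[OF G(2,3) discrete_ring_quad_int[OF d] char_system_iso[OF G(1) H]])
  show "R \<subseteq> quad_int d" using R Ints_subset_quad_int[OF d] by blast
  show "x - y \<in> R" if "x \<in> R" "y \<in> R" for x y using R that quad_int_diff[OF d] by auto
  show "inverse x \<in> R" if "x \<in> R" "cmod x = 1" for x using R that quad_int_inverse_norm_1[OF d] Ints_inverse_norm_1 by blast
 qed
qed

section \<open>The ring of integers of an abstract number field, and the theorem\<close>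

context number_field
begin

lemma complex_hom_integers:
 assumes \<phi>: "\<phi> \<in> Ring.ring_hom K complex_field" shows "complex_hom (ring_of_integers K) \<phi>"
proof -
 have sub: "carrier (ring_of_integers K) \<subseteq> carrier K" by (auto simp: ring_of_integers_def)
 have "\<one>\<^bsub>ring_of_integers K\<^esub> = \<one>" "add (ring_of_integers K) = add K" "monoid.mult (ring_of_integers K) = monoid.mult K"
  by (simp_all add: ring_of_integers_def)
 moreover have "a \<in> carrier K" if "a \<in> carrier (ring_of_integers K)" for a using that sub by blast
 ultimately show ?thesis unfolding complex_hom_def using inj_on_subset[OF \<phi>_inj[OF \<phi>] sub] \<phi>_simps[OF \<phi>] by simp
qed

text \<open>Closure under the ring operations is pulled back along \<phi> from the algebraic
  integers in the complex numbers.\<close>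

lemma cring_integers: "cring (ring_of_integers K)"
proof -
 obtain \<phi> where \<phi>: "\<phi> \<in> Ring.ring_hom K complex_field" using exists_complex_embedding by blast
 interpret F: complex_number_field "\<phi> ` carrier K" by (rule complex_number_field_image[OF \<phi>])
 define S where "S = carrier (ring_of_integers K)"
 have im: "\<phi> ` S = F.ints" unfolding S_def F.ints_def by (rule image_ring_of_integers[OF \<phi>])
 have Sc: "S \<subseteq> carrier K" by (auto simp: S_def ring_of_integers_def)
 have mem: "x \<in> S \<longleftrightarrow> \<phi> x \<in> F.ints" if x: "x \<in> carrier K" for x
 proof
  assume "\<phi> x \<in> F.ints"
  then obtain y where y: "y \<in> S" "\<phi> x = \<phi> y" unfolding im[symmetric] by (rule imageE) auto
  thus "x \<in> S" using inj_onD[OF \<phi>_inj[OF \<phi>], of x y] x Sc by blast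
 qed (use im in blast)
 have "subring S K"
 proof (rule subringI[OF Sc])
  show "\<one> \<in> S" using mem[OF one_closed] F.ints_1 \<phi>_simps(1)[OF \<phi>] by simp
  fix x y assume x: "x \<in> S" and y: "y \<in> S"
  have c: "x \<in> carrier K" "y \<in> carrier K" using x y Sc by blast+
  have xi: "\<phi> x \<in> F.ints" "\<phi> y \<in> F.ints" using x y im by blast+
  show "\<ominus> x \<in> S" using mem[OF a_inv_closed[OF c(1)]] \<phi>_minus[OF \<phi> c(1)] F.ints_minus[OF xi(1)] by simp
  show "x \<otimes> y \<in> S" using mem[OF m_closed[OF c]] \<phi>_simps(3)[OF \<phi> c] F.ints_mult[OF xi] by simp
  show "x \<oplus> y \<in> S" using mem[OF a_closed[OF c]] \<phi>_simps(2)[OF \<phi> c] F.ints_add[OF xi] by simp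
 qed
 hence "cring (K\<lparr>carrier := S\<rparr>)" using subcring_iff[OF Sc] subcringI' by blast
 moreover have "K\<lparr>carrier := S\<rparr> = ring_of_integers K" by (simp add: S_def ring_of_integers_def)
 ultimately show ?thesis by simp
qed

lemma only_trivial_units_complex:
 assumes G: "group G" "finite (carrier G)" "card (carrier G) > 1" and \<psi>: "complex_hom (ring_of_integers K) \<psi>"
 shows "only_trivial_units (ring_of_integers K) G \<longleftrightarrow> complex_only_trivial_units (\<psi> ` carrier (ring_of_integers K)) G"
proof -
 interpret R: complex_group_ring "ring_of_integers K" G \<psi>
  by (intro complex_group_ring.intro complex_group_ring_axioms.intro cring_integers G)
   (use \<psi> in \<open>auto simp: complex_hom_def\<close>)
 show ?thesis by (rule R.only_trivial_units_iff[OF G(3)])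
qed

end

theorem theorem4:
 fixes K :: "('k, 'm) ring_scheme" and G :: "('g, 'n) monoid_scheme"
 assumes "number_field K"
  and "group G" and "finite (carrier G)" and "card (carrier G) > 1"
 shows "only_trivial_units (ring_of_integers K) G \<longleftrightarrow>
   G \<cong> integer_mod_group 2
  \<or> (G \<cong> integer_mod_group 3 \<and> totally_real K)
  \<or> (\<exists>m n :: nat.
     (ring_of_integers K \<simeq> \<Z> \<and>
       (G \<cong> cyclic_power 3 m \<times>\<times> cyclic_power 2 n \<or>
       G \<cong> cyclic_power 4 m \<times>\<times> cyclic_power 2 n \<or>
       G \<cong> quaternion_group \<times>\<times> cyclic_power 2 n))
    \<or> (ring_of_integers K \<simeq> gaussian_integers \<and>
       G \<cong> cyclic_power 4 m \<times>\<times> cyclic_power 2 n)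
    \<or> (ring_of_integers K \<simeq> eisenstein_integers \<and>
       G \<cong> cyclic_power 3 m \<times>\<times> cyclic_power 2 n)
    \<or> ((\<exists>d :: int. d > 1 \<and> d \<noteq> 3 \<and> squarefree d \<and>
        ring_of_integers K \<simeq> ring_of_integers (imaginary_quadratic_field d)) \<and>
       G \<cong> cyclic_power 2 n))"
  (is "?L \<longleftrightarrow> ?R1 \<or> ?R2 \<or> ?R3")
proof -
 interpret K: number_field K by fact
 interpret G: group G by fact
 let ?R = "ring_of_integers K"
 have T1: "gaussian_integers = complex_field\<lparr>carrier := quad_int 1\<rparr>"
  using carrier_gaussian_integers by (simp add: gaussian_integers_def)
 have T3: "eisenstein_integers = complex_field\<lparr>carrier := quad_int 3\<rparr>"
  using carrier_eisenstein_integers by (simp add: eisenstein_integers_def)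
 have Td: "ring_of_integers (imaginary_quadratic_field d) = complex_field\<lparr>carrier := quad_int d\<rparr>" if "d > 0" for d
  using carrier_ring_of_integers_quadratic[OF that] by (simp add: ring_of_integers_def imaginary_quadratic_field_def)
 show ?thesis
 proof
  assume L: ?L
  \<comment> \<open>If K is not totally real, an embedding with a non-real value is chosen. A real
    image F then says that K is totally real, although only one embedding is inspected.\<close>
  have "\<exists>\<phi>. \<phi> \<in> Ring.ring_hom K complex_field \<and> (\<phi> ` carrier K \<subseteq> \<real> \<longrightarrow> totally_real K)"
   using K.exists_complex_embedding unfolding totally_real_def by blast
  then obtain \<phi> where \<phi>: "\<phi> \<in> Ring.ring_hom K complex_field" "\<phi> ` carrier K \<subseteq> \<real> \<Longrightarrow> totally_real K" by blast
  define F where "F = \<phi> ` carrier K"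
  interpret F: complex_number_field F unfolding F_def by (rule K.complex_number_field_image[OF \<phi>(1)])
  have im: "\<phi> ` carrier ?R = F.ints" using K.image_ring_of_integers[OF \<phi>(1)] unfolding F.ints_def F_def[symmetric] .
  have hom: "complex_hom ?R \<phi>" by (rule K.complex_hom_integers[OF \<phi>(1)])
  have "complex_only_trivial_units F.ints G" using L K.only_trivial_units_complex[OF assms(2-4) hom] unfolding im by blast
  then interpret T: trivial_unit_group F G by unfold_locales (rule assms(3))
  show "?R1 \<or> ?R2 \<or> ?R3"
  proof (cases "F.outer_emb = {}")
   case False
   thus ?thesis using T.outer_cases[OF False assms(4)] \<phi>(2) unfolding F_def by blast
  next
   case no: True
   show ?thesis
   proof (cases "F \<subseteq> \<real>")
    case True
    have "F.ints = \<int>" by (rule F.ints_Rats[OF F.real_field_eq_Rats[OF no True]])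
    hence "?R \<simeq> complex_field\<lparr>carrier := \<int>\<rparr>" using ring_iso_image[OF hom] unfolding im by simp
    moreover have "complex_field\<lparr>carrier := \<int>\<rparr> \<simeq> \<Z>"
     using ring_iso_sym[OF cring.axioms(1)[OF int_is_cring] ring_iso_image[OF complex_hom_of_int(1)]]
     unfolding complex_hom_of_int(2) .
    ultimately have "?R \<simeq> \<Z>" by (rule ring_iso_trans)
    thus ?thesis using T.rational_case[OF no] by blast
   next
    case nr: False
    show ?thesis
    proof (cases "\<i> \<in> F")
     case True
     have "F.ints = quad_int 1" using F.ints_quad F.i_mem_imp[OF no nr True] by blast
     hence "?R \<simeq> gaussian_integers" using ring_iso_image[OF hom] unfolding im T1 by simp
     thus ?thesis using T.gaussian_case[OF no nr True] by blast
    next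
     case i: False
     show ?thesis
     proof (cases "omega \<in> F")
      case True
      have "F.ints = quad_int 3" by (rule F.ints_quad[OF F.omega_mem_imp[OF no nr True]])
      hence "?R \<simeq> eisenstein_integers" using ring_iso_image[OF hom] unfolding im T3 by simp
      thus ?thesis using T.eisenstein_case[OF no nr i] by blast
     next
      case om: False
      obtain d where d: "d > 0" "squarefree d" "F = quad_field d" using F.nonreal_field_eq_quad_field[OF no nr] by blast
      have "d \<noteq> 1" using i \<i>_mem_quad_int d(3) by (auto simp: quad_int_def)
      moreover have "d \<noteq> 3" using om omega_mem_quad_int d(3) by (auto simp: quad_int_def)
      moreover have "?R \<simeq> ring_of_integers (imaginary_quadratic_field d)"
       using ring_iso_image[OF hom] unfolding im Td[OF d(1)] F.ints_quad[OF d(3)] .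
      ultimately have "\<exists>d :: int. d > 1 \<and> d \<noteq> 3 \<and> squarefree d \<and> ?R \<simeq> ring_of_integers (imaginary_quadratic_field d)"
       using d(1,2) by (intro exI[of _ d]) simp
      thus ?thesis using T.imaginary_quadratic_case[OF no nr i om] by blast
     qed
    qed
   qed
  qed
 next
  obtain \<phi> where \<phi>: "\<phi> \<in> Ring.ring_hom K complex_field" using K.exists_complex_embedding by blast
  define F where "F = \<phi> ` carrier K"
  interpret F: complex_number_field F unfolding F_def by (rule K.complex_number_field_image[OF \<phi>(1)])
  have im: "\<phi> ` carrier ?R = F.ints" using K.image_ring_of_integers[OF \<phi>(1)] unfolding F.ints_def F_def[symmetric] .
  have hom: "complex_hom ?R \<phi>" by (rule K.complex_hom_integers[OF \<phi>(1)])
  have by_ints: ?L if "complex_only_trivial_units F.ints G" using that K.only_trivial_units_complex[OF assms(2-4) hom] unfolding im by blast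
  \<comment> \<open>Here the embedding of R comes from the given isomorphism and not from \<phi>, so
    its image is literally the integers.\<close>
  have by_Z: ?L if R: "?R \<simeq> \<Z>" and triv: "complex_only_trivial_units \<int> G"
  proof -
   obtain \<psi> where "complex_hom ?R \<psi>" "\<psi> ` carrier ?R = \<int>"
    using complex_hom_of_ring_iso[OF R complex_hom_of_int(1)] unfolding complex_hom_of_int(2) by blast
   thus ?thesis using K.only_trivial_units_complex[OF assms(2-4), of \<psi>] triv by simp
  qed
  have by_quad: ?L if R: "?R \<simeq> T" and T: "T = complex_field\<lparr>carrier := quad_int d\<rparr>"
   and triv: "complex_only_trivial_units (quad_int d) G" for T d
  proof -
   have "complex_hom T (\<lambda>x. x)" unfolding T by (rule complex_hom_id)
   moreover have "(\<lambda>x. x) ` carrier T = quad_int d" unfolding T by simp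
   ultimately obtain \<psi> where "complex_hom ?R \<psi>" "\<psi> ` carrier ?R = quad_int d"
    using complex_hom_of_ring_iso[OF R, of "\<lambda>x. x"] by auto
   thus ?thesis using K.only_trivial_units_complex[OF assms(2-4), of \<psi>] triv by simp
  qed
  have gp: "group (cyclic_power k m \<times>\<times> cyclic_power l n)" for k l m n by (intro DirProd_group group_cyclic_power)
  note quad = quad_only_trivial_units[OF assms(2-4)]
  assume "?R1 \<or> ?R2 \<or> ?R3"
  thus ?L
  proof (elim disjE exE conjE)
   assume g: "G \<cong> integer_mod_group 2"
   have "complex_only_trivial_units F.ints (integer_mod_group 2)" by (rule order_2_only_trivial_units) (rule F.ints_diff)
   thus ?L by (intro by_ints complex_only_trivial_units_iso[OF assms(2) _ g]) simp_all
  next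
   assume g: "G \<cong> integer_mod_group 3" and tr: "totally_real K"
   have "\<sigma> x \<in> \<real>" if s: "\<sigma> \<in> emb F" and x: "x \<in> F" for \<sigma> x
   proof -
    have "\<sigma> \<circ> \<phi> \<in> Ring.ring_hom K complex_field" using K.emb_image_comp[OF \<phi>] s unfolding F_def by blast
    hence "(\<sigma> \<circ> \<phi>) ` carrier K \<subseteq> \<real>" using tr unfolding totally_real_def by blast
    thus ?thesis using x unfolding F_def by auto
   qed
   hence "complex_only_trivial_units F.ints (integer_mod_group 3)" by (rule F.order_3_only_trivial_units)
   thus ?L by (intro by_ints complex_only_trivial_units_iso[OF assms(2) _ g]) simp_all
  next
   fix m n assume "?R \<simeq> \<Z>" "G \<cong> cyclic_power 3 m \<times>\<times> cyclic_power 2 n"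
   thus ?L by (intro by_Z quad[OF _ gp _ char_system_3]) simp_all
  next
   fix m n assume "?R \<simeq> \<Z>" "G \<cong> cyclic_power 4 m \<times>\<times> cyclic_power 2 n"
   thus ?L by (intro by_Z quad[OF _ gp _ char_system_4]) simp_all
  next
   fix m n :: nat assume R: "?R \<simeq> \<Z>" and g: "G \<cong> quaternion_group \<times>\<times> cyclic_power 2 n"
   have "finite (carrier (cyclic_power 2 n))" unfolding cyclic_power_def by (simp add: carrier_integer_mod_group) (intro finite_PiE; simp)
   hence "complex_only_trivial_units \<int> (quaternion_group \<times>\<times> cyclic_power 2 n)"
    by (intro quaternion_only_trivial_units group_cyclic_power char_system_2 discrete_ring_Ints)
   moreover have "group (quaternion_group \<times>\<times> cyclic_power 2 n)" by (intro DirProd_group group_cyclic_power group_quaternion_group)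
   ultimately show ?L using by_Z[OF R] complex_only_trivial_units_iso[OF assms(2) _ g] by blast
  next
   fix m n assume "?R \<simeq> gaussian_integers" "G \<cong> cyclic_power 4 m \<times>\<times> cyclic_power 2 n"
   thus ?L by (intro by_quad[OF _ T1] quad[OF _ gp _ char_system_4]) simp_all
  next
   fix m n assume "?R \<simeq> eisenstein_integers" "G \<cong> cyclic_power 3 m \<times>\<times> cyclic_power 2 n"
   thus ?L by (intro by_quad[OF _ T3] quad[OF _ gp _ char_system_3]) simp_all
  next
   fix m n :: nat and d :: int
   assume d: "d > 1" and R: "?R \<simeq> ring_of_integers (imaginary_quadratic_field d)" and g: "G \<cong> cyclic_power 2 n"
   have d0: "d > 0" using d by simp
   have "complex_only_trivial_units (quad_int d) G" by (rule quad[OF d0 group_cyclic_power g char_system_2[OF discrete_ring_quad_int[OF d0]]]) simp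
   thus ?L by (rule by_quad[OF R Td[OF d0]])
  qed
 qed
qed

end
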